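(* Let $\Lambda$ be an artin algebra of finite global dimension. Then $\mathbb{K}^{\mathrm b}_{\mathrm{ac}}(\mathrm{mod}\text{-}\Lambda)$ has Serre duality, i.e. it admits a Serre functor.
   Context: $\Lambda$ is an artin $R$-algebra, $R$ a commutative artinian ring. $\mathrm{mod}\text{-}\Lambda$ is the category of finitely presented right $\Lambda$-modules, $\mathbb{K}^{\mathrm b}(\mathrm{mod}\text{-}\Lambda)$ its bounded homotopy category, and $\mathbb{K}^{\mathrm b}_{\mathrm{ac}}(\mathrm{mod}\text{-}\Lambda)$ the full subcategory of acyclic complexes. For a Hom-finite Krull-Schmidt $R$-linear triangulated category $\mathcal{T}$, a Serre functor is an auto-equivalence $\mathbb{S}:\mathcal{T}\to\mathcal{T}$ together with bifunctorial isomorphisms $D\mathcal{T}(X,Y)\cong\mathcal{T}(Y,\mathbb{S}X)$ for all $X,Y\in\mathcal{T}$, where $D=\mathrm{Hom}_R(-,E)$ and $E$ is the injective envelope of $R/\mathrm{rad}R$. *)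

theory Defs
  imports "HOL-Algebra.Module" "HOL-Algebra.QuotRing"
begin

section \<open>Artin algebras\<close>

text \<open>Linear maps are only determined on the carrier of their domain.  The definition makes
  sense both for modules over the commutative ring \<open>R\<close> (locale \<^locale>\<open>module\<close>) and for right
  modules over a non-commutative ring (locale \<open>right_module\<close> below).\<close>

definition lin_hom :: "('a, 'z) ring_scheme \<Rightarrow> ('a, 'b, 'y) module_scheme \<Rightarrow>
    ('a, 'c, 'x) module_scheme \<Rightarrow> ('b \<Rightarrow> 'c) set"
  where "lin_hom A M N = {f \<in> carrier M \<rightarrow> carrier N.
    (\<forall>x\<in>carrier M. \<forall>y\<in>carrier M. f (x \<oplus>\<^bsub>M\<^esub> y) = f x \<oplus>\<^bsub>N\<^esub> f y) \<and>
    (\<forall>a\<in>carrier A. \<forall>x\<in>carrier M. f (a \<odot>\<^bsub>M\<^esub> x) = a \<odot>\<^bsub>N\<^esub> f x)}"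

definition finitely_generated :: "('a, 'z) ring_scheme \<Rightarrow> ('a, 'b, 'y) module_scheme \<Rightarrow> bool"
  where "finitely_generated A M \<longleftrightarrow>
    (\<exists>S. finite S \<and> S \<subseteq> carrier M \<and> (\<forall>N. submodule N A M \<and> S \<subseteq> N \<longrightarrow> N = carrier M))"

locale artinian_cring = cring +
  assumes descending_chain_condition:
    "\<lbrakk>\<And>n :: nat. ideal (I n) R; \<And>n. I (Suc n) \<subseteq> I n\<rbrakk> \<Longrightarrow> \<exists>n. \<forall>m\<ge>n. I m = I n"

text \<open>The library locale \<^locale>\<open>algebra\<close> asks for a commutative algebra, so it cannot be used here.\<close>

locale artin_algebra = artinian_cring R + module R L + L: ring L
  for R (structure) and L (structure) +
  assumes smult_mult_left:
      "\<lbrakk>a \<in> carrier R; x \<in> carrier L; y \<in> carrier L\<rbrakk> \<Longrightarrow>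
        (a \<odot>\<^bsub>L\<^esub> x) \<otimes>\<^bsub>L\<^esub> y = a \<odot>\<^bsub>L\<^esub> (x \<otimes>\<^bsub>L\<^esub> y)"
    and smult_mult_right:
      "\<lbrakk>a \<in> carrier R; x \<in> carrier L; y \<in> carrier L\<rbrakk> \<Longrightarrow>
        x \<otimes>\<^bsub>L\<^esub> (a \<odot>\<^bsub>L\<^esub> y) = a \<odot>\<^bsub>L\<^esub> (x \<otimes>\<^bsub>L\<^esub> y)"
    and finitely_generated: "finitely_generated R L"


section \<open>Right modules\<close>

text \<open>For a right module the term \<open>a \<odot>\<^bsub>M\<^esub> x\<close> stands for \<open>x\<cdot>a\<close>; hence the order in the last but one
  axiom.  The fields \<^const>\<open>mult\<close> and \<^const>\<open>one\<close> of a module record are irrelevant.\<close>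

locale right_module = A?: ring A + M: abelian_group M
  for A :: "('a, 'z) ring_scheme" (structure)
    and M :: "('a, 'b, 'y) module_scheme" (structure) +
  assumes smult_closed:
      "\<lbrakk>a \<in> carrier A; x \<in> carrier M\<rbrakk> \<Longrightarrow> a \<odot>\<^bsub>M\<^esub> x \<in> carrier M"
    and smult_l_distr:
      "\<lbrakk>a \<in> carrier A; b \<in> carrier A; x \<in> carrier M\<rbrakk> \<Longrightarrow>
        (a \<oplus> b) \<odot>\<^bsub>M\<^esub> x = a \<odot>\<^bsub>M\<^esub> x \<oplus>\<^bsub>M\<^esub> b \<odot>\<^bsub>M\<^esub> x"
    and smult_r_distr:
      "\<lbrakk>a \<in> carrier A; x \<in> carrier M; y \<in> carrier M\<rbrakk> \<Longrightarrow>
        a \<odot>\<^bsub>M\<^esub> (x \<oplus>\<^bsub>M\<^esub> y) = a \<odot>\<^bsub>M\<^esub> x \<oplus>\<^bsub>M\<^esub> a \<odot>\<^bsub>M\<^esub> y"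
    and smult_assoc:
      "\<lbrakk>a \<in> carrier A; b \<in> carrier A; x \<in> carrier M\<rbrakk> \<Longrightarrow>
        (a \<otimes> b) \<odot>\<^bsub>M\<^esub> x = b \<odot>\<^bsub>M\<^esub> (a \<odot>\<^bsub>M\<^esub> x)"
    and smult_one: "x \<in> carrier M \<Longrightarrow> \<one> \<odot>\<^bsub>M\<^esub> x = x"

definition free_right_module :: "('a, 'z) ring_scheme \<Rightarrow> nat \<Rightarrow> ('a, nat \<Rightarrow> 'a) module"
  where "free_right_module A n =
    \<lparr>carrier = {..<n} \<rightarrow>\<^sub>E carrier A, mult = undefined, one = undefined,
     zero = (\<lambda>i\<in>{..<n}. \<zero>\<^bsub>A\<^esub>), add = (\<lambda>x y. \<lambda>i\<in>{..<n}. x i \<oplus>\<^bsub>A\<^esub> y i),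
     smult = (\<lambda>a x. \<lambda>i\<in>{..<n}. x i \<otimes>\<^bsub>A\<^esub> a)\<rparr>"

definition hom_kernel :: "('a, 'b, 'y) module_scheme \<Rightarrow> ('a, 'c, 'x) module_scheme \<Rightarrow>
    ('b \<Rightarrow> 'c) \<Rightarrow> 'b set"
  where "hom_kernel M N f = {x \<in> carrier M. f x = \<zero>\<^bsub>N\<^esub>}"

text \<open>There is an exact sequence \<open>A\<^sup>m \<rightarrow> A\<^sup>n \<rightarrow> M \<rightarrow> 0\<close>.\<close>

definition finitely_presented :: "('a, 'z) ring_scheme \<Rightarrow> ('a, 'b) module \<Rightarrow> bool"
  where "finitely_presented A M \<longleftrightarrow> right_module A M \<and>
    (\<exists>m n. \<exists>g \<in> lin_hom A (free_right_module A m) (free_right_module A n).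
       \<exists>p \<in> lin_hom A (free_right_module A n) M.
         p ` carrier (free_right_module A n) = carrier M \<and>
         g ` carrier (free_right_module A m) = hom_kernel (free_right_module A n) M p)"


section \<open>Global dimension\<close>

text \<open>All right modules have their carriers in the type \<open>'b\<close>, which plays the role of a universe
  (the theorem assumes it to be large enough to contain every finitely generated right module
  over \<open>A\<close>, and so to be infinite and at least as large as \<open>A\<close>; it is then closed, up to
  isomorphism, under forming free covers).\<close>

definition projective_module :: "('a, 'z) ring_scheme \<Rightarrow> ('a, 'b) module \<Rightarrow> bool"
  where "projective_module A P \<longleftrightarrow> right_module A P \<and>
    (\<forall>(M :: ('a, 'b) module) (N :: ('a, 'b) module). \<forall>g \<in> lin_hom A M N. \<forall>f \<in> lin_hom A P N.
       right_module A M \<and> right_module A N \<and> g ` carrier M = carrier N \<longrightarrow>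
       (\<exists>h \<in> lin_hom A P M. \<forall>x\<in>carrier P. g (h x) = f x))"

text \<open>There is an exact sequence \<open>0 \<rightarrow> P\<^sub>n \<rightarrow> \<dots> \<rightarrow> P\<^sub>0 \<rightarrow> M \<rightarrow> 0\<close> with all \<open>P\<^sub>i\<close> projective.\<close>

definition projective_dimension_le :: "('a, 'z) ring_scheme \<Rightarrow> ('a, 'b) module \<Rightarrow> nat \<Rightarrow> bool"
  where "projective_dimension_le A M n \<longleftrightarrow>
    (\<exists>(P :: nat \<Rightarrow> ('a, 'b) module) d e.
       (\<forall>i. projective_module A (P i)) \<and>
       (\<forall>i>n. carrier (P i) = {\<zero>\<^bsub>P i\<^esub>}) \<and>
       (\<forall>i. d i \<in> lin_hom A (P (Suc i)) (P i)) \<and>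
       e \<in> lin_hom A (P 0) M \<and>
       e ` carrier (P 0) = carrier M \<and>
       d 0 ` carrier (P 1) = hom_kernel (P 0) M e \<and>
       (\<forall>i. d (Suc i) ` carrier (P (Suc (Suc i))) = hom_kernel (P (Suc i)) (P i) (d i)))"

definition finite_global_dimension :: "'b itself \<Rightarrow> ('a, 'z) ring_scheme \<Rightarrow> bool"
  where "finite_global_dimension _ A \<longleftrightarrow>
    (\<exists>n. \<forall>M :: ('a, 'b) module. right_module A M \<longrightarrow> projective_dimension_le A M n)"


section \<open>The duality over the base ring\<close>

definition jacobson_radical :: "('r, 'z) ring_scheme \<Rightarrow> 'r set"
  where "jacobson_radical R = carrier R \<inter> \<Inter>{I. maximalideal I R}"

definition quotient_module :: "('r, 'z) ring_scheme \<Rightarrow> 'r set \<Rightarrow> ('r, 'r set) module"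
  where "quotient_module R I =
    \<lparr>carrier = carrier (R Quot I), mult = mult (R Quot I), one = one (R Quot I),
     zero = zero (R Quot I), add = add (R Quot I),
     smult = (\<lambda>a X. (I +>\<^bsub>R\<^esub> a) \<otimes>\<^bsub>R Quot I\<^esub> X)\<rparr>"

text \<open>A definition cannot quantify over the type carrying the test modules \<open>M\<close> and \<open>N\<close>.  It is
  enough to use \<open>'r\<close>: the inclusions of ideals into \<open>R\<close> are among the test maps, so by Baer's
  criterion the extension property then holds for all modules.\<close>

definition injective_module :: "('r, 'z) ring_scheme \<Rightarrow> ('r, 'e) module \<Rightarrow> bool"
  where "injective_module R E \<longleftrightarrow> module R E \<and>
    (\<forall>(M :: ('r, 'r) module) (N :: ('r, 'r) module). \<forall>i \<in> lin_hom R M N. \<forall>f \<in> lin_hom R M E.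
       module R M \<and> module R N \<and> inj_on i (carrier M) \<longrightarrow>
       (\<exists>h \<in> lin_hom R N E. \<forall>x\<in>carrier M. h (i x) = f x))"

definition injective_envelope ::
    "('r, 'z) ring_scheme \<Rightarrow> ('r, 'b) module \<Rightarrow> ('r, 'e) module \<Rightarrow> ('b \<Rightarrow> 'e) \<Rightarrow> bool"
  where "injective_envelope R M E j \<longleftrightarrow>
    injective_module R E \<and> j \<in> lin_hom R M E \<and> inj_on j (carrier M) \<and>
    (\<forall>N. submodule N R E \<and> N \<inter> j ` carrier M = {\<zero>\<^bsub>E\<^esub>} \<longrightarrow> N = {\<zero>\<^bsub>E\<^esub>})"

text \<open>\<open>Hom\<^sub>R(M, E)\<close>, with maps made unique by extensionality.\<close>

definition dual_module ::
    "('r, 'z) ring_scheme \<Rightarrow> ('r, 'e) module \<Rightarrow> ('r, 'b) module \<Rightarrow> ('r, 'b \<Rightarrow> 'e) module"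
  where "dual_module R E M =
    \<lparr>carrier = lin_hom R M E \<inter> extensional (carrier M), mult = undefined, one = undefined,
     zero = (\<lambda>x\<in>carrier M. \<zero>\<^bsub>E\<^esub>), add = (\<lambda>f g. \<lambda>x\<in>carrier M. f x \<oplus>\<^bsub>E\<^esub> g x),
     smult = (\<lambda>a f. \<lambda>x\<in>carrier M. a \<odot>\<^bsub>E\<^esub> f x)\<rparr>"


section \<open>Linear categories and Serre functors\<close>

text \<open>\<open>Comp C X Y Z g f\<close> is the composite of \<open>f : X \<rightarrow> Y\<close> and \<open>g : Y \<rightarrow> Z\<close>.  Each set of morphisms
  comes with its module structure; different sets of morphisms need not be disjoint.\<close>

record ('o, 'h, 'r) lin_cat =
  Ob :: "'o set"
  Mor :: "'o \<Rightarrow> 'o \<Rightarrow> ('r, 'h) module"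
  Comp :: "'o \<Rightarrow> 'o \<Rightarrow> 'o \<Rightarrow> 'h \<Rightarrow> 'h \<Rightarrow> 'h"
  Ident :: "'o \<Rightarrow> 'h"

abbreviation Arr :: "('o, 'h, 'r) lin_cat \<Rightarrow> 'o \<Rightarrow> 'o \<Rightarrow> 'h set"
  where "Arr C X Y \<equiv> carrier (Mor C X Y)"

locale linear_category = cring R for R :: "('r, 'z) ring_scheme" (structure) +
  fixes C :: "('o, 'h, 'r) lin_cat"
  assumes Mor_module: "\<lbrakk>X \<in> Ob C; Y \<in> Ob C\<rbrakk> \<Longrightarrow> module R (Mor C X Y)"
    and Ident_closed: "X \<in> Ob C \<Longrightarrow> Ident C X \<in> Arr C X X"
    and Comp_left_linear:
      "\<lbrakk>X \<in> Ob C; Y \<in> Ob C; Z \<in> Ob C; f \<in> Arr C X Y\<rbrakk> \<Longrightarrow>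
        (\<lambda>g. Comp C X Y Z g f) \<in> lin_hom R (Mor C Y Z) (Mor C X Z)"
    and Comp_right_linear:
      "\<lbrakk>X \<in> Ob C; Y \<in> Ob C; Z \<in> Ob C; g \<in> Arr C Y Z\<rbrakk> \<Longrightarrow>
        Comp C X Y Z g \<in> lin_hom R (Mor C X Y) (Mor C X Z)"
    and Comp_assoc:
      "\<lbrakk>W \<in> Ob C; X \<in> Ob C; Y \<in> Ob C; Z \<in> Ob C;
        f \<in> Arr C W X; g \<in> Arr C X Y; h \<in> Arr C Y Z\<rbrakk> \<Longrightarrow>
        Comp C W X Z (Comp C X Y Z h g) f = Comp C W Y Z h (Comp C W X Y g f)"
    and Ident_left: "\<lbrakk>X \<in> Ob C; Y \<in> Ob C; f \<in> Arr C X Y\<rbrakk> \<Longrightarrow> Comp C X Y Y (Ident C Y) f = f"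
    and Ident_right: "\<lbrakk>X \<in> Ob C; Y \<in> Ob C; f \<in> Arr C X Y\<rbrakk> \<Longrightarrow> Comp C X X Y f (Ident C X) = f"

text \<open>A functor is given by its object map \<open>FO\<close> and its maps \<open>FM X Y\<close> on morphisms \<open>X \<rightarrow> Y\<close>.\<close>

locale linear_functor = C: linear_category R C + D: linear_category R D
  for R :: "('r, 'z) ring_scheme" (structure)
    and C :: "('o, 'h, 'r) lin_cat" and D :: "('p, 'k, 'r) lin_cat" +
  fixes FO :: "'o \<Rightarrow> 'p" and FM :: "'o \<Rightarrow> 'o \<Rightarrow> 'h \<Rightarrow> 'k"
  assumes FO_closed: "X \<in> Ob C \<Longrightarrow> FO X \<in> Ob D"
    and FM_linear:
      "\<lbrakk>X \<in> Ob C; Y \<in> Ob C\<rbrakk> \<Longrightarrow> FM X Y \<in> lin_hom R (Mor C X Y) (Mor D (FO X) (FO Y))"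
    and FM_Ident: "X \<in> Ob C \<Longrightarrow> FM X X (Ident C X) = Ident D (FO X)"
    and FM_Comp:
      "\<lbrakk>X \<in> Ob C; Y \<in> Ob C; Z \<in> Ob C; f \<in> Arr C X Y; g \<in> Arr C Y Z\<rbrakk> \<Longrightarrow>
        FM X Z (Comp C X Y Z g f) = Comp D (FO X) (FO Y) (FO Z) (FM Y Z g) (FM X Y f)"

definition iso_arrow :: "('o, 'h, 'r) lin_cat \<Rightarrow> 'o \<Rightarrow> 'o \<Rightarrow> 'h \<Rightarrow> bool"
  where "iso_arrow C X Y f \<longleftrightarrow> f \<in> Arr C X Y \<and>
    (\<exists>g \<in> Arr C Y X. Comp C X Y X g f = Ident C X \<and> Comp C Y X Y f g = Ident C Y)"

definition naturally_isomorphic ::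
    "('o, 'h, 'r) lin_cat \<Rightarrow> ('p, 'k, 'r) lin_cat \<Rightarrow>
      ('o \<Rightarrow> 'p) \<Rightarrow> ('o \<Rightarrow> 'o \<Rightarrow> 'h \<Rightarrow> 'k) \<Rightarrow> ('o \<Rightarrow> 'p) \<Rightarrow> ('o \<Rightarrow> 'o \<Rightarrow> 'h \<Rightarrow> 'k) \<Rightarrow> bool"
  where "naturally_isomorphic C D FO FM GO GM \<longleftrightarrow>
    (\<exists>\<alpha>. (\<forall>X\<in>Ob C. iso_arrow D (FO X) (GO X) (\<alpha> X)) \<and>
      (\<forall>X\<in>Ob C. \<forall>Y\<in>Ob C. \<forall>f\<in>Arr C X Y.
        Comp D (FO X) (FO Y) (GO Y) (\<alpha> Y) (FM X Y f) =
        Comp D (FO X) (GO X) (GO Y) (GM X Y f) (\<alpha> X)))"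

definition auto_equivalence ::
    "('r, 'z) ring_scheme \<Rightarrow> ('o, 'h, 'r) lin_cat \<Rightarrow> ('o \<Rightarrow> 'o) \<Rightarrow> ('o \<Rightarrow> 'o \<Rightarrow> 'h \<Rightarrow> 'h) \<Rightarrow> bool"
  where "auto_equivalence R C FO FM \<longleftrightarrow> linear_functor R C C FO FM \<and>
    (\<exists>GO GM. linear_functor R C C GO GM \<and>
      naturally_isomorphic C C
        (\<lambda>X. GO (FO X)) (\<lambda>X Y f. GM (FO X) (FO Y) (FM X Y f)) (\<lambda>X. X) (\<lambda>X Y f. f) \<and>
      naturally_isomorphic C C
        (\<lambda>X. FO (GO X)) (\<lambda>X Y f. FM (GO X) (GO Y) (GM X Y f)) (\<lambda>X. X) (\<lambda>X Y f. f))"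

text \<open>Here \<open>D = Hom\<^sub>R(-, E)\<close>, and \<open>\<eta> X Y : D C(X, Y) \<rightarrow> C(Y, S X)\<close>; the last two clauses are
  naturality in \<open>X\<close> and in \<open>Y\<close>.\<close>

definition serre_functor ::
    "('r, 'z) ring_scheme \<Rightarrow> ('r, 'e) module \<Rightarrow> ('o, 'h, 'r) lin_cat \<Rightarrow>
      ('o \<Rightarrow> 'o) \<Rightarrow> ('o \<Rightarrow> 'o \<Rightarrow> 'h \<Rightarrow> 'h) \<Rightarrow> ('o \<Rightarrow> 'o \<Rightarrow> ('h \<Rightarrow> 'e) \<Rightarrow> 'h) \<Rightarrow> bool"
  where "serre_functor R E C SO SM \<eta> \<longleftrightarrow>
    auto_equivalence R C SO SM \<and>
    (\<forall>X\<in>Ob C. \<forall>Y\<in>Ob C.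
      \<eta> X Y \<in> lin_hom R (dual_module R E (Mor C X Y)) (Mor C Y (SO X)) \<and>
      bij_betw (\<eta> X Y) (carrier (dual_module R E (Mor C X Y))) (Arr C Y (SO X))) \<and>
    (\<forall>X\<in>Ob C. \<forall>X'\<in>Ob C. \<forall>Y\<in>Ob C.
      \<forall>a\<in>Arr C X X'. \<forall>\<phi>\<in>carrier (dual_module R E (Mor C X Y)).
        \<eta> X' Y (\<lambda>h\<in>Arr C X' Y. \<phi> (Comp C X X' Y h a)) =
        Comp C Y (SO X) (SO X') (SM X X' a) (\<eta> X Y \<phi>)) \<and>
    (\<forall>X\<in>Ob C. \<forall>Y\<in>Ob C. \<forall>Y'\<in>Ob C.
      \<forall>b\<in>Arr C Y' Y. \<forall>\<phi>\<in>carrier (dual_module R E (Mor C X Y)).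
        \<eta> X Y' (\<lambda>h\<in>Arr C X Y'. \<phi> (Comp C X Y' Y b h)) =
        Comp C Y' Y (SO X) (\<eta> X Y \<phi>) b)"


section \<open>The bounded homotopy category\<close>

record ('l, 'm) cochain_complex =
  cobj :: "int \<Rightarrow> ('l, 'm) module"
  cdiff :: "int \<Rightarrow> 'm \<Rightarrow> 'm"

definition bounded_complexes :: "('l, 'z) ring_scheme \<Rightarrow> ('l, 'm) cochain_complex set"
  where "bounded_complexes L = {X.
    (\<forall>i. finitely_presented L (cobj X i)) \<and>
    (\<forall>i. cdiff X i \<in> lin_hom L (cobj X i) (cobj X (i + 1))) \<and>
    (\<forall>i. \<forall>x\<in>carrier (cobj X i). cdiff X (i + 1) (cdiff X i x) = \<zero>\<^bsub>cobj X (i + 1 + 1)\<^esub>) \<and>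
    (\<exists>a b. \<forall>i. i < a \<or> b < i \<longrightarrow> carrier (cobj X i) = {\<zero>\<^bsub>cobj X i\<^esub>})}"

definition acyclic_complex :: "('l, 'm) cochain_complex \<Rightarrow> bool"
  where "acyclic_complex X \<longleftrightarrow>
    (\<forall>i. cdiff X i ` carrier (cobj X i) =
      hom_kernel (cobj X (i + 1)) (cobj X (i + 1 + 1)) (cdiff X (i + 1)))"

definition chain_maps ::
    "('l, 'z) ring_scheme \<Rightarrow> ('l, 'm) cochain_complex \<Rightarrow> ('l, 'm) cochain_complex \<Rightarrow>
      (int \<Rightarrow> 'm \<Rightarrow> 'm) set"
  where "chain_maps L X Y = {f.
    (\<forall>i. f i \<in> lin_hom L (cobj X i) (cobj Y i)) \<and>
    (\<forall>i. \<forall>x\<in>carrier (cobj X i). f (i + 1) (cdiff X i x) = cdiff Y i (f i x))}"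

definition homotopic ::
    "('l, 'z) ring_scheme \<Rightarrow> ('l, 'm) cochain_complex \<Rightarrow> ('l, 'm) cochain_complex \<Rightarrow>
      (int \<Rightarrow> 'm \<Rightarrow> 'm) \<Rightarrow> (int \<Rightarrow> 'm \<Rightarrow> 'm) \<Rightarrow> bool"
  where "homotopic L X Y f g \<longleftrightarrow>
    (\<exists>s. (\<forall>i. s i \<in> lin_hom L (cobj X i) (cobj Y (i - 1))) \<and>
      (\<forall>i. \<forall>x\<in>carrier (cobj X i). f i x \<ominus>\<^bsub>cobj Y i\<^esub> g i x =
        cdiff Y (i - 1) (s i x) \<oplus>\<^bsub>cobj Y i\<^esub> s (i + 1) (cdiff X i x)))"

text \<open>Chain maps that agree on the carriers are homotopic, so their values elsewhere do not
  matter for the homotopy class.\<close>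

definition hclass ::
    "('l, 'z) ring_scheme \<Rightarrow> ('l, 'm) cochain_complex \<Rightarrow> ('l, 'm) cochain_complex \<Rightarrow>
      (int \<Rightarrow> 'm \<Rightarrow> 'm) \<Rightarrow> (int \<Rightarrow> 'm \<Rightarrow> 'm) set"
  where "hclass L X Y f = {g \<in> chain_maps L X Y. homotopic L X Y f g}"

text \<open>Operations on homotopy classes are induced by those on representatives; the unions below
  are unions of one and the same class.  The ring \<open>R\<close> acts on a right module by
  \<open>x\<cdot>r = x\<cdot>(r 1)\<close>.\<close>

definition homotopy_hom ::
    "('r, 'l, 'z) module_scheme \<Rightarrow> ('l, 'm) cochain_complex \<Rightarrow> ('l, 'm) cochain_complex \<Rightarrow>
      ('r, (int \<Rightarrow> 'm \<Rightarrow> 'm) set) module"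
  where "homotopy_hom L X Y =
    \<lparr>carrier = hclass L X Y ` chain_maps L X Y, mult = undefined, one = undefined,
     zero = hclass L X Y (\<lambda>i x. \<zero>\<^bsub>cobj Y i\<^esub>),
     add = (\<lambda>F G. \<Union>f\<in>F. \<Union>g\<in>G. hclass L X Y (\<lambda>i x. f i x \<oplus>\<^bsub>cobj Y i\<^esub> g i x)),
     smult = (\<lambda>r F. \<Union>f\<in>F. hclass L X Y (\<lambda>i x. (r \<odot>\<^bsub>L\<^esub> \<one>\<^bsub>L\<^esub>) \<odot>\<^bsub>cobj Y i\<^esub> f i x))\<rparr>"

definition bounded_homotopy_category ::
    "('r, 'l, 'z) module_scheme \<Rightarrow>
      (('l, 'm) cochain_complex, (int \<Rightarrow> 'm \<Rightarrow> 'm) set, 'r) lin_cat"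
  where "bounded_homotopy_category L =
    \<lparr>Ob = bounded_complexes L,
     Mor = homotopy_hom L,
     Comp = (\<lambda>X Y Z G F. \<Union>g\<in>G. \<Union>f\<in>F. hclass L X Z (\<lambda>i x. g i (f i x))),
     Ident = (\<lambda>X. hclass L X X (\<lambda>i x. x))\<rparr>"

definition full_subcategory ::
    "('o, 'h, 'r) lin_cat \<Rightarrow> ('o \<Rightarrow> bool) \<Rightarrow> ('o, 'h, 'r) lin_cat"
  where "full_subcategory C P = C\<lparr>Ob := {X \<in> Ob C. P X}\<rparr>"

definition acyclic_homotopy_category ::
    "('r, 'l, 'z) module_scheme \<Rightarrow>
      (('l, 'm) cochain_complex, (int \<Rightarrow> 'm \<Rightarrow> 'm) set, 'r) lin_cat"
  where "acyclic_homotopy_category L =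
    full_subcategory (bounded_homotopy_category L) acyclic_complex"

end

theory Submission
 imports Defs "HOL-Algebra.Ideal_Product" "HOL-Library.Function_Algebras"
begin

text \<open>Write \<open>D\<close> for the Matlis dual. In the category of finitely generated graded modules every
 projective \<open>P\<close> has a Serre partner: \<open>D Hom(P, -)\<close> is represented by an injective \<open>N P\<close>, where \<open>N\<close>
 is the Nakayama functor. A complex \<open>X\<close> is presented by contractible complexes of projectives
 \<open>P\<^sub>1 \<rightarrow> P\<^sub>0 \<rightarrow> X \<rightarrow> 0\<close>, and if \<open>K\<close> is the kernel of \<open>N P\<^sub>1 \<rightarrow> N P\<^sub>0\<close>, then dimension shifting shows that
 \<open>D Hom(X, -)\<close> is represented on the bounded homotopy category by \<open>K[2]\<close>. This object need not be acyclic, but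
 attaching injective hulls of its homology kills the homology after finitely many steps, because
 the injective dimensions are finite; the attached part is a bounded complex of injectives, which
 acyclic complexes do not see. So \<open>D Hom(X, -)\<close> is represented by an acyclic complex \<open>S X\<close>. By Yoneda \<open>S\<close> is a
 functor; it is full and faithful since the Hom modules have finite length and hence are reflexive.
 Dually \<open>D Hom(-, X)\<close> is represented by an acyclic complex, whence \<open>S\<close> is essentially surjective.\<close>

text \<open>A bounded complex is a single graded object with an endomorphism of degree 1, and
  morphisms of all degrees are elements of one abelian group with a total composition. Homotopies,
  connecting maps and signs thereby become equations in one biadditive multiplication, and homotopy
  classes are formed only at the end.

  The axioms of the graded setting are chosen to be stable under reversal of arrows. The one
  asymmetric point, that functionals on \<open>Hom(X, I)\<close> come from maps out of
  \<open>P\<close>, is supplied by reflexivity of finite length modules. The second representability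
  statement is therefore the first one in the opposite category.

  A mismatch shapes the treatment of dimensions: finite global dimension speaks of resolutions by
  arbitrary, possibly infinitely generated projectives, while the homology has to be killed by
  finitely generated injectives. The two meet in an \<open>Ext\<close> argument in the category of
  all graded modules, where the finitely generated injectives in use are still injective. Since all
  modules live in the type \<open>'m\<close>, quotients and sums are replaced by isomorphic copies
  there.\<close>

abbreviation (input) in_carrier (infix ":." 50) where "x :. M \<equiv> x \<in> carrier M"
abbreviation (input) add_of ("_ +[_] _" [65, 0, 66] 65) where "x +[M] y \<equiv> x \<oplus>\<^bsub>M\<^esub> y"
abbreviation (input) mult_of ("_ **[_] _" [70, 0, 71] 70) where "x **[M] y \<equiv> x \<otimes>\<^bsub>M\<^esub> y"
abbreviation (input) smult_of ("_ *[_] _" [71, 0, 70] 70) where "a *[M] x \<equiv> a \<odot>\<^bsub>M\<^esub> x"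
abbreviation (input) diff_of ("_ -[_] _" [65, 0, 66] 65) where "x -[M] y \<equiv> x \<ominus>\<^bsub>M\<^esub> y"
abbreviation (input) neg_of ("-[_] _" [0, 81] 80) where "-[M] x \<equiv> \<ominus>\<^bsub>M\<^esub> x"
abbreviation (input) zero_of ("0[_]") where "0[M] \<equiv> \<zero>\<^bsub>M\<^esub>"
abbreviation (input) one_of ("1[_]") where "1[M] \<equiv> \<one>\<^bsub>M\<^esub>"

section \<open>Artinian commutative rings\<close>

lemma (in cring) ideal_iff:
 "ideal I R \<longleftrightarrow> I \<subseteq> carrier R & \<zero> : I & (ALL x:I. ALL y:I. x \<oplus> y : I) &
  (ALL r:carrier R. ALL x:I. r \<otimes> x : I)" (is "_ \<longleftrightarrow> ?P") proof
 assume "ideal I R"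
 then interpret ideal I R .
 show ?P using a_subset zero_closed a_closed I_l_closed by auto
next
 assume P: ?P
 have inv: "\<ominus> x : I" if "x : I" for x proof -
  have "\<ominus> x = \<ominus> \<one> \<otimes> x" using that P by (metis l_minus l_one one_closed subsetD)
  thus ?thesis using that P by simp
 qed
 show "ideal I R" proof (rule idealI)
  show "subgroup I (add_monoid R)" using P inv by (intro subgroup.intro) (auto simp flip: a_inv_def)
  show "x \<otimes> a : I" if "a : I" "x :. R" for a x using P that by auto
  thus "a \<otimes> x : I" if "a : I" "x :. R" for a x using P that by (metis m_comm subsetD)
 qed (rule ring_axioms)
qed

text \<open>Zorn's lemma for the ideals between \<open>W0\<close> and \<open>I\<close>. With
  \<open>I\<close> the whole ring and \<open>v\<close> the unit it yields maximal ideals; with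
  \<open>W0 = m \<cdot> I\<close> it yields an ideal \<open>W\<close> such that \<open>I / W\<close>
  is simple.\<close>

lemma (in cring) ideal_exists_maximal_avoiding:
 assumes W0: "ideal W0 R" "W0 \<subseteq> I" "v ~: W0"
 obtains W where "ideal W R" "W0 \<subseteq> W" "W \<subseteq> I" "v ~: W"
  "!!J. ideal J R ==> W \<subseteq> J ==> J \<subseteq> I ==> v ~: J ==> J = W" proof -
 define A where "A = {W. ideal W R & W0 \<subseteq> W & W \<subseteq> I & v ~: W}"
 have "EX M:A. ALL X:A. M \<subseteq> X --> X = M" proof (rule subset_Zorn_nonempty)
  show "A ~= {}" using W0 by (auto simp: A_def)
  fix C assume C: "C ~= {}" "subset.chain A C"
  have CA: "C \<subseteq> A" and ch: "!!X Y. X : C ==> Y : C ==> X \<subseteq> Y | Y \<subseteq> X"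
   using C by (auto simp: subset_chain_def)
  have "ideal (\<Union>C) R" unfolding ideal_iff proof (intro conjI ballI)
   fix x y assume "x : \<Union>C" "y : \<Union>C"
   then obtain X Y where XY: "X : C" "x : X" "Y : C" "y : Y" by auto
   then obtain Z where "Z : C" "x : Z" "y : Z" using ch by blast
   hence "x \<oplus> y : Z" using CA unfolding A_def ideal_iff by blast
   thus "x \<oplus> y : \<Union>C" using `Z : C` by blast
  next
   fix r x assume r: "r :. R" "x : \<Union>C"
   then obtain X where "X : C" "x : X" by auto
   moreover from this have "r \<otimes> x : X" using CA r unfolding A_def ideal_iff by blast
   ultimately show "r \<otimes> x : \<Union>C" by blast
  qed (use CA C in "auto simp: A_def ideal_iff")
  thus "\<Union>C : A" using CA C by (fastforce simp: A_def)
 qed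
 then obtain W where W: "W : A" and m: "!!X. X : A ==> W \<subseteq> X ==> X = W" by auto
 show thesis by (rule that[of W]; use W in "simp add: A_def"; use m[unfolded A_def] in blast)
qed

lemma (in cring) exists_maximalideal_above:
 assumes "ideal I R" "\<one> ~: I"
 obtains m where "maximalideal m R" "I \<subseteq> m" proof -
 obtain W where W: "ideal W R" "I \<subseteq> W" "W \<subseteq> carrier R" "\<one> ~: W"
  "!!J. ideal J R ==> W \<subseteq> J ==> J \<subseteq> carrier R ==> \<one> ~: J ==> J = W"
  using ideal_exists_maximal_avoiding[of I "carrier R" \<one>] assms by (metis ideal_iff)
 have "maximalideal W R" proof (rule maximalidealI)
  fix J assume J: "ideal J R" "W \<subseteq> J" "J \<subseteq> carrier R"
  show "J = W | J = carrier R" using W(5)[OF J] ideal.one_imp_carrier[OF J(1)] by blast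
 qed (use W in auto)
 with W that show thesis by blast
qed

lemma (in cring) ideal_mult_elem:
 assumes "ideal N R" "x :. R" shows "ideal {x \<otimes> e | e. e : N} R" proof -
 have N: "N \<subseteq> carrier R" "\<zero> : N" "!!x y. x : N ==> y : N ==> x \<oplus> y : N"
  "!!r x. r :. R ==> x : N ==> r \<otimes> x : N" using assms(1) by (auto simp: ideal_iff)
 show ?thesis unfolding ideal_iff proof (intro conjI ballI)
  show "{x \<otimes> e | e. e : N} \<subseteq> carrier R" using N(1) assms(2) by auto
  have "x \<otimes> \<zero> = \<zero>" using assms(2) by simp
  thus "\<zero> : {x \<otimes> e | e. e : N}" using N(2) by force
  fix y z assume "y : {x \<otimes> e | e. e : N}" "z : {x \<otimes> e | e. e : N}"
  then obtain e f where ef: "y = x \<otimes> e" "z = x \<otimes> f" "e : N" "f : N" by auto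
  hence "y \<oplus> z = x \<otimes> (e \<oplus> f)" using N(1) assms(2) by (simp add: r_distr subset_iff)
  thus "y \<oplus> z : {x \<otimes> e | e. e : N}" using N(3)[OF ef(3,4)] by blast
 next
  fix r y assume r: "r :. R" "y : {x \<otimes> e | e. e : N}"
  then obtain e where e: "y = x \<otimes> e" "e : N" by auto
  hence "r \<otimes> y = x \<otimes> (r \<otimes> e)" using N(1) assms(2) r(1) by (simp add: m_lcomm subset_iff)
  thus "r \<otimes> y : {x \<otimes> e | e. e : N}" using N(4)[OF r(1) e(2)] by blast
 qed
qed

lemma (in cring) ideal_adjoin:
 assumes mi: "ideal m R" and r: "r :. R"
 defines "J \<equiv> {p \<oplus> r' \<otimes> r | p r'. p : m & r' :. R}" shows "ideal J R" "m \<subseteq> J" "r : J"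
proof -
 have ms: "m \<subseteq> carrier R" using mi by (simp add: ideal_iff)
 show "ideal J R" unfolding ideal_iff proof (intro conjI ballI)
  show "J \<subseteq> carrier R" using ms r by (auto simp: J_def)
  have "\<zero> = \<zero> \<oplus> \<zero> \<otimes> r" using r by simp
  thus "\<zero> : J" using mi unfolding J_def ideal_iff by blast
  fix x y assume "x : J" "y : J"
  then obtain p a q b where xy: "x = p \<oplus> a \<otimes> r" "y = q \<oplus> b \<otimes> r" "p : m" "q : m"
   "a :. R" "b :. R" by (auto simp: J_def)
  hence "x \<oplus> y = (p \<oplus> q) \<oplus> (a \<oplus> b) \<otimes> r" "p \<oplus> q : m"
   using r ms mi by (auto simp: l_distr a_ac subset_iff ideal_iff)
  thus "x \<oplus> y : J" unfolding J_def using xy a_closed by blast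
 next
  fix c x assume c: "c :. R" and "x : J"
  then obtain p a where xy: "x = p \<oplus> a \<otimes> r" "p : m" "a :. R" by (auto simp: J_def)
  hence "c \<otimes> x = (c \<otimes> p) \<oplus> (c \<otimes> a) \<otimes> r" "c \<otimes> p : m"
   using r ms mi c by (auto simp: r_distr m_ac subset_iff ideal_iff)
  thus "c \<otimes> x : J" unfolding J_def using xy c m_closed by blast
 qed
 show "m \<subseteq> J" proof
  fix x assume "x : m"
  moreover have "x = x \<oplus> \<zero> \<otimes> r" using ms r `x : m` by auto
  ultimately show "x : J" unfolding J_def by blast
 qed
 have "r = \<zero> \<oplus> \<one> \<otimes> r" using r by simp
 thus "r : J" using mi unfolding J_def ideal_iff by blast
qed

lemma (in cring) maximalideal_inverse:
 assumes m: "maximalideal m R" and r: "r :. R" "r ~: m"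
 obtains r' p where "r' :. R" "p : m" "r' \<otimes> r \<oplus> p = \<one>" proof -
 have mi: "ideal m R" using m by (rule maximalideal.axioms)
 note J = ideal_adjoin[OF mi r(1)]
 have "{p \<oplus> r' \<otimes> r | p r'. p : m & r' :. R} = carrier R"
  using maximalideal.I_maximal[OF m J(1,2)] J r unfolding ideal_iff by blast
 hence "\<one> : {p \<oplus> r' \<otimes> r | p r'. p : m & r' :. R}" by simp
 then obtain p r' where pr: "\<one> = p \<oplus> r' \<otimes> r" "p : m" "r' :. R" by blast
 moreover have "p :. R" using pr(2) mi by (auto simp: ideal_iff)
 ultimately show thesis using r that[of r' p] by (simp add: a_comm)
qed

text \<open>A composition series read from the top: each quotient \<open>I / I'\<close> is generated
  by the class of one element \<open>y\<close> and is killed by a maximal ideal, so it is simple or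
  zero.\<close>

inductive ideal_chain :: "('r, 'z) ring_scheme => 'r set => bool" for R (structure) where
  top: "ideal_chain R (carrier R)"
 | step: "[|ideal_chain R I; ideal I' R; I' \<subseteq> I; y : I; maximalideal m R;
   !!r. r : m ==> r \<otimes> y : I';
   !!x. x : I ==> EX w:I'. EX r:carrier R. x = w \<oplus> r \<otimes> y|] ==> ideal_chain R I'"

lemma (in cring) ideal_chain_ideal: "ideal_chain R I ==> ideal I R"
 by (induction rule: ideal_chain.induct) (auto simp: oneideal)

lemma (in artinian_cring) minimal_ideal:
 assumes "A I0" "!!I. A I ==> ideal I R" shows "EX I. A I & (ALL J. A J --> J \<subseteq> I --> J = I)"
proof (rule ccontr)
 assume "\<not> ?thesis"
 hence "ALL I. A I --> (EX J. A J & J \<subset> I)" by blast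
 then obtain f where f: "!!I. A I ==> A (f I) & f I \<subset> I" by metis
 define I where "I n = (f ^^ n) I0" for n
 have A: "A (I n)" for n by (induction n) (use assms f in "auto simp: I_def")
 have s: "I (Suc n) \<subset> I n" for n using f[OF A[of n]] by (simp add: I_def)
 obtain n where "ALL m>=n. I m = I n" using descending_chain_condition[of I] A assms s by blast
 hence "I (Suc n) = I n" using le_SucI[OF order_refl] by blast
 with s[of n] show False by simp
qed

inductive max_prod :: "('r, 'z) ring_scheme => 'r set => bool" for R (structure) where
  "max_prod R (carrier R)"
 | "[|max_prod R N; maximalideal m R|] ==> max_prod R (m \<cdot> N)"

text \<open>A form of the nilpotency of the radical. If \<open>m \<cdot> I = I\<close> for all
  maximal \<open>m\<close>, then a minimal product \<open>N\<close> of maximal ideals is idempotent,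
  nonzero and contained in every maximal ideal. A minimal \<open>A\<close> with
  \<open>A \<cdot> N\<close> nonzero is of the form \<open>x N\<close>, so \<open>x = x e\<close>
  with \<open>e\<close> in the radical, and \<open>x = 0\<close> because \<open>1 - e\<close> is a
  unit.\<close>

lemma (in artinian_cring) exists_maximalideal_prod_neq:
 assumes I: "ideal I R" "I ~= {\<zero>}"
 obtains m where "maximalideal m R" "m \<cdot> I ~= I" proof (rule ccontr)
 assume "\<not> thesis"
 with that have mI: "!!m. maximalideal m R ==> m \<cdot> I = I" by blast
 have idm: "ideal m R" if "maximalideal m R" for m using that by (rule maximalideal.axioms)
 have P: "max_prod R N ==> ideal N R & N \<cdot> I = I" for N proof (induction rule: max_prod.induct)
  case 1 thus ?case using I(1) ideal_prod_commute[OF oneideal I(1)] ideal_prod_one[of I] oneideal by simp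
 next
  case (2 N m) thus ?case using ideal_prod_assoc[of m N I] idm[of m] I mI by (simp add: ideal_prod_is_ideal)
 qed
 obtain N where N: "max_prod R N" "!!J. max_prod R J ==> J \<subseteq> N ==> J = N"
  using minimal_ideal[of "max_prod R", OF max_prod.intros(1)] P by blast
 note Ni = P[OF N(1), THEN conjunct1]
 have mN: "m \<cdot> N = N" "N \<subseteq> m" if "maximalideal m R" for m proof -
  show "m \<cdot> N = N" using N(2)[OF max_prod.intros(2)[OF N(1) that]] ideal_prod_inter[OF idm[OF that] Ni] by simp
  thus "N \<subseteq> m" using ideal_prod_inter[OF idm[OF that] Ni] by auto
 qed
 have "N' \<cdot> N = N" if "max_prod R N'" for N' using that proof (induction rule: max_prod.induct)
  case 1 thus ?case using Ni ideal_prod_commute[OF oneideal Ni] ideal_prod_one[of N] by simp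
 next
  case (2 N' m) thus ?case using ideal_prod_assoc[of m N' N] idm[of m] Ni P[OF 2(1)] mN by simp
 qed
 with N have NN: "N \<cdot> N = N" by blast
 have "N ~= {\<zero>}" proof
  assume "N = {\<zero>}"
  hence "I = {\<zero>} \<cdot> I" using P[OF N(1)] by simp
  also have "\<dots> \<subseteq> {\<zero>}" using ideal_prod_inter[OF zeroideal I(1)] by auto
  finally show False using I by (auto simp: ideal_iff)
 qed
 define B where "B A \<longleftrightarrow> ideal A R & A \<cdot> N ~= {\<zero>}" for A
 have "B N" using Ni NN `N ~= {\<zero>}` by (simp add: B_def)
 then obtain A where A: "B A" "!!J. B J ==> J \<subseteq> A ==> J = A" using minimal_ideal[of B N] B_def by blast
 have Ai: "ideal A R" and AN: "A \<cdot> N ~= {\<zero>}" using A by (auto simp: B_def)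
 obtain x e0 where x: "x : A" "e0 : N" "x \<otimes> e0 ~= \<zero>" proof (rule ccontr)
  assume "\<not> thesis"
  with that have z: "!!x e. x : A ==> e : N ==> x \<otimes> e = \<zero>" by blast
  have "y = \<zero>" if "y : A \<cdot> N" for y using that by induction (auto simp: z)
  moreover have "\<zero> : A \<cdot> N" using ideal_prod_is_ideal[OF Ai Ni] by (simp add: ideal_iff)
  ultimately show False using AN by blast
 qed
 have xR: "x :. R" using x Ai by (auto simp: ideal_iff)
 define A' where "A' = {x \<otimes> e | e. e : N}"
 have A'i: "ideal A' R" unfolding A'_def by (rule ideal_mult_elem[OF Ni xR])
 have Nc: "N \<subseteq> carrier R" using Ni by (simp add: ideal_iff)
 \<comment> \<open>By idempotence \<open>x N = x N \<cdot> N\<close>, so \<open>A' = x N\<close>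
   competes with the minimal \<open>A\<close>.\<close>
 have "x \<otimes> e : A' \<cdot> N" if "e : N" for e proof -
  have "e : N \<cdot> N" using that NN by simp
  thus ?thesis proof induction
   case (prod i k)
   hence "x \<otimes> i : A'" by (auto simp: A'_def)
   hence "(x \<otimes> i) \<otimes> k : A' \<cdot> N" using prod by (intro ideal_prod.prod)
   thus ?case using prod xR Nc by (simp add: m_assoc subset_iff)
  next
   case (sum s1 s2)
   have "s1 :. R" "s2 :. R" using sum NN Nc by auto
   thus ?case using sum ideal_prod.sum[OF sum.IH] xR by (simp add: r_distr)
  qed
 qed
 hence "x \<otimes> e0 : A' \<cdot> N" using x by simp
 hence "B A'" using A'i x by (auto simp: B_def)
 moreover have "A' \<subseteq> A" using x Ai Nc by (auto simp: A'_def ideal_iff m_comm subset_iff xR)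
 ultimately have "A' = A" using A by blast
 then obtain e where e: "e : N" "x = x \<otimes> e" using x by (auto simp: A'_def)
 have eR: "e :. R" using e Nc by auto
 define J where "J = {(\<one> \<ominus> e) \<otimes> r | r. r :. R}"
 have J: "ideal J R" unfolding J_def by (rule ideal_mult_elem[OF oneideal]) (use eR in simp)
 \<comment> \<open>A maximal ideal above \<open>J\<close> would contain both \<open>1 - e\<close>
   and \<open>e\<close>.\<close>
 have "\<one> : J" proof (rule ccontr)
  assume "\<one> ~: J"
  then obtain m where m: "maximalideal m R" "J \<subseteq> m" using exists_maximalideal_above[OF J] by metis
  have "\<one> \<ominus> e = (\<one> \<ominus> e) \<otimes> \<one>" using eR by simp
  hence "\<one> \<ominus> e : J" unfolding J_def by blast
  moreover have "e : m" using mN[OF m(1)] e by auto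
  ultimately have "(\<one> \<ominus> e) \<oplus> e : m" using m idm[OF m(1)] by (auto simp: ideal_iff)
  moreover have "(\<one> \<ominus> e) \<oplus> e = \<one>" using eR by (simp add: minus_eq a_assoc l_neg)
  ultimately have "m = carrier R" using ideal.one_imp_carrier[OF idm[OF m(1)]] by simp
  thus False using maximalideal.I_notcarr[OF m(1)] by simp
 qed
 then obtain r where r: "r :. R" "\<one> = (\<one> \<ominus> e) \<otimes> r" by (auto simp: J_def)
 have "x \<otimes> (\<one> \<ominus> e) = \<zero>" proof -
  have "x \<otimes> (\<one> \<ominus> e) = x \<ominus> x \<otimes> e" using xR eR by (simp add: minus_eq r_distr r_minus)
  thus ?thesis using e xR by (simp add: minus_eq r_neg)
 qed
 hence "x \<otimes> ((\<one> \<ominus> e) \<otimes> r) = \<zero>" using xR eR r(1) by (simp flip: m_assoc)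
 hence "x \<otimes> \<one> = \<zero>" by (subst r(2))
 hence "x = \<zero>" using xR by simp
 thus False using x Nc by auto
qed

text \<open>Hopkins' theorem. If the lowest term \<open>I\<close> of all chains were nonzero,
  \<open>I / (m \<cdot> I)\<close> would be a nonzero vector space over \<open>R / m\<close> for
  some maximal \<open>m\<close>. A subspace \<open>W\<close> maximal among those avoiding a vector
  \<open>v\<close> has codimension one, because every larger one contains \<open>v\<close>; so
  \<open>W\<close> continues the chain.\<close>

theorem (in artinian_cring) ideal_chain_zero: "ideal_chain R {\<zero>}"
proof -
 obtain I where I: "ideal_chain R I" "!!J. ideal_chain R J ==> J \<subseteq> I ==> J = I"
  using minimal_ideal[of "ideal_chain R", OF ideal_chain.top ideal_chain_ideal] by blast
 note Ii = ideal_chain_ideal[OF I(1)]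
 have Ic: "I \<subseteq> carrier R" using Ii by (simp add: ideal_iff)
 have "I = {\<zero>}" proof (rule ccontr)
  assume "I ~= {\<zero>}"
  then obtain m where m: "maximalideal m R" "m \<cdot> I ~= I" using exists_maximalideal_prod_neq[OF Ii] by metis
  have mi: "ideal m R" using m(1) by (rule maximalideal.axioms)
  have sub: "m \<cdot> I \<subseteq> I" using ideal_prod_inter[OF mi Ii] by auto
  then obtain v where v: "v : I" "v ~: m \<cdot> I" using m by auto
  have vR: "v :. R" using v Ic by auto
  obtain W where W: "ideal W R" "m \<cdot> I \<subseteq> W" "W \<subseteq> I" "v ~: W"
   "!!J. ideal J R ==> W \<subseteq> J ==> J \<subseteq> I ==> v ~: J ==> J = W"
   using ideal_exists_maximal_avoiding[OF ideal_prod_is_ideal[OF mi Ii] sub v(2)] by metis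
  have mI: "r \<otimes> u : W" if "r : m" "u : I" for r u using W(2) ideal_prod.prod[OF that, of R] by auto
  \<comment> \<open>If \<open>u\<close> lies outside \<open>W\<close>, then \<open>v\<close> is
    \<open>r u\<close> modulo \<open>W\<close> with \<open>r\<close> outside \<open>m\<close>;
    inverting \<open>r\<close> modulo \<open>m\<close> makes \<open>u\<close> a multiple of
    \<open>v\<close>.\<close>
  have "EX w:W. EX r:carrier R. u = w \<oplus> r \<otimes> v" if u: "u : I" for u proof (cases "u : W")
   case True
   have "u = u \<oplus> \<zero> \<otimes> v" using u Ic vR by auto
   thus ?thesis using True by blast
  next
   case False
   have uR: "u :. R" using u Ic by auto
   note J = ideal_adjoin[OF W(1) uR]
   have "{w \<oplus> r \<otimes> u | w r. w : W & r :. R} \<subseteq> I" using W(3) u Ii unfolding ideal_iff by blast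
   hence "v : {w \<oplus> r \<otimes> u | w r. w : W & r :. R}" using W(5)[OF J(1,2)] J(3) False by blast
   then obtain w r where wr: "v = w \<oplus> r \<otimes> u" "w : W" "r :. R" by blast
   have wR: "w :. R" using wr W(3) Ic by auto
   have "r ~: m" proof
    assume "r : m"
    hence "r \<otimes> u : W" using mI u by simp
    thus False using wr W(1,4) unfolding ideal_iff by metis
   qed
   then obtain r' p where r': "r' :. R" "p : m" "r' \<otimes> r \<oplus> p = \<one>"
    using maximalideal_inverse[OF m(1)] wr by metis
   have pR: "p :. R" using r' mi by (auto simp: ideal_iff)
   have "u = (r' \<otimes> r \<oplus> p) \<otimes> u" using r' uR by simp
   also have "\<dots> = r' \<otimes> (r \<otimes> u) \<oplus> p \<otimes> u"
    using r'(1) wr(3) uR pR by (simp add: l_distr m_assoc)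
   also have "r \<otimes> u = v \<oplus> \<ominus> \<one> \<otimes> w" using wr uR wR by (simp add: l_minus a_ac r_neg2)
   finally have "u = (r' \<otimes> (\<ominus> \<one> \<otimes> w) \<oplus> p \<otimes> u) \<oplus> r' \<otimes> v"
    using r' uR vR wR pR by (simp add: r_distr a_ac)
   moreover have "r' \<otimes> (\<ominus> \<one> \<otimes> w) \<oplus> p \<otimes> u : W"
    using W(1) mI[OF r'(2) u] wr r' unfolding ideal_iff by auto
   ultimately show ?thesis using r' by blast
  qed
  hence "ideal_chain R W" using ideal_chain.step[OF I(1) W(1,3) v(1) m(1)] mI[OF _ v(1)] by blast
  thus False using I(2)[OF _ W(3)] v W(4) by simp
 qed
 with I show ?thesis by simp
qed

section \<open>Modules of finite length inside abelian groups\<close>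

text \<open>Modules are subsets of a type of class \<open>ab_group_add\<close> with an explicit
  scalar action, so that submodules, kernels and images share the addition of the type. Module
  records enter later through an embedding into such a type.\<close>

locale rmod = cring R for R (structure) and s :: "'r => 'v::ab_group_add => 'v" and V :: "'v set" +
 assumes zero_mem [simp]: "0 : V"
  and add_mem: "[|x : V; y : V|] ==> x + y : V"
  and smult_mem: "[|r :. R; x : V|] ==> s r x : V"
  and smult_add: "[|r :. R; x : V; y : V|] ==> s r (x + y) = s r x + s r y"
  and add_smult: "[|r :. R; q :. R; x : V|] ==> s (r \<oplus> q) x = s r x + s q x"
  and mult_smult: "[|r :. R; q :. R; x : V|] ==> s (r \<otimes> q) x = s r (s q x)"
  and one_smult [simp]: "x : V ==> s \<one> x = x"
begin

lemma zero_smult [simp]: "x : V ==> s \<zero> x = 0"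
 using add_smult[of \<zero> \<zero> x] by simp

lemma smult_zero [simp]: "r :. R ==> s r 0 = 0"
 using smult_add[of r 0 0] by simp

lemma minus_one_smult: "x : V ==> s (\<ominus> \<one>) x = - x"
 using add_smult[of "\<ominus> \<one>" \<one> x] by (simp add: l_neg eq_neg_iff_add_eq_0)

lemma uminus_mem: "x : V ==> - x : V"
 using smult_mem[of "\<ominus> \<one>" x] by (simp add: minus_one_smult)

lemma diff_mem: "x : V ==> y : V ==> x - y : V"
 using add_mem[of x "- y"] uminus_mem by simp

lemma smult_uminus: "r :. R ==> x : V ==> s r (- x) = - s r x"
 using smult_add[of r x "- x"] uminus_mem[of x] by (simp add: eq_neg_iff_add_eq_0 add.commute)

lemma smult_diff: "r :. R ==> x : V ==> y : V ==> s r (x - y) = s r x - s r y"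
 using smult_add[of r x "- y"] uminus_mem[of y] smult_uminus[of r y] by simp

lemma a_inv_smult: "r :. R ==> x : V ==> s (\<ominus> r) x = - s r x"
 using add_smult[of "\<ominus> r" r x] by (simp add: l_neg eq_neg_iff_add_eq_0)

lemma rmodI_sub:
 assumes "W \<subseteq> V" "0 : W" "!!x y. x : W ==> y : W ==> x + y : W"
  "!!r x. r :. R ==> x : W ==> s r x : W" shows "rmod R s W" by unfold_locales
  (use assms in "auto simp: subset_iff smult_add add_smult mult_smult")

end

definition adjoin :: "('r, 'z) ring_scheme => ('r => 'v => 'v) => 'v set => 'v::ab_group_add => 'v set"
 where "adjoin R s W x = {w + s r x | w r. w : W & r :. R}"

context rmod
begin

lemma adjoin:
 assumes W: "rmod R s W" "W \<subseteq> V" and x: "x : V"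
 shows "rmod R s (adjoin R s W x)" "W \<subseteq> adjoin R s W x" "x : adjoin R s W x"
  "adjoin R s W x \<subseteq> V" proof -
 interpret W: rmod R s W by fact
 show sub: "adjoin R s W x \<subseteq> V" using W(2) x by (auto simp: adjoin_def intro!: add_mem smult_mem)
 have "w : adjoin R s W x" if "w : W" for w proof -
  have "w = w + s \<zero> x" using x by simp
  thus ?thesis using that unfolding adjoin_def by blast
 qed
 thus "W \<subseteq> adjoin R s W x" by blast
 hence z: "0 : adjoin R s W x" by auto
 have "x = 0 + s \<one> x" using x by simp
 thus "x : adjoin R s W x" unfolding adjoin_def using W.zero_mem by blast
 show "rmod R s (adjoin R s W x)" proof (rule rmodI_sub[OF sub z])
  fix y z assume "y : adjoin R s W x" "z : adjoin R s W x"
  then obtain a b r q where *: "y = a + s r x" "z = b + s q x" "a : W" "b : W"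
   "r :. R" "q :. R" by (auto simp: adjoin_def)
  hence "y + z = (a + b) + s (r \<oplus> q) x" using x by (simp add: add_smult)
  moreover have "a + b : W" using * by (simp add: W.add_mem)
  ultimately show "y + z : adjoin R s W x" unfolding adjoin_def using * a_closed by blast
 next
  fix r z assume r: "r :. R" and "z : adjoin R s W x"
  then obtain b q where *: "z = b + s q x" "b : W" "q :. R" by (auto simp: adjoin_def)
  hence "s r z = s r b + s (r \<otimes> q) x" using x r W(2) by (auto simp: smult_add mult_smult smult_mem)
  moreover have "s r b : W" using * r by (simp add: W.smult_mem)
  ultimately show "s r z : adjoin R s W x" unfolding adjoin_def using * r m_closed by blast
 qed
qed

end

definition linear_on :: "('r, 'z) ring_scheme => ('r => 'v => 'v) => 'v set =>
  ('r => 'w => 'w) => 'w set => ('v::ab_group_add => 'w::ab_group_add) => bool"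
 where "linear_on R s V s' V' f \<longleftrightarrow> (ALL x:V. f x : V') & (ALL x:V. ALL y:V. f (x + y) = f x + f y) &
  (ALL r:carrier R. ALL x:V. f (s r x) = s' r (f x))"

lemma linear_onI:
 assumes "!!x. x : V ==> f x : V'" "!!x y. x : V ==> y : V ==> f (x + y) = f x + f y"
  "!!r x. r :. R ==> x : V ==> f (s r x) = s' r (f x)" shows "linear_on R s V s' V' f"
 using assms by (auto simp: linear_on_def)

lemma linear_onD:
 assumes "linear_on R s V s' V' f" shows "x : V ==> f x : V'" "x : V ==> y : V ==> f (x + y) = f x + f y"
  "r :. R ==> x : V ==> f (s r x) = s' r (f x)" using assms by (auto simp: linear_on_def)

lemma linear_on_subset:
 "linear_on R s V s' V' f ==> W \<subseteq> V ==> linear_on R s W s' V' f" by (auto simp: linear_on_def subset_iff)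

lemma linear_on_cong:
 assumes "linear_on R s V s' V' f" "rmod R s V" "!!x. x : V ==> f x = g x" shows "linear_on R s V s' V' g" proof -
 interpret rmod R s V by fact
 show ?thesis using assms(1,3) by (auto simp: linear_on_def add_mem smult_mem)
qed

context rmod
begin

lemma linear_on_zero: assumes "linear_on R s V s' V' f" shows "f 0 = 0"
 using linear_onD(2)[OF assms, of 0 0] by simp

lemma linear_on_uminus: assumes "linear_on R s V s' V' f" "x : V" shows "f (- x) = - f x"
 using linear_onD(2)[OF assms(1), of x "- x"] uminus_mem[OF assms(2)] assms
  linear_on_zero[OF assms(1)] by (simp add: eq_neg_iff_add_eq_0 add.commute)

lemma linear_on_diff:
 assumes "linear_on R s V s' V' f" "x : V" "y : V" shows "f (x - y) = f x - f y"
 using linear_onD(2)[OF assms(1), of x "- y"] uminus_mem[OF assms(3)] assms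
  linear_on_uminus[OF assms(1)] by simp

lemma rmod_kernel:
 assumes "linear_on R s V s' V' f" "rmod R s' V'" shows "rmod R s {x : V. f x = 0}" proof -
 interpret V': rmod R s' V' by fact
 show ?thesis by (rule rmodI_sub) (use linear_onD[OF assms(1)] linear_on_zero[OF assms(1)] in
   \<open>auto simp: add_mem smult_mem\<close>)
qed

lemma rmod_vimage:
 assumes "linear_on R s V s' V' f" "rmod R s' W'" shows "rmod R s {x : V. f x : W'}" proof -
 interpret W': rmod R s' W' by fact
 show ?thesis by (rule rmodI_sub) (use linear_onD[OF assms(1)] linear_on_zero[OF assms(1)] in
   \<open>auto simp: add_mem smult_mem W'.add_mem W'.smult_mem\<close>)
qed

lemma rmod_image:
 assumes f: "linear_on R s V s' V' f" "rmod R s' V'" shows "rmod R s' (f ` V)" proof -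
 interpret V': rmod R s' V' by fact
 show ?thesis proof (rule V'.rmodI_sub)
  show "0 : f ` V" using linear_on_zero[OF f(1)] by (metis imageI zero_mem)
  show "x + y : f ` V" if xy: "x : f ` V" "y : f ` V" for x y proof -
   obtain a b where "x = f a" "y = f b" "a : V" "b : V" using xy by auto
   hence "x + y = f (a + b)" "a + b : V" using linear_onD(2)[OF f(1)] by (auto simp: add_mem)
   thus ?thesis by auto
  qed
  show "s' r x : f ` V" if r: "r :. R" "x : f ` V" for r x proof -
   obtain a where "x = f a" "a : V" using r by auto
   hence "s' r x = f (s r a)" "s r a : V" using linear_onD(3)[OF f(1)] r by (auto simp: smult_mem)
   thus ?thesis by auto
  qed
 qed (use linear_onD(1)[OF f(1)] in auto)
qed

end

text \<open>The module version of \<open>ideal_chain\<close>, read from the bottom. Steps with zero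
  quotient are permitted, so that the image of a series is again a series.\<close>

inductive finite_length :: "('r, 'z) ring_scheme => ('r => 'v::ab_group_add => 'v) => 'v set => bool" for R and s where
  zero: "rmod R s {0} ==> finite_length R s {0}"
 | step: "[|finite_length R s W; rmod R s V; W \<subseteq> V; x : V; maximalideal m R;
   !!r. r : m ==> s r x : W; !!v. v : V ==> EX w:W. EX r:carrier R. v = w + s r x|] ==>
   finite_length R s V"

lemma finite_length_rmod: "finite_length R s V ==> rmod R s V"
 by (induction rule: finite_length.induct) auto

text \<open>A series of the image pulls back along \<open>f\<close> to a series from the kernel up
  to \<open>V\<close>. Every preimage contains the kernel, so restricting \<open>f\<close> during
  the induction does not change the kernel.\<close>

lemma finite_length_extension:
 assumes "finite_length R s' V'" shows "rmod R s V ==> linear_on R s V s' V' f ==> f ` V = V' ==>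
  finite_length R s {x : V. f x = 0} ==> finite_length R s V" using assms
proof (induction arbitrary: V rule: finite_length.induct)
 case zero
 hence "{x : V. f x = 0} = V" by auto
 thus ?case using zero by simp
next
 case (step W' V' x' m)
 interpret rmod R s V by fact
 interpret V': rmod R s' V' by fact
 interpret W': rmod R s' W' using finite_length_rmod step by blast
 define W where "W = {x : V. f x : W'}"
 have Wr: "rmod R s W" unfolding W_def by (rule rmod_vimage) (use step in "auto intro: W'.rmod_axioms")
 have lin: "linear_on R s W s' W' f" using step.prems(2) by (auto simp: linear_on_def W_def)
 have "f ` W = W'" using step.prems(3) step.hyps(3) by (auto simp: W_def)
 moreover have "{x : W. f x = 0} = {x : V. f x = 0}" by (auto simp: W_def)
 ultimately have W: "finite_length R s W" using step.IH[OF Wr lin] step.prems(4) by simp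
 obtain x where x: "x : V" "f x = x'" using step.prems(3) step.hyps(4) by auto
 have mR: "r :. R" if "r : m" for r using that maximalideal.axioms(1)[OF step.hyps(5)] by (auto simp: ideal_iff)
 show ?case proof (rule finite_length.step[OF W rmod_axioms _ x(1) step.hyps(5)])
  show "W \<subseteq> V" by (auto simp: W_def)
  show "s r x : W" if "r : m" for r
   using step.hyps(6)[OF that] linear_onD(3)[OF step.prems(2) mR[OF that] x(1)] x mR[OF that]
   by (simp add: W_def smult_mem)
  fix v assume v: "v : V"
  hence "f v : V'" using step.prems(3) by auto
  then obtain w r where wr: "w : W'" "r :. R" "f v = w + s' r x'" using step.hyps(7) by blast
  have "f (v - s r x) = w"
   using linear_on_diff[OF step.prems(2) v, of "s r x"] linear_onD(3)[OF step.prems(2) wr(2) x(1)] wr x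
   by (simp add: smult_mem)
  hence "v - s r x : W" using v wr x by (simp add: W_def diff_mem smult_mem)
  moreover have "v = (v - s r x) + s r x" by simp
  ultimately show "EX w:W. EX r:carrier R. v = w + s r x" using wr by blast
 qed
qed

lemma finite_length_sub:
 assumes "finite_length R s V" shows "rmod R s U ==> U \<subseteq> V ==> finite_length R s U" using assms
proof (induction arbitrary: U rule: finite_length.induct)
 case zero
 then interpret rmod R s U by simp
 have "U = {0}" using zero by auto
 thus ?case using zero finite_length.zero by blast
next
 case (step W V x m)
 interpret V: rmod R s V by fact
 interpret U: rmod R s U by fact
 interpret W: rmod R s W using finite_length_rmod step by blast
 have r: "rmod R s (U \<inter> W)" by (rule U.rmodI_sub) (auto simp: U.add_mem U.smult_mem W.add_mem W.smult_mem)
 have FL: "finite_length R s (U \<inter> W)" using step.IH[OF r] by simp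
 have mi: "ideal m R" using step.hyps(5) by (rule maximalideal.axioms)
 have mR: "r :. R" if "r : m" for r using that mi by (auto simp: V.ideal_iff)
 show ?case proof (cases "U \<subseteq> W")
  case True thus ?thesis using FL by (simp add: Int_absorb2)
 next
  case False
  \<comment> \<open>An element of \<open>U\<close> outside \<open>W\<close> generates
    \<open>V\<close> modulo \<open>W\<close>, since its coefficient at \<open>x\<close> is
    invertible modulo \<open>m\<close>.\<close>
  then obtain u where u: "u : U" "u ~: W" by auto
  have uV: "u : V" using u step.prems by auto
  note xV = step.hyps(4)
  obtain w r where wr: "w : W" "r :. R" "u = w + s r x" using step.hyps(7)[OF uV] by blast
  have wV: "w : V" using wr step.hyps by auto
  have "r ~: m" using wr u step.hyps(6) W.add_mem by blast
  then obtain r' p where r': "r' :. R" "p : m" "r' **[R] r +[R] p = 1[R]"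
   using V.maximalideal_inverse[OF step.hyps(5)] wr by metis
  have "x = s (r' **[R] r +[R] p) x" using r' xV by simp
  also have "\<dots> = s r' (u - w) + s p x" using r'(1) mR[OF r'(2)] wr xV by (simp add: V.add_smult V.mult_smult)
  also have "\<dots> = (s p x - s r' w) + s r' u" using r' wV uV by (simp add: V.smult_diff)
  finally have x: "x = (s p x - s r' w) + s r' u" .
  have xw: "s p x - s r' w : W" using r' wr step.hyps(6) by (simp add: W.diff_mem W.smult_mem)
  show ?thesis proof (rule finite_length.step[OF FL U.rmod_axioms _ u(1) step.hyps(5)])
   show "s q u : U \<inter> W" if q: "q : m" for q proof -
    note qR = mR[OF q]
    have "s q u = s q w + s q (s r x)" using wr qR wV xV by (simp add: V.smult_add V.smult_mem)
    also have "s q (s r x) = s r (s q x)" using wr qR xV V.m_comm by (simp flip: V.mult_smult)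
    finally have "s q u : W" using wr qR step.hyps(6)[OF q] by (simp add: W.add_mem W.smult_mem)
    thus ?thesis using qR u by (simp add: U.smult_mem)
   qed
   fix v assume v: "v : U"
   hence "v : V" using step.prems by auto
   then obtain a c where ac: "a : W" "c :. R" "v = a + s c x" using step.hyps(7) by blast
   have e: "v = (a + s c (s p x - s r' w)) + s (c **[R] r') u" proof -
    have "s c x = s c ((s p x - s r' w) + s r' u)" using x by simp
    also have "\<dots> = s c (s p x - s r' w) + s (c **[R] r') u"
     using ac r' xw step.hyps(3) uV by (auto simp: V.smult_add V.mult_smult V.smult_mem)
    finally show ?thesis using ac by (simp add: add.assoc)
   qed
   have 1: "a + s c (s p x - s r' w) : W" using ac xw by (simp add: W.add_mem W.smult_mem)
   have 2: "s (c **[R] r') u : U" using ac r' u by (simp add: U.smult_mem)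
   have "a + s c (s p x - s r' w) : U" using U.diff_mem[OF v 2] e by (metis add_diff_cancel_right')
   thus "EX w:U \<inter> W. EX r:carrier R. v = w + s r u" using 1 e ac r' by blast
  qed auto
 qed
qed

lemma finite_length_image:
 assumes "finite_length R s V" "rmod R s' V'" "linear_on R s V s' V' f" shows "finite_length R s' (f ` V)" using assms
proof (induction rule: finite_length.induct)
 case zero
 then interpret V: rmod R s "{0}" by simp
 interpret V': rmod R s' V' by fact
 have "f 0 = 0" using V.linear_on_zero zero by blast
 thus ?case by (auto intro!: finite_length.zero V'.rmodI_sub)
next
 case (step W V x m)
 interpret V: rmod R s V by fact
 have W: "finite_length R s' (f ` W)" using step linear_on_subset by blast
 have mR: "r :. R" if "r : m" for r using that maximalideal.axioms(1)[OF step.hyps(5)] by (auto simp: V.ideal_iff)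
 show ?case proof (rule finite_length.step[OF W V.rmod_image[OF step.prems(2,1)] _ _ step.hyps(5)])
  show "s' r (f x) : f ` W" if "r : m" for r
   using step.hyps(6)[OF that] linear_onD(3)[OF step.prems(2) mR[OF that] step.hyps(4)] by (metis imageI)
  fix v assume "v : f ` V"
  then obtain u where u: "v = f u" "u : V" by auto
  obtain w r where wr: "w : W" "r :. R" "u = w + s r x" using step.hyps(7)[OF u(2)] by blast
  have "v = f w + s' r (f x)"
   using linear_onD(2,3)[OF step.prems(2)] wr step.hyps u by (auto simp: V.smult_mem subset_iff)
  thus "EX w:f ` W. EX r:carrier R. v = w + s' r (f x)" using wr by auto
 qed (use step.hyps in auto)
qed

context rmod
begin

lemma finite_length_trivial: "finite_length R s {0}"
 by (auto intro!: finite_length.zero rmodI_sub)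

lemma smult_ideal_adjoin:
 assumes W: "rmod R s W" "W \<subseteq> V" and x: "x : V" and I: "ideal I R"
 shows "rmod R s {w + s r x | w r. w : W & r : I}" proof -
 interpret W: rmod R s W by fact
 note I = I[unfolded ideal_iff]
 show ?thesis proof (rule rmodI_sub)
  show "{w + s r x | w r. w : W & r : I} \<subseteq> V" using W(2) x I by (auto intro!: add_mem smult_mem)
  have "0 = 0 + s \<zero> x" using x by simp
  thus "0 : {w + s r x | w r. w : W & r : I}" using I W.zero_mem by blast
  fix y z assume "y : {w + s r x | w r. w : W & r : I}" "z : {w + s r x | w r. w : W & r : I}"
  then obtain a b r q where *: "y = a + s r x" "z = b + s q x" "a : W" "b : W"
   "r : I" "q : I" by auto
  hence "y + z = (a + b) + s (r \<oplus> q) x" "r \<oplus> q : I" "a + b : W"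
   using x I by (auto simp: add_smult W.add_mem subset_iff)
  thus "y + z : {w + s r x | w r. w : W & r : I}" by blast
 next
  fix r z assume r: "r :. R" and "z : {w + s r x | w r. w : W & r : I}"
  then obtain b q where *: "z = b + s q x" "b : W" "q : I" by auto
  hence "s r z = s r b + s (r \<otimes> q) x" "r \<otimes> q : I" "s r b : W"
   using x r I W(2) by (auto simp: smult_add mult_smult smult_mem W.smult_mem subset_iff)
  thus "s r z : {w + s r x | w r. w : W & r : I}" by blast
 qed
qed

text \<open>The chain of ideals from \<open>R\<close> down to zero, applied to \<open>x\<close>,
  becomes the chain \<open>W + I x\<close> from \<open>W + R x\<close> down to \<open>W\<close>,
  whose quotients are again cyclic and killed by maximal ideals.\<close>

lemma finite_length_adjoin:
 assumes ch: "ideal_chain R {\<zero>}" and FW: "finite_length R s W" and WV: "W \<subseteq> V" and x: "x : V"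
 shows "finite_length R s (adjoin R s W x)" proof -
 interpret W: rmod R s W using FW by (rule finite_length_rmod)
 have "finite_length R s {w + s r x | w r. w : W & r : I} ==>
   finite_length R s (adjoin R s W x)" if "ideal_chain R I" for I using that proof (induction rule: ideal_chain.induct)
  case top thus ?case by (simp add: adjoin_def)
 next
  case (step I I' y m)
  have Ii: "ideal I R" using step by (simp add: ideal_chain_ideal)
  hence Ic: "I \<subseteq> carrier R" by (simp add: ideal_iff)
  have mR: "r :. R" if "r : m" for r using that maximalideal.axioms(1)[OF step.hyps(5)] by (auto simp: ideal_iff)
  have "finite_length R s {w + s r x | w r. w : W & r : I}"
  proof (rule finite_length.step[OF step.prems smult_ideal_adjoin[OF W.rmod_axioms WV x Ii] _ _ step.hyps(5)])
   show "s y x : {w + s r x | w r. w : W & r : I}" using step.hyps(4) W.zero_mem by force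
   show "s r (s y x) : {w + s r x | w r. w : W & r : I'}" if "r : m" for r proof -
    have "s r (s y x) = 0 + s (r \<otimes> y) x"
     using mR[OF that] x step.hyps(4) Ic by (simp add: mult_smult subset_iff)
    thus ?thesis using step.hyps(6)[OF that] W.zero_mem by blast
   qed
   fix v assume "v : {w + s r x | w r. w : W & r : I}"
   then obtain w r where wr: "v = w + s r x" "w : W" "r : I" by auto
   obtain a b where ab: "a : I'" "b :. R" "r = a \<oplus> b \<otimes> y" using step.hyps(7)[OF wr(3)] by blast
   have "v = (w + s a x) + s b (s y x)"
    using wr ab x Ic step.hyps(3,4) by (auto simp: add_smult mult_smult subset_iff add.assoc)
   thus "EX w:{w + s r x | w r. w : W & r : I'}. EX r:carrier R. v = w + s r (s y x)" using wr ab by blast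
  qed (use step.hyps(3) in blast)
  thus ?case by (rule step.IH)
 qed
 note this[OF ch]
 moreover have "{w + s r x | w r. w : W & r : {\<zero>}} = W" using x by auto
 ultimately show ?thesis using FW by simp
qed

primrec spans :: "'v list => 'v set" where
 "spans [] = {0}"
| "spans (x # xs) = adjoin R s (spans xs) x"

lemma spans:
 assumes "set xs \<subseteq> V" shows "rmod R s (spans xs) & spans xs \<subseteq> V & set xs \<subseteq> spans xs"
 using assms proof (induction xs)
 case Nil thus ?case by (auto intro: finite_length_rmod[OF finite_length_trivial])
next
 case (Cons x xs)
 thus ?case using adjoin[of "spans xs" x] by auto
qed

lemma spans_minimal:
 assumes "rmod R s U" "set xs \<subseteq> U" shows "spans xs \<subseteq> U" using assms(2) proof (induction xs)
 case Nil thus ?case using rmod.zero_mem[OF assms(1)] by simp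
next
 case (Cons x xs)
 interpret U: rmod R s U by fact
 show ?case using Cons by (auto simp: adjoin_def intro!: U.add_mem U.smult_mem)
qed

lemma finite_length_spans:
 assumes "ideal_chain R {\<zero>}" "set xs \<subseteq> V" shows "finite_length R s (spans xs)" using assms(2)
proof (induction xs)
 case Nil thus ?case by (simp add: finite_length_trivial)
next
 case (Cons x xs)
 thus ?case using finite_length_adjoin[OF assms(1), of "spans xs" x] spans[of xs] by auto
qed

end

lemma finite_length_finitely_spanned:
 assumes "finite_length R s V" shows "EX xs. set xs \<subseteq> V & rmod.spans R s xs = V" using assms
proof (induction rule: finite_length.induct)
 case zero
 then interpret rmod R s "{0}" by simp
 show ?case by (rule exI[of _ "[]"]) simp
next
 case (step W V x m)
 interpret V: rmod R s V by fact
 interpret W: rmod R s W using step.hyps(1) by (rule finite_length_rmod)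
 obtain xs where xs: "set xs \<subseteq> W" "W.spans xs = W" using step.IH by blast
 have "V.spans xs = W" using xs by simp
 hence "V.spans (x # xs) = adjoin R s W x" by simp
 also have "\<dots> = V" proof
  show "adjoin R s W x \<subseteq> V" by (rule V.adjoin(4)[OF W.rmod_axioms step.hyps(3,4)])
  show "V \<subseteq> adjoin R s W x" using step.hyps(7) unfolding adjoin_def by blast
 qed
 finally have "V.spans (x # xs) = V" .
 thus ?case using xs step.hyps by (intro exI[of _ "x # xs"]) auto
qed

section \<open>Matlis duality\<close>

text \<open>\<open>E_baer\<close> is Baer's form of injectivity. \<open>E_socle\<close> says that
  the elements killed by \<open>m\<close> form a line over \<open>R / m\<close>: \<open>E\<close>
  contains each simple module exactly once, which makes it a cogenerator and makes finite length
  modules reflexive.\<close>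

locale matlis = artinian_cring R for R (structure) +
 fixes se :: "'r => 'e::ab_group_add => 'e" and E :: "'e set"
 assumes E_rmod: "rmod R se E"
  and E_baer: "!!I g. [|ideal I R; !!r. r : I ==> g r : E;
   !!r q. [|r : I; q : I|] ==> g (r \<oplus> q) = g r + g q;
   !!r q. [|r :. R; q : I|] ==> g (r \<otimes> q) = se r (g q)|] ==>
   EX e:E. ALL r:I. g r = se r e"
  and E_socle: "maximalideal m R ==> EX e0:E. e0 ~= 0 & (ALL r:m. se r e0 = 0) &
   (ALL e:E. (ALL r:m. se r e = 0) --> (EX r:carrier R. e = se r e0))"
begin

sublocale E: rmod R se E by (rule E_rmod)

abbreviation functional :: "('r => 'v => 'v) => 'v set => ('v::ab_group_add => 'e) => bool"
 where "functional s V ph \<equiv> linear_on R s V se E ph"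

text \<open>\<open>compat\<close> makes the value \<open>f w + se r e\<close> at
  \<open>w + s r x\<close> independent of the presentation.\<close>

lemma functional_glue:
 assumes V: "rmod R s V" and W: "rmod R s W" "W \<subseteq> V" and x: "x : V"
  and f: "functional s W f" and e: "e : E"
  and compat: "!!r. r :. R ==> s r x : W ==> f (s r x) = se r e"
 shows "EX g. functional s (adjoin R s W x) g & (ALL w:W. g w = f w) & g x = e" proof -
 interpret V: rmod R s V by fact
 interpret W: rmod R s W by fact
 have wd: "f w + se r e = f w' + se r' e" if "w : W" "w' : W" "r :. R" "r' :. R" "w + s r x = w' + s r' x" for w w' r r'
 proof -
  have d: "s (r \<oplus> \<ominus> r') x = w' - w" using that x by (simp add: V.add_smult V.a_inv_smult algebra_simps)
  have "f (w' - w) = se (r \<oplus> \<ominus> r') e"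
   using compat[of "r \<oplus> \<ominus> r'"] d that by (simp add: W.diff_mem)
  hence "f w' - f w = se r e - se r' e" using W.linear_on_diff[OF f] that e by (simp add: E.add_smult E.a_inv_smult)
  thus ?thesis by (simp add: algebra_simps)
 qed
 define g where "g v = (SOME y. EX w r. w : W & r :. R & v = w + s r x & y = f w + se r e)" for v
 have g: "g (w + s r x) = f w + se r e" if "w : W" "r :. R" for w r proof -
  have "EX w' r'. w' : W & r' :. R & w + s r x = w' + s r' x & g (w + s r x) = f w' + se r' e"
   unfolding g_def by (rule someI_ex) (use that in blast)
  thus ?thesis using wd that by metis
 qed
 have "functional s (adjoin R s W x) g" proof (rule linear_onI)
  fix v assume "v : adjoin R s W x"
  thus "g v : E" using linear_onD(1)[OF f] e by (auto simp: adjoin_def g intro!: E.add_mem E.smult_mem)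
 next
  fix v u assume "v : adjoin R s W x" "u : adjoin R s W x"
  then obtain a r b q where *: "v = a + s r x" "u = b + s q x" "a : W" "b : W"
   "r :. R" "q :. R" by (auto simp: adjoin_def)
  have "v + u = (a + b) + s (r \<oplus> q) x" using * x by (simp add: V.add_smult)
  moreover have "a + b : W" "r \<oplus> q :. R" using * W.add_mem by auto
  ultimately have "g (v + u) = f (a + b) + se (r \<oplus> q) e" using g by metis
  thus "g (v + u) = g v + g u" using * g linear_onD(2)[OF f] e by (simp add: E.add_smult)
 next
  fix c v assume c: "c :. R" and "v : adjoin R s W x"
  then obtain a r where *: "v = a + s r x" "a : W" "r :. R" by (auto simp: adjoin_def)
  have "s c v = s c a + s (c \<otimes> r) x" using * x c W(2) by (auto simp: V.smult_add V.mult_smult V.smult_mem)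
  hence "g (s c v) = f (s c a) + se (c \<otimes> r) e" using g[of "s c a" "c \<otimes> r"] * c W.smult_mem by simp
  thus "g (s c v) = se c (g v)" using * g linear_onD(1,3)[OF f] e c by (simp add: E.smult_add E.mult_smult E.smult_mem)
 qed
 moreover have "g w = f w" if "w : W" for w using g[of w \<zero>] that x e by simp
 moreover have "g x = e" using g[of 0 \<one>] x e W.linear_on_zero[OF f] by simp
 ultimately show ?thesis by blast
qed

lemma functional_extend_one:
 assumes V: "rmod R s V" and W: "rmod R s W" "W \<subseteq> V" and x: "x : V" and f: "functional s W f"
 shows "EX g. functional s (adjoin R s W x) g & (ALL w:W. g w = f w)" proof -
 interpret V: rmod R s V by fact
 interpret W: rmod R s W by fact
 define I where "I = {r : carrier R. s r x : W}"
 have I: "ideal I R" unfolding ideal_iff I_def using x by (auto simp: V.add_smult V.mult_smult W.add_mem W.smult_mem)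
 have "EX e:E. ALL r:I. f (s r x) = se r e" by (rule E_baer[OF I])
   (use x linear_onD[OF f] in "auto simp: I_def V.add_smult V.mult_smult")
 then obtain e where e: "e : E" "!!r. r : I ==> f (s r x) = se r e" by blast
 show ?thesis using functional_glue[OF V W x f e(1)] e(2) unfolding I_def by blast
qed

text \<open>Baer's criterion turned into an extension theorem for arbitrary modules: Zorn's lemma
  together with the one-element extensions of \<open>functional_extend_one\<close>.\<close>

theorem functional_extend:
 assumes V: "rmod R s V" and W: "rmod R s W" "W \<subseteq> V" and f: "functional s W f"
 obtains g where "functional s V g" "!!w. w : W ==> g w = f w" proof -
 interpret V: rmod R s V by fact
 \<comment> \<open>Partial extensions are given by their graphs, so that the union of a chain is an
   upper bound. For a graph closed under the operations, \<open>(0, y) : G --> y = 0\<close>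
   expresses single-valuedness.\<close>
 define A where "A = {G. (%w. (w, f w)) ` W \<subseteq> G & G \<subseteq> V \<times> E & (ALL y. (0, y) : G --> y = 0) &
  (ALL (u, y):G. ALL (v, z):G. (u + v, y + z) : G) & (ALL r:carrier R. ALL (u, y):G. (s r u, se r y) : G)}"
 have AI: "(%u. (u, g u)) ` U : A"
  if U: "rmod R s U" "W \<subseteq> U" "U \<subseteq> V" "functional s U g" "ALL w:W. g w = f w" for U g proof -
  interpret U: rmod R s U by fact
  have "g 0 = 0" using U.linear_on_zero[OF U(4)] .
  with U linear_onD[OF U(4)] show ?thesis by (auto simp: A_def U.add_mem U.smult_mem image_iff subset_iff)
 qed
 have "EX M:A. ALL X:A. M \<subseteq> X --> X = M" proof (rule subset_Zorn_nonempty)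
  show "A ~= {}" using AI[OF W(1) order_refl W(2) f] by auto
  fix C assume C: "C ~= {}" "subset.chain A C"
  hence CA: "C \<subseteq> A" and ch: "!!X Y. X : C ==> Y : C ==> X \<subseteq> Y | Y \<subseteq> X"
   by (auto simp: subset_chain_def)
  have add: "(u + v, y + z) : \<Union>C" if uv: "(u, y) : \<Union>C" "(v, z) : \<Union>C" for u v y z proof -
   obtain X Y where "X : C" "(u, y) : X" "Y : C" "(v, z) : Y" using uv by blast
   then obtain G where "G : C" "(u, y) : G" "(v, z) : G" using ch[of X Y] by blast
   thus ?thesis using CA unfolding A_def by blast
  qed
  obtain X where "X : C" using C by blast
  hence "(%w. (w, f w)) ` W \<subseteq> \<Union>C" using CA unfolding A_def by blast
  moreover have "\<Union>C \<subseteq> V \<times> E" "ALL y. (0, y) : \<Union>C --> y = 0" "ALL r:carrier R. ALL (u, y):\<Union>C. (s r u, se r y) : \<Union>C"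
   using CA unfolding A_def by blast+
  moreover have "ALL (u, y):\<Union>C. ALL (v, z):\<Union>C. (u + v, y + z) : \<Union>C"
   unfolding split_def using add by (metis prod.collapse)
  ultimately show "\<Union>C : A" by (simp only: A_def mem_Collect_eq simp_thms)
 qed
 then obtain G where G: "G : A" "!!X. X : A ==> G \<subseteq> X ==> X = G" by blast
 have GV: "u : V" "y : E" if "(u, y) : G" for u y using that G(1) unfolding A_def by auto
 have Gadd: "(u + v, y + z) : G" if "(u, y) : G" "(v, z) : G" for u v y z using that G(1) unfolding A_def by blast
 have Gs: "(s r u, se r y) : G" if "r :. R" "(u, y) : G" for r u y using that G(1) unfolding A_def by blast
 have Gf: "(w, f w) : G" if "w : W" for w using that G(1) unfolding A_def by blast
 define U where "U = fst ` G"
 define g where "g u = (THE y. (u, y) : G)" for u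
 have gU: "u : U" "g u = y" if uy: "(u, y) : G" for u y proof -
  show "u : U" using uy by (force simp: U_def)
  have "z = y" if z: "(u, z) : G" for z proof -
   have "(s (\<ominus> \<one>) u, se (\<ominus> \<one>) y) : G" by (rule Gs) (use uy in auto)
   hence "(0, z - y) : G" using Gadd[OF z] GV[OF uy] by (force simp: V.minus_one_smult E.minus_one_smult)
   thus ?thesis using G(1) unfolding A_def by force
  qed
  with uy show "g u = y" unfolding g_def by blast
 qed
 have Ug: "(u, g u) : G" if "u : U" for u using that gU by (force simp: U_def)
 have UV: "U \<subseteq> V" "W \<subseteq> U" using GV gU Gf Ug by blast+
 have Ur: "rmod R s U" using UV(2) rmod.zero_mem[OF W(1)] gU(1)[OF Gadd[OF Ug Ug]] gU(1)[OF Gs[OF _ Ug]]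
  by (intro V.rmodI_sub[OF UV(1)]) auto
 have gl: "functional s U g"
  using GV(2)[OF Ug] gU(2)[OF Gadd[OF Ug Ug]] gU(2)[OF Gs[OF _ Ug]] by (intro linear_onI) auto
 have gf: "ALL w:W. g w = f w" using gU(2) Gf by blast
 have "U = V" proof (rule ccontr)
  assume "U ~= V"
  then obtain x where x: "x : V" "x ~: U" using UV by auto
  obtain h where h: "functional s (adjoin R s U x) h" "ALL u:U. h u = g u"
   using functional_extend_one[OF V Ur UV(1) x(1) gl] by blast
  note ad = V.adjoin[OF Ur UV(1) x(1)]
  have "(%u. (u, h u)) ` adjoin R s U x : A" using ad UV h gf by (intro AI) auto
  moreover have "G \<subseteq> (%u. (u, h u)) ` adjoin R s U x" using h(2) ad(2) gU by force
  ultimately have "(x, h x) : G" using G(2) ad(3) by blast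
  with x gU show False by blast
 qed
 with gl gf that show thesis by blast
qed

text \<open>The multipliers carrying \<open>x\<close> into \<open>W\<close> form a proper ideal. It
  lies in a maximal ideal, and a nonzero element of \<open>E\<close> killed by the latter is an
  admissible value at \<open>x\<close>.\<close>

theorem functional_separate:
 assumes V: "rmod R s V" and W: "rmod R s W" "W \<subseteq> V" and x: "x : V" "x ~: W"
 obtains g where "functional s V g" "!!w. w : W ==> g w = 0" "g x ~= 0" proof -
 interpret V: rmod R s V by fact
 interpret W: rmod R s W by fact
 define I where "I = {r : carrier R. s r x : W}"
 have I: "ideal I R" unfolding ideal_iff I_def using x by (auto simp: V.add_smult V.mult_smult W.add_mem W.smult_mem)
 have "\<one> ~: I" using x by (simp add: I_def)
 then obtain m where m: "maximalideal m R" "I \<subseteq> m" using exists_maximalideal_above[OF I] by metis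
 obtain e0 where e0: "e0 : E" "e0 ~= 0" "ALL r:m. se r e0 = 0" using E_socle[OF m(1)] by blast
 have f: "functional s W (%_. 0)" by (rule linear_onI) auto
 obtain g where g: "functional s (adjoin R s W x) g" "ALL w:W. g w = 0" "g x = e0"
  using functional_glue[OF V W x(1) f e0(1)] e0(3) m(2) unfolding I_def by (metis (lifting) mem_Collect_eq subsetD)
 note ad = V.adjoin[OF W x(1)]
 obtain h where "functional s V h" "!!v. v : adjoin R s W x ==> h v = g v"
  using functional_extend[OF V ad(1,4) g(1)] by metis
 moreover from this(2) have "h w = 0" if "w : W" for w using that g(2) ad(2) by auto
 moreover have "h x ~= 0" using calculation(2)[OF ad(3)] g(3) e0(2) by simp
 ultimately show thesis using that[of h] by blast
qed

text \<open>Exactness of the duality: \<open>f\<close> descends to the image of \<open>F\<close> and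
  extends from there to \<open>V'\<close> by injectivity. The dimension shifts below are
  applications of this.\<close>

lemma functional_factor:
 assumes V: "rmod R s V" and V': "rmod R s' V'" and F: "linear_on R s V s' V' F"
  and f: "functional s V f" and ker: "!!v. v : V ==> F v = 0 ==> f v = 0"
 obtains g where "functional s' V' g" "!!v. v : V ==> g (F v) = f v" proof -
 interpret V: rmod R s V by fact
 have eq: "f v = f w" if "v : V" "w : V" "F v = F w" for v w
  using ker[of "v - w"] V.linear_on_diff[OF F that(1,2)] V.linear_on_diff[OF f that(1,2)] that V.diff_mem by simp
 define g where "g u = f (SOME v. v : V & F v = u)" for u
 have g: "g (F v) = f v" if "v : V" for v proof -
  have "(SOME w. w : V & F w = F v) : V & F (SOME w. w : V & F w = F v) = F v"
   by (rule someI[of "%w. w : V & F w = F v"]) (use that in simp)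
  thus ?thesis unfolding g_def using eq[OF _ that] by blast
 qed
 have im: "rmod R s' (F ` V)" by (rule V.rmod_image[OF F V'])
 have "functional s' (F ` V) g" proof (rule linear_onI)
  show "g x : E" if "x : F ` V" for x using that g linear_onD(1)[OF f] by auto
  show "g (x + y) = g x + g y" if xy: "x : F ` V" "y : F ` V" for x y proof -
   obtain a b where ab: "x = F a" "y = F b" "a : V" "b : V" using xy by auto
   hence "x + y = F (a + b)" using linear_onD(2)[OF F] by simp
   thus ?thesis using ab g linear_onD(2)[OF f] V.add_mem[of a b] by simp
  qed
  show "g (s' r x) = se r (g x)" if xr: "r :. R" "x : F ` V" for r x proof -
   obtain a where ab: "x = F a" "a : V" using xr by auto
   hence "s' r x = F (s r a)" using linear_onD(3)[OF F] xr by simp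
   thus ?thesis using ab g linear_onD(3)[OF f] V.smult_mem[of r a] xr by simp
  qed
 qed
 moreover have "F ` V \<subseteq> V'" using linear_onD(1)[OF F] by auto
 ultimately obtain h where "functional s' V' h" "!!u. u : F ` V ==> h u = g u"
  using functional_extend[OF V' im] by metis
 thus thesis using that[of h] g by simp
qed

text \<open>Values outside \<open>V\<close> are fixed to be zero, so that a functional is determined
  by its restriction to \<open>V\<close> and the functionals form an \<open>rmod\<close> under
  pointwise operations.\<close>

definition dual :: "('r => 'v => 'v) => 'v set => ('v::ab_group_add => 'e) set"
 where "dual s V = {f. functional s V f & (ALL x. x ~: V --> f x = 0)}"

definition sdual :: "'r => ('v => 'e) => 'v => 'e" where "sdual r f = (%x. se r (f x))"

lemma sdual_apply [simp]: "sdual r f x = se r (f x)"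
 by (simp add: sdual_def)

lemma dual_apply_mem: "f : dual s V ==> f x : E"
 by (cases "x : V") (auto simp: dual_def linear_onD)

lemma dual_eqI: "f : dual s V ==> g : dual s V ==> (!!x. x : V ==> f x = g x) ==> f = g"
 unfolding dual_def by (rule ext) (metis (mono_tags, lifting) mem_Collect_eq)

lemma functional_in_dual:
 assumes V: "rmod R s V" and f: "functional s V f" shows "(%x. if x : V then f x else 0) : dual s V"
 using linear_on_cong[OF f V] by (auto simp: dual_def)

lemma rmod_dual:
 assumes "rmod R s V" shows "rmod R sdual (dual s V)" proof -
 interpret V: rmod R s V by fact
 have "functional s V (%x. f x + g x)" if "functional s V f" "functional s V g" for f g
  using linear_onD[OF that(1)] linear_onD[OF that(2)] by (intro linear_onI) (auto simp: E.add_mem E.smult_add)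
 moreover have "functional s V (%x. se r (f x))" if "functional s V f" "r :. R" for f r
  using linear_onD[OF that(1)] that(2)
  by (intro linear_onI) (auto simp: E.smult_mem E.smult_add m_comm simp flip: E.mult_smult)
 moreover have "functional s V (%x. 0)" by (intro linear_onI) auto
 ultimately show ?thesis by unfold_locales (auto simp: fun_eq_iff dual_apply_mem E.smult_add E.add_smult E.mult_smult,
   auto simp: dual_def plus_fun_def zero_fun_def sdual_def)
qed

text \<open>Both assertions follow the composition series: the functionals killing the penultimate
 term form a module that embeds into \<open>{e : E. m e = 0}\<close>, which is cyclic and killed by \<open>m\<close>.\<close>

lemma
 fixes s :: "'r => 'v::ab_group_add => 'v"
 assumes "finite_length R s V" shows finite_length_dual: "finite_length R sdual (dual s V)"
  and reflexive_dual: "functional sdual (dual s V) Ph ==> EX x:V. ALL f:dual s V. Ph f = f x" proof -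
 have "finite_length R sdual (dual s V) &
  (ALL Ph. functional sdual (dual s V) Ph --> (EX x:V. ALL f:dual s V. Ph f = f x))" using assms
 proof (induction rule: finite_length.induct)
  case zero
  then interpret V: rmod R s "{0}" by simp
  interpret D: rmod R sdual "dual s {0}" by (rule rmod_dual) (rule zero)
  have "f = 0" if f: "f : dual s {0}" for f proof (rule dual_eqI[OF f D.zero_mem])
   have "functional s {0} f" using f by (simp add: dual_def)
   thus "f x = 0 x" if "x : {0}" for x using V.linear_on_zero that by auto
  qed
  hence e: "dual s {0} = {0}" using D.zero_mem by auto
  show ?case unfolding e proof (intro conjI allI impI)
   show "finite_length R sdual {0::'v => 'e}" using D.finite_length_trivial .
   show "EX x:{0}. ALL f:{0}. Ph f = f x" if "functional sdual {0} Ph" for Ph :: "('v => 'e) => 'e"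
    using D.linear_on_zero[unfolded e, OF that] by simp
  qed
 next
  case (step W V x m)
  interpret V: rmod R s V by fact
  interpret W: rmod R s W using step.hyps(1) by (rule finite_length_rmod)
  interpret D: rmod R sdual "dual s V" by (rule rmod_dual) (rule step)
  interpret DW: rmod R sdual "dual s W" by (rule rmod_dual) (rule W.rmod_axioms)
  have mR: "r :. R" if "r : m" for r using that maximalideal.axioms(1)[OF step.hyps(5)] by (auto simp: ideal_iff)
  define \<rho> where "\<rho> f = (%y. if y : W then f y else 0)" for f :: "'v => 'e"
  have fV: "functional s V f" if "f : dual s V" for f using that by (simp add: dual_def)
  have \<rho>: "linear_on R sdual (dual s V) sdual (dual s W) \<rho>" proof (rule linear_onI)
   show "\<rho> f : dual s W" if "f : dual s V" for f
    unfolding \<rho>_def by (rule functional_in_dual[OF W.rmod_axioms linear_on_subset[OF fV[OF that] step.hyps(3)]])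
  qed (auto simp: \<rho>_def fun_eq_iff)
  have lift: "EX f:dual s V. \<rho> f = g" if g: "g : dual s W" for g proof -
   have "functional s W g" using g by (simp add: dual_def)
   then obtain f where f: "functional s V f" "!!w. w : W ==> f w = g w"
    using functional_extend[OF V.rmod_axioms W.rmod_axioms step.hyps(3)] by metis
   thus ?thesis using functional_in_dual[OF V.rmod_axioms f(1)] g step.hyps(3)
    by (intro bexI[of _ "%x. if x : V then f x else 0"]) (auto simp: \<rho>_def dual_def fun_eq_iff)
  qed
  hence sur: "\<rho> ` dual s V = dual s W" using linear_onD(1)[OF \<rho>] by (force simp: image_iff)
  define K where "K = {f : dual s V. \<rho> f = 0}"
  have Kr: "rmod R sdual K" unfolding K_def by (rule D.rmod_kernel[OF \<rho> DW.rmod_axioms])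
  then interpret K: rmod R sdual K .
  have KW: "f w = 0" if "f : K" "w : W" for f w using that by (auto simp: K_def \<rho>_def fun_eq_iff split: if_splits)
  have Kx: "f = g" if fg: "f : K" "g : K" "f x = g x" for f g proof (rule dual_eqI)
   show 1: "f : dual s V" and 2: "g : dual s V" using fg by (auto simp: K_def)
   fix v assume "v : V"
   then obtain w r where wr: "w : W" "r :. R" "v = w + s r x" using step.hyps(7) by blast
   hence "s r x : V" "w : V" using step.hyps(3,4) by (auto simp: V.smult_mem)
   thus "f v = g v" using wr step.hyps(4) fg(3) KW[OF fg(1) wr(1)] KW[OF fg(2) wr(1)]
     linear_onD(2,3)[OF fV[OF 1]] linear_onD(2,3)[OF fV[OF 2]] by simp
  qed
  have Kann: "se r (f x) = 0" if "f : K" "r : m" for f r proof -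
   have "f (s r x) = 0" using KW[OF that(1) step.hyps(6)[OF that(2)]] .
   moreover have "f : dual s V" using that by (simp add: K_def)
   ultimately show ?thesis using linear_onD(3)[OF fV mR[OF that(2)] step.hyps(4), of f] by simp
  qed
  obtain e0 where e0: "e0 : E" "e0 ~= 0" "ALL r:m. se r e0 = 0"
   "!!e. e : E ==> ALL r:m. se r e = 0 ==> EX r:carrier R. e = se r e0" using E_socle[OF step.hyps(5)] by blast
  \<comment> \<open>Every nonzero element of the socle line generates it, not only
    \<open>e0\<close>.\<close>
  have gen: "EX r:carrier R. e = se r e1" if e: "e : E" "e1 : E" "e1 ~= 0"
   "ALL r:m. se r e = 0" "ALL r:m. se r e1 = 0" for e e1 proof -
   obtain a b where ab: "a :. R" "b :. R" "e = se a e0" "e1 = se b e0" using e0(4) e by metis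
   hence "b ~: m" using e0(3) e by auto
   then obtain b' p where b': "b' :. R" "p : m" "b' \<otimes> b \<oplus> p = \<one>"
    using maximalideal_inverse[OF step.hyps(5)] ab by metis
   have "e0 = se (b' \<otimes> b \<oplus> p) e0" using b' e0 by simp
   also have "\<dots> = se b' e1" using b'(1,2) mR[OF b'(2)] ab e0 by (simp add: E.add_smult E.mult_smult)
   finally have "e = se (a \<otimes> b') e1" using ab b' e by (simp add: E.mult_smult)
   thus ?thesis using ab b' by blast
  qed
  \<comment> \<open>Evaluation at \<open>x\<close> embeds \<open>K\<close> into the socle line, so
    any nonzero \<open>f0\<close> generates \<open>K\<close>; the value \<open>f0 = 0\<close> covers
    the case \<open>K = {0}\<close>.\<close>
  obtain f0 where f0: "f0 : K" "ALL f:K. EX r:carrier R. f = sdual r f0" "f0 x = 0 ==> f0 = 0" proof (cases "K = {0}")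
   case True thus ?thesis using that[of 0] K.smult_zero by fastforce
  next
   case False
   then obtain f0 where f0: "f0 : K" "f0 ~= 0" using K.zero_mem by blast
   hence f0x: "f0 x ~= 0" using Kx[OF f0(1) K.zero_mem] by auto
   have "EX r:carrier R. f = sdual r f0" if f: "f : K" for f proof -
    have "f x : E" "f0 x : E" using f f0 by (auto simp: K_def intro: dual_apply_mem)
    then obtain r where r: "r :. R" "f x = se r (f0 x)" using gen[of "f x" "f0 x"] f0x Kann f f0 by metis
    hence "f = sdual r f0" by (intro Kx[OF f K.smult_mem[OF r(1) f0(1)]]) simp
    with r show ?thesis by blast
   qed
   thus ?thesis using that[OF f0(1)] f0x by blast
  qed
  have f0m: "sdual q f0 = 0" if "q : m" for q
   using Kx[OF K.smult_mem[OF mR[OF that] f0(1)] K.zero_mem] Kann[OF f0(1) that] by simp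
  have FK: "finite_length R sdual K" by (rule finite_length.step[OF K.finite_length_trivial Kr _ f0(1) step.hyps(5)])
    (use K.zero_mem f0m f0(2) in auto)
  have FL: "finite_length R sdual (dual s V)"
   by (rule finite_length_extension[OF _ D.rmod_axioms \<rho> sur]) (use step.IH FK in "auto simp: K_def simp del: sdual_apply")
  have "EX y:V. ALL f:dual s V. Ph f = f y" if Ph: "functional sdual (dual s V) Ph" for Ph proof -
   have KD: "K \<subseteq> dual s V" by (auto simp: K_def)
   have f0D: "f0 : dual s V" using f0 KD by auto
   have "se q (Ph f0) = 0" if "q : m" for q
    using linear_onD(3)[OF Ph mR[OF that] f0D] f0m[OF that] D.linear_on_zero[OF Ph] by simp
   \<comment> \<open>Both \<open>Ph f0\<close> and \<open>f0 x\<close> are killed by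
     \<open>m\<close>, so the former is a multiple of the latter, and on \<open>K\<close> the
     functional \<open>Ph\<close> is evaluation at \<open>s r x\<close>.\<close>
   then obtain r where r0: "r :. R" "Ph f0 = se r (f0 x)"
    using gen[of "Ph f0" "f0 x"] f0(3) Kann[OF f0(1)] linear_onD(1)[OF Ph f0D] dual_apply_mem[OF f0D]
     D.linear_on_zero[OF Ph] zero_closed E.smult_zero zero_fun_apply by metis
   have "Ph f = f (s r x)" if f: "f : K" for f proof -
    have fD: "f : dual s V" using f KD by auto
    obtain c where c: "c :. R" "f = sdual c f0" using f0(2) f by blast
    hence "Ph f = se c (Ph f0)" using linear_onD(3)[OF Ph c(1) f0D] by simp
    also have "\<dots> = se r (f x)" using r0 c dual_apply_mem[OF f0D] m_comm by (simp flip: E.mult_smult)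
    also have "\<dots> = f (s r x)" using linear_onD(3)[OF fV[OF fD] r0(1) step.hyps(4)] by simp
    finally show ?thesis .
   qed
   with r0 have r: "r :. R" "ALL f:K. Ph f = f (s r x)" by auto
   have srx: "s r x : V" using r step.hyps(4) by (simp add: V.smult_mem)
   \<comment> \<open>Subtracting the evaluation at \<open>s r x\<close> makes the functional vanish
     on \<open>K\<close>; it then descends to the dual of \<open>W\<close>, where induction provides
     the remaining summand \<open>w\<close>.\<close>
   define \<Psi> where "\<Psi> f = Ph f - f (s r x)" for f
   have \<Psi>: "functional sdual (dual s V) \<Psi>"
    by (rule linear_onI) (auto simp: \<Psi>_def linear_onD[OF Ph] dual_apply_mem E.diff_mem E.smult_diff)
   obtain \<theta> where \<theta>: "functional sdual (dual s W) \<theta>" "!!f. f : dual s V ==> \<theta> (\<rho> f) = \<Psi> f"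
    by (rule functional_factor[OF D.rmod_axioms DW.rmod_axioms \<rho> \<Psi>])
     (use r(2) in "auto simp: K_def \<Psi>_def")
   then obtain w where w: "w : W" "!!g. g : dual s W ==> \<theta> g = g w" using step.IH by blast
   have wV: "w : V" using w step.hyps(3) by auto
   have "Ph f = f (w + s r x)" if f: "f : dual s V" for f proof -
    have "\<Psi> f = f w" using \<theta>(2)[OF f] w(2)[OF linear_onD(1)[OF \<rho> f]] w(1) by (simp add: \<rho>_def)
    thus ?thesis using linear_onD(2)[OF fV[OF f] wV srx] by (simp add: \<Psi>_def algebra_simps)
   qed
   thus ?thesis using V.add_mem[OF wV srx] by blast
  qed
  with FL show ?case by blast
 qed
 thus "finite_length R sdual (dual s V)"
  "functional sdual (dual s V) Ph ==> EX x:V. ALL f:dual s V. Ph f = f x" by auto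
qed

text \<open>The pairing identifies \<open>H\<close> with the dual of \<open>V\<close>. A functional
  on \<open>H\<close> is thus one on the dual, and by reflexivity it is evaluation at an element of
  \<open>V\<close>.\<close>

theorem perfect_pairing_swap:
 assumes V: "finite_length R s V" and H: "rmod R s' H"
  and \<beta>1: "!!h. h : H ==> functional s V (\<beta> h)"
  and \<beta>2: "!!v. v : V ==> functional s' H (%h. \<beta> h v)"
  and sur: "!!f. functional s V f ==> EX h:H. ALL v:V. f v = \<beta> h v"
  and inj: "!!h. h : H ==> (!!v. v : V ==> \<beta> h v = 0) ==> h = 0"
  and f: "functional s' H f" shows "EX v:V. ALL h:H. f h = \<beta> h v" proof -
 interpret V: rmod R s V using V by (rule finite_length_rmod)
 interpret H: rmod R s' H by fact
 interpret D: rmod R sdual "dual s V" by (rule rmod_dual) (rule V.rmod_axioms)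
 define b where "b h = (%x. if x : V then \<beta> h x else 0)" for h
 have b: "linear_on R s' H sdual (dual s V) b" proof (rule linear_onI)
  show "b h : dual s V" if "h : H" for h
   unfolding b_def by (rule functional_in_dual[OF V.rmod_axioms \<beta>1[OF that]])
 qed (use linear_onD[OF \<beta>2] in "auto simp: b_def fun_eq_iff")
 have "f h = 0" if "h : H" "b h = 0" for h proof -
  have "h = 0" by (rule inj[OF that(1)]) (use that(2) in "auto simp: b_def fun_eq_iff split: if_splits")
  thus ?thesis using H.linear_on_zero[OF f] by simp
 qed
 then obtain Ph where Ph: "functional sdual (dual s V) Ph" "!!h. h : H ==> Ph (b h) = f h"
  using functional_factor[OF H.rmod_axioms D.rmod_axioms b f] by metis
 obtain x where x: "x : V" "ALL g:dual s V. Ph g = g x" using reflexive_dual[OF V Ph(1)] by blast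
 hence "f h = \<beta> h x" if "h : H" for h using Ph(2)[OF that] linear_onD(1)[OF b that] by (auto simp: b_def)
 thus ?thesis using x by blast
qed

end

section \<open>Graded additive categories\<close>

text \<open>Composition is a total biadditive operation; \<open>hom k X Y\<close> are the morphisms of degree \<open>k\<close>.
 Everything below is self-dual: the opposite category is obtained by swapping the arguments of
 the composition and of \<open>hom\<close>, without changing degrees.\<close>

locale gcat =
 fixes m :: "'h::ab_group_add => 'h => 'h" (infixl "**" 70)
  and hom :: "int => 'o => 'o => 'h set" and Id :: "'o => 'h" and Ob :: "'o set"
 assumes m_assoc: "(x ** y) ** z = x ** (y ** z)"
  and m_add_left: "(x + y) ** z = x ** z + y ** z"
  and m_add_right: "x ** (y + z) = x ** y + x ** z"
  and hom_Ob: "f : hom k X Y ==> X : Ob & Y : Ob"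
  and hom_zero: "X : Ob ==> Y : Ob ==> 0 : hom k X Y"
  and hom_add: "f : hom k X Y ==> g : hom k X Y ==> f + g : hom k X Y"
  and hom_uminus: "f : hom k X Y ==> - f : hom k X Y"
  and hom_comp: "g : hom k Y Z ==> f : hom l X Y ==> g ** f : hom (k + l) X Z"
  and Id_hom: "X : Ob ==> Id X : hom 0 X X"
  and Id_left: "f : hom k X Y ==> Id Y ** f = f"
  and Id_right: "f : hom k X Y ==> f ** Id X = f"
begin

lemma m_zero_left [simp]: "0 ** x = 0" using m_add_left[of 0 0 x] by simp
lemma m_zero_right [simp]: "x ** 0 = 0" using m_add_right[of x 0 0] by simp
lemma m_uminus_left: "(- x) ** y = - (x ** y)"
 using m_add_left[of x "- x" y] by (simp add: eq_neg_iff_add_eq_0 add.commute)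
lemma m_uminus_right: "x ** (- y) = - (x ** y)"
 using m_add_right[of x y "- y"] by (simp add: eq_neg_iff_add_eq_0 add.commute)
lemma m_diff_left: "(x - y) ** z = x ** z - y ** z"
 using m_add_left[of x "- y" z] by (simp add: m_uminus_left)
lemma m_diff_right: "x ** (y - z) = x ** y - x ** z"
 using m_add_right[of x y "- z"] by (simp add: m_uminus_right)

lemmas m_simps = m_assoc m_add_left m_add_right m_uminus_left m_uminus_right m_diff_left m_diff_right

lemma m_reassoc: "a ** b = c ==> a ** (b ** x) = c ** x"
 by (simp flip: m_assoc)

lemma hom_diff: "f : hom k X Y ==> g : hom k X Y ==> f - g : hom k X Y"
 using hom_add[of f k X Y "- g"] hom_uminus[of g] by simp

lemma hom_compI: "g : hom k Y Z ==> f : hom l X Y ==> n = k + l ==> g ** f : hom n X Z"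
 using hom_comp by simp

lemma hom_ObD: "f : hom k X Y ==> X : Ob" "f : hom k X Y ==> Y : Ob"
 using hom_Ob by auto

text \<open>\<open>i\<close> is a kernel of \<open>p\<close> and \<open>p\<close> a cokernel of
  \<open>i\<close>, tested against maps of every degree. As \<open>i\<close> and \<open>p\<close>
  carry degrees of their own, shifting an outer term or reversing the arrows only affects the
  numbers \<open>a\<close> and \<open>b\<close>.\<close>

definition short_exact :: "int => int => 'o => 'o => 'o => 'h => 'h => bool"
 where "short_exact a b X Y Z i p \<longleftrightarrow> i : hom a X Y & p : hom b Y Z & p ** i = 0 &
  (ALL A k. ALL f:hom k A Y. p ** f = 0 --> (EX g:hom (k - a) A X. f = i ** g)) &
  (ALL A k. ALL g:hom k A X. i ** g = 0 --> g = 0) &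
  (ALL A k. ALL f:hom k Y A. f ** i = 0 --> (EX g:hom (k - b) Z A. f = g ** p)) &
  (ALL A k. ALL g:hom k Z A. g ** p = 0 --> g = 0)"

lemma short_exactD:
 assumes "short_exact a b X Y Z i p" shows "i : hom a X Y" "p : hom b Y Z" "p ** i = 0" "X : Ob" "Y : Ob" "Z : Ob"
 using assms by (auto simp: short_exact_def dest: hom_Ob)

lemma short_exact_kernel:
 assumes "short_exact a b X Y Z i p" "f : hom k A Y" "p ** f = 0"
 obtains g where "g : hom (k - a) A X" "f = i ** g" using assms unfolding short_exact_def by blast

lemma short_exact_cokernel:
 assumes "short_exact a b X Y Z i p" "f : hom k Y A" "f ** i = 0"
 obtains g where "g : hom (k - b) Z A" "f = g ** p" using assms unfolding short_exact_def by blast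

lemma short_exact_mono: "short_exact a b X Y Z i p ==> g : hom k A X ==> i ** g = 0 ==> g = 0"
 unfolding short_exact_def by blast

lemma short_exact_epi: "short_exact a b X Y Z i p ==> g : hom k Z A ==> g ** p = 0 ==> g = 0"
 unfolding short_exact_def by blast

lemma short_exact_mono_eq:
 "short_exact a b X Y Z i p ==> g : hom k A X ==> h : hom k A X ==> i ** g = i ** h ==> g = h"
 using short_exact_mono[of a b X Y Z i p "g - h" k A] by (simp add: m_diff_right hom_diff)

lemma short_exact_epi_eq:
 "short_exact a b X Y Z i p ==> g : hom k Z A ==> h : hom k Z A ==> g ** p = h ** p ==> g = h"
 using short_exact_epi[of a b X Y Z i p "g - h" k A] by (simp add: m_diff_left hom_diff)

end

text \<open>The homological dimensions are taken with respect to a class \<open>ses\<close> of short exact sequences;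
 it varies because the hypothesis on \<open>\<Lambda>\<close> involves modules that are not finitely generated.\<close>

locale gcat_ses = gcat m hom Id Ob for m :: "'h::ab_group_add => 'h => 'h" (infixl "**" 70)
  and hom :: "int => 'o => 'o => 'h set" and Id :: "'o => 'h" and Ob :: "'o set" +
 fixes ses :: "int => int => 'o => 'o => 'o => 'h => 'h => bool"
 assumes ses_short_exact: "ses a b X Y Z i p ==> short_exact a b X Y Z i p"
begin

definition injective_ob :: "'o => bool"
 where "injective_ob J \<longleftrightarrow> (ALL a b X Y Z i p k. ses a b X Y Z i p -->
  (ALL f:hom k X J. EX g:hom (k - a) Y J. f = g ** i))"

definition projective_ob :: "'o => bool"
 where "projective_ob P \<longleftrightarrow> (ALL a b X Y Z i p k. ses a b X Y Z i p -->
  (ALL f:hom k P Z. EX g:hom (k - b) P Y. f = p ** g))"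

lemma injective_obE:
 assumes "injective_ob J" "ses a b X Y Z i p" "f : hom k X J"
 obtains g where "g : hom (k - a) Y J" "f = g ** i" using assms unfolding injective_ob_def by blast

lemma projective_obE:
 assumes "projective_ob P" "ses a b X Y Z i p" "f : hom k P Z"
 obtains g where "g : hom (k - b) P Y" "f = p ** g" using assms unfolding projective_ob_def by blast

lemma injective_ob_retract:
 assumes J: "injective_ob J" and i: "i : hom a C J" and p: "p : hom (- a) J C" and pi: "p ** i = Id C"
 shows "injective_ob C" unfolding injective_ob_def proof (intro allI impI ballI)
 fix b c X Y Z j q k f assume s: "ses b c X Y Z j q" and f: "f : hom k X C"
 obtain g where g: "g : hom (a + k - b) Y J" "i ** f = g ** j" using injective_obE[OF J s hom_comp[OF i f]] by metis
 have "f = (p ** g) ** j" using Id_left[OF f] g(2) pi by (metis m_assoc)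
 moreover have "p ** g : hom (k - b) Y C" by (rule hom_compI[OF p g(1)]) simp
 ultimately show "EX g:hom (k - b) Y C. f = g ** j" by blast
qed

inductive pdim_le :: "nat => 'o => bool" where
  "projective_ob P ==> pdim_le 0 P"
 | "ses a b K P A kap pj ==> projective_ob P ==> pdim_le n K ==> pdim_le (Suc n) A"

inductive idim_le :: "'o set => nat => 'o => bool" for \<J> where
  "J : \<J> ==> idim_le \<J> 0 J"
 | "ses a b A J C i p ==> J : \<J> ==> idim_le \<J> n C ==> idim_le \<J> (Suc n) A"

inductive cosyzygy :: "nat => 'o => 'o => bool" where
  "cosyzygy 0 B B"
 | "cosyzygy n B C ==> ses a b C J C' i p ==> injective_ob J ==> cosyzygy (Suc n) B C'"

text \<open>\<open>Ext\<^sup>1(A, C) = 0\<close>, since \<open>C\<close> is the (\<open>n\<close>-th) cosyzygy of \<open>B\<close> and so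
 \<open>Ext\<^sup>1(A, C) = Ext\<^sup>n\<^sup>+\<^sup>1(A, B)\<close>.\<close>

lemma pdim_le_lifting:
 assumes "pdim_le n A" "cosyzygy n B C" "ses a b C J C' i p" "injective_ob J" "f : hom k A C'"
 shows "EX g:hom (k - b) A J. f = p ** g" using assms
proof (induction arbitrary: C a b J C' i p k f rule: pdim_le.induct)
 case (1 P)
 thus ?case using projective_obE by metis
next
 case (2 a0 b0 K P A kap pj n)
 from `cosyzygy (Suc n) B C` obtain B1 a1 b1 J1 i1 p1 where
  C: "cosyzygy n B B1" "ses a1 b1 B1 J1 C i1 p1" "injective_ob J1" by (cases rule: cosyzygy.cases) auto
 note s0 = ses_short_exact[OF 2(1)] and s1 = ses_short_exact[OF C(2)] and s = ses_short_exact[OF 2(6)]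
 \<comment> \<open>Maps from \<open>K\<close> to \<open>C\<close> lift to \<open>J1\<close> by
   induction and then extend to \<open>P\<close> because \<open>J1\<close> is injective.\<close>
 have ext: "EX g':hom (l - a0) P C. g = g' ** kap" if g: "g : hom l K C" for g l proof -
  obtain u where u: "u : hom (l - b1) K J1" "g = p1 ** u" using 2(4)[OF C g] by blast
  obtain u' where u': "u' : hom (l - b1 - a0) P J1" "u = u' ** kap" using injective_obE[OF C(3) 2(1) u(1)] by metis
  have "p1 ** u' : hom (l - a0) P C" by (rule hom_compI[OF short_exactD(2)[OF s1] u'(1)]) simp
  moreover have "g = (p1 ** u') ** kap" using u(2) u'(2) by (simp add: m_assoc)
  ultimately show ?thesis by blast
 qed
 have pj: "pj : hom b0 P A" and kap: "kap : hom a0 K P" using short_exactD[OF s0] by auto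
 have i: "i : hom a C J" and p: "p : hom b J C'" and pi: "p ** i = 0" using short_exactD[OF s] by auto
 \<comment> \<open>On \<open>K\<close> the lift \<open>v\<close> takes values in \<open>C\<close>.
   Extending this restriction to \<open>P\<close> and subtracting it makes \<open>v\<close> vanish
   on \<open>K\<close>, so that it descends to \<open>A\<close>.\<close>
 obtain v where v: "v : hom (k + b0 - b) P J" "f ** pj = p ** v"
  using projective_obE[OF 2(2) 2(6) hom_comp[OF 2(8) pj]] by metis
 have "p ** (v ** kap) = 0" using v(2) short_exactD(3)[OF s0] by (metis m_assoc m_zero_right)
 then obtain g where g: "g : hom (k + b0 - b + a0 - a) K C" "v ** kap = i ** g"
  using short_exact_kernel[OF s hom_comp[OF v(1) kap]] by metis
 obtain g' where g': "g' : hom (k + b0 - b + a0 - a - a0) P C" "g = g' ** kap" using ext[OF g(1)] by blast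
 have "i ** g' : hom (k + b0 - b) P J" by (rule hom_compI[OF i g'(1)]) simp
 hence w: "v - i ** g' : hom (k + b0 - b) P J" using v by (simp add: hom_diff)
 have "(v - i ** g') ** kap = 0" using g(2) g'(2) by (simp add: m_simps)
 then obtain h where h: "h : hom (k + b0 - b - b0) A J" "v - i ** g' = h ** pj"
  using short_exact_cokernel[OF s0 w] by metis
 have h1: "h : hom (k - b) A J" using h(1) by (simp add: algebra_simps)
 have "p ** (h ** pj) = f ** pj" using v(2) m_reassoc[OF pi] by (simp add: m_simps flip: h(2))
 hence "(p ** h) ** pj = f ** pj" by (simp add: m_assoc)
 hence "p ** h = f" using short_exact_epi_eq[OF s0 hom_compI[OF p h1] 2(8)] by simp
 with h1 show ?case by blast
qed

text \<open>At the \<open>n\<close>-th cosyzygy the identity of the next one, \<open>C\<close>,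
  lifts through the hull by \<open>pdim_le_lifting\<close>. Hence \<open>C\<close> is a retract of
  an injective and the coresolution stops there. The class \<open>Sm\<close> may be much smaller
  than the category in which the projective dimension is measured.\<close>

theorem idim_le_of_pdim_le:
 assumes hull: "!!X. X : Sm ==> EX a b J C i p. ses a b X J C i p & J : \<J> & C : Sm"
  and inj: "!!J. J : \<J> ==> injective_ob J"
  and retract: "!!J C i p a. J : \<J> ==> C : Sm ==> i : hom a C J ==> p : hom (- a) J C ==>
   p ** i = Id C ==> C : \<J>"
  and pd: "!!X. X : Sm ==> pdim_le n X"
  and X: "X : Sm" shows "idim_le \<J> (Suc n) X" proof -
 have "idim_le \<J> (Suc j) Y" if "Y : Sm" "cosyzygy r B Y" "r + j = n" for r j B Y using that
 proof (induction j arbitrary: r Y)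
  case 0
  obtain a b J C i p where h: "ses a b Y J C i p" "J : \<J>" "C : Sm" using hull[OF 0(1)] by blast
  note C = short_exactD[OF ses_short_exact[OF h(1)]]
  have "pdim_le n C" "cosyzygy n B Y" using pd h 0 by auto
  then obtain g where g: "g : hom (0 - b) C J" "Id C = p ** g"
   using pdim_le_lifting[OF _ _ h(1) inj[OF h(2)] Id_hom[OF C(6)]] by blast
  have "C : \<J>" by (rule retract[OF h(2,3), of g "- b" p]) (use g C in auto)
  thus ?case using idim_le.intros(2)[OF h(1,2) idim_le.intros(1)] by blast
 next
  case (Suc j)
  obtain a b J C i p where h: "ses a b Y J C i p" "J : \<J>" "C : Sm" using hull[OF Suc(2)] by blast
  have "cosyzygy (Suc r) B C" using cosyzygy.intros(2)[OF Suc(3) h(1) inj[OF h(2)]] .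
  hence "idim_le \<J> (Suc j) C" using Suc.IH[OF h(3)] Suc(4) by simp
  thus ?case using idim_le.intros(2)[OF h(1,2)] by blast
 qed
 from this[OF X cosyzygy.intros(1), of n] show ?thesis by simp
qed

end

section \<open>Serre duality for complexes over an abelian category with enough Serre pairs\<close>

lemma linear_on_comp:
 "linear_on R s' W s'' U G ==> linear_on R s V s' W F ==> linear_on R s V s'' U (%x. G (F x))"
 by (auto simp: linear_on_def)

definition (in gcat) biprod :: "int => 'o => 'o => 'o => 'h => 'h => 'h => 'h => bool"
 where "biprod k X Y Z i1 i2 p1 p2 \<longleftrightarrow> i1 : hom 0 X Z & i2 : hom k Y Z &
   p1 : hom 0 Z X & p2 : hom (- k) Z Y & p1 ** i1 = Id X & p2 ** i2 = Id Y &
   p1 ** i2 = 0 & p2 ** i1 = 0 & i1 ** p1 + i2 ** p2 = Id Z"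

lemma (in gcat) biprodD:
 assumes "biprod k X Y Z i1 i2 p1 p2" shows "i1 : hom 0 X Z" "i2 : hom k Y Z" "p1 : hom 0 Z X" "p2 : hom (- k) Z Y"
  "p1 ** i1 = Id X" "p2 ** i2 = Id Y" "p1 ** i2 = 0" "p2 ** i1 = 0" "i1 ** p1 + i2 ** p2 = Id Z"
  "Z : Ob" using assms by (auto simp: biprod_def dest: hom_Ob)

text \<open>An abelian category of graded objects with a projective generator \<open>L0\<close> and
  an injective cogenerator \<open>D0\<close>, paired by \<open>t0\<close>; for graded modules they
  are \<open>\<Lambda>\<close> and \<open>Hom(\<Lambda>, E)\<close> in degree 0. Most conditions
  come in pairs that reversal of arrows exchanges. In \<open>factorization\<close> the whole degree
  sits on the epimorphism.\<close>

locale serre_setup = matlis R se E + gcat m hom Id Ob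
 for R :: "('r, 'z) ring_scheme" (structure) and se :: "'r => 'e::ab_group_add => 'e" and E :: "'e set"
  and m :: "'h::ab_group_add => 'h => 'h" (infixl "**" 70)
  and hom :: "int => 'o => 'o => 'h set" and Id :: "'o => 'h" and Ob :: "'o set" +
 fixes sc :: "'r => 'h => 'h" and L0 D0 :: 'o and t0 :: "'h => 'e"
 assumes hom_finite_length: "X : Ob ==> Y : Ob ==> finite_length R sc (hom k X Y)"
  and sc_left: "r :. R ==> g : hom k Y Z ==> f : hom l X Y ==> sc r (g ** f) = sc r g ** f"
  and sc_right: "r :. R ==> g : hom k Y Z ==> f : hom l X Y ==> sc r (g ** f) = g ** sc r f"
  and shift: "X : Ob ==> EX X' s s'. s : hom k X' X & s' : hom (- k) X X' &
   s ** s' = Id X & s' ** s = Id X'"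
  and biproduct: "X : Ob ==> Y : Ob ==> EX Z i1 i2 p1 p2. biprod 0 X Y Z i1 i2 p1 p2"
  and zero_object: "EX Z:Ob. Id Z = 0"
  and factorization: "f : hom k X Y ==> EX K I C kap p i c. short_exact 0 k K X I kap p &
   short_exact 0 0 I Y C i c & f = i ** p"
  and L0_Ob: "L0 : Ob" and D0_Ob: "D0 : Ob" and t0: "functional sc (hom 0 L0 D0) t0"
  and t0_perfect: "X : Ob ==> functional sc (hom k L0 X) ph ==>
   EX a:hom (- k) X D0. ALL f:hom k L0 X. ph f = t0 (a ** f)"
  and t0_nondegenerate: "a : hom k X D0 ==> (!!f. f : hom (- k) L0 X ==> t0 (a ** f) = 0) ==> a = 0"
  and generator: "f : hom k X Y ==> (!!l w. w : hom l L0 X ==> f ** w = 0) ==> f = 0"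
  and cogenerator: "f : hom k X Y ==> (!!l w. w : hom l Y D0 ==> w ** f = 0) ==> f = 0"
  and finite_generation: "X : Ob ==> EX G. finite G & (ALL (k, w):G. w : hom k L0 X) &
   (ALL l. ALL a:hom l X D0. (ALL (k, w):G. a ** w = 0) --> a = 0)"
  and finite_cogeneration: "X : Ob ==> EX G. finite G & (ALL (k, w):G. w : hom k X D0) &
   (ALL l. ALL a:hom l L0 X. (ALL (k, w):G. w ** a = 0) --> a = 0)"
begin

lemma hom_rmod: "X : Ob ==> Y : Ob ==> rmod R sc (hom k X Y)"
 using hom_finite_length finite_length_rmod by blast

lemma comp_left_linear:
 assumes "g : hom k Y Z" "X : Ob" "n = k + l" shows "linear_on R sc (hom l X Y) sc (hom n X Z) (%f. g ** f)"
 by (rule linear_onI) (use assms sc_right in "auto intro: hom_compI simp: m_add_right")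

lemma comp_right_linear:
 assumes "f : hom l X Y" "Z : Ob" "n = k + l" shows "linear_on R sc (hom k Y Z) sc (hom n X Z) (%g. g ** f)"
 by (rule linear_onI) (use assms sc_left in "auto intro: hom_compI simp: m_add_left")

lemma functional_comp:
 "functional sc W ph ==> linear_on R sc V sc W F ==> functional sc V (%f. ph (F f))"
 by (auto simp: linear_on_def)

lemma functional_add:
 "functional sc V ph ==> functional sc V ps ==> functional sc V (%f. ph f + ps f)"
 by (auto simp: linear_on_def E.add_mem E.smult_add)

text \<open>\<open>I\<close> represents \<open>D Hom(P, -)\<close> in all degrees with
  \<open>t\<close> as universal element, so it is the Nakayama image of \<open>P\<close>.\<close>

definition serre_pair :: "'o => 'o => ('h => 'e) => bool"
 where "serre_pair P I t \<longleftrightarrow> P : Ob & I : Ob & functional sc (hom 0 P I) t &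
  (ALL X k ph. X : Ob --> functional sc (hom k P X) ph -->
   (EX a:hom (- k) X I. ALL f:hom k P X. ph f = t (a ** f))) &
  (ALL X k. ALL a:hom k X I. (ALL f:hom (- k) P X. t (a ** f) = 0) --> a = 0)"

lemma serre_pair_L0: "serre_pair L0 D0 t0"
 unfolding serre_pair_def using L0_Ob D0_Ob t0 t0_perfect t0_nondegenerate by blast

lemma serre_pairD:
 assumes "serre_pair P I t" shows "P : Ob" "I : Ob" "functional sc (hom 0 P I) t"
 using assms by (auto simp: serre_pair_def)

lemma serre_pair_repr:
 assumes "serre_pair P I t" "X : Ob" "functional sc (hom k P X) ph"
 obtains a where "a : hom (- k) X I" "!!f. f : hom k P X ==> ph f = t (a ** f)"
 using assms unfolding serre_pair_def by blast

lemma serre_pair_eq_0: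
 assumes "serre_pair P I t" "a : hom k X I" "!!f. f : hom (- k) P X ==> t (a ** f) = 0" shows "a = 0"
 using assms unfolding serre_pair_def by blast

lemma serre_pair_t:
 assumes "serre_pair P I t" shows "x : hom 0 P I ==> y : hom 0 P I ==> t (x + y) = t x + t y"
  "x : hom 0 P I ==> y : hom 0 P I ==> t (x - y) = t x - t y"
  "x : hom 0 P I ==> t (- x) = - t x" "t 0 = 0" using linear_onD(2)[OF serre_pairD(3)[OF assms]]
  rmod.linear_on_diff[OF hom_rmod[OF serre_pairD(1,2)[OF assms]] serre_pairD(3)[OF assms]]
  rmod.linear_on_uminus[OF hom_rmod[OF serre_pairD(1,2)[OF assms]] serre_pairD(3)[OF assms]]
  rmod.linear_on_zero[OF hom_rmod[OF serre_pairD(1,2)[OF assms]] serre_pairD(3)[OF assms]] by auto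

lemma serre_pair_eq:
 assumes s: "serre_pair P I t" and ab: "a : hom k X I" "b : hom k X I"
  and eq: "!!f. f : hom (- k) P X ==> t (a ** f) = t (b ** f)" shows "a = b" proof -
 have "a - b = 0" proof (rule serre_pair_eq_0[OF s hom_diff[OF ab]])
  fix f assume f: "f : hom (- k) P X"
  have "a ** f : hom 0 P I" "b ** f : hom 0 P I" using ab f by (auto intro: hom_compI)
  thus "t ((a - b) ** f) = 0" using eq[OF f] serre_pair_t(2)[OF s] by (simp add: m_diff_left)
 qed
 thus ?thesis by simp
qed

text \<open>As the Hom modules have finite length, the pairing is perfect from the other side too:
  \<open>P\<close> corepresents \<open>D Hom(-, I)\<close>. This makes the notion of a Serre pair
  self-dual.\<close>

lemma serre_pair_corepr:
 assumes s: "serre_pair P I t" and X: "X : Ob" and ph: "functional sc (hom k X I) ph"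
 obtains f where "f : hom (- k) P X" "!!a. a : hom k X I ==> ph a = t (a ** f)" proof -
 note PI = serre_pairD[OF s]
 have "EX v:hom (- k) P X. ALL h:hom k X I. ph h = t (h ** v)"
 proof (rule perfect_pairing_swap[OF hom_finite_length[OF PI(1) X] hom_rmod[OF X PI(2)] _ _ _ _ ph])
  show "functional sc (hom (- k) P X) (%v. t (h ** v))" if "h : hom k X I" for h
   by (rule functional_comp[OF PI(3) comp_left_linear[OF that PI(1)]]) simp
  show "functional sc (hom k X I) (%h. t (h ** v))" if "v : hom (- k) P X" for v
   by (rule functional_comp[OF PI(3) comp_right_linear[OF that PI(2)]]) simp
  show "EX h:hom k X I. ALL v:hom (- k) P X. f v = t (h ** v)" if f: "functional sc (hom (- k) P X) f" for f proof -
   obtain h where "h : hom (- (- k)) X I" "!!v. v : hom (- k) P X ==> f v = t (h ** v)"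
    using serre_pair_repr[OF s X f] by blast
   thus ?thesis by auto
  qed
  show "h = 0" if h: "h : hom k X I" "!!v. v : hom (- k) P X ==> t (h ** v) = 0" for h
   by (rule serre_pair_eq_0[OF s h(1)]) (rule h(2))
 qed
 then obtain v where v: "v : hom (- k) P X" "ALL h:hom k X I. ph h = t (h ** v)" by blast
 show thesis by (rule that[OF v(1)]) (use v(2) in blast)
qed

lemma serre_pair_co_eq_0:
 assumes s: "serre_pair P I t" and f: "f : hom k P X" and z: "!!a. a : hom (- k) X I ==> t (a ** f) = 0" shows "f = 0"
proof (rule ccontr)
 assume "f ~= 0"
 note X = hom_ObD[OF f]
 interpret H: rmod R sc "hom k P X" by (rule hom_rmod[OF X])
 have zero: "rmod R sc {0}" by (rule finite_length_rmod[OF H.finite_length_trivial])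
 obtain ph where ph: "functional sc (hom k P X) ph" "ph f ~= 0"
  using functional_separate[OF H.rmod_axioms zero _ f] H.zero_mem `f ~= 0`
  by (metis empty_subsetI insert_subset singletonD)
 obtain a where "a : hom (- k) X I" "!!f. f : hom k P X ==> ph f = t (a ** f)"
  using serre_pair_repr[OF s X(2) ph(1)] by metis
 with z ph(2) f show False by metis
qed

text \<open>Transposition with respect to the two trace pairings; it determines \<open>h\<close>
  from \<open>g\<close>.\<close>

definition adjoint :: "'o => 'o => ('h => 'e) => 'o => 'o => ('h => 'e) => int => 'h => 'h => bool"
 where "adjoint P I t P' I' t' k g h \<longleftrightarrow> g : hom k P P' & h : hom k I I' &
  (ALL a:hom (- k) P' I. t' (h ** a) = t (a ** g))"

text \<open>The Nakayama functor on the objects that have a Serre partner.\<close>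

lemma adjoint_exists:
 assumes s: "serre_pair P I t" and s': "serre_pair P' I' t'" and g: "g : hom k P P'"
 obtains h where "adjoint P I t P' I' t' k g h" proof -
 note PI = serre_pairD[OF s]
 have "functional sc (hom (- k) P' I) (%a. t (a ** g))"
  by (rule functional_comp[OF PI(3) comp_right_linear[OF g PI(2)]]) simp
 then obtain h where "h : hom (- (- k)) I I'" "!!a. a : hom (- k) P' I ==> t (a ** g) = t' (h ** a)"
  using serre_pair_repr[OF s' PI(2)] by metis
 hence "adjoint P I t P' I' t' k g h" using g by (simp add: adjoint_def)
 thus thesis by (rule that)
qed

lemma adjointD:
 assumes "adjoint P I t P' I' t' k g h"
 shows "g : hom k P P'" "h : hom k I I'" "a : hom (- k) P' I ==> t' (h ** a) = t (a ** g)"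
 using assms by (auto simp: adjoint_def)

lemma adjoint_comp:
 assumes a: "adjoint P I t P' I' t' k g h" and b: "adjoint P' I' t' P'' I'' t'' l g' h'"
 shows "adjoint P I t P'' I'' t'' (l + k) (g' ** g) (h' ** h)" unfolding adjoint_def proof (intro conjI ballI)
 note A = adjointD(1,2)[OF a] and B = adjointD(1,2)[OF b]
 fix x assume x: "x : hom (- (l + k)) P'' I"
 have "h ** x : hom (- l) P'' I'" by (rule hom_compI[OF A(2) x]) simp
 moreover have "x ** g' : hom (- k) P' I" by (rule hom_compI[OF x B(1)]) simp
 ultimately show "t'' (h' ** h ** x) = t (x ** (g' ** g))"
  using adjointD(3)[OF a, of "x ** g'"] adjointD(3)[OF b, of "h ** x"] by (simp add: m_assoc)
qed (use adjointD[OF a] adjointD[OF b] in "auto intro: hom_comp")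

lemma adjoint_add:
 assumes s: "serre_pair P I t" and s': "serre_pair P' I' t'"
  and a: "adjoint P I t P' I' t' k g h" and b: "adjoint P I t P' I' t' k g' h'"
 shows "adjoint P I t P' I' t' k (g + g') (h + h')" unfolding adjoint_def proof (intro conjI ballI)
 note A = adjointD[OF a] and B = adjointD[OF b]
 fix x assume x: "x : hom (- k) P' I"
 have "h ** x : hom 0 P' I'" "h' ** x : hom 0 P' I'" "x ** g : hom 0 P I" "x ** g' : hom 0 P I"
  using A B x by (auto intro: hom_compI)
 thus "t' ((h + h') ** x) = t (x ** (g + g'))"
  using A(3)[OF x] B(3)[OF x] by (simp add: m_simps serre_pair_t[OF s] serre_pair_t[OF s'])
qed (use adjointD[OF a] adjointD[OF b] in "auto intro: hom_add")

lemma adjoint_Id: "serre_pair P I t ==> adjoint P I t P I t 0 (Id P) (Id I)"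
 by (auto simp: adjoint_def Id_hom serre_pairD Id_left Id_right)

lemma adjoint_unique:
 assumes s': "serre_pair P' I' t'"
  and a: "adjoint P I t P' I' t' k g h" and b: "adjoint P I t P' I' t' k g h'" shows "h = h'"
 by (rule serre_pair_eq[OF s']) (use adjointD[OF a] adjointD[OF b] in auto)

lemma adjoint_zero:
 assumes s: "serre_pair P I t" and s': "serre_pair P' I' t'"
  and a: "adjoint P I t P' I' t' k 0 h" shows "h = 0" by (rule serre_pair_eq_0[OF s' adjointD(2)[OF a]])
  (use adjointD(3)[OF a] serre_pair_t(4)[OF s] in simp)

lemma graded_biproduct:
 assumes "X : Ob" "Y : Ob"
 obtains Z i1 i2 p1 p2 where "biprod k X Y Z i1 i2 p1 p2" proof -
 obtain Y' s s' where s: "s : hom (- k) Y' Y" "s' : hom k Y Y'" "s ** s' = Id Y" "s' ** s = Id Y'"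
  using shift[OF assms(2), of "- k"] by auto
 obtain Z i1 i2 p1 p2 where "biprod 0 X Y' Z i1 i2 p1 p2" using biproduct[OF assms(1) hom_ObD(1)[OF s(1)]] by blast
 note Z = biprodD[OF this]
 have 1: "s ** p2 ** (i2 ** s') = Id Y" using Z(6) s Id_left[OF s(2)] m_reassoc[OF Z(6)] by (simp add: m_assoc)
 have 2: "p1 ** (i2 ** s') = 0" using m_reassoc[OF Z(7)] by simp
 have 3: "s ** p2 ** i1 = 0" using Z(8) by (simp add: m_assoc)
 have 4: "i1 ** p1 + i2 ** s' ** (s ** p2) = Id Z" using Z(9) m_reassoc[OF s(4)] Id_left[OF Z(4)] by (simp add: m_assoc)
 have 5: "i2 ** s' : hom k Y Z" "s ** p2 : hom (- k) Z Y" using Z(2,4) s by (auto intro: hom_compI)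
 have "biprod k X Y Z i1 (i2 ** s') p1 (s ** p2)" unfolding biprod_def using 1 2 3 4 5 Z(1,3,5) by simp
 thus thesis by (rule that)
qed

lemma serre_pair_biproduct:
 assumes s: "serre_pair P I t" and s': "serre_pair P' I' t'"
 obtains Q J tt i1 i2 p1 p2 where "serre_pair Q J tt" "biprod k P P' Q i1 i2 p1 p2" proof -
 note PI = serre_pairD[OF s] and PI' = serre_pairD[OF s']
 obtain Q i1 i2 p1 p2 where bQ: "biprod k P P' Q i1 i2 p1 p2" using graded_biproduct[OF PI(1) PI'(1), of k] by metis
 note Q = biprodD[OF bQ]
 obtain J j1 j2 r1 r2 where bJ: "biprod k I I' J j1 j2 r1 r2" using graded_biproduct[OF PI(2) PI'(2), of k] by metis
 note J = biprodD[OF bJ]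
 \<comment> \<open>The sum of the traces of the two diagonal blocks.\<close>
 define tt where "tt f = t (r1 ** f ** i1) + t' (r2 ** f ** i2)" for f
 have l1: "linear_on R sc (hom 0 Q J) sc (hom 0 P I) (%f. r1 ** f ** i1)"
  by (rule linear_on_comp[OF comp_right_linear[OF Q(1) PI(2)] comp_left_linear[OF J(3) Q(10)]]) auto
 have l2: "linear_on R sc (hom 0 Q J) sc (hom 0 P' I') (%f. r2 ** f ** i2)"
  by (rule linear_on_comp[OF comp_right_linear[OF Q(2) PI'(2)] comp_left_linear[OF J(4) Q(10)]]) auto
 have "serre_pair Q J tt" unfolding serre_pair_def proof (intro conjI allI impI ballI)
  show "functional sc (hom 0 Q J) tt"
   unfolding tt_def using functional_add[OF functional_comp[OF PI(3) l1] functional_comp[OF PI'(3) l2]] .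
 next
  fix X l ph assume X: "X : Ob" and ph: "functional sc (hom l Q X) ph"
  have "functional sc (hom l P X) (%f. ph (f ** p1))"
   by (rule functional_comp[OF ph comp_right_linear[OF Q(3) X]]) simp
  then obtain a1 where a1: "a1 : hom (- l) X I" "!!f. f : hom l P X ==> ph (f ** p1) = t (a1 ** f)"
   using serre_pair_repr[OF s X] by metis
  have "functional sc (hom (l + k) P' X) (%f. ph (f ** p2))"
   by (rule functional_comp[OF ph comp_right_linear[OF Q(4) X]]) simp
  then obtain a2 where a2: "a2 : hom (- (l + k)) X I'" "!!f. f : hom (l + k) P' X ==> ph (f ** p2) = t' (a2 ** f)"
   using serre_pair_repr[OF s' X] by metis
  have ja1: "j1 ** a1 : hom (- l) X J" by (rule hom_compI[OF J(1) a1(1)]) simp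
  have ja2: "j2 ** a2 : hom (- l) X J" by (rule hom_compI[OF J(2) a2(1)]) simp
  have "ph f = tt ((j1 ** a1 + j2 ** a2) ** f)" if f: "f : hom l Q X" for f proof -
   have f1: "f ** i1 : hom l P X" and f2: "f ** i2 : hom (l + k) P' X"
    using hom_comp[OF f Q(1)] hom_comp[OF f Q(2)] by simp_all
   have "f ** i1 ** p1 : hom l Q X" "f ** i2 ** p2 : hom l Q X"
    using hom_comp[OF f1 Q(3)] hom_comp[OF f2 Q(4)] by simp_all
   moreover have "f = f ** i1 ** p1 + f ** i2 ** p2" using Id_right[OF f] Q(9) by (simp add: m_assoc flip: m_add_right)
   ultimately have "ph f = ph (f ** i1 ** p1) + ph (f ** i2 ** p2)" using linear_onD(2)[OF ph] by metis
   also have "\<dots> = t (a1 ** (f ** i1)) + t' (a2 ** (f ** i2))" using a1(2)[OF f1] a2(2)[OF f2] by simp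
   also have "\<dots> = tt ((j1 ** a1 + j2 ** a2) ** f)"
    by (simp only: tt_def m_simps m_reassoc[OF J(5)] m_reassoc[OF J(6)] m_reassoc[OF J(7)]
     m_reassoc[OF J(8)] m_reassoc[OF Id_left[OF a1(1)]] m_reassoc[OF Id_left[OF a2(1)]]
     m_zero_left m_zero_right add_0_left add_0_right)
   finally show ?thesis .
  qed
  thus "EX a:hom (- l) X J. ALL f:hom l Q X. ph f = tt (a ** f)" using hom_add[OF ja1 ja2] by blast
 next
  fix X l a assume a: "a : hom l X J" and z: "ALL f:hom (- l) Q X. tt (a ** f) = 0"
  have r1a: "r1 ** a : hom l X I" and r2a: "r2 ** a : hom (l - k) X I'"
   using hom_comp[OF J(3) a] hom_comp[OF J(4) a] by (simp_all add: algebra_simps)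
  have "r1 ** a = 0" proof (rule serre_pair_eq_0[OF s r1a])
   fix f assume f: "f : hom (- l) P X"
   have "f ** p1 : hom (- l) Q X" using hom_comp[OF f Q(3)] by simp
   hence "tt (a ** (f ** p1)) = 0" using z by blast
   moreover have "tt (a ** (f ** p1)) = t (r1 ** a ** f)"
    unfolding tt_def using Q(5,7) Id_right[OF f] by (simp add: m_assoc serre_pair_t(4)[OF s'])
   ultimately show "t (r1 ** a ** f) = 0" by simp
  qed
  moreover have "r2 ** a = 0" proof (rule serre_pair_eq_0[OF s' r2a])
   fix f assume f: "f : hom (- (l - k)) P' X"
   have "f ** p2 : hom (- l) Q X" using hom_comp[OF f Q(4)] by simp
   hence "tt (a ** (f ** p2)) = 0" using z by blast
   moreover have "tt (a ** (f ** p2)) = t' (r2 ** a ** f)"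
    unfolding tt_def using Q(6,8) Id_right[OF f] by (simp add: m_assoc serre_pair_t(4)[OF s])
   ultimately show "t' (r2 ** a ** f) = 0" by simp
  qed
  ultimately show "a = 0" using Id_left[OF a] J(9) by (metis m_add_left m_assoc m_zero_right add.right_neutral)
 qed (use Q(10) J(10) in auto)
 thus thesis using that bQ by blast
qed

end

section \<open>Projectivity and injectivity of Serre pairs, and contractible covers\<close>

context serre_setup
begin

sublocale gcat_ses m hom Id Ob short_exact by unfold_locales

text \<open>Maps into \<open>I\<close> are functionals on maps out of \<open>P\<close>, and
  functionals extend along the injection that \<open>i\<close> induces on these.\<close>

lemma serre_pair_injective:
 assumes s: "serre_pair P I t" shows "injective_ob I" unfolding injective_ob_def proof (intro allI impI ballI)
 fix a b X Y Z i p k f assume e: "short_exact a b X Y Z i p" and f: "f : hom k X I"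
 note PI = serre_pairD[OF s] and E = short_exactD[OF e]
 have lin: "linear_on R sc (hom (- k) P X) sc (hom (a - k) P Y) (%g. i ** g)"
  by (rule comp_left_linear[OF E(1) PI(1)]) simp
 have \<theta>: "functional sc (hom (- k) P X) (%g. t (f ** g))"
  by (rule functional_comp[OF PI(3) comp_left_linear[OF f PI(1)]]) simp
 have ker: "t (f ** v) = 0" if "v : hom (- k) P X" "i ** v = 0" for v
  using short_exact_mono[OF e that] serre_pair_t(4)[OF s] by simp
 obtain ps where ps: "functional sc (hom (a - k) P Y) ps" "!!v. v : hom (- k) P X ==> ps (i ** v) = t (f ** v)"
  by (rule functional_factor[OF hom_rmod hom_rmod lin \<theta> ker]) (use PI E in auto)
 obtain g where g: "g : hom (- (a - k)) Y I" "!!v. v : hom (a - k) P Y ==> ps v = t (g ** v)"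
  using serre_pair_repr[OF s E(5) ps(1)] by metis
 have g1: "g : hom (k - a) Y I" using g(1) by simp
 have gi: "g ** i : hom k X I" by (rule hom_compI[OF g1 E(1)]) simp
 have "f = g ** i" proof (rule serre_pair_eq[OF s f gi])
  fix v assume v: "v : hom (- k) P X"
  have "i ** v : hom (a - k) P Y" by (rule hom_compI[OF E(1) v]) simp
  thus "t (f ** v) = t (g ** i ** v)" using ps(2)[OF v] g(2) by (simp add: m_assoc)
 qed
 thus "EX g:hom (k - a) Y I. f = g ** i" using g1 by blast
qed

text \<open>A functional separating \<open>f\<close> from the maps that lift would be given by some
  \<open>g\<close> from \<open>Z\<close> to \<open>I\<close> with \<open>g ** p = 0\<close>; but
  then \<open>g = 0\<close>.\<close>

lemma serre_pair_projective:
 assumes s: "serre_pair P I t" shows "projective_ob P" unfolding projective_ob_def proof (intro allI impI ballI)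
 fix a b X Y Z i p k f assume e: "short_exact a b X Y Z i p" and f: "f : hom k P Z"
 note PI = serre_pairD[OF s] and E = short_exactD[OF e]
 have lin: "linear_on R sc (hom (k - b) P Y) sc (hom k P Z) (%g. p ** g)" by (rule comp_left_linear[OF E(2) PI(1)]) simp
 define W where "W = (%g. p ** g) ` hom (k - b) P Y"
 interpret HY: rmod R sc "hom (k - b) P Y" by (rule hom_rmod) (use PI E in auto)
 interpret HZ: rmod R sc "hom k P Z" by (rule hom_rmod) (use PI E in auto)
 have Wr: "rmod R sc W" "W \<subseteq> hom k P Z"
  unfolding W_def using HY.rmod_image[OF lin HZ.rmod_axioms] linear_onD(1)[OF lin] by auto
 have "f : W" proof (rule ccontr)
  assume "f ~: W"
  then obtain ph where ph: "functional sc (hom k P Z) ph" "!!w. w : W ==> ph w = 0" "ph f ~= 0"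
   using functional_separate[OF HZ.rmod_axioms Wr f] by metis
  obtain g where g: "g : hom (- k) Z I" "!!v. v : hom k P Z ==> ph v = t (g ** v)"
   using serre_pair_repr[OF s E(6) ph(1)] by metis
  have gp: "g ** p : hom (b - k) Y I" by (rule hom_compI[OF g(1) E(2)]) simp
  have "g ** p = 0" proof (rule serre_pair_eq_0[OF s gp])
   fix v assume "v : hom (- (b - k)) P Y"
   hence v: "v : hom (k - b) P Y" by simp
   hence "t (g ** (p ** v)) = ph (p ** v)" using g(2) linear_onD(1)[OF lin v] by simp
   also have "\<dots> = 0" using ph(2) v unfolding W_def by blast
   finally show "t (g ** p ** v) = 0" by (simp add: m_assoc)
  qed
  hence "g = 0" using short_exact_epi[OF e g(1)] by simp
  thus False using g(2)[OF f] ph(3) serre_pair_t(4)[OF s] by simp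
 qed
 thus "EX g:hom (k - b) P Y. f = p ** g" unfolding W_def by blast
qed

text \<open>For an epimorphism the mono part of the factorization has zero cokernel and is therefore
  invertible, so \<open>f\<close> can take the place of the epi part.\<close>

lemma epi_short_exact:
 assumes f: "f : hom k X Y" and epi: "!!A l g. g : hom l Y A ==> g ** f = 0 ==> g = 0"
 obtains K kap where "short_exact 0 k K X Y kap f" proof -
 obtain K I C kap p i c where s: "short_exact 0 k K X I kap p" "short_exact 0 0 I Y C i c" "f = i ** p"
  using factorization[OF f] by blast
 note P = short_exactD[OF s(1)] and I = short_exactD[OF s(2)]
 have "c = 0" using epi[OF I(2)] m_reassoc[OF I(3)] s(3) by simp
 then obtain g where g: "g : hom (0 - 0) Y I" "Id Y = i ** g" using short_exact_kernel[OF s(2) Id_hom[OF I(5)]] by auto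
 have "g ** i = Id I" proof (rule short_exact_mono_eq[OF s(2)])
  show "g ** i : hom 0 I I" by (rule hom_compI[OF g(1) I(1)]) simp
  show "i ** (g ** i) = i ** Id I" using m_reassoc[OF g(2)[symmetric], of i] Id_left[OF I(1)] Id_right[OF I(1)] by simp
 qed (rule Id_hom[OF I(4)])
 hence gf: "g ** f = p" using s(3) Id_left[OF P(2)] by (metis m_assoc)
 have "short_exact 0 k K X Y kap f" unfolding short_exact_def proof (intro conjI allI impI ballI)
  show "f ** kap = 0" using P(3) s(3) by (simp add: m_assoc)
  show "EX h:hom (l - 0) A K. v = kap ** h" if "v : hom l A X" "f ** v = 0" for A l v proof -
   have "p ** v = 0" using m_reassoc[OF gf, of v] that(2) by simp
   thus ?thesis using short_exact_kernel[OF s(1) that(1)] by blast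
  qed
  show "v = 0" if "v : hom l A K" "kap ** v = 0" for A l v using short_exact_mono[OF s(1) that] .
  show "EX h:hom (l - k) Y A. v = h ** f" if v: "v : hom l X A" "v ** kap = 0" for A l v proof -
   obtain h where h: "h : hom (l - k) I A" "v = h ** p" using short_exact_cokernel[OF s(1) v] by blast
   hence "h ** g : hom (l - k) Y A" "v = (h ** g) ** f" using g(1) gf by (auto intro: hom_compI simp: m_assoc)
   thus ?thesis by blast
  qed
  show "v = 0" if "v : hom l Y A" "v ** f = 0" for A l v using epi[OF that] .
 qed (use f P in auto)
 thus thesis by (rule that)
qed

text \<open>One shifted copy of \<open>L0\<close> for each of finitely many generators. Only
  surjectivity matters; the cover need not be minimal.\<close>

theorem projective_cover:
 assumes X: "X : Ob"
 obtains P I t K kap pj where "serre_pair P I t" "short_exact 0 0 K P X kap pj" proof -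
 obtain G where G: "finite G" "ALL (k, w):G. w : hom k L0 X"
  "ALL l. ALL a:hom l X D0. (ALL (k, w):G. a ** w = 0) --> a = 0" using finite_generation[OF X] by metis
 have "EX P I t f. serre_pair P I t & f : hom 0 P X & (ALL (k, w):F. EX u:hom k L0 P. w = f ** u)"
  if "finite F" "F \<subseteq> G" for F using that proof (induction rule: finite_induct)
  case empty
  show ?case using serre_pair_L0 hom_zero[OF L0_Ob X, of 0] by blast
 next
  case (insert kw F)
  obtain k w where kw: "kw = (k, w)" by (cases kw)
  have w: "w : hom k L0 X" using insert.prems G(2) kw by auto
  obtain P I t f where P: "serre_pair P I t" "f : hom 0 P X" "ALL (k, w):F. EX u:hom k L0 P. w = f ** u"
   using insert by auto
  obtain Q J tt i1 i2 p1 p2 where Q: "serre_pair Q J tt" "biprod k P L0 Q i1 i2 p1 p2"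
   using serre_pair_biproduct[OF P(1) serre_pair_L0, of k] by metis
  note B = biprodD[OF Q(2)]
  define f' where "f' = f ** p1 + w ** p2"
  have f': "f' : hom 0 Q X" unfolding f'_def by (intro hom_add hom_compI[OF P(2) B(3)] hom_compI[OF w B(4)]) auto
  have 1: "f' ** (i1 ** u) = f ** u" if "u : hom l L0 P" for l u
   using m_reassoc[OF B(5)] m_reassoc[OF B(8)] Id_left[OF that] by (simp add: f'_def m_simps)
  have 2: "f' ** i2 = w" using B(6,7) Id_right[OF w] by (simp add: f'_def m_simps)
  have "EX u:hom l L0 Q. v = f' ** u" if lv: "(l, v) : insert kw F" for l v proof (cases "(l, v) : F")
   case True
   then obtain u where u: "u : hom l L0 P" "v = f ** u" using P(3) by blast
   have "i1 ** u : hom l L0 Q" by (rule hom_compI[OF B(1) u(1)]) simp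
   thus ?thesis using 1[OF u(1)] u(2) by metis
  next
   case False
   thus ?thesis using lv kw 2 B(2) by auto
  qed
  thus ?case using Q(1) f' by blast
 qed
 from this[OF G(1) order_refl] obtain P I t f where P: "serre_pair P I t" "f : hom 0 P X"
  "ALL (k, w):G. EX u:hom k L0 P. w = f ** u" by blast
 have D0: "a = 0" if a: "a : hom l X D0" "a ** f = 0" for l a proof -
  have "ALL (k, w):G. a ** w = 0" using P(3) m_reassoc[OF a(2)] by fastforce
  thus ?thesis using G(3) a(1) by blast
 qed
 obtain K kap where "short_exact 0 0 K P X kap f" proof (rule epi_short_exact[OF P(2)])
  fix A l g assume g: "g : hom l X A" "g ** f = 0"
  show "g = 0" proof (rule cogenerator[OF g(1)])
   fix j v assume v: "v : hom j A D0"
   have "(v ** g) ** f = 0" using g(2) by (simp add: m_assoc)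
   thus "v ** g = 0" using D0[OF hom_comp[OF v g(1)]] by blast
  qed
 qed
 thus thesis using that P(1) by blast
qed

definition cplx :: "'o => 'h => bool" where "cplx X d \<longleftrightarrow> d : hom 1 X X & d ** d = 0"

definition chain :: "'o => 'h => 'o => 'h => 'h set" where "chain X d Y e = {f : hom 0 X Y. f ** d = e ** f}"

definition bdry :: "'o => 'h => 'o => 'h => 'h set" where "bdry X d Y e = {e ** s + s ** d | s. s : hom (- 1) X Y}"

text \<open>If \<open>Q \<rightarrow> X\<close> is a projective cover of the graded object underlying \<open>X\<close>, then the contractible
 complex \<open>P = Q \<oplus> Q[-1]\<close> covers the complex \<open>X\<close>.\<close>

lemma contractible_cover:
 assumes X: "cplx X d"
 obtains P I t K kap pj dl sig where "serre_pair P I t" "short_exact 0 0 K P X kap pj"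
  "dl : hom 1 P P" "sig : hom (- 1) P P" "dl ** dl = 0" "dl ** sig + sig ** dl = Id P" "pj ** dl = d ** pj"
proof -
 have d: "d : hom 1 X X" "d ** d = 0" using X by (auto simp: cplx_def)
 obtain Q J t K0 kap0 pj0 where Q: "serre_pair Q J t" "short_exact 0 0 K0 Q X kap0 pj0"
  using projective_cover[OF hom_ObD(1)[OF d(1)]] by metis
 note E = short_exactD[OF Q(2)]
 obtain P I tt i1 i2 p1 p2 where P: "serre_pair P I tt" "biprod 1 Q Q P i1 i2 p1 p2"
  using serre_pair_biproduct[OF Q(1) Q(1), of 1] by metis
 note B = biprodD[OF P(2)]
 \<comment> \<open>\<open>dl\<close> carries the first copy of \<open>Q\<close> identically onto the
   second and \<open>sig\<close> carries it back. \<open>pj\<close> is the only chain map that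
   restricts to \<open>pj0\<close> on the first copy.\<close>
 define dl where "dl = i2 ** p1"
 define sig where "sig = i1 ** p2"
 define pj where "pj = pj0 ** p1 + d ** (pj0 ** p2)"
 have 1: "dl : hom 1 P P" unfolding dl_def by (rule hom_compI[OF B(2,3)]) simp
 have 2: "sig : hom (- 1) P P" unfolding sig_def by (rule hom_compI[OF B(1,4)]) simp
 have 3: "pj : hom 0 P X" unfolding pj_def
  by (intro hom_add hom_compI[OF E(2) B(3)] hom_compI[OF d(1) hom_compI[OF E(2) B(4)]]) auto
 have 4: "dl ** dl = 0" unfolding dl_def by (simp add: m_assoc m_reassoc[OF B(7)])
 have 5: "dl ** sig + sig ** dl = Id P" unfolding dl_def sig_def using B(9)
  by (simp add: m_assoc m_reassoc[OF B(5)] m_reassoc[OF B(6)] Id_left[OF B(3)] Id_left[OF B(4)] add.commute)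
 have 6: "pj ** dl = d ** pj" unfolding dl_def pj_def
  by (simp add: m_simps m_reassoc[OF B(6)] m_reassoc[OF B(7)] m_reassoc[OF d(2)] Id_left[OF B(3)])
 obtain K kap where "short_exact 0 0 K P X kap pj" proof (rule epi_short_exact[OF 3])
  fix A l g assume g: "g : hom l X A" "g ** pj = 0"
  have "pj ** i1 = pj0" unfolding pj_def using B(5,8) Id_right[OF E(2)] by (simp add: m_simps)
  hence "g ** pj0 = 0" using m_reassoc[OF g(2), of i1] by simp
  thus "g = 0" using short_exact_epi[OF Q(2) g(1)] by simp
 qed
 thus thesis using that P(1) 1 2 4 5 6 by blast
qed

end

section \<open>Representability on the bounded homotopy category\<close>

context serre_setup
begin

text \<open>Maps from \<open>Y\<close> to \<open>T\<close> up to homotopy are the functionals on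
  homotopy classes of maps from \<open>X\<close> to \<open>Y\<close>. The statement is phrased with
  chain maps and boundaries, so that no quotient is formed.\<close>

definition represents :: "'o => 'h => 'o => 'h => ('h => 'e) => 'o => 'h => bool"
 where "represents X d T dT tau Y e \<longleftrightarrow>
  (ALL ph. functional sc (chain X d Y e) ph --> (ALL b:bdry X d Y e. ph b = 0) -->
   (EX h:chain Y e T dT. ALL f:chain X d Y e. ph f = tau (h ** f))) &
  (ALL h:chain Y e T dT. (ALL f:chain X d Y e. tau (h ** f) = 0) --> h : bdry Y e T dT)"

lemma chain_rmod:
 assumes "cplx X d" "cplx Y e" shows "rmod R sc (chain X d Y e)" proof -
 have d: "d : hom 1 X X" "e : hom 1 Y Y" using assms by (auto simp: cplx_def)
 note O = hom_ObD(1)[OF d(1)] hom_ObD(1)[OF d(2)]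
 interpret H: rmod R sc "hom 0 X Y" by (rule hom_rmod[OF O])
 show ?thesis by (rule H.rmodI_sub) (auto simp: chain_def m_simps hom_zero O H.smult_mem intro: hom_add,
   metis d(1) d(2) sc_left sc_right)
qed

text \<open>Serre duality in the bounded homotopy category.  Contractible covers
 \<open>P\<^sub>1 \<rightarrow> P\<^sub>0 \<rightarrow> X \<rightarrow> 0\<close> give an exact sequence
 \<open>0 \<rightarrow> \<H>(Y, K) \<rightarrow> \<H>(Y, nuP\<^sub>1) \<rightarrow> \<H>(Y, nuP\<^sub>0) \<rightarrow> D\<H>(X, Y) \<rightarrow> 0\<close> of complexes
 whose middle terms are contractible, so that \<open>D\<H>(X, Y) \<simeq> \<H>(Y, K)[2]\<close>; the object
 \<open>T\<close> below is \<open>K[2]\<close>, and \<open>om\<close> is the composite of the two connecting isomorphisms.\<close>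

theorem serre_duality_cplx:
 assumes X: "cplx X d"
 obtains T dT tau where "cplx T dT" "functional sc (hom 0 X T) tau" "!!b. b : bdry X d T dT ==> tau b = 0"
  "!!Y e. cplx Y e ==> represents X d T dT tau Y e" proof -
 have d: "d : hom 1 X X" "d ** d = 0" using X by (auto simp: cplx_def)
 note XOb = hom_ObD(1)[OF d(1)]
 obtain P0 I0 t K kap0 pj dl0 sig0 where P0: "serre_pair P0 I0 t" "short_exact 0 0 K P0 X kap0 pj"
  "dl0 : hom 1 P0 P0" "sig0 : hom (- 1) P0 P0" "dl0 ** dl0 = 0" "dl0 ** sig0 + sig0 ** dl0 = Id P0"
  "pj ** dl0 = d ** pj" using contractible_cover[OF X] by metis
 note E0 = short_exactD[OF P0(2)]
 note O0 = serre_pairD[OF P0(1)]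
 have "pj ** (dl0 ** kap0) = 0" using E0(3) by (simp add: m_reassoc[OF P0(7)] m_assoc)
 then obtain dK where dK: "dK : hom (1 + 0 - 0) K K" "dl0 ** kap0 = kap0 ** dK"
  using short_exact_kernel[OF P0(2) hom_comp[OF P0(3) E0(1)]] by metis
 have dK1: "dK : hom 1 K K" using dK(1) by simp
 have "kap0 ** (dK ** dK) = 0"
  using P0(5) by (simp add: m_reassoc[OF dK(2)[symmetric]] m_assoc dK(2)[symmetric] m_reassoc[OF P0(5)])
 hence "dK ** dK = 0" using short_exact_mono[OF P0(2) hom_comp[OF dK1 dK1]] by simp
 hence "cplx K dK" using dK1 by (simp add: cplx_def)
 then obtain P1 I1 t1 K1 kap1 pj1 dl1 sig1 where P1: "serre_pair P1 I1 t1" "short_exact 0 0 K1 P1 K kap1 pj1"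
  "dl1 : hom 1 P1 P1" "sig1 : hom (- 1) P1 P1" "dl1 ** dl1 = 0" "dl1 ** sig1 + sig1 ** dl1 = Id P1"
  "pj1 ** dl1 = dK ** pj1" using contractible_cover by metis
 note E1 = short_exactD[OF P1(2)]
 note O1 = serre_pairD[OF P1(1)]
 \<comment> \<open>The presentation of \<open>X\<close> by the two covers; \<open>pcok\<close> says
   that \<open>pj\<close> is a cokernel of \<open>p\<close>.\<close>
 define p where "p = kap0 ** pj1"
 have p: "p : hom 0 P1 P0" unfolding p_def by (rule hom_compI[OF E0(1) E1(2)]) simp
 have pjp: "pj ** p = 0" unfolding p_def using m_reassoc[OF E0(3)] by simp
 have pdl: "p ** dl1 = dl0 ** p"
  unfolding p_def by (simp add: m_assoc P1(7) m_reassoc[OF dK(2)[symmetric]])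
 have pcok: "EX s:hom l X Y. g = s ** pj" if g: "g : hom l P0 Y" "g ** p = 0" for l Y g proof -
  have "(g ** kap0) ** pj1 = 0" using g(2) by (simp add: p_def m_assoc)
  hence "g ** kap0 = 0" using short_exact_epi[OF P1(2) hom_comp[OF g(1) E0(1)]] by blast
  thus ?thesis using short_exact_cokernel[OF P0(2) g(1)] by auto
 qed
 obtain nudl0 where nudl0: "adjoint P0 I0 t P0 I0 t 1 dl0 nudl0" using adjoint_exists[OF P0(1,1,3)] .
 obtain nudl1 where nudl1: "adjoint P1 I1 t1 P1 I1 t1 1 dl1 nudl1" using adjoint_exists[OF P1(1,1,3)] .
 obtain nusig0 where nusig0: "adjoint P0 I0 t P0 I0 t (- 1) sig0 nusig0" using adjoint_exists[OF P0(1,1,4)] .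
 obtain nusig1 where nusig1: "adjoint P1 I1 t1 P1 I1 t1 (- 1) sig1 nusig1" using adjoint_exists[OF P1(1,1,4)] .
 obtain q where nup: "adjoint P1 I1 t1 P0 I0 t 0 p q" using adjoint_exists[OF P1(1) P0(1) p] .
 \<comment> \<open>With this sign the trace \<open>t\<close> vanishes on the boundaries
   \<open>D0 ** a + a ** dl0\<close> of the Hom complex from \<open>P0\<close> to \<open>I0\<close>,
   see \<open>tD\<close>. Changing both signs preserves the contraction identities.\<close>
 define D0 D1 S0 S1 where DS: "D0 = - nudl0" "D1 = - nudl1" "S0 = - nusig0" "S1 = - nusig1"
 have D0: "D0 : hom 1 I0 I0" and D1: "D1 : hom 1 I1 I1" and S0: "S0 : hom (- 1) I0 I0"
  and S1: "S1 : hom (- 1) I1 I1" and q: "q : hom 0 I1 I0"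
  using adjointD(2)[OF nudl0] adjointD(2)[OF nudl1] adjointD(2)[OF nusig0] adjointD(2)[OF nusig1]
   adjointD(2)[OF nup] by (auto simp: DS intro: hom_uminus)
 have DD0: "D0 ** D0 = 0"
  using adjoint_comp[OF nudl0 nudl0] adjoint_zero[OF P0(1,1)] by (simp add: P0(5) DS m_simps)
 have DD1: "D1 ** D1 = 0"
  using adjoint_comp[OF nudl1 nudl1] adjoint_zero[OF P1(1,1)] by (simp add: P1(5) DS m_simps)
 have DS0: "D0 ** S0 + S0 ** D0 = Id I0" proof -
  have "adjoint P0 I0 t P0 I0 t 0 (Id P0) (nudl0 ** nusig0 + nusig0 ** nudl0)"
   using adjoint_add[OF P0(1,1), of 0 "dl0 ** sig0" "nudl0 ** nusig0" "sig0 ** dl0" "nusig0 ** nudl0"]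
    adjoint_comp[OF nusig0 nudl0] adjoint_comp[OF nudl0 nusig0] by (simp add: P0(6))
  from adjoint_unique[OF P0(1) this adjoint_Id[OF P0(1)]] show ?thesis by (simp add: DS m_simps)
 qed
 have DS1: "D1 ** S1 + S1 ** D1 = Id I1" proof -
  have "adjoint P1 I1 t1 P1 I1 t1 0 (Id P1) (nudl1 ** nusig1 + nusig1 ** nudl1)"
   using adjoint_add[OF P1(1,1), of 0 "dl1 ** sig1" "nudl1 ** nusig1" "sig1 ** dl1" "nusig1 ** nudl1"]
    adjoint_comp[OF nusig1 nudl1] adjoint_comp[OF nudl1 nusig1] by (simp add: P1(6))
  from adjoint_unique[OF P1(1) this adjoint_Id[OF P1(1)]] show ?thesis by (simp add: DS m_simps)
 qed
 have qD: "q ** D1 = D0 ** q" proof -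
  have "adjoint P1 I1 t1 P0 I0 t 1 (dl0 ** p) (q ** nudl1)"
   using adjoint_comp[OF nudl1 nup] by (simp add: pdl)
  moreover have "adjoint P1 I1 t1 P0 I0 t 1 (dl0 ** p) (nudl0 ** q)"
   using adjoint_comp[OF nup nudl0] by simp
  ultimately have "q ** nudl1 = nudl0 ** q" by (rule adjoint_unique[OF P0(1)])
  thus ?thesis by (simp add: DS m_simps)
 qed
 have h0: "D0 ** (S0 ** a) = a - S0 ** (D0 ** a)" if "a : hom l Y I0" for l Y a
  using arg_cong[OF DS0, of "%x. x ** a"] Id_left[OF that] by (simp add: m_simps algebra_simps)
 have h1: "D1 ** (S1 ** a) = a - S1 ** (D1 ** a)" if "a : hom l Y I1" for l Y a
  using arg_cong[OF DS1, of "%x. x ** a"] Id_left[OF that] by (simp add: m_simps algebra_simps)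
 have tD: "t (D0 ** a) = - t (a ** dl0)" if a: "a : hom (- 1) P0 I0" for a proof -
  have "nudl0 ** a : hom 0 P0 I0" by (rule hom_compI[OF adjointD(2)[OF nudl0] a]) simp
  thus ?thesis using adjointD(3)[OF nudl0, of a] a by (simp add: DS m_simps serre_pair_t[OF P0(1)])
 qed
 have tq: "t (q ** a) = t1 (a ** p)" if "a : hom 0 P0 I1" for a using adjointD(3)[OF nup, of a] that by simp
 note t_simps = serre_pair_t[OF P0(1)]
 obtain KT II C kap' p' i' c' where f: "short_exact 0 0 KT I1 II kap' p'" "short_exact 0 0 II I0 C i' c'" "q = i' ** p'"
  using factorization[OF q] by metis
 note F = short_exactD[OF f(1)] and F' = short_exactD[OF f(2)]
 \<comment> \<open>\<open>T\<close> is the kernel shifted by 2, so that its inclusion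
   \<open>kap\<close> into \<open>I1\<close> has degree 2, one for each of the two connecting
   maps.\<close>
 obtain T s s' where s: "s : hom 2 T KT" "s' : hom (- 2) KT T" "s ** s' = Id KT" "s' ** s = Id T"
  using shift[OF F(4), of 2] by metis
 define kap where "kap = kap' ** s"
 have kap: "kap : hom 2 T I1" unfolding kap_def by (rule hom_compI[OF F(1) s(1)]) simp
 have TOb: "T : Ob" using hom_ObD[OF kap] by simp
 have qkap: "q ** kap = 0" unfolding kap_def f(3) by (simp add: m_assoc m_reassoc[OF F(3)])
 have ker: "EX h:hom (l - 2) Y T. a = kap ** h" if a: "a : hom l Y I1" "q ** a = 0" for l Y a proof -
  have "i' ** (p' ** a) = 0" using a(2) by (simp add: f(3) m_assoc)
  hence "p' ** a = 0" using short_exact_mono[OF f(2) hom_comp[OF F(2) a(1)]] by simp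
  then obtain g where g: "g : hom (l - 0) Y KT" "a = kap' ** g" using short_exact_kernel[OF f(1) a(1)] by metis
  have "s' ** g : hom (l - 2) Y T" by (rule hom_compI[OF s(2) g(1)]) simp
  moreover have "a = kap ** (s' ** g)" using g by (simp add: kap_def m_assoc m_reassoc[OF s(3)] Id_left[OF g(1)])
  ultimately show ?thesis by blast
 qed
 have mono: "g = h" if gh: "g : hom l Y T" "h : hom l Y T" "kap ** g = kap ** h" for l Y g h proof -
  have "s ** g = s ** h" using short_exact_mono_eq[OF f(1) hom_comp[OF s(1) gh(1)] hom_comp[OF s(1) gh(2)]] gh(3)
   by (simp add: kap_def m_assoc)
  hence "s' ** (s ** g) = s' ** (s ** h)" by simp
  thus ?thesis by (simp add: m_reassoc[OF s(4)] Id_left[OF gh(1)] Id_left[OF gh(2)])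
 qed
 have "q ** (D1 ** kap) = 0" using qkap by (simp add: m_reassoc[OF qD] m_assoc)
 then obtain dT where dT: "dT : hom (1 + 2 - 2) T T" "D1 ** kap = kap ** dT"
  using ker[OF hom_comp[OF D1 kap]] by metis
 have dT1: "dT : hom 1 T T" using dT(1) by simp
 have "kap ** (dT ** dT) = kap ** 0"
  by (simp add: m_reassoc[OF dT(2)[symmetric]] m_assoc dT(2)[symmetric] m_reassoc[OF DD1])
 hence "dT ** dT = 0" by (rule mono[OF hom_comp[OF dT1 dT1] hom_zero[OF TOb TOb]])
 hence T: "cplx T dT" using dT1 by (simp add: cplx_def)
 \<comment> \<open>The composite of the connecting maps, made explicit by the contractions: contract
   in \<open>I1\<close>, apply \<open>q\<close>, contract in \<open>I0\<close>. The degrees add up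
   to \<open>2 - 1 + 0 - 1 = 0\<close>.\<close>
 define om where "om = S0 ** (q ** (S1 ** kap))"
 have u: "q ** (S1 ** kap) : hom 1 T I0" by (rule hom_compI[OF q hom_compI[OF S1 kap]]) auto
 have om: "om : hom 0 T I0" unfolding om_def by (rule hom_compI[OF S0 u]) simp
 have "S1 ** (kap ** dT) = kap - D1 ** (S1 ** kap)" using h1[OF kap] dT(2) by simp
 hence "om ** dT = - (S0 ** (D0 ** (q ** (S1 ** kap))))"
  unfolding om_def using qkap by (simp add: m_simps m_reassoc[OF qD])
 \<comment> \<open>\<open>om\<close> fails to be a chain map only by a term through
   \<open>q\<close>. The trace does not see such a term on maps factoring over \<open>pj\<close>,
   because \<open>q\<close> is adjoint to \<open>p\<close> and \<open>pj ** p = 0\<close>.\<close>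
 hence omd: "om ** dT = D0 ** om - q ** (S1 ** kap)" using h0[OF u] by (simp add: om_def)
 define tau where "tau g = t (om ** g ** pj)" for g
 have tau: "functional sc (hom 0 X T) tau" unfolding tau_def
  by (rule functional_comp[OF O0(3) linear_on_comp[OF comp_right_linear[OF E0(2) O0(2)] comp_left_linear[OF om XOb]]]) auto
 have taub: "tau b = 0" if b: "b : bdry X d T dT" for b proof -
  obtain s where s: "s : hom (- 1) X T" "b = dT ** s + s ** d" using b by (auto simp: bdry_def)
  have spj: "s ** pj : hom (- 1) P0 T" by (rule hom_compI[OF s(1) E0(2)]) simp
  have oms: "om ** (s ** pj) : hom (- 1) P0 I0" by (rule hom_compI[OF om spj]) simp
  have us: "S1 ** (kap ** (s ** pj)) : hom 0 P0 I1" by (rule hom_compI[OF S1 hom_compI[OF kap spj]]) auto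
  have 1: "D0 ** (om ** (s ** pj)) : hom 0 P0 I0" by (rule hom_compI[OF D0 oms]) simp
  have 2: "q ** (S1 ** (kap ** (s ** pj))) : hom 0 P0 I0" by (rule hom_compI[OF q us]) simp
  have 3: "om ** (s ** pj) ** dl0 : hom 0 P0 I0" by (rule hom_compI[OF oms P0(3)]) simp
  have "om ** b ** pj = D0 ** (om ** (s ** pj)) - q ** (S1 ** (kap ** (s ** pj))) + om ** (s ** pj) ** dl0"
   unfolding s(2) by (simp add: m_simps m_reassoc[OF omd] P0(7))
  hence "tau b = t (D0 ** (om ** (s ** pj))) - t (q ** (S1 ** (kap ** (s ** pj)))) + t (om ** (s ** pj) ** dl0)"
   unfolding tau_def using 1 2 3 by (simp add: t_simps hom_diff)
  also have "\<dots> = - t1 (S1 ** (kap ** (s ** pj)) ** p)" using tD[OF oms] tq[OF us] by simp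
  also have "\<dots> = 0" using pjp serre_pair_t(4)[OF P1(1)] by (simp add: m_assoc)
  finally show ?thesis .
 qed
 \<comment> \<open>If \<open>b\<close> is orthogonal to everything that factors over
   \<open>X\<close>, its functional on maps \<open>P0 -> Y\<close> vanishes on those killed by
   \<open>p\<close>. So it factors through maps \<open>P1 -> Y\<close>, where it is represented by
   \<open>c\<close>.\<close>
 have exact: "EX c:hom k Y I1. b = q ** c"
  if b: "b : hom k Y I0" and z: "!!s. s : hom (- k) X Y ==> t (b ** s ** pj) = 0" for b k Y proof -
  note Y = hom_ObD(1)[OF b]
  have lin: "linear_on R sc (hom (- k) P0 Y) sc (hom (- k) P1 Y) (%g. g ** p)" by (rule comp_right_linear[OF p Y]) simp
  have \<theta>: "functional sc (hom (- k) P0 Y) (%g. t (b ** g))"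
   by (rule functional_comp[OF O0(3) comp_left_linear[OF b O0(1)]]) simp
  have "t (b ** g) = 0" if g: "g : hom (- k) P0 Y" "g ** p = 0" for g using pcok[OF g] z by (auto simp: m_assoc)
  then obtain ps where ps: "functional sc (hom (- k) P1 Y) ps"
   "!!g. g : hom (- k) P0 Y ==> ps (g ** p) = t (b ** g)"
   using functional_factor[OF hom_rmod[OF O0(1) Y] hom_rmod[OF O1(1) Y] lin \<theta>] by metis
  obtain c where c: "c : hom (- (- k)) Y I1" "!!g. g : hom (- k) P1 Y ==> ps g = t1 (c ** g)"
   using serre_pair_repr[OF P1(1) Y ps(1)] by metis
  have c1: "c : hom k Y I1" using c(1) by simp
  have qc: "q ** c : hom k Y I0" by (rule hom_compI[OF q c1]) simp
  have "b = q ** c" proof (rule serre_pair_eq[OF P0(1) b qc])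
   fix g assume g: "g : hom (- k) P0 Y"
   have cg: "c ** g : hom 0 P0 I1" by (rule hom_compI[OF c1 g]) simp
   show "t (b ** g) = t (q ** c ** g)"
    using ps(2)[OF g] c(2)[OF linear_onD(1)[OF lin g]] tq[OF cg] by (simp add: m_assoc)
  qed
  thus ?thesis using c1 by blast
 qed
 have "represents X d T dT tau Y e" if Y: "cplx Y e" for Y e proof -
  have e: "e : hom 1 Y Y" "e ** e = 0" using Y by (auto simp: cplx_def)
  note YOb = hom_ObD(1)[OF e(1)]
  note Zr = chain_rmod[OF X Y]
  have chD: "f : hom 0 X Y" "f ** d = e ** f" if "f : chain X d Y e" for f using that by (auto simp: chain_def)
  have surj: "EX h:chain Y e T dT. ALL f:chain X d Y e. ph f = tau (h ** f)"
   if ph: "functional sc (chain X d Y e) ph" and ph0: "ALL b:bdry X d Y e. ph b = 0" for ph proof -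
   have lin: "linear_on R sc (chain X d Y e) sc (hom 0 P0 Y) (%f. f ** pj)"
    by (rule linear_on_subset[OF comp_right_linear[OF E0(2) YOb]]) (auto simp: chain_def)
   have "ph f = 0" if f: "f : chain X d Y e" "f ** pj = 0" for f proof -
    have "f = 0" using short_exact_epi[OF P0(2) chD(1)[OF f(1)] f(2)] .
    thus ?thesis using rmod.linear_on_zero[OF Zr ph] by simp
   qed
   then obtain ps where ps: "functional sc (hom 0 P0 Y) ps" "!!f. f : chain X d Y e ==> ps (f ** pj) = ph f"
    using functional_factor[OF Zr hom_rmod[OF O0(1) YOb] lin ph] by metis
   obtain a where a: "a : hom (- 0) Y I0" "!!g. g : hom 0 P0 Y ==> ps g = t (a ** g)"
    using serre_pair_repr[OF P0(1) YOb ps(1)] by metis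
   have a1: "a : hom 0 Y I0" using a(1) by simp
   have pha: "ph f = t (a ** (f ** pj))" if "f : chain X d Y e" for f
    using ps(2)[OF that] a(2)[OF linear_onD(1)[OF lin that]] by simp
   \<comment> \<open>\<open>a\<close> represents an extension of \<open>ph\<close> to all graded
     maps from \<open>P0\<close> and need not be a chain map. Its defect \<open>b\<close> is
     orthogonal to the maps over \<open>X\<close> because \<open>ph\<close> vanishes on boundaries,
     so it comes from some \<open>c\<close>, whose own defect in turn factors through
     \<open>kap\<close>.\<close>
   define b where "b = D0 ** a - a ** e"
   have b: "b : hom 1 Y I0" unfolding b_def by (intro hom_diff hom_compI[OF D0 a1] hom_compI[OF a1 e(1)]) auto
   have "t (b ** s ** pj) = 0" if s: "s : hom (- 1) X Y" for s proof -
    have es: "e ** s : hom 0 X Y" "s ** d : hom 0 X Y" using hom_comp[OF e(1) s] hom_comp[OF s d(1)] by simp_all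
    have "e ** s + s ** d : chain X d Y e"
     using es by (auto simp: chain_def m_simps d(2) m_reassoc[OF e(2)] intro: hom_add)
    moreover have "e ** s + s ** d : bdry X d Y e" using s by (auto simp: bdry_def)
    ultimately have "t (a ** ((e ** s + s ** d) ** pj)) = 0" using pha ph0 by metis
    moreover have "a ** (s ** pj) : hom (- 1) P0 I0" by (rule hom_compI[OF a1 hom_compI[OF s E0(2)]]) auto
    note as = this tD[OF this]
    have 1: "a ** (e ** (s ** pj)) : hom 0 P0 I0"
     by (rule hom_compI[OF a1 hom_compI[OF e(1) hom_compI[OF s E0(2)]]]) auto
    have 2: "a ** (s ** (pj ** dl0)) : hom 0 P0 I0"
     by (rule hom_compI[OF a1 hom_compI[OF s hom_compI[OF E0(2) P0(3)]]]) auto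
    have 3: "D0 ** (a ** (s ** pj)) : hom 0 P0 I0" by (rule hom_compI[OF D0 as(1)]) simp
    have "a ** ((e ** s + s ** d) ** pj) = a ** (e ** (s ** pj)) + a ** (s ** (pj ** dl0))"
     by (simp add: m_simps P0(7))
    ultimately have sum: "t (a ** (e ** (s ** pj))) + t (a ** (s ** (pj ** dl0))) = 0"
     using 1 2 by (simp add: t_simps)
    have "b ** s ** pj = D0 ** (a ** (s ** pj)) - a ** (e ** (s ** pj))" by (simp add: b_def m_simps)
    hence "t (b ** s ** pj) = t (D0 ** (a ** (s ** pj))) - t (a ** (e ** (s ** pj)))"
     using 1 3 by (simp add: t_simps)
    also have "\<dots> = - (t (a ** (e ** (s ** pj))) + t (a ** (s ** (pj ** dl0))))"
     using as(2) by (simp add: m_assoc)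
    finally show ?thesis using sum by simp
   qed
   then obtain c where c: "c : hom 1 Y I1" "b = q ** c" using exact[OF b] by blast
   have be: "D0 ** b + b ** e = 0" by (simp add: b_def m_simps m_reassoc[OF DD0] e(2))
   have Dc: "D1 ** c + c ** e : hom 2 Y I1" by (intro hom_add hom_compI[OF D1 c(1)] hom_compI[OF c(1) e(1)]) auto
   have "q ** (D1 ** c + c ** e) = 0" using be by (simp add: m_simps m_reassoc[OF qD] c(2))
   then obtain h where h: "h : hom (2 - 2) Y T" "D1 ** c + c ** e = kap ** h" using ker[OF Dc] by blast
   have h1': "h : hom 0 Y T" using h(1) by simp
   have hch: "h : chain Y e T dT" proof -
    have "kap ** (h ** e) = kap ** (dT ** h)" by (simp add: m_reassoc[OF dT(2)[symmetric]] m_assoc flip: h(2))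
      (simp add: m_simps e(2) m_reassoc[OF DD1] m_reassoc[OF h(2)[symmetric]] flip: m_assoc[of kap h e] h(2))
    hence "h ** e = dT ** h" by (rule mono[rotated 2]) (use h1' e dT1 in "auto intro: hom_compI")
    thus ?thesis using h1' by (simp add: chain_def)
   qed
   \<comment> \<open>\<open>om ** h\<close> is \<open>a\<close> up to a term through
     \<open>q\<close> and a boundary; on chain maps the trace kills both.\<close>
   have omh: "om ** h = a - q ** (S1 ** c) -
     (D0 ** (S0 ** a - S0 ** (q ** (S1 ** c))) + (S0 ** a - S0 ** (q ** (S1 ** c))) ** e)" proof -
    have qSc: "q ** (S1 ** c) : hom 0 Y I0" by (rule hom_compI[OF q hom_compI[OF S1 c(1)]]) auto
    have "S1 ** (D1 ** c) = c - D1 ** (S1 ** c)" using h1[OF c(1)] by simp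
    hence "q ** (S1 ** (kap ** h)) = b - D0 ** (q ** (S1 ** c)) + q ** (S1 ** (c ** e))"
     by (simp add: m_simps m_reassoc[OF qD] c(2) flip: h(2))
    hence omh: "om ** h = S0 ** (D0 ** a) - S0 ** (a ** e) - S0 ** (D0 ** (q ** (S1 ** c))) +
      S0 ** (q ** (S1 ** (c ** e)))" by (simp add: om_def m_simps b_def)
    have e1: "S0 ** (D0 ** a) = a - D0 ** (S0 ** a)" using h0[OF a1] by simp
    have e2: "S0 ** (D0 ** (q ** (S1 ** c))) = q ** (S1 ** c) - D0 ** (S0 ** (q ** (S1 ** c)))" using h0[OF qSc] by simp
    show ?thesis unfolding omh e1 e2 by (simp add: m_simps)
   qed
   define v where "v = S0 ** a - S0 ** (q ** (S1 ** c))"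
   have Sc: "S1 ** c : hom 0 Y I1" by (rule hom_compI[OF S1 c(1)]) simp
   have v: "v : hom (- 1) Y I0"
    unfolding v_def by (intro hom_diff hom_compI[OF S0 a1] hom_compI[OF S0 hom_compI[OF q Sc]]) auto
   have "ph f = tau (h ** f)" if f: "f : chain X d Y e" for f proof -
    have fpj: "f ** pj : hom 0 P0 Y" by (rule linear_onD(1)[OF lin f])
    have vf: "v ** (f ** pj) : hom (- 1) P0 I0" by (rule hom_compI[OF v fpj]) simp
    have Scf: "S1 ** c ** (f ** pj) : hom 0 P0 I1" by (rule hom_compI[OF Sc fpj]) simp
    have 1: "a ** (f ** pj) : hom 0 P0 I0" by (rule hom_compI[OF a1 fpj]) simp
    have 2: "q ** (S1 ** c ** (f ** pj)) : hom 0 P0 I0" by (rule hom_compI[OF q Scf]) simp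
    have 3: "D0 ** (v ** (f ** pj)) : hom 0 P0 I0" by (rule hom_compI[OF D0 vf]) simp
    have 4: "v ** (f ** pj) ** dl0 : hom 0 P0 I0" by (rule hom_compI[OF vf P0(3)]) simp
    have "v ** (f ** pj) ** dl0 = v ** (e ** (f ** pj))"
     by (simp add: m_assoc P0(7) m_reassoc[OF chD(2)[OF f]])
    hence "om ** (h ** f) ** pj = a ** (f ** pj) - q ** (S1 ** c ** (f ** pj)) -
      (D0 ** (v ** (f ** pj)) + v ** (f ** pj) ** dl0)"
     unfolding v_def using omh by (simp add: m_simps m_reassoc[OF omh])
    hence "tau (h ** f) = t (a ** (f ** pj)) - t (q ** (S1 ** c ** (f ** pj))) -
      (t (D0 ** (v ** (f ** pj))) + t (v ** (f ** pj) ** dl0))"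
     unfolding tau_def using 1 2 3 4 by (simp add: t_simps hom_diff hom_add)
    also have "t (q ** (S1 ** c ** (f ** pj))) = 0"
     using tq[OF Scf] pjp serre_pair_t(4)[OF P1(1)] by (simp add: m_assoc)
    finally show ?thesis using tD[OF vf] pha[OF f] by simp
   qed
   thus ?thesis using hch by blast
  qed
  have inj: "h : bdry Y e T dT" if hch: "h : chain Y e T dT" and z: "ALL f:chain X d Y e. tau (h ** f) = 0" for h
  proof -
   have h: "h : hom 0 Y T" "h ** e = dT ** h" using hch by (auto simp: chain_def)
   \<comment> \<open>Here \<open>a\<close> is \<open>om ** h\<close>, and \<open>c\<close> and
     \<open>b\<close> are the intermediate stages. They satisfy the same equations as in the
     surjectivity part.\<close>
   define c where "c = S1 ** (kap ** h)"
   define b where "b = q ** c"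
   define a where "a = S0 ** b"
   have c: "c : hom 1 Y I1" unfolding c_def by (rule hom_compI[OF S1 hom_compI[OF kap h(1)]]) auto
   have b: "b : hom 1 Y I0" unfolding b_def by (rule hom_compI[OF q c]) simp
   have a: "a : hom 0 Y I0" unfolding a_def by (rule hom_compI[OF S0 b]) simp
   have kaph: "kap ** h : hom 2 Y I1" by (rule hom_compI[OF kap h(1)]) simp
   have Dc: "D1 ** c + c ** e = kap ** h"
    unfolding c_def using h1[OF kaph] by (simp add: m_assoc m_reassoc[OF dT(2)] h(2))
   have "q ** (D1 ** c + c ** e) = 0" unfolding Dc using m_reassoc[OF qkap] by simp
   hence Db: "D0 ** b + b ** e = 0" by (simp add: b_def m_simps m_reassoc[OF qD])
   have Da: "D0 ** a - a ** e = b" proof -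
    have "D0 ** a - a ** e = b - S0 ** (D0 ** b + b ** e)" unfolding a_def using h0[OF b] by (simp add: m_simps)
    thus ?thesis by (simp add: Db)
   qed
   \<comment> \<open>The differential of the Hom complex, with the chain maps as kernel. The
     functional of \<open>a\<close> vanishes there, hence factors through \<open>F\<close>;
     representing the factor by \<open>v\<close> changes \<open>a\<close> by a boundary into a map
     \<open>a'\<close> orthogonal to all of \<open>Hom(X, Y)\<close>.\<close>
   define F where "F f = e ** f - f ** d" for f
   have F: "linear_on R sc (hom 0 X Y) sc (hom 1 X Y) F" unfolding F_def proof (rule linear_onI)
    fix f assume f: "f : hom 0 X Y"
    show "e ** f - f ** d : hom 1 X Y" by (intro hom_diff hom_compI[OF e(1) f] hom_compI[OF f d(1)]) auto
    fix r assume r: "r :. R"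
    have "e ** f : hom 1 X Y" "f ** d : hom 1 X Y" using hom_comp[OF e(1) f] hom_comp[OF f d(1)] by auto
    thus "e ** sc r f - sc r f ** d = sc r (e ** f - f ** d)"
     using rmod.smult_diff[OF hom_rmod[OF XOb YOb] r] sc_right[OF r e(1) f] sc_left[OF r f d(1)] by simp
   qed (simp add: m_simps)
   have \<theta>: "functional sc (hom 0 X Y) (%f. t (a ** f ** pj))"
    by (rule functional_comp[OF O0(3) linear_on_comp[OF comp_right_linear[OF E0(2) O0(2)] comp_left_linear[OF a XOb]]]) auto
   have taua: "tau (h ** f) = t (a ** f ** pj)" for f
    by (simp add: tau_def om_def a_def b_def c_def m_assoc)
   have "t (a ** f ** pj) = 0" if "f : hom 0 X Y" "F f = 0" for f
    using z that taua by (auto simp: chain_def F_def)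
   then obtain ps where ps: "functional sc (hom 1 X Y) ps"
    "!!f. f : hom 0 X Y ==> ps (F f) = t (a ** f ** pj)"
    using functional_factor[OF hom_rmod[OF XOb YOb] hom_rmod[OF XOb YOb] F \<theta>] by metis
   have lin: "linear_on R sc (hom 1 X Y) sc (hom 1 P0 Y) (%f. f ** pj)"
    by (rule comp_right_linear[OF E0(2) YOb]) simp
   have "ps f = 0" if f: "f : hom 1 X Y" "f ** pj = 0" for f
    using short_exact_epi[OF P0(2) f] rmod.linear_on_zero[OF hom_rmod[OF XOb YOb] ps(1)] by simp
   then obtain \<chi> where \<chi>: "functional sc (hom 1 P0 Y) \<chi>" "!!f. f : hom 1 X Y ==> \<chi> (f ** pj) = ps f"
    using functional_factor[OF hom_rmod[OF XOb YOb] hom_rmod[OF O0(1) YOb] lin ps(1)] by metis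
   obtain v where v: "v : hom (- 1) Y I0" "!!g. g : hom 1 P0 Y ==> \<chi> g = t (v ** g)"
    using serre_pair_repr[OF P0(1) YOb \<chi>(1)] by metis
   define a' where "a' = a - (D0 ** v + v ** e)"
   have a': "a' : hom 0 Y I0"
    unfolding a'_def by (intro hom_diff hom_add a hom_compI[OF D0 v(1)] hom_compI[OF v(1) e(1)]) auto
   have "t (a' ** f ** pj) = 0" if "f : hom (- 0) X Y" for f proof -
    have f: "f : hom 0 X Y" using that by simp
    have fpj: "f ** pj : hom 0 P0 Y" by (rule hom_compI[OF f E0(2)]) simp
    have 0: "v ** (f ** pj) : hom (- 1) P0 I0" by (rule hom_compI[OF v(1) fpj]) simp
    have 1: "v ** (e ** (f ** pj)) : hom 0 P0 I0" by (rule hom_compI[OF v(1) hom_compI[OF e(1) fpj]]) auto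
    have 2: "v ** (f ** pj) ** dl0 : hom 0 P0 I0" by (rule hom_compI[OF 0 P0(3)]) simp
    have 3: "D0 ** (v ** (f ** pj)) : hom 0 P0 I0" by (rule hom_compI[OF D0 0]) simp
    have 4: "a ** (f ** pj) : hom 0 P0 I0" by (rule hom_compI[OF a fpj]) simp
    have "t (a ** (f ** pj)) = t (v ** (F f ** pj))"
     using ps(2)[OF f] \<chi>(2)[OF linear_onD(1)[OF F f]] v(2)[OF linear_onD(1)[OF lin linear_onD(1)[OF F f]]]
     by (simp add: m_assoc)
    also have "v ** (F f ** pj) = v ** (e ** (f ** pj)) - v ** (f ** pj) ** dl0"
     by (simp add: F_def m_simps P0(7))
    finally have "t (a ** (f ** pj)) = t (v ** (e ** (f ** pj))) - t (v ** (f ** pj) ** dl0)"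
     using 1 2 by (simp add: t_simps)
    moreover have "a' ** f ** pj = a ** (f ** pj) - (D0 ** (v ** (f ** pj)) + v ** (e ** (f ** pj)))"
     by (simp add: a'_def m_simps)
    ultimately show ?thesis using 1 3 4 tD[OF 0] by (simp add: t_simps hom_add)
   qed
   then obtain w where w: "w : hom 0 Y I1" "a' = q ** w" using exact[OF a'] by blast
   have av: "a = D0 ** v + v ** e + q ** w" using w(2) by (simp add: a'_def algebra_simps)
   \<comment> \<open>Writing \<open>a'\<close> as \<open>q ** w\<close> allows \<open>c\<close> to
     be corrected by the boundary of \<open>w\<close> to a map killed by \<open>q\<close>. Its
     factor \<open>s\<close> through \<open>kap\<close> is the null homotopy of
     \<open>h\<close>.\<close>
   define u where "u = c - D1 ** w + w ** e"
   have u: "u : hom 1 Y I1"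
    unfolding u_def by (intro hom_diff hom_add c hom_compI[OF D1 w(1)] hom_compI[OF w(1) e(1)]) auto
   have "q ** u = 0" unfolding u_def using Da[unfolded av]
    by (simp add: m_simps m_reassoc[OF qD] m_reassoc[OF DD0] e(2) b_def[symmetric] algebra_simps)
   then obtain s where s: "s : hom (1 - 2) Y T" "u = kap ** s" using ker[OF u] by blast
   have s1: "s : hom (- 1) Y T" using s(1) by simp
   have cs: "c = kap ** s + D1 ** w - w ** e" using s(2) by (simp add: u_def algebra_simps)
   have "kap ** h = kap ** (dT ** s + s ** e)"
    using Dc unfolding cs by (simp add: m_simps m_reassoc[OF dT(2)] m_reassoc[OF DD1] e(2))
   hence "h = dT ** s + s ** e"
    by (rule mono[rotated 2]) (use h(1) s1 dT1 e(1) in "auto intro!: hom_add intro: hom_compI")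
   thus ?thesis using s1 by (auto simp: bdry_def)
  qed
  show ?thesis unfolding represents_def using surj inj by blast
 qed
 with T tau taub that show thesis by blast
qed

end

section \<open>Acyclic complexes and the coreflection onto them\<close>

context serre_setup
begin

text \<open>Exactness is tested on maps from \<open>L0\<close>; for graded modules these are the
  elements of \<open>N\<close>.\<close>

definition acyc :: "'o => 'h => bool" where "acyc N d \<longleftrightarrow> cplx N d &
  (ALL k. ALL w:hom k L0 N. d ** w = 0 --> (EX v:hom (k - 1) L0 N. w = d ** v))"

text \<open>Cycles \<open>Z\<close> and boundaries \<open>B\<close>. Cancelling the mono
  \<open>i\<close> and the epi \<open>p\<close> in \<open>d ** d = 0\<close> leaves
  \<open>p ** i = 0\<close>, which gives the inclusion \<open>j\<close> of the boundaries into the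
  cycles.\<close>

lemma differential_factorization:
 assumes "cplx N d"
 obtains Z B C z p i c j where "short_exact 0 1 Z N B z p" "short_exact 0 0 B N C i c" "d = i ** p"
  "j : hom 0 B Z" "i = z ** j" proof -
 have d: "d : hom 1 N N" "d ** d = 0" using assms by (auto simp: cplx_def)
 obtain Z B C z p i c where f: "short_exact 0 1 Z N B z p" "short_exact 0 0 B N C i c" "d = i ** p"
  using factorization[OF d(1)] by blast
 note E = short_exactD[OF f(1)] and F = short_exactD[OF f(2)]
 have pi: "p ** i : hom 1 B B" using hom_comp[OF E(2) F(1)] by simp
 have "i ** (p ** (i ** p)) = 0" using d(2) f(3) by (simp add: m_assoc)
 hence "p ** (i ** p) = 0" using short_exact_mono[OF f(2) hom_comp[OF pi E(2)]] by (simp add: m_assoc)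
 hence "p ** i = 0" using short_exact_epi[OF f(1) pi] by (simp add: m_assoc)
 then obtain j where "j : hom (0 - 0) B Z" "i = z ** j" using short_exact_kernel[OF f(1) F(1)] by metis
 with f show thesis using that by simp
qed

text \<open>Acyclicity makes \<open>j\<close> an epimorphism. So \<open>w\<close>, which vanishes on
  boundaries, vanishes on cycles; it then factors over \<open>B\<close>, and injectivity extends the
  factor to \<open>N\<close>.\<close>

lemma acyc_injective:
 assumes N: "acyc N d" and J: "injective_ob J" and w: "w : hom k N J" "w ** d = 0"
 obtains v where "v : hom (k - 1) N J" "w = v ** d" proof -
 have Nc: "cplx N d" using N by (simp add: acyc_def)
 obtain Z B C z p i c j where f: "short_exact 0 1 Z N B z p" "short_exact 0 0 B N C i c" "d = i ** p"
  "j : hom 0 B Z" "i = z ** j" using differential_factorization[OF Nc] by metis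
 note E = short_exactD[OF f(1)] and F = short_exactD[OF f(2)]
 have jepi: "g = 0" if g: "g : hom l Z A" "g ** j = 0" for l A g proof (rule generator[OF g(1)])
  fix l' v assume v: "v : hom l' L0 Z"
  have zv: "z ** v : hom l' L0 N" by (rule hom_compI[OF E(1) v]) simp
  have "d ** (z ** v) = 0" using m_reassoc[OF E(3)] by (simp add: f(3) m_assoc)
  then obtain u where u: "u : hom (l' - 1) L0 N" "z ** v = d ** u" using N zv unfolding acyc_def by blast
  have jpu: "j ** (p ** u) : hom l' L0 Z" by (rule hom_compI[OF f(4) hom_compI[OF E(2) u(1)]]) auto
  have "v = j ** (p ** u)" by (rule short_exact_mono_eq[OF f(1) v jpu]) (use u(2) f in "simp add: m_assoc")
  thus "g ** v = 0" using m_reassoc[OF g(2)] by simp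
 qed
 have wi: "w ** i : hom k B J" using hom_comp[OF w(1) F(1)] by simp
 have "(w ** i) ** p = 0" using w(2) f(3) by (simp add: m_assoc)
 hence "w ** i = 0" using short_exact_epi[OF f(1) wi] by simp
 hence "(w ** z) ** j = 0" using f(5) by (simp add: m_assoc)
 hence "w ** z = 0" using jepi[OF hom_comp[OF w(1) E(1)]] by simp
 then obtain g where g: "g : hom (k - 1) B J" "w = g ** p" using short_exact_cokernel[OF f(1) w(1)] by metis
 obtain v where "v : hom (k - 1 - 0) N J" "g = v ** i" using injective_obE[OF J f(2) g(1)] by metis
 thus thesis using that[of v] g f(3) by (simp add: m_assoc)
qed

text \<open>Every object is a quotient of a projective, so the kernel property may be tested on
  projectives. The cokernel property is then derived by lifting a projective cover of
  \<open>H\<close> along \<open>h\<close>.\<close>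

lemma short_exact_by_tests:
 assumes j: "j : hom a B Z" and h: "h : hom b Z H" and hj: "h ** j = 0"
  and ker: "!!P k w. projective_ob P ==> w : hom k P Z ==> h ** w = 0 ==> EX v:hom (k - a) P B. w = j ** v"
  and mono: "!!P k w. projective_ob P ==> w : hom k P B ==> j ** w = 0 ==> w = 0"
  and lift: "!!P k w. projective_ob P ==> w : hom k P H ==> EX v:hom (k - b) P Z. w = h ** v"
 shows "short_exact a b B Z H j h" proof -
 note O = hom_ObD[OF j] hom_ObD[OF h]
 have mono': "g = 0" if g: "g : hom k A B" "j ** g = 0" for k A g proof -
  obtain P I t K kap pj where P: "serre_pair P I t" "short_exact 0 0 K P A kap pj"
   using projective_cover[OF hom_ObD(1)[OF g(1)]] by metis
  have "g ** pj = 0"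
   using mono[OF serre_pair_projective[OF P(1)] hom_comp[OF g(1) short_exactD(2)[OF P(2)]]] m_reassoc[OF g(2)] by simp
  thus ?thesis using short_exact_epi[OF P(2) g(1)] by simp
 qed
 have ker': "EX g:hom (k - a) A B. f = j ** g" if f: "f : hom k A Z" "h ** f = 0" for k A f proof -
  obtain P I t K kap pj where P: "serre_pair P I t" "short_exact 0 0 K P A kap pj"
   using projective_cover[OF hom_ObD(1)[OF f(1)]] by metis
  note E = short_exactD[OF P(2)]
  obtain v where v: "v : hom (k + 0 - a) P B" "f ** pj = j ** v"
   using ker[OF serre_pair_projective[OF P(1)] hom_comp[OF f(1) E(2)]] m_reassoc[OF f(2)] by auto
  have "j ** (v ** kap) = 0" using m_reassoc[OF v(2)[symmetric]] E(3) by (simp add: m_assoc)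
  hence "v ** kap = 0" using mono'[OF hom_comp[OF v(1) E(1)]] by simp
  then obtain g where g: "g : hom (k - a) A B" "v = g ** pj" using short_exact_cokernel[OF P(2) v(1)] by auto
  have jg: "j ** g : hom k A Z" by (rule hom_compI[OF j g(1)]) simp
  have "f = j ** g" by (rule short_exact_epi_eq[OF P(2) f(1) jg]) (use v(2) g(2) in "simp add: m_assoc")
  thus ?thesis using g(1) by blast
 qed
 obtain P I t K kap pj where P: "serre_pair P I t" "short_exact 0 0 K P H kap pj"
  using projective_cover[OF O(4)] by metis
 note E = short_exactD[OF P(2)]
 obtain w where w: "w : hom (0 - b) P Z" "pj = h ** w" using lift[OF serre_pair_projective[OF P(1)] E(2)] by blast
 have cok: "EX g:hom (k - b) H A. f = g ** h" if f: "f : hom k Z A" "f ** j = 0" for k A f proof -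
  have "h ** (w ** kap) = 0" using w(2) E(3) by (simp add: m_assoc)
  then obtain u where u: "w ** kap = j ** u" using ker'[OF hom_comp[OF w(1) E(1)]] by blast
  have "(f ** w) ** kap = 0" using u m_reassoc[OF f(2)] by (simp add: m_assoc)
  then obtain g where g: "g : hom (k + (0 - b) - 0) H A" "f ** w = g ** pj"
   using short_exact_cokernel[OF P(2) hom_comp[OF f(1) w(1)]] by metis
  have g1: "g : hom (k - b) H A" using g(1) by simp
  have gh: "g ** h : hom k Z A" by (rule hom_compI[OF g1 h]) simp
  obtain P' I' t' K' kap' pj' where P': "serre_pair P' I' t'" "short_exact 0 0 K' P' Z kap' pj'"
   using projective_cover[OF O(2)] by metis
  note E' = short_exactD[OF P'(2)]
  obtain v where v: "v : hom (b + 0 - 0) P' P" "h ** pj' = pj ** v"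
   using projective_obE[OF serre_pair_projective[OF P'(1)] P(2) hom_comp[OF h E'(2)]] by metis
  have wv: "w ** v : hom 0 P' Z" by (rule hom_compI[OF w(1) v(1)]) simp
  have "h ** (pj' - w ** v) = 0" using v(2) w(2) by (simp add: m_simps)
  then obtain u' where u': "pj' - w ** v = j ** u'" using ker'[OF hom_diff[OF E'(2) wv]] by blast
  have "f ** (pj' - w ** v) = 0" unfolding u' using m_reassoc[OF f(2)] by simp
  hence "f ** pj' = f ** w ** v" by (simp add: m_simps)
  also have "\<dots> = g ** h ** pj'" by (simp add: g(2) m_assoc v(2))
  finally have "f = g ** h" by (rule short_exact_epi_eq[OF P'(2) f(1) gh])
  thus ?thesis using g1 by blast
 qed
 have epi: "g = 0" if g: "g : hom k H A" "g ** h = 0" for k A g proof -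
  have "g ** pj = 0" using w(2) m_reassoc[OF g(2)] by simp
  thus ?thesis using short_exact_epi[OF P(2) g(1)] by simp
 qed
 show ?thesis unfolding short_exact_def using j h hj ker' mono' cok epi by blast
qed

text \<open>\<open>Z\<close>, \<open>B\<close> and \<open>H\<close> are the cycles, boundaries and homology of the complex \<open>N\<close>.\<close>

definition homology_data :: "'o => 'h => 'o => 'o => 'o => 'h => 'h => 'h => 'h => int => bool"
 where "homology_data N d Z B H z p j h c \<longleftrightarrow>
  short_exact 0 1 Z N B z p & short_exact 0 c B Z H j h & d = z ** (j ** p)"

lemma homology_exists:
 assumes "cplx N d"
 obtains Z B H z p j h where "homology_data N d Z B H z p j h 0" proof -
 obtain Z B C z p i c j where f: "short_exact 0 1 Z N B z p" "short_exact 0 0 B N C i c" "d = i ** p"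
  "j : hom 0 B Z" "i = z ** j" using differential_factorization[OF assms] by metis
 obtain K I H kap p' i' h where g: "short_exact 0 0 K B I kap p'" "short_exact 0 0 I Z H i' h" "j = i' ** p'"
  using factorization[OF f(4)] by metis
 note G = short_exactD[OF g(1)] and G' = short_exactD[OF g(2)]
 have "short_exact 0 0 B Z H j h" proof (rule short_exact_by_tests[OF f(4) G'(2)])
  show "h ** j = 0" using m_reassoc[OF G'(3)] g(3) by simp
  fix P k w assume P: "projective_ob P"
  show "EX v:hom (k - 0) P B. w = j ** v" if w: "w : hom k P Z" "h ** w = 0" proof -
   obtain u where u: "u : hom (k - 0) P I" "w = i' ** u" using short_exact_kernel[OF g(2) w] by metis
   obtain v where "v : hom (k - 0 - 0) P B" "u = p' ** v" using projective_obE[OF P g(1) u(1)] by metis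
   thus ?thesis using u(2) g(3) by (auto simp: m_assoc)
  qed
  show "w = 0" if "w : hom k P B" "j ** w = 0"
   using short_exact_mono[OF f(2) that(1)] that(2) f(5) by (simp add: m_assoc)
  show "EX v:hom (k - 0) P Z. w = h ** v" if "w : hom k P H" using projective_obE[OF P g(2) that] by metis
 qed
 thus thesis using that[of Z B H z p j h] f by (simp add: homology_data_def m_assoc)
qed

lemma acyc_of_homology_zero:
 assumes N: "cplx N d" and hd: "homology_data N d Z B H z p j h c" and H: "Id H = 0" shows "acyc N d" unfolding acyc_def
proof (intro conjI N allI ballI impI)
 have e: "short_exact 0 1 Z N B z p" "short_exact 0 c B Z H j h" "d = z ** (j ** p)"
  using hd by (auto simp: homology_data_def)
 note E = short_exactD[OF e(1)] and F = short_exactD[OF e(2)]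
 fix k w assume w: "w : hom k L0 N" "d ** w = 0"
 have pw: "p ** w : hom (1 + k) L0 B" by (rule hom_comp[OF E(2) w(1)])
 have "z ** (j ** (p ** w)) = 0" using w(2) e(3) by (simp add: m_assoc)
 hence "j ** (p ** w) = 0" using short_exact_mono[OF e(1) hom_comp[OF F(1) pw]] by simp
 hence "p ** w = 0" using short_exact_mono[OF e(2) pw] by simp
 then obtain v where v: "v : hom (k - 0) L0 Z" "w = z ** v" using short_exact_kernel[OF e(1) w(1)] by metis
 have "h ** v = 0" using Id_left[OF hom_comp[OF F(2) v(1)]] H by simp
 then obtain b where b: "b : hom (k - 0 - 0) L0 B" "v = j ** b" using short_exact_kernel[OF e(2) v(1)] by metis
 obtain x where "x : hom (k - 0 - 0 - 1) L0 N" "b = p ** x"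
  using projective_obE[OF serre_pair_projective[OF serre_pair_L0] e(1) b(1)] by metis
 thus "EX v:hom (k - 1) L0 N. w = d ** v" using v(2) b(2) e(3) by (auto simp: m_assoc)
qed

text \<open>Attaching an injective hull \<open>J\<close> of the homology \<open>H\<close> of \<open>N\<close> replaces \<open>H\<close> by \<open>J/H\<close>.\<close>

lemma attach_homology:
 assumes hd: "homology_data N d Z B H z p j h c" and s: "short_exact \<alpha> \<beta> H J M m' n"
  and q: "q : hom (\<alpha> + c) N J" "m' ** h = q ** z"
  and bp: "biprod (1 - (\<alpha> + c)) N J N' i1 i2 p1 p2"
  and d'_def: "d' = i1 ** (d ** p1) + i2 ** (q ** p1)" and N': "cplx N' d'"
 shows "EX Z' B' z' p' j' h'. homology_data N' d' Z' B' M z' p' j' h' (\<alpha> + \<beta> + c - 1)" proof -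
 have e: "short_exact 0 1 Z N B z p" "short_exact 0 c B Z H j h" "d = z ** (j ** p)"
  using hd by (auto simp: homology_data_def)
 note E = short_exactD[OF e(1)] and F = short_exactD[OF e(2)] and S = short_exactD[OF s]
 note bp = biprodD[OF bp]
 obtain Z' B' H' z' p' j' h0 where "homology_data N' d' Z' B' H' z' p' j' h0 0" using homology_exists[OF N'] by metis
 hence e': "short_exact 0 1 Z' N' B' z' p'" "short_exact 0 0 B' Z' H' j' h0" "d' = z' ** (j' ** p')"
  by (auto simp: homology_data_def)
 note E' = short_exactD[OF e'(1)] and F' = short_exactD[OF e'(2)]
 have p1d': "p1 ** d' = d ** p1" unfolding d'_def
  by (simp add: m_simps m_reassoc[OF bp(5)] m_reassoc[OF bp(7)] Id_left[OF hom_comp[OF E(2) bp(3)]])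
   (simp add: e(3) m_assoc m_reassoc[OF Id_left[OF E(1)]])
 have p2d': "p2 ** d' = q ** p1" unfolding d'_def
  by (simp add: m_simps m_reassoc[OF bp(6)] m_reassoc[OF bp(8)] m_reassoc[OF Id_left[OF q(1)]])
 have d'z': "d' ** z' = 0" by (simp add: e'(3) m_assoc E'(3))
 have p1z': "p1 ** z' : hom 0 Z' N" by (rule hom_compI[OF bp(3) E'(1)]) simp
 have dp: "d ** (p1 ** z') = 0" using d'z' m_reassoc[OF p1d', of z'] by (simp add: m_assoc)
 have qp: "q ** (p1 ** z') = 0" using d'z' m_reassoc[OF p2d', of z'] by (simp add: m_assoc)
 have pp: "p ** (p1 ** z') : hom 1 Z' B" by (rule hom_compI[OF E(2) p1z']) simp
 have "j ** (p ** (p1 ** z')) = 0" using short_exact_mono[OF e(1) hom_comp[OF F(1) pp]] dp e(3) by (simp add: m_assoc)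
 hence "p ** (p1 ** z') = 0" using short_exact_mono[OF e(2) pp] by simp
 then obtain \<zeta> where \<zeta>: "\<zeta> : hom (0 - 0) Z' Z" "p1 ** z' = z ** \<zeta>" using short_exact_kernel[OF e(1) p1z'] by metis
 \<comment> \<open>A cycle of \<open>N'\<close> projects to a cycle of \<open>N\<close> killed by
   \<open>q\<close>. Its homology class dies in \<open>J\<close>, hence is zero, and the projected
   cycle is a boundary.\<close>
 have "m' ** (h ** \<zeta>) = 0" using qp \<zeta>(2) m_reassoc[OF q(2), of \<zeta>] by (simp add: m_assoc)
 hence "h ** \<zeta> = 0" using short_exact_mono[OF s hom_comp[OF F(2) \<zeta>(1)]] by simp
 then obtain b where b: "b : hom (0 - 0 - 0) Z' B" "\<zeta> = j ** b" using short_exact_kernel[OF e(2) \<zeta>(1)] by metis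
 have b0: "b : hom 0 Z' B" using b(1) by simp
 have p1z'b: "p1 ** z' = z ** (j ** b)" using \<zeta>(2) b(2) by simp
 have nq: "n ** q : hom (\<beta> + (\<alpha> + c)) N M" by (rule hom_comp[OF S(2) q(1)])
 have "(n ** q) ** z = 0" using q(2)[symmetric] m_reassoc[OF S(3)] by (simp add: m_assoc)
 then obtain \<epsilon> where \<epsilon>: "\<epsilon> : hom (\<beta> + (\<alpha> + c) - 1) B M" "n ** q = \<epsilon> ** p"
  using short_exact_cokernel[OF e(1) nq] by metis
 \<comment> \<open>A cycle of \<open>N'\<close> is a pair of some \<open>d x\<close> in
   \<open>N\<close> and some \<open>y\<close> in \<open>J\<close>; its class in
   \<open>M = J / H\<close> is the image under \<open>n\<close> of \<open>y - q x\<close>. The map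
   \<open>\<epsilon> ** b\<close> computes the image of \<open>q x\<close> without a choice of
   \<open>x\<close>.\<close>
 define h' where "h' = n ** (p2 ** z') - \<epsilon> ** b"
 have h': "h' : hom (\<alpha> + \<beta> + c - 1) Z' M"
  unfolding h'_def by (intro hom_diff hom_compI[OF S(2) hom_compI[OF bp(4) E'(1)]] hom_compI[OF \<epsilon>(1) b0]) auto
 have "short_exact 0 (\<alpha> + \<beta> + c - 1) B' Z' M j' h'" proof (rule short_exact_by_tests[OF F'(1) h'])
  have "z ** (j ** (b ** (j' ** p'))) = z ** (j ** (p ** p1))"
   using arg_cong[OF p1z'b, of "%x. x ** (j' ** p')"] p1d' e(3) e'(3) by (simp add: m_assoc)
  hence 1: "j ** (b ** (j' ** p')) = j ** (p ** p1)" by (rule short_exact_mono_eq[OF e(1), of _ 1 N', rotated 2])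
    (rule hom_compI[OF F(1) hom_compI[OF b0 hom_compI[OF F'(1) E'(2)]]] hom_compI[OF F(1) hom_compI[OF E(2) bp(3)]]; simp)+
  have bjp: "b ** (j' ** p') = p ** p1" by (rule short_exact_mono_eq[OF e(2) _ _ 1, of 1 N'])
    (rule hom_compI[OF b0 hom_compI[OF F'(1) E'(2)]] hom_compI[OF E(2) bp(3)]; simp)+
  have "(h' ** j') ** p' = 0"
   using p2d'[unfolded e'(3)] bjp m_reassoc[OF \<epsilon>(2), of p1] by (simp add: h'_def m_simps)
  thus "h' ** j' = 0" using short_exact_epi[OF e'(1) hom_comp[OF h' F'(1)]] by simp
 next
  fix P k w assume P: "projective_ob P" and w: "w : hom k P Z'" and hw: "h' ** w = 0"
  have bw: "b ** w : hom k P B" by (rule hom_compI[OF b0 w]) simp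
  obtain x where x: "x : hom (k - 1) P N" "b ** w = p ** x" using projective_obE[OF P e(1) bw] by metis
  \<comment> \<open>This difference comes from \<open>H\<close>, hence from a cycle of
    \<open>N\<close>. Adding that cycle to \<open>x\<close> makes the component in \<open>J\<close>
    equal to \<open>q ** x'\<close>, so that \<open>w\<close> is a boundary.\<close>
  have y: "p2 ** (z' ** w) - q ** x : hom (\<alpha> + c - 1 + k) P J"
   by (intro hom_diff hom_compI[OF bp(4) hom_compI[OF E'(1) w]] hom_compI[OF q(1) x(1)]) auto
  have "n ** (p2 ** (z' ** w) - q ** x) = 0"
   using hw m_reassoc[OF \<epsilon>(2), of x] by (simp add: h'_def m_simps x(2))
  then obtain \<eta> where \<eta>: "\<eta> : hom (\<alpha> + c - 1 + k - \<alpha>) P H" "p2 ** (z' ** w) - q ** x = m' ** \<eta>"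
   using short_exact_kernel[OF s y] by metis
  obtain \<xi> where \<xi>: "\<xi> : hom (\<alpha> + c - 1 + k - \<alpha> - c) P Z" "\<eta> = h ** \<xi>"
   using projective_obE[OF P e(2) \<eta>(1)] by metis
  have \<xi>1: "\<xi> : hom (k - 1) P Z" using \<xi>(1) by (simp add: algebra_simps)
  define x' where "x' = x + z ** \<xi>"
  have x': "x' : hom (k - 1) P N" unfolding x'_def by (intro hom_add x hom_compI[OF E(1) \<xi>1]) simp
  have px': "p ** x' = b ** w" using m_reassoc[OF E(3)] x(2) by (simp add: x'_def m_simps)
  have qx': "q ** x' = p2 ** (z' ** w)"
   using \<eta>(2) \<xi>(2) m_reassoc[OF q(2), of \<xi>] by (simp add: x'_def m_simps algebra_simps)
  have z'w: "z' ** w : hom k P N'" by (rule hom_compI[OF E'(1) w]) simp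
  have "z' ** w = i1 ** (p1 ** (z' ** w)) + i2 ** (p2 ** (z' ** w))"
   using arg_cong[OF bp(9), of "%u. u ** (z' ** w)"] Id_left[OF z'w] by (simp add: m_simps)
  also have "p1 ** (z' ** w) = d ** x'" using m_reassoc[OF p1z'b, of w] px' e(3) by (simp add: m_assoc)
  also have "i1 ** (d ** x') + i2 ** (p2 ** (z' ** w)) = d' ** (i1 ** x')"
   unfolding d'_def qx'[symmetric] by (simp add: m_simps m_reassoc[OF bp(5)] Id_left[OF x'])
  finally have eq: "z' ** w = z' ** (j' ** (p' ** (i1 ** x')))" by (simp add: e'(3) m_assoc)
  have v: "p' ** (i1 ** x') : hom (k - 0) P B'" by (rule hom_compI[OF E'(2) hom_compI[OF bp(1) x']]) auto
  have jv: "j' ** (p' ** (i1 ** x')) : hom k P Z'" by (rule hom_compI[OF F'(1) v]) simp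
  have "w = j' ** (p' ** (i1 ** x'))" by (rule short_exact_mono_eq[OF e'(1) w jv eq])
  thus "EX v:hom (k - 0) P B'. w = j' ** v" using v by blast
 next
  fix P k w assume "projective_ob P" "w : hom k P B'" "j' ** w = 0"
  thus "w = 0" using short_exact_mono[OF e'(2)] by blast
 next
  fix P k w assume P: "projective_ob P" and w: "w : hom k P M"
  obtain y where y: "y : hom (k - \<beta>) P J" "w = n ** y" using projective_obE[OF P s w] by metis
  have iy: "i2 ** y : hom (k - (\<alpha> + \<beta> + c - 1)) P N'" by (rule hom_compI[OF bp(2) y(1)]) simp
  have "d' ** (i2 ** y) = 0" unfolding d'_def by (simp add: m_simps m_reassoc[OF bp(7)])
  hence "z' ** (j' ** (p' ** (i2 ** y))) = 0" by (simp add: e'(3) m_assoc)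
  hence "j' ** (p' ** (i2 ** y)) = 0" using short_exact_mono[OF e'(1) hom_comp[OF F'(1) hom_comp[OF E'(2) iy]]] by simp
  hence "p' ** (i2 ** y) = 0" using short_exact_mono[OF e'(2) hom_comp[OF E'(2) iy]] by simp
  then obtain v where v: "v : hom (k - (\<alpha> + \<beta> + c - 1) - 0) P Z'" "i2 ** y = z' ** v"
   using short_exact_kernel[OF e'(1) iy] by metis
  have bv: "b ** v : hom (0 + (k - (\<alpha> + \<beta> + c - 1) - 0)) P B" by (rule hom_comp[OF b0 v(1)])
  have "z ** (j ** (b ** v)) = p1 ** (i2 ** y)" using m_reassoc[OF p1z'b, of v] v(2) by (simp add: m_assoc)
  also have "\<dots> = 0" using m_reassoc[OF bp(7)] by simp
  finally have "j ** (b ** v) = 0" using short_exact_mono[OF e(1) hom_comp[OF F(1) bv]] by simp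
  hence "b ** v = 0" using short_exact_mono[OF e(2) bv] by simp
  hence "h' ** v = n ** (p2 ** (i2 ** y))" by (simp add: h'_def m_simps v(2))
  also have "\<dots> = w" using m_reassoc[OF bp(6)] Id_left[OF y(1)] y(2) by simp
  finally show "EX v:hom (k - (\<alpha> + \<beta> + c - 1)) P Z'. w = h' ** v" using v(1) by auto
 qed
 hence "homology_data N' d' Z' B' M z' p' j' h' (\<alpha> + \<beta> + c - 1)"
  using e'(1,3) by (simp add: homology_data_def)
 thus ?thesis by blast
qed

text \<open>\<open>r\<close> induces a bijection on homotopy classes of maps out of every acyclic
  complex.\<close>

definition coreflects :: "'o => 'h => 'h => 'o => 'h => bool"
 where "coreflects N' d' r N d \<longleftrightarrow> r : chain N' d' N d & (ALL Y e. acyc Y e -->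
  (ALL f:chain Y e N d. EX f':chain Y e N' d'. r ** f' - f : bdry Y e N d) &
  (ALL f':chain Y e N' d'. r ** f' : bdry Y e N d --> f' : bdry Y e N' d'))"

lemma chain_comp: "g : chain Y e Z c ==> f : chain X d Y e ==> g ** f : chain X d Z c"
proof -
 assume g: "g : chain Y e Z c" and f: "f : chain X d Y e"
 hence "g ** f : hom 0 X Z" by (auto simp: chain_def intro: hom_compI)
 moreover have "g ** e = c ** g" "f ** d = e ** f" using f g by (auto simp: chain_def)
 ultimately show ?thesis using m_reassoc[of g e "c ** g" f] by (simp add: chain_def m_assoc)
qed

lemma bdry_comp_left: "b : bdry Y e Z c ==> f : chain X d Y e ==> b ** f : bdry X d Z c"
proof -
 assume "b : bdry Y e Z c" and f: "f : chain X d Y e"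
 then obtain s where s: "s : hom (- 1) Y Z" "b = c ** s + s ** e" by (auto simp: bdry_def)
 have "s ** f : hom (- 1) X Z" using s f by (auto simp: chain_def intro: hom_compI)
 moreover have "b ** f = c ** (s ** f) + (s ** f) ** d" using f by (simp add: chain_def s(2) m_simps)
 ultimately show ?thesis by (auto simp: bdry_def)
qed

lemma bdry_comp_right: "g : chain Y e Z c ==> b : bdry X d Y e ==> g ** b : bdry X d Z c"
proof -
 assume g: "g : chain Y e Z c" and "b : bdry X d Y e"
 then obtain s where s: "s : hom (- 1) X Y" "b = e ** s + s ** d" by (auto simp: bdry_def)
 have "g ** s : hom (- 1) X Z" using s g by (auto simp: chain_def intro: hom_compI)
 moreover have "g ** e = c ** g" using g by (simp add: chain_def)
 from m_reassoc[OF this] have "g ** b = c ** (g ** s) + (g ** s) ** d" by (simp add: s(2) m_simps)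
 ultimately show ?thesis by (auto simp: bdry_def)
qed

lemma bdry_add: "a : bdry X d Y e ==> b : bdry X d Y e ==> a + b : bdry X d Y e"
proof -
 assume "a : bdry X d Y e" "b : bdry X d Y e"
 then obtain s s' where "s : hom (- 1) X Y" "a = e ** s + s ** d" "s' : hom (- 1) X Y" "b = e ** s' + s' ** d"
  by (auto simp: bdry_def)
 hence "a + b = e ** (s + s') + (s + s') ** d" "s + s' : hom (- 1) X Y" by (auto simp: m_simps intro: hom_add)
 thus ?thesis unfolding bdry_def by blast
qed

lemma bdry_uminus: "a : bdry X d Y e ==> - a : bdry X d Y e"
proof -
 assume "a : bdry X d Y e"
 then obtain s where "s : hom (- 1) X Y" "a = e ** s + s ** d" by (auto simp: bdry_def)
 hence "- a = e ** (- s) + (- s) ** d" "- s : hom (- 1) X Y" by (auto simp: m_simps intro: hom_uminus)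
 thus ?thesis unfolding bdry_def by blast
qed

lemma bdry_diff: "a : bdry X d Y e ==> b : bdry X d Y e ==> a - b : bdry X d Y e"
 using bdry_add[of a X d Y e "- b"] bdry_uminus[of b] by simp

lemma coreflects_comp:
 assumes a: "coreflects N' d' r N d" and b: "coreflects N'' d'' r' N' d'" shows "coreflects N'' d'' (r ** r') N d"
 unfolding coreflects_def proof (intro conjI allI impI ballI)
 have r: "r : chain N' d' N d" and r': "r' : chain N'' d'' N' d'" using a b by (auto simp: coreflects_def)
 thus "r ** r' : chain N'' d'' N d" by (rule chain_comp)
 fix Y e assume Y: "acyc Y e"
 show "EX f':chain Y e N'' d''. r ** r' ** f' - f : bdry Y e N d" if f: "f : chain Y e N d" for f proof -
  obtain f' where f': "f' : chain Y e N' d'" "r ** f' - f : bdry Y e N d" using a Y f unfolding coreflects_def by blast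
  obtain f'' where f'': "f'' : chain Y e N'' d''" "r' ** f'' - f' : bdry Y e N' d'"
   using b Y f' unfolding coreflects_def by blast
  have "r ** (r' ** f'' - f') + (r ** f' - f) : bdry Y e N d" by (rule bdry_add[OF bdry_comp_right[OF r f''(2)] f'(2)])
  thus ?thesis using f''(1) by (auto simp: m_simps)
 qed
 show "f' : bdry Y e N'' d''" if f': "f' : chain Y e N'' d''" "r ** r' ** f' : bdry Y e N d" for f' proof -
  have "r' ** f' : chain Y e N' d'" by (rule chain_comp[OF r' f'(1)])
  hence "r' ** f' : bdry Y e N' d'" using a Y f'(2) unfolding coreflects_def by (metis m_assoc)
  thus ?thesis using b Y f'(1) unfolding coreflects_def by blast
 qed
qed

text \<open>The obstruction to lifting a chain map along \<open>p1\<close>, and that to lifting a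
  null homotopy, are maps from \<open>Y\<close> to \<open>J\<close> that vanish on boundaries. By
  \<open>acyc_injective\<close> they factor through the differential, and the factor supplies the
  missing component.\<close>

lemma coreflects_attach:
 assumes N: "cplx N d" and J: "injective_ob J" and q: "q : hom a N J" "q ** d = 0"
  and bp: "biprod (1 - a) N J N' i1 i2 p1 p2"
  and d'_def: "d' = i1 ** (d ** p1) + i2 ** (q ** p1)" shows "cplx N' d'" "coreflects N' d' p1 N d" proof -
 note bp = biprodD[OF bp]
 have d: "d : hom 1 N N" "d ** d = 0" using N by (auto simp: cplx_def)
 have d'1: "d' : hom 1 N' N'" unfolding d'_def
  by (intro hom_add hom_compI[OF bp(1) hom_compI[OF d(1) bp(3)]] hom_compI[OF bp(2) hom_compI[OF q(1) bp(3)]]) auto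
 have "d' ** d' = 0" unfolding d'_def
  by (simp add: m_simps m_reassoc[OF bp(5)] m_reassoc[OF bp(7)] m_reassoc[OF Id_left[OF d(1)]]
    m_reassoc[OF d(2)] m_reassoc[OF q(2)])
 with d'1 show "cplx N' d'" by (simp add: cplx_def)
 have p1d': "p1 ** d' = d ** p1" unfolding d'_def
  by (simp add: m_simps m_reassoc[OF bp(5)] m_reassoc[OF bp(7)] m_reassoc[OF Id_left[OF d(1)]])
 show "coreflects N' d' p1 N d" unfolding coreflects_def proof (intro conjI allI impI ballI)
  show p1: "p1 : chain N' d' N d" using bp(3) p1d' by (simp add: chain_def)
  fix Y e assume Y: "acyc Y e"
  hence e: "e : hom 1 Y Y" "e ** e = 0" by (auto simp: acyc_def cplx_def)
  have YOb: "Y : Ob" "N : Ob" using hom_ObD e(1) d(1) by blast+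
  have z: "0 : bdry Y e N d" unfolding bdry_def using hom_zero[OF YOb, of "- 1"] by force
  show "EX f':chain Y e N' d'. p1 ** f' - f : bdry Y e N d" if "f : chain Y e N d" for f proof -
   have f: "f : hom 0 Y N" "f ** e = d ** f" using that by (auto simp: chain_def)
   have qf: "q ** f : hom a Y J" by (rule hom_compI[OF q(1) f(1)]) simp
   have "(q ** f) ** e = 0" using f(2) m_reassoc[OF q(2)] by (simp add: m_assoc)
   then obtain k where k: "k : hom (a - 1) Y J" "q ** f = k ** e" using acyc_injective[OF Y J qf] by metis
   define f' where "f' = i1 ** f + i2 ** k"
   have "f' : hom 0 Y N'" unfolding f'_def by (intro hom_add hom_compI[OF bp(1) f(1)] hom_compI[OF bp(2) k(1)]) auto
   moreover have "f' ** e = d' ** f'" unfolding f'_def d'_def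
    by (simp add: m_simps m_reassoc[OF bp(5)] m_reassoc[OF bp(7)] Id_left[OF f(1)] f(2) k(2))
   ultimately have "f' : chain Y e N' d'" by (simp add: chain_def)
   moreover have "p1 ** f' = f"
    unfolding f'_def by (simp add: m_simps m_reassoc[OF bp(5)] m_reassoc[OF bp(7)] Id_left[OF f(1)])
   ultimately show ?thesis using z by force
  qed
  show "f' : bdry Y e N' d'" if f': "f' : chain Y e N' d'" "p1 ** f' : bdry Y e N d" for f' proof -
   have g: "f' : hom 0 Y N'" "f' ** e = d' ** f'" using f' by (auto simp: chain_def)
   obtain s where s: "s : hom (- 1) Y N" "p1 ** f' = d ** s + s ** e" using f'(2) by (auto simp: bdry_def)
   have p2d': "p2 ** d' = q ** p1" unfolding d'_def
    by (simp add: m_simps m_reassoc[OF bp(6)] m_reassoc[OF bp(8)] m_reassoc[OF Id_left[OF q(1)]])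
   have w: "p2 ** f' - q ** s : hom (a - 1) Y J"
    by (intro hom_diff hom_compI[OF bp(4) g(1)] hom_compI[OF q(1) s(1)]) auto
   have "(p2 ** f' - q ** s) ** e = 0"
    using m_reassoc[OF p2d', of f'] by (simp add: m_simps g(2) s(2) m_reassoc[OF q(2)])
   then obtain l where l: "l : hom (a - 1 - 1) Y J" "p2 ** f' - q ** s = l ** e" using acyc_injective[OF Y J w] by metis
   define s' where "s' = i1 ** s + i2 ** l"
   have s': "s' : hom (- 1) Y N'"
    unfolding s'_def by (intro hom_add hom_compI[OF bp(1) s(1)] hom_compI[OF bp(2) l(1)]) auto
   have p2: "p2 ** f' = q ** s + l ** e" using l(2) by (simp add: algebra_simps)
   have "f' = i1 ** (p1 ** f') + i2 ** (p2 ** f')"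
    using arg_cong[OF bp(9), of "%u. u ** f'"] Id_left[OF g(1)] by (simp add: m_simps)
   also have "\<dots> = d' ** s' + s' ** e" unfolding s(2) p2 s'_def d'_def
    by (simp add: m_simps m_reassoc[OF bp(5)] m_reassoc[OF bp(7)] Id_left[OF s(1)] algebra_simps)
   finally show ?thesis using s' by (auto simp: bdry_def)
  qed
 qed
qed

text \<open>For homology that is itself injective: attaching it to itself leaves zero
  homology.\<close>

lemma short_exact_Id_zero:
 assumes H: "H : Ob" and Z: "Z0 : Ob" "Id Z0 = 0" shows "short_exact 0 0 H H Z0 (Id H) 0" unfolding short_exact_def
proof (intro conjI allI impI ballI)
 show "g = 0" if "g : hom k Z0 A" for A k g using Id_right[OF that] Z by simp
 show "EX g:hom (k - 0) A H. f = Id H ** g" if "f : hom k A H" for A k f using that Id_left[OF that] by force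
 show "g = 0" if "g : hom k A H" "Id H ** g = 0" for A k g using Id_left[OF that(1)] that(2) by simp
 show "EX g:hom (k - 0) Z0 A. f = g ** 0" if "f : hom k H A" "f ** Id H = 0" for A k f
  using Id_right[OF that(1)] that hom_zero[OF Z(1) hom_ObD(2)[OF that(1)]] by force
qed (use H Z Id_hom hom_zero in auto)

theorem acyclic_coreflection:
 assumes "idim_le \<J> k H" "!!J. J : \<J> ==> injective_ob J" "cplx N d"
  "homology_data N d Z B H z p j h c" shows "EX N' d' r. acyc N' d' & coreflects N' d' r N d" using assms(1,3,4)
proof (induction arbitrary: N d Z B z p j h c rule: idim_le.induct)
 have step: "EX N' d' r Z' B' z' p' j' h' c'. cplx N' d' & coreflects N' d' r N d &
   homology_data N' d' Z' B' M z' p' j' h' c'"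
  if N: "cplx N d" and hd: "homology_data N d Z B H z p j h c" and s: "short_exact \<alpha> \<beta> H J M m' n"
   and J: "injective_ob J" for N d Z B H z p j h c \<alpha> \<beta> J M m' n proof -
  have e: "short_exact 0 1 Z N B z p" "short_exact 0 c B Z H j h" "d = z ** (j ** p)"
   using hd by (auto simp: homology_data_def)
  note E = short_exactD[OF e(1)] and F = short_exactD[OF e(2)] and S = short_exactD[OF s]
  obtain q where q: "q : hom (\<alpha> + c - 0) N J" "m' ** h = q ** z"
   using injective_obE[OF J e(1) hom_comp[OF S(1) F(2)]] by metis
  have q1: "q : hom (\<alpha> + c) N J" using q(1) by simp
  have "q ** d = 0" using m_reassoc[OF q(2)[symmetric]] m_reassoc[OF F(3)] by (simp add: e(3) m_assoc)
  obtain N' i1 i2 p1 p2 where bp: "biprod (1 - (\<alpha> + c)) N J N' i1 i2 p1 p2"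
   using graded_biproduct[OF E(5) S(5)] by metis
  note at = coreflects_attach[OF N J q1 `q ** d = 0` bp refl]
  show ?thesis using attach_homology[OF hd s q1 q(2) bp refl at(1)] at by blast
 qed
 {
  case (1 H)
  hence e: "short_exact 0 c B Z H j h" by (auto simp: homology_data_def)
  obtain Z0 where Z0: "Z0 : Ob" "Id Z0 = 0" using zero_object by blast
  obtain N' d' r Z' B' z' p' j' h' c' where "cplx N' d'" "coreflects N' d' r N d"
   "homology_data N' d' Z' B' Z0 z' p' j' h' c'"
   using step[OF 1(2,3) short_exact_Id_zero[OF short_exactD(6)[OF e] Z0] assms(2)[OF 1(1)]] by metis
  thus ?case using acyc_of_homology_zero Z0(2) by blast
 next
  case (2 a b A J C i p n)
  obtain N' d' r Z' B' z' p' j' h' c' where N': "cplx N' d'" "coreflects N' d' r N d"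
   "homology_data N' d' Z' B' C z' p' j' h' c'" using step[OF 2(5,6) 2(1) assms(2)[OF 2(2)]] by metis
  obtain N'' d'' r' where N'': "acyc N'' d''" "coreflects N'' d'' r' N' d'" using 2(4)[OF N'(1,3)] by metis
  thus ?case using coreflects_comp[OF N'(2) N''(2)] by blast
 }
qed

text \<open>Up to homotopy the coreflection \<open>r\<close> does not change the maps from acyclic
  complexes, so \<open>T\<close> with the trace \<open>tau\<close> composed with \<open>r\<close>
  represents the same functor on them.\<close>

theorem serre_duality_acyc:
 assumes dim: "!!H. H : Ob ==> EX k. idim_le \<J> k H" and inj: "!!J. J : \<J> ==> injective_ob J"
  and X: "cplx X d"
 obtains T dT tau where "acyc T dT" "functional sc (hom 0 X T) tau" "!!b. b : bdry X d T dT ==> tau b = 0"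
  "!!Y e. acyc Y e ==> represents X d T dT tau Y e" proof -
 obtain N dN tau where N: "cplx N dN" "functional sc (hom 0 X N) tau" "!!b. b : bdry X d N dN ==> tau b = 0"
  "!!Y e. cplx Y e ==> represents X d N dN tau Y e" using serre_duality_cplx[OF X] by metis
 obtain Z B H z p j h where hd: "homology_data N dN Z B H z p j h 0" using homology_exists[OF N(1)] by metis
 hence "H : Ob" by (auto simp: homology_data_def dest: short_exactD)
 then obtain T dT r where T: "acyc T dT" "coreflects T dT r N dN"
  using acyclic_coreflection[OF _ inj N(1) hd] dim by metis
 have r: "r : chain T dT N dN" using T(2) by (simp add: coreflects_def)
 hence r0: "r : hom 0 T N" by (simp add: chain_def)
 have XOb: "X : Ob" using X by (auto simp: cplx_def dest: hom_ObD)
 define tau' where "tau' g = tau (r ** g)" for g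
 have "functional sc (hom 0 X T) tau'"
  unfolding tau'_def by (rule functional_comp[OF N(2) comp_left_linear[OF r0 XOb]]) simp
 moreover have "tau' b = 0" if "b : bdry X d T dT" for b
  unfolding tau'_def by (rule N(3)[OF bdry_comp_right[OF r that]])
 moreover have "represents X d T dT tau' Y e" if Y: "acyc Y e" for Y e proof -
  have Yc: "cplx Y e" using Y by (simp add: acyc_def)
  note rep = N(4)[OF Yc, unfolded represents_def]
  show ?thesis unfolding represents_def proof (intro conjI allI impI ballI)
   fix ph assume "functional sc (chain X d Y e) ph" "ALL b:bdry X d Y e. ph b = 0"
   then obtain h where h: "h : chain Y e N dN" "ALL f:chain X d Y e. ph f = tau (h ** f)" using rep by blast
   obtain h' where h': "h' : chain Y e T dT" "r ** h' - h : bdry Y e N dN"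
    using T(2) Y h(1) unfolding coreflects_def by blast
   have "ph f = tau' (h' ** f)" if f: "f : chain X d Y e" for f proof -
    have 1: "r ** h' ** f : hom 0 X N" "h ** f : hom 0 X N"
     using chain_comp[OF chain_comp[OF r h'(1)] f] chain_comp[OF h(1) f] by (auto simp: chain_def)
    have "tau ((r ** h' - h) ** f) = 0" by (rule N(3)[OF bdry_comp_left[OF h'(2) f]])
    hence "tau (r ** h' ** f) = tau (h ** f)"
     using rmod.linear_on_diff[OF hom_rmod[OF XOb hom_ObD(2)[OF r0]] N(2) 1] by (simp add: m_diff_left)
    thus ?thesis using h(2) f by (simp add: tau'_def m_assoc)
   qed
   thus "EX h:chain Y e T dT. ALL f:chain X d Y e. ph f = tau' (h ** f)" using h'(1) by blast
  next
   fix h assume h: "h : chain Y e T dT" "ALL f:chain X d Y e. tau' (h ** f) = 0"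
   have "r ** h : chain Y e N dN" by (rule chain_comp[OF r h(1)])
   moreover have "ALL f:chain X d Y e. tau ((r ** h) ** f) = 0" using h(2) by (simp add: tau'_def m_assoc)
   ultimately have "r ** h : bdry Y e N dN" using rep by blast
   thus "h : bdry Y e T dT" using T(2) Y h(1) unfolding coreflects_def by blast
  qed
 qed
 ultimately show thesis using that T(1) by blast
qed

end

section \<open>The opposite category and dual representability\<close>

context serre_setup
begin

lemma short_exact_iso_right:
 assumes e: "short_exact a b X Y Z i p" and s: "s : hom k Z' Z" "s' : hom (- k) Z Z'" "s ** s' = Id Z" "s' ** s = Id Z'"
 shows "short_exact a (b - k) X Y Z' i (s' ** p)" unfolding short_exact_def proof (intro conjI allI impI ballI)
 note E = short_exactD[OF e]
 show "s' ** p : hom (b - k) Y Z'" by (rule hom_compI[OF s(2) E(2)]) simp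
 show "s' ** p ** i = 0" using E(3) by (simp add: m_assoc)
 show "EX g:hom (l - a) A X. f = i ** g" if f: "f : hom l A Y" "s' ** p ** f = 0" for A l f proof -
  have "s ** (s' ** (p ** f)) = 0" using f(2) by (simp add: m_assoc)
  hence "p ** f = 0" by (simp add: m_reassoc[OF s(3)] Id_left[OF hom_comp[OF E(2) f(1)]])
  thus ?thesis using short_exact_kernel[OF e f(1)] by metis
 qed
 show "EX g:hom (l - (b - k)) Z' A. f = g ** (s' ** p)" if f: "f : hom l Y A" "f ** i = 0" for A l f proof -
  obtain g where g: "g : hom (l - b) Z A" "f = g ** p" using short_exact_cokernel[OF e f] by metis
  have "f = (g ** s) ** (s' ** p)" using g(2) by (simp add: m_assoc m_reassoc[OF s(3)] Id_left[OF E(2)])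
  moreover have "g ** s : hom (l - (b - k)) Z' A" by (rule hom_compI[OF g(1) s(1)]) simp
  ultimately show ?thesis by blast
 qed
 show "g = 0" if g: "g : hom l Z' A" "g ** (s' ** p) = 0" for A l g proof -
  have "g ** s' = 0" using short_exact_epi[OF e hom_comp[OF g(1) s(2)]] g(2) by (simp add: m_assoc)
  hence "g ** s' ** s = 0" by simp
  thus ?thesis using s(4) Id_right[OF g(1)] by (simp add: m_assoc)
 qed
qed (use short_exactD[OF e] short_exact_mono[OF e] in auto)

lemma short_exact_iso_left:
 assumes e: "short_exact a b X Y Z i p" and s: "s : hom k X' X" "s' : hom (- k) X X'" "s ** s' = Id X" "s' ** s = Id X'"
 shows "short_exact (a + k) b X' Y Z (i ** s) p" unfolding short_exact_def proof (intro conjI allI impI ballI)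
 note E = short_exactD[OF e]
 show "i ** s : hom (a + k) X' Y" by (rule hom_compI[OF E(1) s(1)]) simp
 show "p ** (i ** s) = 0" using m_reassoc[OF E(3)] by simp
 show "EX g:hom (l - (a + k)) A X'. f = i ** s ** g" if f: "f : hom l A Y" "p ** f = 0" for A l f proof -
  obtain g where g: "g : hom (l - a) A X" "f = i ** g" using short_exact_kernel[OF e f] by metis
  have "f = i ** s ** (s' ** g)" using g(2) by (simp add: m_assoc m_reassoc[OF s(3)] Id_left[OF g(1)])
  moreover have "s' ** g : hom (l - (a + k)) A X'" by (rule hom_compI[OF s(2) g(1)]) simp
  ultimately show ?thesis by blast
 qed
 show "g = 0" if g: "g : hom l A X'" "i ** s ** g = 0" for A l g proof -
  have "s ** g = 0" using short_exact_mono[OF e hom_comp[OF s(1) g(1)]] g(2) by (simp add: m_assoc)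
  hence "s' ** (s ** g) = 0" by simp
  thus ?thesis using Id_left[OF g(1)] by (simp add: m_reassoc[OF s(4)])
 qed
 show "EX g:hom (l - b) Z A. f = g ** p" if f: "f : hom l Y A" "f ** (i ** s) = 0" for A l f proof -
  have "f ** i ** s ** s' = 0" using f(2) by (simp add: m_assoc[symmetric])
  hence "f ** i = 0" using Id_right[OF hom_comp[OF f(1) E(1)]] by (simp add: m_assoc s(3))
  thus ?thesis using short_exact_cokernel[OF e f(1)] by metis
 qed
qed (use short_exactD[OF e] short_exact_epi[OF e] in auto)

lemma gcat_opposite: "gcat (%x y. y ** x) (%k X Y. hom k Y X) Id Ob"
proof
 show "f ** g : hom (k + l) Z X" if "g : hom k Z Y" "f : hom l Y X" for g k Y Z f l X
  by (rule hom_compI[OF that(2,1)]) simp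
qed (auto simp: m_simps hom_zero hom_add hom_uminus Id_hom Id_left Id_right dest: hom_Ob)

lemma short_exact_opposite:
 "gcat.short_exact (%x y. y ** x) (%k X Y. hom k Y X) a b X Y Z i p \<longleftrightarrow> short_exact b a Z Y X p i"
proof -
 interpret op: gcat "%x y. y ** x" "%k X Y. hom k Y X" Id Ob by (rule gcat_opposite)
 show ?thesis unfolding op.short_exact_def short_exact_def by blast
qed

text \<open>Generator and cogenerator change places. Perfectness of \<open>t0\<close> on the other
  side is \<open>serre_pair_corepr\<close>. In a factorization the degree has to be moved from the
  epimorphism to the monomorphism, by shifting the image.\<close>

lemma serre_setup_opposite:
 "serre_setup R se E (%x y. y ** x) (%k X Y. hom k Y X) Id Ob sc D0 L0 t0" proof -
 interpret op: gcat "%x y. y ** x" "%k X Y. hom k Y X" Id Ob by (rule gcat_opposite)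
 show ?thesis proof
  show "finite_length R sc (hom k Y X)" if "X : Ob" "Y : Ob" for X Y k using hom_finite_length that by blast
  show "sc r (f ** g) = f ** sc r g" if "r :. R" "g : hom k Z Y" "f : hom l Y X" for r g k Y Z f l X
   using sc_right that by blast
  show "sc r (f ** g) = sc r f ** g" if "r :. R" "g : hom k Z Y" "f : hom l Y X" for r g k Y Z f l X
   using sc_left that by blast
  show "EX X' s s'. s : hom k X X' & s' : hom (- k) X' X & s' ** s = Id X & s ** s' = Id X'" if X: "X : Ob" for X k
   using shift[OF X, of "- k"] by auto
  show "EX Z i1 i2 p1 p2. op.biprod 0 X Y Z i1 i2 p1 p2" if X: "X : Ob" "Y : Ob" for X Y proof -
   obtain Z i1 i2 p1 p2 where "biprod 0 X Y Z i1 i2 p1 p2" using biproduct[OF X] by blast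
   hence "op.biprod 0 X Y Z p1 p2 i1 i2" by (simp add: biprod_def op.biprod_def)
   thus ?thesis by blast
  qed
  show "EX Z:Ob. Id Z = 0" by (rule zero_object)
  show "EX K I C kap p i c. op.short_exact 0 k K X I kap p & op.short_exact 0 0 I Y C i c & f = p ** i"
   if f: "f : hom k Y X" for f k X Y proof -
   obtain K I C kap p i c where g: "short_exact 0 k K Y I kap p" "short_exact 0 0 I X C i c" "f = i ** p"
    using factorization[OF f] by metis
   obtain I' s s' where s: "s : hom k I' I" "s' : hom (- k) I I'" "s ** s' = Id I" "s' ** s = Id I'"
    using shift[OF short_exactD(6)[OF g(1)], of k] by metis
   have "short_exact 0 0 K Y I' kap (s' ** p)" using short_exact_iso_right[OF g(1) s] by simp
   moreover have "short_exact k 0 I' X C (i ** s) c" using short_exact_iso_left[OF g(2) s] by simp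
   moreover have "f = (i ** s) ** (s' ** p)"
    using g(3) by (simp add: m_assoc m_reassoc[OF s(3)] Id_left[OF short_exactD(2)[OF g(1)]])
   ultimately show ?thesis unfolding short_exact_opposite by blast
  qed
  show "EX a:hom (- k) L0 X. ALL f:hom k X D0. ph f = t0 (f ** a)"
   if "X : Ob" "functional sc (hom k X D0) ph" for X k ph
   using serre_pair_corepr[OF serre_pair_L0 that] by metis
  show "a = 0" if "a : hom k L0 X" "!!f. f : hom (- k) X D0 ==> t0 (f ** a) = 0" for a k X
   using serre_pair_co_eq_0[OF serre_pair_L0 that] .
  show "f = 0" if "f : hom k Y X" "!!l w. w : hom l X D0 ==> w ** f = 0" for f k X Y using cogenerator[OF that] .
  show "f = 0" if "f : hom k Y X" "!!l w. w : hom l L0 Y ==> f ** w = 0" for f k X Y using generator[OF that] .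
 qed (use L0_Ob D0_Ob t0 finite_generation finite_cogeneration in auto)
qed

theorem serre_duality_acyc_dual:
 assumes dim: "!!H. H : Ob ==> idim_le \<J> n H" and inj: "!!J. J : \<J> ==> injective_ob J"
  and Y: "cplx Y e"
 obtains X d tau where "acyc X d" "functional sc (hom 0 X Y) tau" "!!b. b : bdry X d Y e ==> tau b = 0"
  "!!Z c ph. acyc Z c ==> functional sc (chain Z c Y e) ph ==> (!!b. b : bdry Z c Y e ==> ph b = 0) ==>
   EX h:chain X d Z c. ALL f:chain Z c Y e. ph f = tau (f ** h)"
  "!!Z c h. acyc Z c ==> h : chain X d Z c ==> (!!f. f : chain Z c Y e ==> tau (f ** h) = 0) ==>
   h : bdry X d Z c" proof -
 interpret op: serre_setup R se E "%x y. y ** x" "%k X Y. hom k Y X" Id Ob sc D0 L0 t0 by (rule serre_setup_opposite)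
 have cplx: "op.cplx X d \<longleftrightarrow> cplx X d" for X d by (simp add: op.cplx_def cplx_def)
 have chain: "op.chain X d Z c = chain Z c X d" for X d Z c by (auto simp: op.chain_def chain_def)
 have bdry: "op.bdry X d Z c = bdry Z c X d" for X d Z c by (simp add: op.bdry_def bdry_def add.commute)
 have injop: "op.injective_ob P \<longleftrightarrow> projective_ob P" for P
  unfolding op.injective_ob_def projective_ob_def short_exact_opposite by blast
 have projop: "op.projective_ob P \<longleftrightarrow> injective_ob P" for P
  unfolding op.projective_ob_def injective_ob_def short_exact_opposite by blast
 \<comment> \<open>Acyclicity is tested on \<open>L0\<close> here and on \<open>D0\<close> in the
   opposite category. The tests agree because acyclic complexes stay exact under maps into
   injectives.\<close>
 have acyc1: "op.acyc Z c" if Z: "acyc Z c" for Z c proof -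
  have "cplx Z c" using Z by (simp add: acyc_def)
  thus ?thesis unfolding op.acyc_def cplx using acyc_injective[OF Z serre_pair_injective[OF serre_pair_L0]] by metis
 qed
 have acyc2: "acyc Z c" if Z: "op.acyc Z c" for Z c proof -
  have "cplx Z c" using Z by (simp add: op.acyc_def cplx)
  thus ?thesis unfolding acyc_def using op.acyc_injective[OF Z op.serre_pair_injective[OF op.serre_pair_L0]] by metis
 qed
 have pd: "op.pdim_le k X" if "idim_le \<J> k X" for k X using that proof (induction rule: idim_le.induct)
  case (1 J) thus ?case by (intro op.pdim_le.intros(1)) (simp add: inj projop)
 next
  case (2 a b A J C i p k)
  have "op.short_exact b a C J A p i" using 2(1) by (simp add: short_exact_opposite)
  thus ?case by (rule op.pdim_le.intros(2)) (simp_all add: inj[OF 2(2)] projop 2(4))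
 qed
 \<comment> \<open>Bounded injective dimension is bounded projective dimension in the opposite
   category, and this bounds the injective dimension there with one more step.\<close>
 have idim: "op.idim_le {P. projective_ob P} (Suc n) X" if X: "X : Ob" for X
 proof (rule op.idim_le_of_pdim_le[OF _ _ _ _ X])
  show "EX a b J C i p. op.short_exact a b X J C i p & J : {P. projective_ob P} & C : Ob" if X: "X : Ob" for X proof -
   obtain P I t K kap pj where P: "serre_pair P I t" "short_exact 0 0 K P X kap pj"
    using projective_cover[OF X] by metis
   hence "op.short_exact 0 0 X P K pj kap" by (simp add: short_exact_opposite)
   thus ?thesis using serre_pair_projective[OF P(1)] short_exactD(4)[OF P(2)] by (intro exI conjI) auto
  qed
  show "C : {P. projective_ob P}" if "J : {P. projective_ob P}" "C : Ob" "i : hom a J C"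
   "p : hom (- a) C J" "i ** p = Id C" for J C i p a using op.injective_ob_retract[of J i a C p] that injop by simp
  show "op.pdim_le n X" if "X : Ob" for X using pd[OF dim[OF that]] .
 qed (simp add: injop)
 obtain X d tau where X: "op.acyc X d" "functional sc (hom 0 X Y) tau" "!!b. b : op.bdry Y e X d ==> tau b = 0"
  "!!Z c. op.acyc Z c ==> op.represents Y e X d tau Z c"
  using op.serre_duality_acyc[of "{P. projective_ob P}" Y e] idim injop cplx Y by (metis mem_Collect_eq)
 show thesis proof (rule that[OF acyc2[OF X(1)] X(2)])
  show "tau b = 0" if "b : bdry X d Y e" for b using X(3) that bdry by blast
  show "EX h:chain X d Z c. ALL f:chain Z c Y e. ph f = tau (f ** h)"
   if "acyc Z c" "functional sc (chain Z c Y e) ph" "!!b. b : bdry Z c Y e ==> ph b = 0" for Z c ph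
   using X(4)[OF acyc1[OF that(1)]] that(2,3) unfolding op.represents_def chain bdry by blast
  show "h : bdry X d Z c" if "acyc Z c" "h : chain X d Z c" "!!f. f : chain Z c Y e ==> tau (f ** h) = 0" for Z c h
   using X(4)[OF acyc1[OF that(1)]] that(2,3) unfolding op.represents_def chain bdry by blast
 qed
qed

end

section \<open>A criterion for the existence of a Serre functor\<close>

lemma lin_homD:
 assumes "f : lin_hom A M N" shows "x :. M ==> f x :. N"
  "x :. M ==> y :. M ==> f (x +[M] y) = f x +[N] f y"
  "a :. A ==> x :. M ==> f (a *[M] x) = a *[N] f x" using assms by (auto simp: lin_hom_def)

lemma lin_homI:
 assumes "!!x. x :. M ==> f x :. N"
  "!!x y. x :. M ==> y :. M ==> f (x +[M] y) = f x +[N] f y"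
  "!!a x. a :. A ==> x :. M ==> f (a *[M] x) = a *[N] f x" shows "f : lin_hom A M N"
 using assms by (auto simp: lin_hom_def)

lemma dual_module_simps [simp]:
 "carrier (dual_module R E M) = lin_hom R M E \<inter> extensional (carrier M)"
 "f +[dual_module R E M] g = (\<lambda>x\<in>carrier M. f x +[E] g x)"
 "a *[dual_module R E M] f = (\<lambda>x\<in>carrier M. a *[E] f x)" by (simp_all add: dual_module_def)

lemma restrict_in_dual:
 assumes "module R M" "f : lin_hom R M E" shows "restrict f (carrier M) :. (dual_module R E M)" proof -
 interpret module R M by fact
 show ?thesis using lin_homD[OF assms(2)] by (auto intro!: lin_homI)
qed

lemma lin_hom_comp: "g : lin_hom A N P ==> f : lin_hom A M N ==> (%x. g (f x)) : lin_hom A M P"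
 by (auto simp: lin_hom_def Pi_def)

locale module_pairing = cring R + M: module R M + N: module R N + E: module R E
 for R :: "('r, 'z) ring_scheme" (structure) and M :: "('r, 'm) module" and N :: "('r, 'n) module"
  and E :: "('r, 'e) module" +
 fixes b :: "'m => 'n => 'e"
 assumes left_linear: "n :. N ==> (%m. b m n) : lin_hom R M E"
  and right_linear: "m :. M ==> b m : lin_hom R N E"
  and represents: "ph : lin_hom R M E ==> EX n:carrier N. ALL m:carrier M. ph m = b m n"
  and inj: "[|n :. N; n' :. N; !!m. m :. M ==> b m n = b m n'|] ==> n = n'"
begin

definition rep :: "('m => 'e) => 'n" where "rep ph = (SOME n. n :. N & (ALL m:carrier M. b m n = ph m))"

lemma rep:
 assumes "ph : lin_hom R M E" shows "rep ph :. N" "m :. M ==> b m (rep ph) = ph m"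
 using someI_ex[of "%n. n :. N & (ALL m:carrier M. b m n = ph m)"] represents[OF assms]
 unfolding rep_def by (metis (no_types, lifting))+

lemma rep_eqI:
 assumes "n :. N" "!!m. m :. M ==> b m n = ph m" shows "rep ph = n" proof -
 have "ph : lin_hom R M E" using left_linear[OF assms(1)] assms(2) by (simp add: lin_hom_def Pi_def)
 from rep[OF this] show ?thesis using assms by (intro inj) simp_all
qed

lemma rep_linear: "rep : lin_hom R (dual_module R E M) N"
 by (rule lin_homI; (rule rep_eqI)?) (simp_all add: rep lin_homD[OF right_linear])

lemma rep_bij: "bij_betw rep (carrier (dual_module R E M)) (carrier N)"
proof (rule bij_betwI[where g = "%n. \<lambda>m\<in>carrier M. b m n"])
 show *: "(%n. \<lambda>m\<in>carrier M. b m n) : carrier N \<rightarrow> carrier (dual_module R E M)"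
  using restrict_in_dual[OF M.module_axioms left_linear] by blast
 show "(\<lambda>m\<in>carrier M. b m (rep ph)) = ph" if "ph :. (dual_module R E M)" for ph
  using that by (auto simp: rep extensional_def)
qed (auto intro: rep rep_eqI)

text \<open>The record version of \<open>perfect_pairing_swap\<close>: \<open>N\<close> is the dual
  of \<open>M\<close>, so reflexivity turns a functional on \<open>N\<close> into an element of
  \<open>M\<close>.\<close>

lemma swap:
 assumes reflexive: "!!Ph. Ph : lin_hom R (dual_module R E M) E ==>
   EX x:carrier M. ALL ph:carrier (dual_module R E M). Ph ph = ph x"
  and ps: "ps : lin_hom R N E" shows "EX m:carrier M. ALL n:carrier N. ps n = b m n" proof -
 obtain m where m: "m :. M" "ALL ph:carrier (dual_module R E M). ps (rep ph) = ph m"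
  using reflexive[OF lin_hom_comp[OF ps rep_linear]] by blast
 have "ps n = b m n" if n: "n :. N" for n
  using m(2)[rule_format, OF restrict_in_dual[OF M.module_axioms left_linear[OF n]]] m(1) n
   rep_eqI[of n "\<lambda>m\<in>carrier M. b m n"] by simp
 thus ?thesis using m(1) by blast
qed

end

text \<open>\<open>S X\<close> represents \<open>D C(X, -)\<close> with trace \<open>t X\<close>,
  and \<open>G Y\<close> corepresents \<open>D C(-, Y)\<close> with trace \<open>u Y\<close>. Both
  are given object by object; functoriality is derived.\<close>

locale serre_criterion = linear_category R C + E: module R E
 for R :: "('r, 'z) ring_scheme" (structure) and C :: "('o, 'h, 'r) lin_cat" and E :: "('r, 'e) module" +
 fixes S G :: "'o => 'o" and t u :: "'o => 'h => 'e"
 assumes reflexive: "[|X : Ob C; Y : Ob C; Ph : lin_hom R (dual_module R E (Mor C X Y)) E|] ==>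
   EX x:Arr C X Y. ALL ph:carrier (dual_module R E (Mor C X Y)). Ph ph = ph x"
  and separated: "[|X : Ob C; Y : Ob C; x : Arr C X Y; y : Arr C X Y;
   !!ph. ph : lin_hom R (Mor C X Y) E ==> ph x = ph y|] ==> x = y"
  and S_Ob: "X : Ob C ==> S X : Ob C"
  and t_lin: "X : Ob C ==> t X : lin_hom R (Mor C X (S X)) E"
  and t_repr: "[|X : Ob C; Y : Ob C; ph : lin_hom R (Mor C X Y) E|] ==>
   EX h:Arr C Y (S X). ALL f:Arr C X Y. ph f = t X (Comp C X Y (S X) h f)"
  and t_inj: "[|X : Ob C; Y : Ob C; h : Arr C Y (S X); h' : Arr C Y (S X);
   !!f. f : Arr C X Y ==> t X (Comp C X Y (S X) h f) = t X (Comp C X Y (S X) h' f)|] ==> h = h'"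
  and G_Ob: "Y : Ob C ==> G Y : Ob C"
  and u_lin: "Y : Ob C ==> u Y : lin_hom R (Mor C (G Y) Y) E"
  and u_repr: "[|Y : Ob C; Z : Ob C; ph : lin_hom R (Mor C Z Y) E|] ==>
   EX h:Arr C (G Y) Z. ALL f:Arr C Z Y. ph f = u Y (Comp C (G Y) Z Y f h)"
  and u_inj: "[|Y : Ob C; Z : Ob C; h : Arr C (G Y) Z; h' : Arr C (G Y) Z;
   !!f. f : Arr C Z Y ==> u Y (Comp C (G Y) Z Y f h) = u Y (Comp C (G Y) Z Y f h')|] ==> h = h'"
begin

abbreviation D :: "'o => 'o => ('r, 'h => 'e) module" where "D X Y \<equiv> dual_module R E (Mor C X Y)"

lemma comp_closed:
 "[|X : Ob C; Y : Ob C; Z : Ob C; g : Arr C Y Z; f : Arr C X Y|] ==> Comp C X Y Z g f : Arr C X Z"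
 using lin_homD(1)[OF Comp_right_linear] by blast

lemmas [simp] = S_Ob G_Ob Ident_closed Ident_left Ident_right Comp_assoc comp_closed

lemma S_pairing:
 assumes "X : Ob C" "Y : Ob C" shows "module_pairing R (Mor C X Y) (Mor C Y (S X)) E (%f h. t X (Comp C X Y (S X) h f))"
 using assms t_repr t_inj
 by (intro module_pairing.intro Mor_module module_pairing_axioms.intro is_cring E.module_axioms)
  (auto intro!: lin_hom_comp[OF t_lin] Comp_left_linear Comp_right_linear)

lemma G_pairing:
 assumes "Y : Ob C" "Z : Ob C" shows "module_pairing R (Mor C Z Y) (Mor C (G Y) Z) E (%f h. u Y (Comp C (G Y) Z Y f h))"
 using assms u_repr u_inj
 by (intro module_pairing.intro Mor_module module_pairing_axioms.intro is_cring E.module_axioms)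
  (auto intro!: lin_hom_comp[OF u_lin] Comp_left_linear Comp_right_linear)

definition eta :: "'o => 'o => ('h => 'e) => 'h"
 where "eta X Y = module_pairing.rep (Mor C X Y) (Mor C Y (S X)) (%f h. t X (Comp C X Y (S X) h f))"

lemmas eta [simp] = module_pairing.rep[OF S_pairing, folded eta_def]
lemmas eta_eqI = module_pairing.rep_eqI[OF S_pairing, folded eta_def]
lemmas eta_linear = module_pairing.rep_linear[OF S_pairing, folded eta_def]
lemmas eta_bij = module_pairing.rep_bij[OF S_pairing, folded eta_def]

text \<open>Yoneda: the map from \<open>S X\<close> to \<open>S X'\<close> that represents the trace
  of \<open>X\<close> after composition with \<open>a\<close>.\<close>

definition SM :: "'o => 'o => 'h => 'h" where "SM X X' a = eta X' (S X) (%f. t X (Comp C X X' (S X) f a))"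

lemma t_comp:
 assumes "X : Ob C" "X' : Ob C" "a : Arr C X X'"
 shows "(%f. t X (Comp C X X' (S X) f a)) : lin_hom R (Mor C X' (S X)) E"
 using assms by (intro lin_hom_comp[OF t_lin] Comp_left_linear) simp_all

lemma SM [simp]:
 assumes "X : Ob C" "X' : Ob C" "a : Arr C X X'" shows "SM X X' a : Arr C (S X) (S X')"
  "f : Arr C X' (S X) ==> t X' (Comp C X' (S X) (S X') (SM X X' a) f) = t X (Comp C X X' (S X) f a)"
 using assms t_comp[OF assms] by (simp_all add: SM_def)

lemma SM_eqI:
 assumes "X : Ob C" "X' : Ob C" "s : Arr C (S X) (S X')"
  "!!f. f : Arr C X' (S X) ==> t X' (Comp C X' (S X) (S X') s f) = t X (Comp C X X' (S X) f a)" shows "SM X X' a = s"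
 unfolding SM_def using assms by (intro eta_eqI) simp_all

lemma SM_functor: "linear_functor R C C S SM"
proof unfold_locales
 fix X Y assume O: "X : Ob C" "Y : Ob C"
 interpret M: module R "Mor C X Y" using O by (rule Mor_module)
 interpret N: module R "Mor C (S X) (S Y)" using O by (intro Mor_module) simp_all
 show "SM X Y : lin_hom R (Mor C X Y) (Mor C (S X) (S Y))" by (rule lin_homI; (rule SM_eqI)?)
   (use O in "simp_all add: lin_homD[OF t_lin] lin_homD[OF Comp_left_linear] lin_homD[OF Comp_right_linear]")
next
 fix X Y Z f g assume "X : Ob C" "Y : Ob C" "Z : Ob C" "f : Arr C X Y" "g : Arr C Y Z"
 thus "SM X Z (Comp C X Y Z g f) = Comp C (S X) (S Y) (S Z) (SM Y Z g) (SM X Y f)"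
  by (intro SM_eqI) (simp_all flip: Comp_assoc, simp_all)
qed (auto intro!: SM_eqI)

text \<open>Under \<open>C(X', S X) \<cong> D C(X, X')\<close> the map \<open>SM X X'\<close> becomes the evaluation
 \<open>C(X, X') \<rightarrow> D D C(X, X')\<close>.\<close>

lemma SM_full:
 assumes O: "X : Ob C" "X' : Ob C" and s: "s : Arr C (S X) (S X')" shows "EX a:Arr C X X'. SM X X' a = s" proof -
 have "(%f. t X' (Comp C X' (S X) (S X') s f)) : lin_hom R (Mor C X' (S X)) E"
  using O s by (intro lin_hom_comp[OF t_lin] Comp_right_linear) simp_all
 from module_pairing.swap[OF S_pairing[OF O] reflexive[OF O] this] show ?thesis using O s by (metis SM_eqI)
qed

lemma SM_faithful:
 assumes "X : Ob C" "X' : Ob C" "a : Arr C X X'" "b : Arr C X X'" "SM X X' a = SM X X' b" shows "a = b"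
proof (rule separated[OF assms(1-4)])
 fix ph assume "ph : lin_hom R (Mor C X X') E"
 with SM(2)[of X X' a "eta X X' ph"] SM(2)[of X X' b "eta X X' ph"] show "ph a = ph b" using assms by simp
qed

text \<open>\<open>\<epsilon>\<close> represents the trace \<open>u Y\<close>, so composition with
  it carries the pairing of \<open>G Y\<close> to that of \<open>S (G Y)\<close>; hence it is a
  monomorphism. Reflexivity turns the trace of \<open>G Y\<close> into a map \<open>dl\<close> back,
  which is a right inverse of \<open>\<epsilon>\<close> and therefore inverse to it.\<close>

lemma S_essentially_surjective:
 assumes Y: "Y : Ob C" shows "EX \<epsilon>:Arr C Y (S (G Y)). EX dl:Arr C (S (G Y)) Y.
  Comp C Y (S (G Y)) Y dl \<epsilon> = Ident C Y & Comp C (S (G Y)) Y (S (G Y)) \<epsilon> dl = Ident C (S (G Y))"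
proof -
 define \<epsilon> where "\<epsilon> = eta (G Y) Y (u Y)"
 have \<epsilon>: "\<epsilon> : Arr C Y (S (G Y))"
  "f : Arr C (G Y) Y ==> t (G Y) (Comp C (G Y) Y (S (G Y)) \<epsilon> f) = u Y f" for f
  using Y u_lin by (simp_all add: \<epsilon>_def)
 have inj: "k = k'" if Z: "Z : Ob C" and k: "k : Arr C Z Y" "k' : Arr C Z Y"
  "Comp C Z Y (S (G Y)) \<epsilon> k = Comp C Z Y (S (G Y)) \<epsilon> k'" for Z k k'
 proof (rule separated[OF Z Y k(1,2)])
  fix ph assume "ph : lin_hom R (Mor C Z Y) E"
  then obtain h where h: "h : Arr C (G Y) Z" "ALL f:Arr C Z Y. ph f = u Y (Comp C (G Y) Z Y f h)"
   using u_repr[OF Y Z] by blast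
  have "u Y (Comp C (G Y) Z Y f h) = t (G Y) (Comp C (G Y) Z (S (G Y)) (Comp C Z Y (S (G Y)) \<epsilon> f) h)"
   if "f : Arr C Z Y" for f using that h Y Z \<epsilon> by simp
  thus "ph k = ph k'" using h(2) k by simp
 qed
 have "(%f. t (G Y) (Comp C (G Y) (S (G Y)) (S (G Y)) (Ident C (S (G Y))) f))
   : lin_hom R (Mor C (G Y) (S (G Y))) E" using Y by (intro lin_hom_comp[OF t_lin] Comp_right_linear) simp_all
 from module_pairing.swap[OF G_pairing[OF Y] reflexive this] obtain dl where dl: "dl : Arr C (S (G Y)) Y"
  "ALL f:Arr C (G Y) (S (G Y)). t (G Y) f = u Y (Comp C (G Y) (S (G Y)) Y dl f)" using Y by auto
 have *: "Comp C (S (G Y)) Y (S (G Y)) \<epsilon> dl = Ident C (S (G Y))"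
  by (rule t_inj[of "G Y" "S (G Y)"]) (use Y \<epsilon> dl in simp_all)
 have "Comp C Y (S (G Y)) Y dl \<epsilon> = Ident C Y"
  by (rule inj[OF Y]) (use Y \<epsilon>(1) dl(1) * Comp_assoc[of Y "S (G Y)" Y "S (G Y)" \<epsilon> dl \<epsilon>] in "simp_all del: Comp_assoc")
 thus ?thesis using \<epsilon>(1) dl(1) * by blast
qed

theorem serre_functor_exists: "EX SO SM \<eta>. serre_functor R E C SO SM \<eta>"
proof -
 have "ALL Y:Ob C. EX \<epsilon> dl. \<epsilon> : Arr C Y (S (G Y)) & dl : Arr C (S (G Y)) Y &
   Comp C Y (S (G Y)) Y dl \<epsilon> = Ident C Y & Comp C (S (G Y)) Y (S (G Y)) \<epsilon> dl = Ident C (S (G Y))"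
  using S_essentially_surjective by blast
 then obtain \<epsilon> dl where *: "ALL Y:Ob C. \<epsilon> Y : Arr C Y (S (G Y)) & dl Y : Arr C (S (G Y)) Y &
   Comp C Y (S (G Y)) Y (dl Y) (\<epsilon> Y) = Ident C Y & Comp C (S (G Y)) Y (S (G Y)) (\<epsilon> Y) (dl Y) = Ident C (S (G Y))"
  by metis
 note [simp] = *[rule_format, THEN conjunct1] *[rule_format, THEN conjunct2, THEN conjunct1]
  *[rule_format, THEN conjunct2, THEN conjunct2, THEN conjunct1] *[rule_format, THEN conjunct2, THEN conjunct2, THEN conjunct2]
 have [simp]: "Comp C X (S (G Y)) Y (dl Y) (Comp C X Y (S (G Y)) (\<epsilon> Y) f) = f"
  if "X : Ob C" "Y : Ob C" "f : Arr C X Y" for X Y f using that by (simp flip: Comp_assoc)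
 interpret F: linear_functor R C C S SM by (rule SM_functor)
 note [simp] = F.FM_Comp F.FM_Ident
 define L where "L X X' s = (SOME a. a : Arr C X X' & SM X X' a = s)" for X X' s
 have [simp]: "L X X' s : Arr C X X'" "SM X X' (L X X' s) = s"
  if "X : Ob C" "X' : Ob C" "s : Arr C (S X) (S X')" for X X' s
  using someI_ex[of "%a. a : Arr C X X' & SM X X' a = s"] SM_full[OF that] unfolding L_def by blast+
 \<comment> \<open>\<open>b\<close> is conjugated by the isomorphisms \<open>\<epsilon>\<close> and
   \<open>dl\<close> and then pulled back along the full functor \<open>S\<close>. Equations for
   \<open>GM\<close> are checked after applying the faithful \<open>SM\<close>.\<close>
 define GM where "GM X Y b = L (G X) (G Y) (Comp C (S (G X)) Y (S (G Y)) (\<epsilon> Y) (Comp C (S (G X)) X Y b (dl X)))" for X Y b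
 have "linear_functor R C C G GM" proof unfold_locales
  fix X Y assume O: "X : Ob C" "Y : Ob C"
  interpret M: module R "Mor C X Y" using O by (rule Mor_module)
  interpret N: module R "Mor C (G X) (G Y)" using O by (intro Mor_module) simp_all
  interpret K: module R "Mor C (S (G X)) (S (G Y))" using O by (intro Mor_module) simp_all
  show "GM X Y : lin_hom R (Mor C X Y) (Mor C (G X) (G Y))" by (rule lin_homI; (rule SM_faithful[of "G X" "G Y"])?)
    (use O in "simp_all add: GM_def lin_homD[OF F.FM_linear] lin_homD[OF Comp_left_linear] lin_homD[OF Comp_right_linear]")
 next
  show "GM X X (Ident C X) = Ident C (G X)" if "X : Ob C" for X
   by (rule SM_faithful[of "G X" "G X"]) (use that in "simp_all add: GM_def")
  show "GM X Z (Comp C X Y Z g f) = Comp C (G X) (G Y) (G Z) (GM Y Z g) (GM X Y f)"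
   if "X : Ob C" "Y : Ob C" "Z : Ob C" "f : Arr C X Y" "g : Arr C Y Z" for X Y Z f g
   by (rule SM_faithful[of "G X" "G Z"]) (use that in "simp_all add: GM_def")
 qed simp
 moreover have "iso_arrow C (S (G Y)) Y (dl Y)" if "Y : Ob C" for Y
  unfolding iso_arrow_def using that by (auto intro!: bexI[of _ "\<epsilon> Y"])
 hence "naturally_isomorphic C C (%X. S (G X)) (%X Y f. SM (G X) (G Y) (GM X Y f)) (%X. X) (%X Y f. f)"
  unfolding naturally_isomorphic_def by (intro exI[of _ dl]) (simp add: GM_def)
 moreover have iso: "iso_arrow C (G (S X)) X (L (G (S X)) X (dl (S X)))" if X: "X : Ob C" for X
  unfolding iso_arrow_def by (intro conjI bexI[of _ "L X (G (S X)) (\<epsilon> (S X))"];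
    (rule SM_faithful[of "G (S X)" "G (S X)"] SM_faithful[of X X])?) (use X in simp_all)
 have "Comp C (G (S X)) (G (S Y)) Y (L (G (S Y)) Y (dl (S Y))) (GM (S X) (S Y) (SM X Y f)) =
   Comp C (G (S X)) X Y f (L (G (S X)) X (dl (S X)))" if "X : Ob C" "Y : Ob C" "f : Arr C X Y" for X Y f
  by (rule SM_faithful[of "G (S X)" Y]) (use that in "simp_all add: GM_def")
 with iso have "naturally_isomorphic C C (%X. G (S X)) (%X Y f. GM (S X) (S Y) (SM X Y f)) (%X. X) (%X Y f. f)"
  unfolding naturally_isomorphic_def by (intro exI[of _ "%X. L (G (S X)) X (dl (S X))"]) simp
 ultimately have "auto_equivalence R C S SM" unfolding auto_equivalence_def using SM_functor by blast
 moreover have "eta X' Y (\<lambda>h\<in>Arr C X' Y. ph (Comp C X X' Y h a)) = Comp C Y (S X) (S X') (SM X X' a) (eta X Y ph)"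
  if "X : Ob C" "X' : Ob C" "Y : Ob C" "a : Arr C X X'" "ph :. (D X Y)" for X X' Y a ph
  using that by (intro eta_eqI) simp_all
 moreover have "eta X Y' (\<lambda>h\<in>Arr C X Y'. ph (Comp C X Y' Y b h)) = Comp C Y' Y (S X) (eta X Y ph) b"
  if "X : Ob C" "Y : Ob C" "Y' : Ob C" "b : Arr C Y' Y" "ph :. (D X Y)" for X Y Y' b ph
  using that by (intro eta_eqI) simp_all
 ultimately have "serre_functor R E C S SM eta" unfolding serre_functor_def using eta_linear eta_bij by blast
 thus ?thesis by blast
qed

end

section \<open>A universal abelian group and its endomorphisms\<close>

text \<open>The product of all abelian groups with carrier in \<open>'b\<close>, each taken once in every degree.
 It turns elements and morphisms of modules, which live in records, into elements of types of
 class \<open>ab_group_add\<close>.\<close>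

typedef ('a, 'b) tot =
 "{u :: int => ('a, 'b) module => 'b. ALL i M. if abelian_group M then u i M : carrier M else u i M = undefined}" proof
 show "(%i M. if abelian_group M then 0[M] else undefined) :
  {u :: int => ('a, 'b) module => 'b. ALL i M. if abelian_group M then u i M : carrier M else u i M = undefined}"
  by (auto intro: abelian_groupE)
qed

lemma Rep_tot_mem: "abelian_group M ==> Rep_tot u i M :. M"
 using Rep_tot[of u] by auto

lemma tot_eqI:
 assumes "!!i M. abelian_group M ==> Rep_tot u i M = Rep_tot v i M" shows "u = v" proof -
 have "Rep_tot u i M = Rep_tot v i M" for i M
  using assms Rep_tot[of u] Rep_tot[of v] by (cases "abelian_group M") (simp, (auto split: if_splits)[])
 thus ?thesis by (metis Rep_tot_inject ext)
qed

definition mk_tot :: "(int => ('a, 'b) module => 'b) => ('a, 'b) tot"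
 where "mk_tot f = Abs_tot (%i M. if abelian_group M then f i M else undefined)"

lemma Rep_mk_tot:
 assumes "!!i M. abelian_group M ==> f i M :. M" "abelian_group M" shows "Rep_tot (mk_tot f) i M = f i M"
 unfolding mk_tot_def using assms by (subst Abs_tot_inverse) auto

instantiation tot :: (type, type) ab_group_add
begin
definition "0 = mk_tot (%i M. 0[M])"
definition "u + v = mk_tot (%i M. Rep_tot u i M +[M] Rep_tot v i M)"
definition "- u = mk_tot (%i M. -[M] Rep_tot u i M)"
definition "u - v = u + - (v :: ('a, 'b) tot)"

lemma Rep_tot_zero: "abelian_group M ==> Rep_tot 0 i M = 0[M]"
 unfolding zero_tot_def by (rule Rep_mk_tot) (auto intro: abelian_groupE)

lemma Rep_tot_plus: "abelian_group M ==> Rep_tot (u + v) i M = Rep_tot u i M +[M] Rep_tot v i M"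
 unfolding plus_tot_def by (rule Rep_mk_tot) (auto intro: abelian_groupE Rep_tot_mem)

lemma Rep_tot_uminus: "abelian_group M ==> Rep_tot (- u) i M = -[M] Rep_tot u i M"
 unfolding uminus_tot_def by (rule Rep_mk_tot) (auto intro: abelian_group.a_inv_closed Rep_tot_mem)

instance proof
 fix a b c :: "('a, 'b) tot"
 show "a + b + c = a + (b + c)"
  by (rule tot_eqI) (simp add: Rep_tot_plus abelian_monoid.a_assoc abelian_group.axioms(1) Rep_tot_mem)
 show "a + b = b + a"
  by (rule tot_eqI) (simp add: Rep_tot_plus abelian_monoid.a_comm abelian_group.axioms(1) Rep_tot_mem)
 show "0 + a = a"
  by (rule tot_eqI) (simp add: Rep_tot_plus Rep_tot_zero abelian_monoid.l_zero abelian_group.axioms(1) Rep_tot_mem)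
 show "- a + a = 0"
  by (rule tot_eqI) (simp add: Rep_tot_plus Rep_tot_zero Rep_tot_uminus abelian_group.l_neg Rep_tot_mem)
 show "a - b = a + - b" by (rule minus_tot_def)
qed

end

definition emb :: "int => ('a, 'b) module => 'b => ('a, 'b) tot"
 where "emb i M x = mk_tot (%j N. if j = i & N = M then x else 0[N])"

lemma Rep_emb:
 assumes "abelian_group N" "x :. M" shows "Rep_tot (emb i M x) j N = (if j = i & N = M then x else 0[N])"
 unfolding emb_def by (rule Rep_mk_tot) (use assms in "auto intro: abelian_groupE")

lemma emb_eq_iff:
 assumes "abelian_group M" "x :. M" "y :. M" shows "emb i M x = emb i M y \<longleftrightarrow> x = y"
 using Rep_emb[OF assms(1), of _ M i i] assms by metis

lemma emb_add:
 assumes "abelian_group M" "x :. M" "y :. M" shows "emb i M (x +[M] y) = emb i M x + emb i M y" proof -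
 interpret abelian_group M by fact
 show ?thesis by (rule tot_eqI)
   (use assms in "simp add: Rep_tot_plus Rep_emb abelian_monoid.l_zero abelian_group.axioms(1) abelian_groupE")
qed

lemma emb_zero: "abelian_group M ==> emb i M 0[M] = 0"
 using emb_add[of M "0[M]" "0[M]" i] by (simp add: abelian_groupE abelian_monoid.l_zero abelian_group.axioms(1))

definition prj :: "('a, 'b) module => ('a, 'b) tot => 'b" where "prj M v = Rep_tot v 0 M"

lemma prj_emb [simp]: "abelian_group M ==> x :. M ==> prj M (emb 0 M x) = x"
 by (simp add: prj_def Rep_emb)

lemma prj_mem: "abelian_group M ==> prj M v :. M"
 by (simp add: prj_def Rep_tot_mem)

lemma prj_add: "abelian_group M ==> prj M (u + v) = prj M u +[M] prj M v"
 by (simp add: prj_def Rep_tot_plus)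

text \<open>Degree 0 of the universal group holds a faithful copy of every module record. The action
  takes the module as an argument because copies of different modules share one type.\<close>

definition act :: "('a, 'b) module => 'a => ('a, 'b) tot => ('a, 'b) tot" where "act M r v = emb 0 M (r *[M] prj M v)"

definition embedded :: "('a, 'b) module => ('a, 'b) tot set" where "embedded M = emb 0 M ` carrier M"

lemma act_emb: "module R M ==> x :. M ==> act M r (emb 0 M x) = emb 0 M (r *[M] x)"
 by (simp add: act_def module.axioms)

lemma rmod_embedded:
 fixes M :: "('r, 'b) module"
 assumes "module R M" shows "rmod R (act M) (embedded M)" proof -
 interpret module R M by fact
 note ab = M.abelian_group_axioms
 show ?thesis proof unfold_locales
  show "0 : embedded M" using emb_zero[OF ab, of 0] by (force simp: embedded_def)
 qed (auto simp: embedded_def act_emb[OF assms] smult_l_distr smult_r_distr smult_assoc1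
   simp flip: emb_add[OF ab])
qed

lemma linear_on_embedded:
 fixes M :: "('r, 'b) module" and N :: "('r, 'c) module"
 assumes "module R M" "module R N" "f : lin_hom R M N"
 shows "linear_on R (act M) (embedded M) (act N) (embedded N) (%v. emb 0 N (f (prj M v)))" proof -
 interpret M: module R M by fact
 interpret N: module R N by fact
 note ab = M.M.abelian_group_axioms N.M.abelian_group_axioms
 show ?thesis by (rule linear_onI)
   (auto simp: embedded_def act_emb[OF assms(1)] act_emb[OF assms(2)] ab prj_add lin_homD[OF assms(3)]
    emb_add)
qed

definition fin_length :: "('r, 'z) ring_scheme => ('r, 'b) module => bool"
 where "fin_length R M \<longleftrightarrow> finite_length R (act M) (embedded M)"

lemma fin_length_image:
 fixes M :: "('r, 'b) module" and N :: "('r, 'c) module"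
 assumes "fin_length R M" "module R M" "module R N" "f : lin_hom R M N" "f ` carrier M = carrier N"
 shows "fin_length R N" proof -
 have ab: "abelian_group M" using assms(2) by (rule module.axioms)
 have "(%v. emb 0 N (f (prj M v))) ` embedded M = emb 0 N ` f ` carrier M"
  using ab by (auto simp: embedded_def image_iff)
 thus ?thesis using finite_length_image[OF _ rmod_embedded[OF assms(3)] linear_on_embedded[OF assms(2-4)]] assms(1,5)
  by (simp add: fin_length_def embedded_def)
qed

lemma fin_length_sub:
 fixes M :: "('r, 'b) module" and N :: "('r, 'c) module"
 assumes "fin_length R N" "module R M" "module R N" "f : lin_hom R M N" "inj_on f (carrier M)" shows "fin_length R M"
proof -
 have ab: "abelian_group M" "abelian_group N" using assms by (auto intro: module.axioms)
 interpret M: rmod R "act M" "embedded M" by (rule rmod_embedded) fact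
 let ?F = "%v. emb 0 N (f (prj M v))"
 note lin = linear_on_embedded[OF assms(2-4)]
 have im: "finite_length R (act N) (?F ` embedded M)"
  using finite_length_sub[OF _ M.rmod_image[OF lin rmod_embedded[OF assms(3)]]] assms(1) linear_onD(1)[OF lin]
  by (auto simp: fin_length_def)
 have "?F v = 0 \<longleftrightarrow> v = 0" if v: "v : embedded M" for v proof
  obtain x where x: "v = emb 0 M x" "x :. M" using v by (auto simp: embedded_def)
  assume "?F v = 0"
  hence "emb 0 N (f x) = ?F 0" using x ab M.linear_on_zero[OF lin] by simp
  also have "\<dots> = emb 0 N (f 0[M])" using emb_zero[OF ab(1), of 0] ab(1) by (metis abelian_groupE(2) prj_emb)
  finally have "f x = f 0[M]" using emb_eq_iff[OF ab(2)] lin_homD(1)[OF assms(4)] x ab(1) abelian_groupE(2) by metis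
  hence "x = 0[M]" using assms(5) x ab(1) by (metis abelian_groupE(2) inj_onD)
  thus "v = 0" using x emb_zero[OF ab(1)] by simp
 qed (use M.linear_on_zero[OF lin] in simp)
 hence "{v : embedded M. ?F v = 0} = {0}" by auto
 thus ?thesis using finite_length_extension[OF im M.rmod_axioms _ refl] linear_on_embedded[OF assms(2-4)]
   M.finite_length_trivial by (auto simp: fin_length_def linear_on_def)
qed

typedef (overloaded) 'v endo = "{f :: 'v::ab_group_add => 'v. ALL x y. f (x + y) = f x + f y}"
 by (rule exI[of _ "%_. 0"]) simp

lemma endo_add: "Rep_endo f (x + y) = Rep_endo f x + Rep_endo f y"
 using Rep_endo[of f] by simp

lemma endo_eqI: "(!!x. Rep_endo f x = Rep_endo g x) ==> f = g"
 by (metis Rep_endo_inject ext)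

lemma Rep_Abs_endo: "(!!x y. f (x + y) = f x + f y) ==> Rep_endo (Abs_endo f) x = f x"
 by (subst Abs_endo_inverse) auto

instantiation endo :: (ab_group_add) ab_group_add
begin
definition "0 = Abs_endo (%x. 0)"
definition "f + g = Abs_endo (%x. Rep_endo f x + Rep_endo g x)"
definition "- f = Abs_endo (%x. - Rep_endo f x)"
definition "f - g = f + - (g :: 'a endo)"

lemma Rep_endo_zero: "Rep_endo 0 x = 0"
 unfolding zero_endo_def by (rule Rep_Abs_endo) simp
lemma Rep_endo_plus: "Rep_endo (f + g) x = Rep_endo f x + Rep_endo g x"
 unfolding plus_endo_def by (rule Rep_Abs_endo) (simp add: endo_add algebra_simps)
lemma Rep_endo_uminus: "Rep_endo (- f) x = - Rep_endo f x"
 unfolding uminus_endo_def by (rule Rep_Abs_endo) (simp add: endo_add algebra_simps)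

instance
 by standard (auto intro!: endo_eqI simp: Rep_endo_zero Rep_endo_plus Rep_endo_uminus minus_endo_def algebra_simps)

end

definition ecomp :: "'v::ab_group_add endo => 'v endo => 'v endo"
 where "ecomp f g = Abs_endo (%x. Rep_endo f (Rep_endo g x))"

lemma Rep_ecomp: "Rep_endo (ecomp f g) x = Rep_endo f (Rep_endo g x)"
 unfolding ecomp_def by (rule Rep_Abs_endo) (simp add: endo_add)

lemma ecomp_assoc: "ecomp (ecomp f g) h = ecomp f (ecomp g h)"
 by (rule endo_eqI) (simp add: Rep_ecomp)

lemma ecomp_add: "ecomp (f + g) h = ecomp f h + ecomp g h" "ecomp f (g + h) = ecomp f g + ecomp f h"
 by (rule endo_eqI; simp add: Rep_ecomp Rep_endo_plus endo_add)+

section \<open>Right modules\<close>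

lemma right_module_abelian: "right_module A M ==> abelian_group M"
 by (rule right_module.axioms)

lemma lin_hom_zero:
 assumes "abelian_group M" "abelian_group N" "f : lin_hom A M N" shows "f 0[M] = 0[N]" proof -
 interpret M: abelian_group M by fact
 interpret N: abelian_group N by fact
 have "f 0[M] +[N] f 0[M] = f 0[M]" using lin_homD(2)[OF assms(3), of "0[M]" "0[M]"] by simp
 thus ?thesis using lin_homD(1)[OF assms(3) M.zero_closed] N.add.l_cancel_one' by simp
qed

lemma lin_hom_minus:
 assumes "abelian_group M" "abelian_group N" "f : lin_hom A M N" "x :. M" "y :. M" shows "f (x -[M] y) = f x -[N] f y"
proof -
 interpret M: abelian_group M by fact
 interpret N: abelian_group N by fact
 note f = lin_homD(1,2)[OF assms(3)]
 have "f (x -[M] y) +[N] f y = f x" using f(2)[of "x -[M] y" y] assms(4,5) by (simp add: M.minus_eq M.a_assoc M.l_neg)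
 thus ?thesis using f(1) assms(4,5) by (metis M.minus_closed N.add.inv_solve_right' N.minus_eq)
qed

lemma (in abelian_group) minus_eq_zero_iff:
 "x :. G ==> y :. G ==> x \<ominus> y = \<zero> \<longleftrightarrow> x = y"
 by (metis a_minus_def add.inv_closed minus_equality minus_minus r_neg)

lemma emb_minus:
 assumes "abelian_group M" "x :. M" shows "emb i M (-[M] x) = - emb i M x" proof -
 interpret abelian_group M by fact
 have "emb i M (-[M] x) + emb i M x = 0" using assms by (simp add: l_neg emb_zero flip: emb_add)
 thus ?thesis by (simp add: eq_neg_iff_add_eq_0)
qed

lemma emb_diff:
 assumes "abelian_group M" "x :. M" "y :. M" shows "emb i M (x -[M] y) = emb i M x - emb i M y"
 using assms by (simp add: a_minus_def emb_add emb_minus abelian_group.a_inv_closed)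

text \<open>Identities in an abelian group are checked in the type \<open>tot\<close>.\<close>

lemma emb_eqI:
 "abelian_group M ==> x :. M ==> y :. M ==> emb 0 M x = emb 0 M y ==> x = y" by (simp add: emb_eq_iff)

lemma (in right_module) smult_zero: "a :. A ==> a *[M] 0[M] = 0[M]"
 using smult_r_distr[of a "0[M]" "0[M]"] smult_closed[of a "0[M]"] by simp

lemma (in right_module) zero_smult: "x :. M ==> \<zero> *[M] x = 0[M]"
 using smult_l_distr[of \<zero> \<zero> x] smult_closed[of \<zero> x] by simp

lemma (in right_module) minus_one_smult: "x :. M ==> (\<ominus> \<one>) *[M] x = -[M] x"
 using smult_l_distr[of "\<ominus> \<one>" \<one> x] smult_closed[of "\<ominus> \<one>" x]
 by (simp add: l_neg zero_smult smult_one M.minus_equality)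

lemma (in right_module) smult_minus:
 assumes a: "a :. A" and x: "x :. M" shows "a *[M] (-[M] x) = -[M] (a *[M] x)" proof -
 have "a *[M] (-[M] x) +[M] a *[M] x = 0[M]" using a x by (simp add: M.l_neg smult_zero flip: smult_r_distr)
 thus ?thesis using a x M.minus_equality smult_closed by simp
qed

lemma lin_hom_pointwise:
 assumes "right_module A N" "f : lin_hom A M N" "g : lin_hom A M N"
 shows "(%x. f x +[N] g x) : lin_hom A M N" "(%x. -[N] f x) : lin_hom A M N"
  "(%x. f x -[N] g x) : lin_hom A M N" proof -
 interpret N: right_module A N by fact
 show "(%x. f x +[N] g x) : lin_hom A M N" "(%x. -[N] f x) : lin_hom A M N"
  "(%x. f x -[N] g x) : lin_hom A M N" using lin_homD[OF assms(2)] lin_homD[OF assms(3)]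
  by (auto intro!: lin_homI simp: N.M.a_ac N.smult_r_distr N.M.minus_add N.smult_minus a_minus_def)
qed

lemmas lin_hom_add = lin_hom_pointwise(1) and lin_hom_diff = lin_hom_pointwise(3)

lemma lin_hom_const_zero:
 assumes "right_module A N" shows "(%_. 0[N]) : lin_hom A M N" proof -
 interpret right_module A N by fact
 show ?thesis by (rule lin_homI) (simp_all add: smult_zero)
qed

lemma right_module_sub:
 fixes M :: "('a, 'b) module"
 assumes "right_module A M" "W \<subseteq> carrier M" "0[M] : W" "!!x y. x : W ==> y : W ==> x +[M] y : W"
  "!!a x. a :. A ==> x : W ==> a *[M] x : W" shows "right_module A (M\<lparr>carrier := W\<rparr>)" proof -
 interpret right_module A M by fact
 have inv: "-[M] x : W" if "x : W" for x using assms(5)[of "-[A] 1[A]" x] minus_one_smult[of x] that assms(2) by auto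
 have "abelian_group (M\<lparr>carrier := W\<rparr>)" proof (rule abelian_groupI)
  fix x assume x: "x :. (M\<lparr>carrier := W\<rparr>)"
  hence "-[M] x +[M] x = 0[M]" using assms(2) by (auto intro: M.l_neg)
  thus "EX y:carrier (M\<lparr>carrier := W\<rparr>). y +[M\<lparr>carrier := W\<rparr>] x = 0[M\<lparr>carrier := W\<rparr>]"
   using inv x by auto
 qed (use assms in "auto simp: M.a_assoc subset_iff intro: M.a_comm")
 thus ?thesis by (intro right_module.intro right_module_axioms.intro ring_axioms)
   (use assms in "auto simp: smult_l_distr smult_r_distr smult_assoc smult_one subset_iff")
qed

text \<open>Transport of structure along a map compatible with the operations. An injective
  \<open>q\<close> gives an isomorphic copy, a \<open>q\<close> choosing representatives of cosets
  gives a quotient.\<close>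

definition induced_module :: "('a, 'b) module => ('b => 'c) => ('a, 'c) module"
 where "induced_module M q = \<lparr>carrier = q ` carrier M, mult = undefined, one = undefined,
  zero = q 0[M], add = (%u v. q (inv_into (carrier M) q u +[M] inv_into (carrier M) q v)),
  smult = (%a u. q (a *[M] inv_into (carrier M) q u))\<rparr>"

lemma induced_module:
 fixes M :: "('a, 'b) module"
 assumes M: "right_module A M"
  and add: "!!x x' y y'. [|x :. M; x' :. M; y :. M; y' :. M; q x = q x'; q y = q y'|] ==>
   q (x +[M] y) = q (x' +[M] y')"
  and smult: "!!a x x'. [|a :. A; x :. M; x' :. M; q x = q x'|] ==>
   q (a *[M] x) = q (a *[M] x')" shows "right_module A (induced_module M q)" "q : lin_hom A M (induced_module M q)"
  "carrier (induced_module M q) = q ` carrier M" proof -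
 interpret right_module A M by fact
 let ?Q = "induced_module M q"
 have pre: "inv_into (carrier M) q (q x) :. M" "q (inv_into (carrier M) q (q x)) = q x" if "x :. M" for x
  using that by (auto intro: inv_into_into f_inv_into_f)
 have 1: "q x +[?Q] q y = q (x +[M] y)" if "x :. M" "y :. M" for x y
  using add[of "inv_into (carrier M) q (q x)" x "inv_into (carrier M) q (q y)" y] pre that
  by (simp add: induced_module_def del: inv_into_image_cancel)
 have 2: "a *[?Q] q x = q (a *[M] x)" if "a :. A" "x :. M" for a x
  using smult[of a "inv_into (carrier M) q (q x)" x] pre that by (simp add: induced_module_def)
 show c: "carrier ?Q = q ` carrier M" by (simp add: induced_module_def)
 have z: "0[?Q] = q 0[M]" by (simp add: induced_module_def)
 show "q : lin_hom A M ?Q" by (rule lin_homI) (auto simp: 1 2 c)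
 have "abelian_group ?Q" proof (rule abelian_groupI)
  show "EX y:carrier ?Q. y +[?Q] x = 0[?Q]" if xQ: "x : carrier ?Q" for x proof -
   obtain w where w: "x = q w" "w :. M" using xQ c by auto
   hence "q (-[M] w) +[?Q] x = 0[?Q]" by (simp add: 1 z M.l_neg)
   thus ?thesis using c w by blast
  qed
 qed (auto simp: c z 1 M.a_assoc M.a_comm M.a_lcomm)
 thus "right_module A ?Q" by (intro right_module.intro right_module_axioms.intro ring_axioms)
   (auto simp: c 1 2 smult_closed smult_l_distr smult_r_distr smult_assoc smult_one)
qed

definition exact_seq :: "('a, 'z) ring_scheme => ('a, 'b) module => ('a, 'c) module => ('a, 'd) module =>
  ('b => 'c) => ('c => 'd) => bool"
 where "exact_seq A M N P f g \<longleftrightarrow> right_module A M & right_module A N & right_module A P &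
  f : lin_hom A M N & g : lin_hom A N P & inj_on f (carrier M) & g ` carrier N = carrier P &
  f ` carrier M = hom_kernel N P g"

lemma exact_seqD:
 assumes "exact_seq A M N P f g"
 shows "right_module A M" "right_module A N" "right_module A P" "f : lin_hom A M N" "g : lin_hom A N P"
  "inj_on f (carrier M)" "g ` carrier N = carrier P"
  "f ` carrier M = {y : carrier N. g y = 0[P]}" using assms by (auto simp: exact_seq_def hom_kernel_def)

lemma exact_seq_kernel:
 assumes e: "exact_seq A M N P f g" and B: "right_module A B" and h: "h : lin_hom A B N"
  and gh: "!!x. x :. B ==> g (h x) = 0[P]" shows "EX k:lin_hom A B M. ALL x:carrier B. h x = f (k x)" proof -
 note E = exact_seqD[OF e]
 interpret B: right_module A B by fact
 interpret M: right_module A M by (rule E)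
 define k where "k x = inv_into (carrier M) f (h x)" for x
 have k: "k x :. M" "f (k x) = h x" if "x :. B" for x proof -
  have "h x : f ` carrier M" using E(8) gh[OF that] lin_homD(1)[OF h that] by auto
  thus "k x :. M" "f (k x) = h x" by (auto simp: k_def intro: inv_into_into f_inv_into_f)
 qed
 have "k : lin_hom A B M" proof (rule lin_homI)
  fix x assume x: "x :. B"
  thus "k x :. M" by (rule k)
  show "k (x +[B] y) = k x +[M] k y" if "y :. B" for y
   by (rule inj_onD[OF E(6)]) (use x that k lin_homD[OF h] lin_homD[OF E(4)] in simp_all)
  show "k (a *[B] x) = a *[M] k x" if "a :. A" for a by (rule inj_onD[OF E(6)])
    (use x that k lin_homD[OF h] lin_homD[OF E(4)] B.smult_closed M.smult_closed in simp_all)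
 qed
 thus ?thesis using k by metis
qed

lemma exact_seq_cokernel:
 assumes e: "exact_seq A M N P f g" and B: "right_module A B" and h: "h : lin_hom A N B"
  and hf: "!!x. x :. M ==> h (f x) = 0[B]" shows "EX k:lin_hom A P B. ALL x:carrier N. h x = k (g x)" proof -
 note E = exact_seqD[OF e]
 interpret B: right_module A B by fact
 interpret N: right_module A N by (rule E)
 interpret P: right_module A P by (rule E)
 note abN = right_module_abelian[OF E(2)] and abP = right_module_abelian[OF E(3)] and abB = right_module_abelian[OF B]
 have eq: "h x = h y" if "x :. N" "y :. N" "g x = g y" for x y proof -
  have "g (x -[N] y) = 0[P]"
   using lin_hom_minus[OF abN abP E(5) that(1,2)] that lin_homD(1)[OF E(5)] P.M.minus_eq_zero_iff by simp
  hence "x -[N] y : f ` carrier M" using E(8) that by simp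
  hence "h (x -[N] y) = 0[B]" using hf by auto
  thus ?thesis using lin_hom_minus[OF abN abB h that(1,2)] that lin_homD(1)[OF h] B.M.minus_eq_zero_iff by simp
 qed
 define k where "k u = h (inv_into (carrier N) g u)" for u
 have pre: "inv_into (carrier N) g (g x) :. N" "g (inv_into (carrier N) g (g x)) = g x" if "x :. N" for x
  using that by (auto intro: inv_into_into f_inv_into_f)
 have k: "k (g x) = h x" if "x :. N" for x unfolding k_def using eq pre that by blast
 have "k : lin_hom A P B" proof (rule lin_homI)
  fix u assume "u :. P"
  then obtain x where x: "u = g x" "x :. N" using E(7) by auto
  show "k u :. B" using x k lin_homD(1)[OF h] by simp
  show "k (u +[P] v) = k u +[B] k v" if v: "v :. P" for v proof -
   obtain y where y: "v = g y" "y :. N" using v E(7) by auto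
   have "u +[P] v = g (x +[N] y)" using x y lin_homD(2)[OF E(5)] by simp
   thus ?thesis using k x y lin_homD(2)[OF h] by simp
  qed
  show "k (a *[P] u) = a *[B] k u" if "a :. A" for a proof -
   have "a *[P] u = g (a *[N] x)" using x that lin_homD(3)[OF E(5)] by simp
   thus ?thesis using k x that lin_homD(3)[OF h] N.smult_closed by simp
  qed
 qed
 thus ?thesis using k by metis
qed

lemma exact_seq_of_kernel:
 fixes M :: "('a, 'b) module" and N :: "('a, 'c) module"
 assumes M: "right_module A M" and N: "right_module A N" and f: "f : lin_hom A M N"
  and sur: "f ` carrier M = carrier N" shows "exact_seq A (M\<lparr>carrier := hom_kernel M N f\<rparr>) M N (%x. x) f"
proof -
 interpret M: right_module A M by fact
 interpret N: right_module A N by fact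
 have "right_module A (M\<lparr>carrier := hom_kernel M N f\<rparr>)" by (rule right_module_sub[OF M])
   (use lin_homD[OF f] lin_hom_zero[OF right_module_abelian[OF M] right_module_abelian[OF N] f]
    in "auto simp: hom_kernel_def M.smult_closed N.smult_zero")
 thus ?thesis using assms by (auto simp: exact_seq_def hom_kernel_def intro!: lin_homI)
qed

text \<open>The quotient has to live in the same type as \<open>M\<close>. Its elements are
  representatives chosen by \<open>q\<close>, which depend only on the coset of
  \<open>W\<close>.\<close>

lemma exact_seq_of_submodule:
 fixes M :: "('a, 'b) module"
 assumes M: "right_module A M" and W: "W \<subseteq> carrier M" "right_module A (M\<lparr>carrier := W\<rparr>)"
 obtains Q :: "('a, 'b) module" and q where "exact_seq A (M\<lparr>carrier := W\<rparr>) M Q (%x. x) q" proof -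
 interpret M: right_module A M by fact
 interpret W: right_module A "M\<lparr>carrier := W\<rparr>" by fact
 note ab = right_module_abelian[OF M]
 define V where "V = emb 0 M ` W"
 have mem: "emb 0 M x : V \<longleftrightarrow> x : W" if "x :. M" for x
  using emb_eqI[OF ab that] W(1) by (auto simp: V_def)
 have V: "x + y : V" "- x : V" if "x : V" "y : V" for x y proof -
  obtain u v where "x = emb 0 M u" "y = emb 0 M v" "u : W" "v : W" "u :. M" "v :. M"
   using `x : V` \<open>y : V\<close> W(1) by (auto simp: V_def)
  thus "x + y : V" "- x : V" using W.M.a_closed[of u v] W.smult_closed[of "-[A] 1[A]" u] M.minus_one_smult[of u]
   by (auto simp: V_def simp flip: emb_add[OF ab] emb_minus[OF ab])
 qed
 have V_diff: "x - y : V" if "x : V" "y : V" for x y using V[of x "- y"] V(2)[of y y] that by simp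
 define q where "q x = (SOME z. z :. M & emb 0 M z - emb 0 M x : V)" for x
 have V0: "0 : V" using mem[of "0[M]"] W.M.zero_closed by (simp add: emb_zero[OF ab])
 have q: "q x :. M & emb 0 M (q x) - emb 0 M x : V" if "x :. M" for x
  unfolding q_def by (rule someI[of _ x]) (simp add: that V0)
 have iff: "q x = q y \<longleftrightarrow> emb 0 M x - emb 0 M y : V" if xy: "x :. M" "y :. M" for x y proof
  show "emb 0 M x - emb 0 M y : V" if "q x = q y"
   using V_diff[of "emb 0 M (q y) - emb 0 M y" "emb 0 M (q x) - emb 0 M x"] q[OF xy(1)] q[OF xy(2)] that by simp
  assume d: "emb 0 M x - emb 0 M y : V"
  have "v - emb 0 M x : V \<longleftrightarrow> v - emb 0 M y : V" for v
   using V(1)[OF _ d, of "v - emb 0 M x"] V_diff[OF _ d, of "v - emb 0 M y"] by auto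
  thus "q x = q y" by (simp add: q_def)
 qed
 have add: "q (x +[M] y) = q (x' +[M] y')"
  if "x :. M" "x' :. M" "y :. M" "y' :. M" "q x = q x'" "q y = q y'" for x x' y y'
  using that V(1)[of "emb 0 M x - emb 0 M x'" "emb 0 M y - emb 0 M y'"] by (simp add: iff emb_add[OF ab] algebra_simps)
 have sm: "q (a *[M] x) = q (a *[M] x')" if "a :. A" "x :. M" "x' :. M" "q x = q x'" for a x x' proof -
  have "x -[M] x' : W" using that mem[of "x -[M] x'"] by (simp add: iff emb_diff[OF ab])
  hence "a *[M] x -[M] a *[M] x' : W"
   using W.smult_closed[of a "x -[M] x'"] that by (simp add: a_minus_def M.smult_r_distr M.smult_minus)
  thus ?thesis using that mem[of "a *[M] x -[M] a *[M] x'"] by (simp add: iff emb_diff[OF ab] M.smult_closed)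
 qed
 note Q = induced_module[OF M add sm]
 have "0[induced_module M q] = q 0[M]" by (simp add: induced_module_def)
 moreover have "q x = q 0[M] \<longleftrightarrow> x : W" if "x :. M" for x
  using that mem by (simp add: iff emb_zero[OF ab])
 ultimately have ker: "hom_kernel M (induced_module M q) q = W" using W(1) by (auto simp: hom_kernel_def)
 have "(%x. x) : lin_hom A (M\<lparr>carrier := W\<rparr>) M" by (rule lin_homI) (use W(1) in auto)
 hence "exact_seq A (M\<lparr>carrier := W\<rparr>) M (induced_module M q) (%x. x) q"
  unfolding exact_seq_def ker by (simp add: Q M W(2))
 thus thesis by (rule that)
qed

lemma lin_hom_image:
 assumes M: "right_module A M" and N: "right_module A N" and f: "f : lin_hom A M N"
 shows "f ` carrier M \<subseteq> carrier N" "0[N] : f ` carrier M"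
  "x : f ` carrier M ==> y : f ` carrier M ==> x +[N] y : f ` carrier M"
  "a :. A ==> x : f ` carrier M ==> a *[N] x : f ` carrier M" proof -
 interpret M: right_module A M by fact
 show "f ` carrier M \<subseteq> carrier N" using lin_homD(1)[OF f] by auto
 show "0[N] : f ` carrier M" using lin_hom_zero[OF right_module_abelian[OF M] right_module_abelian[OF N] f] by force
 show "x +[N] y : f ` carrier M" if xy: "x : f ` carrier M" "y : f ` carrier M" proof -
  obtain u v where "x = f u" "y = f v" "u :. M" "v :. M" using xy by auto
  hence "x +[N] y = f (u +[M] v)" "u +[M] v :. M" using lin_homD(2)[OF f] by simp_all
  thus ?thesis by (rule image_eqI)
 qed
 show "a *[N] x : f ` carrier M" if ax: "a :. A" "x : f ` carrier M" proof -
  obtain u where "x = f u" "u :. M" using ax by auto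
  hence "a *[N] x = f (a *[M] u)" "a *[M] u :. M" using lin_homD(3)[OF f] M.smult_closed ax by simp_all
  thus ?thesis by (rule image_eqI)
 qed
qed

lemma exact_seq_factorization:
 fixes M N :: "('a, 'b) module"
 assumes M: "right_module A M" and N: "right_module A N" and f: "f : lin_hom A M N"
 obtains K I Q :: "('a, 'b) module" and q where
  "exact_seq A K M I (%x. x) f" "exact_seq A I N Q (%x. x) q" "K = M\<lparr>carrier := hom_kernel M N f\<rparr>"
  "I = N\<lparr>carrier := f ` carrier M\<rparr>" proof -
 interpret M: right_module A M by fact
 interpret N: right_module A N by fact
 define I where "I = N\<lparr>carrier := f ` carrier M\<rparr>"
 note im = lin_hom_image[OF M N f]
 have I: "right_module A I" unfolding I_def by (rule right_module_sub[OF N im])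
 have fI: "f : lin_hom A M I" using f by (auto simp: lin_hom_def I_def)
 obtain Q :: "('a, 'b) module" and q where Q: "exact_seq A I N Q (%x. x) q"
  using exact_seq_of_submodule[OF N im(1)] I unfolding I_def by metis
 have "hom_kernel M I f = hom_kernel M N f" by (simp add: hom_kernel_def I_def)
 moreover have "f ` carrier M = carrier I" by (simp add: I_def)
 ultimately have "exact_seq A (M\<lparr>carrier := hom_kernel M N f\<rparr>) M I (%x. x) f"
  using exact_seq_of_kernel[OF M I fI] by simp
 thus thesis using that Q I_def by blast
qed

section \<open>Graded modules\<close>

definition graded_ob :: "('l, 'z) ring_scheme => (int => ('l, 'm) module) => bool"
 where "graded_ob L X \<longleftrightarrow> (ALL i. right_module L (X i))"

definition ghom :: "('l, 'z) ring_scheme => int => (int => ('l, 'm) module) => (int => ('l, 'm) module) =>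
  (int => 'm => 'm) set"
 where "ghom L k X Y = {f. graded_ob L X & graded_ob L Y & (ALL i. f i : lin_hom L (X i) (Y (i + k)))}"

text \<open>An endomorphism of the universal group with a single block in each degree, from the
  coordinate \<open>X (j - k)\<close> in degree \<open>j - k\<close> to the coordinate
  \<open>Y j\<close> in degree \<open>j\<close>. Blocks with a common middle object compose like
  maps, and two of them are equal if the maps agree on carriers.\<close>

definition arr :: "int => (int => ('l, 'm) module) => (int => ('l, 'm) module) =>
  (int => 'm => 'm) => ('l, 'm) tot endo" where "arr k X Y f = Abs_endo (%u. mk_tot (%j N.
  if N = Y j then f (j - k) (Rep_tot u (j - k) (X (j - k))) else 0[N]))"

definition bhom :: "('l, 'z) ring_scheme => int => (int => ('l, 'm) module) => (int => ('l, 'm) module) =>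
  ('l, 'm) tot endo set" where "bhom L k X Y = arr k X Y ` ghom L k X Y"

definition gid :: "(int => ('l, 'm) module) => ('l, 'm) tot endo" where "gid X = arr 0 X X (%i x. x)"

lemma graded_obD: "graded_ob L X ==> right_module L (X i)" "graded_ob L X ==> abelian_group (X i)"
 by (auto simp: graded_ob_def dest: right_module_abelian)

lemma ghomD:
 assumes "f : ghom L k X Y" shows "graded_ob L X" "graded_ob L Y" "f i : lin_hom L (X i) (Y (i + k))"
  "i + k = j ==> f i : lin_hom L (X i) (Y j)"
  "right_module L (X i)" "right_module L (Y i)" "abelian_group (X i)" "abelian_group (Y i)"
 using assms by (auto simp: ghom_def dest: graded_obD)

lemma ghomI:
 "graded_ob L X ==> graded_ob L Y ==> (!!i. f i : lin_hom L (X i) (Y (i + k))) ==> f : ghom L k X Y"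
 by (simp add: ghom_def)

lemma bhomI: "f : ghom L k X Y ==> arr k X Y f : bhom L k X Y"
 by (simp add: bhom_def)

lemma bhomE:
 assumes "z : bhom L k X Y" obtains f where "f : ghom L k X Y" "z = arr k X Y f" using assms by (auto simp: bhom_def)

lemma Rep_arr:
 fixes X Y :: "int => ('a, 'c) module"
 assumes f: "f : ghom L k X Y" and N: "abelian_group N" shows "Rep_tot (Rep_endo (arr k X Y f) u) j N =
  (if N = Y j then f (j - k) (Rep_tot u (j - k) (X (j - k))) else 0[N])" proof -
 note F = ghomD[OF f]
 note fD = lin_homD[OF F(4)]
 let ?F = "%u. mk_tot (%j N. if N = Y j then f (j - k) (Rep_tot u (j - k) (X (j - k))) else 0[N])"
 have r: "Rep_tot (?F u) j N = (if N = Y j then f (j - k) (Rep_tot u (j - k) (X (j - k))) else 0[N])"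
  if "abelian_group N" for u j N
  by (rule Rep_mk_tot) (use that fD(1)[OF _ Rep_tot_mem] F(7) in "auto intro: abelian_groupE")
 have "?F (u + v) = ?F u + ?F v" for u v proof (rule tot_eqI)
  fix i and M :: "('a, 'c) module" assume M: "abelian_group M"
  then interpret abelian_group M .
  show "Rep_tot (?F (u + v)) i M = Rep_tot (?F u + ?F v) i M" using M F(7)[of "i - k"]
   by (simp add: r Rep_tot_plus fD(2)[of "i - k" i] Rep_tot_mem)
 qed
 hence "Rep_endo (arr k X Y f) u = ?F u" for u unfolding arr_def by (rule Rep_Abs_endo)
 thus ?thesis by (simp add: r N)
qed

lemma arr_apply:
 assumes f: "f : ghom L k X Y" and x: "x :. (X i)"
 shows "Rep_tot (Rep_endo (arr k X Y f) (emb i (X i) x)) (i + k) (Y (i + k)) = f i x"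
 using Rep_arr[OF f ghomD(8)[OF f]] Rep_emb[OF ghomD(7)[OF f] x] by simp

lemma arr_eqI:
 fixes X Y :: "int => ('a, 'c) module"
 assumes f: "f : ghom L k X Y" and g: "g : ghom L k X Y"
  and eq: "!!i x. x :. (X i) ==> f i x = g i x" shows "arr k X Y f = arr k X Y g" proof (rule endo_eqI, rule tot_eqI)
 fix u i and M :: "('a, 'c) module" assume M: "abelian_group M"
 show "Rep_tot (Rep_endo (arr k X Y f) u) i M = Rep_tot (Rep_endo (arr k X Y g) u) i M"
  using eq[OF Rep_tot_mem[OF ghomD(7)[OF f]]] by (simp add: Rep_arr[OF f M] Rep_arr[OF g M])
qed

lemma arr_eqD:
 assumes "arr k X Y f = arr k X Y g" "f : ghom L k X Y" "g : ghom L k X Y" "x :. (X i)" shows "f i x = g i x"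
 using arr_apply[OF assms(2,4)] arr_apply[OF assms(3,4)] assms(1) by simp

lemma ghom_zero:
 assumes "graded_ob L X" "graded_ob L Y" shows "(%i x. 0[Y (i + k)]) : ghom L k X Y"
 by (intro ghomI assms lin_hom_const_zero graded_obD)

lemma arr_zero:
 assumes "graded_ob L X" "graded_ob L Y" shows "arr k X Y (%i x. 0[Y (i + k)]) = 0" by (rule endo_eqI, rule tot_eqI)
  (simp add: Rep_arr[OF ghom_zero[OF assms]] Rep_endo_zero Rep_tot_zero)

lemma arr_eq_0_iff:
 assumes f: "f : ghom L k X Y"
 shows "arr k X Y f = 0 \<longleftrightarrow> (ALL i. ALL x:carrier (X i). f i x = 0[Y (i + k)])"
 using arr_eqI[OF f ghom_zero] arr_eqD[OF _ f ghom_zero] arr_zero ghomD[OF f] by metis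

lemma ghom_add:
 assumes f: "f : ghom L k X Y" and g: "g : ghom L k X Y" shows "(%i x. f i x +[Y (i + k)] g i x) : ghom L k X Y"
 by (intro ghomI lin_hom_add ghomD[OF f] ghomD(3)[OF g])

lemma arr_add:
 fixes X Y :: "int => ('a, 'c) module"
 assumes f: "f : ghom L k X Y" and g: "g : ghom L k X Y"
 shows "arr k X Y (%i x. f i x +[Y (i + k)] g i x) = arr k X Y f + arr k X Y g" proof (rule endo_eqI, rule tot_eqI)
 fix u i and M :: "('a, 'c) module" assume M: "abelian_group M"
 then interpret abelian_group M .
 show "Rep_tot (Rep_endo (arr k X Y (%i x. f i x +[Y (i + k)] g i x)) u) i M =
   Rep_tot (Rep_endo (arr k X Y f + arr k X Y g) u) i M"
  using M by (simp add: Rep_arr[OF f M] Rep_arr[OF g M] Rep_arr[OF ghom_add[OF f g] M] Rep_endo_plus Rep_tot_plus)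
qed

lemma ghom_uminus:
 assumes f: "f : ghom L k X Y" shows "(%i x. -[Y (i + k)] f i x) : ghom L k X Y"
 by (intro ghomI lin_hom_pointwise(2)[OF _ _ ghomD(3)[OF f]] ghomD[OF f])

lemma arr_uminus:
 fixes X Y :: "int => ('a, 'c) module"
 assumes f: "f : ghom L k X Y" shows "arr k X Y (%i x. -[Y (i + k)] f i x) = - arr k X Y f"
proof (rule endo_eqI, rule tot_eqI)
 fix u i and M :: "('a, 'c) module" assume M: "abelian_group M"
 then interpret abelian_group M .
 have mz: "-[M] 0[M] = 0[M]" by (rule minus_equality) simp_all
 show "Rep_tot (Rep_endo (arr k X Y (%i x. -[Y (i + k)] f i x)) u) i M =
   Rep_tot (Rep_endo (- arr k X Y f) u) i M"
  using M by (simp add: mz Rep_arr[OF f M] Rep_arr[OF ghom_uminus[OF f] M] Rep_endo_uminus Rep_tot_uminus)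
qed

lemma ghom_comp:
 assumes g: "g : ghom L k Y Z" and f: "f : ghom L l X Y" shows "(%i x. g (i + l) (f i x)) : ghom L (k + l) X Z"
proof (rule ghomI[OF ghomD(1)[OF f] ghomD(2)[OF g]])
 fix i
 have "g (i + l) : lin_hom L (Y (i + l)) (Z (i + (k + l)))" by (rule ghomD(4)[OF g]) simp
 thus "(%x. g (i + l) (f i x)) : lin_hom L (X i) (Z (i + (k + l)))" using lin_hom_comp ghomD(3)[OF f] by blast
qed

lemma arr_comp:
 fixes X Y Z :: "int => ('a, 'c) module"
 assumes g: "g : ghom L k Y Z" and f: "f : ghom L l X Y"
 shows "ecomp (arr k Y Z g) (arr l X Y f) = arr (k + l) X Z (%i x. g (i + l) (f i x))"
proof (rule endo_eqI, rule tot_eqI)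
 fix u i and M :: "('a, 'c) module" assume M: "abelian_group M"
 have "i - (k + l) + l = i - k" by simp
 thus "Rep_tot (Rep_endo (ecomp (arr k Y Z g) (arr l X Y f)) u) i M =
   Rep_tot (Rep_endo (arr (k + l) X Z (%i x. g (i + l) (f i x))) u) i M"
  using ghomD(7)[OF g] by (simp add: diff_diff_eq Rep_ecomp Rep_arr[OF g M] Rep_arr[OF f] Rep_arr[OF ghom_comp[OF g f] M])
qed

lemma arr_comp_eq_0D:
 assumes "ecomp (arr k Y Z g) (arr l X Y f) = 0" "g : ghom L k Y Z" "f : ghom L l X Y" "x :. (X i)"
  "j = i + l" "n = j + k" shows "g j (f i x) = 0[Z n]" proof -
 have "n = i + (k + l)" using assms(5,6) by simp
 thus ?thesis using assms(1,4,5) arr_eq_0_iff[OF ghom_comp[OF assms(2,3)]] arr_comp[OF assms(2,3)] by simp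
qed

lemma ghom_id: "graded_ob L X ==> (%i x. x) : ghom L 0 X X"
 by (auto intro!: ghomI lin_homI)

lemma gcat_big: "gcat ecomp (bhom L) gid (Collect (graded_ob L) :: (int => ('a, 'c) module) set)"
proof
 fix f :: "('a, 'c) tot endo" and k and X Y :: "int => ('a, 'c) module" assume f: "f : bhom L k X Y"
 then obtain u where u: "u : ghom L k X Y" "f = arr k X Y u" by (rule bhomE)
 show "X : Collect (graded_ob L) & Y : Collect (graded_ob L)" using ghomD[OF u(1)] by simp
 show "- f : bhom L k X Y" using bhomI[OF ghom_uminus[OF u(1)]] by (simp add: arr_uminus[OF u(1)] u(2))
 show "ecomp (gid Y) f = f" using arr_comp[OF ghom_id[OF ghomD(2)[OF u(1)]] u(1)] by (simp add: gid_def u(2))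
 show "ecomp f (gid X) = f" using arr_comp[OF u(1) ghom_id[OF ghomD(1)[OF u(1)]]] by (simp add: gid_def u(2))
 show "f + g : bhom L k X Y" if g: "g : bhom L k X Y" for g proof -
  obtain v where v: "v : ghom L k X Y" "g = arr k X Y v" using g by (rule bhomE)
  show ?thesis using bhomI[OF ghom_add[OF u(1) v(1)]] by (simp add: arr_add[OF u(1) v(1)] u(2) v(2))
 qed
next
 fix X Y :: "int => ('a, 'c) module" and k assume "X : Collect (graded_ob L)" "Y : Collect (graded_ob L)"
 thus "0 : bhom L k X Y" using bhomI[OF ghom_zero] arr_zero by (metis mem_Collect_eq)
next
 fix g f :: "('a, 'c) tot endo" and k l and X Y Z :: "int => ('a, 'c) module" assume gf: "g : bhom L k Y Z" "f : bhom L l X Y"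
 obtain u where u: "u : ghom L k Y Z" "g = arr k Y Z u" using gf(1) by (rule bhomE)
 obtain v where v: "v : ghom L l X Y" "f = arr l X Y v" using gf(2) by (rule bhomE)
 show "ecomp g f : bhom L (k + l) X Z"
  using bhomI[OF ghom_comp[OF u(1) v(1)]] by (simp add: arr_comp[OF u(1) v(1)] u(2) v(2))
next
 fix X :: "int => ('a, 'c) module" assume "X : Collect (graded_ob L)"
 thus "gid X : bhom L 0 X X" unfolding gid_def by (intro bhomI ghom_id) simp
qed (simp_all add: ecomp_assoc ecomp_add)

lemma gcat_restrict:
 assumes "gcat m H I U" "U' \<subseteq> U" shows "gcat m (%k X Y. if X : U' & Y : U' then H k X Y else {}) I U'" proof -
 interpret gcat m H I U by fact
 show ?thesis by unfold_locales (use assms(2) in "auto simp: m_assoc m_add_left m_add_right Id_left Id_right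
    intro: hom_zero hom_add hom_uminus hom_comp Id_hom split: if_splits")
qed

lemma short_exact_restrict:
 assumes g: "gcat m H I U" and s: "U' \<subseteq> U" and se: "gcat.short_exact m H a b X Y Z i p"
  and XYZ: "X : U'" "Y : U'" "Z : U'"
 shows "gcat.short_exact m (%k X Y. if X : U' & Y : U' then H k X Y else {}) a b X Y Z i p" proof -
 interpret B: gcat m H I U by fact
 interpret S: gcat m "%k X Y. if X : U' & Y : U' then H k X Y else {}" I U' using g s by (rule gcat_restrict)
 show ?thesis unfolding S.short_exact_def
  using XYZ B.short_exactD[OF se] B.short_exact_mono[OF se] B.short_exact_epi[OF se]
   B.short_exact_kernel[OF se] B.short_exact_cokernel[OF se] by (auto split: if_splits; blast)
qed

definition gses :: "('l, 'z) ring_scheme => int => int => (int => ('l, 'm) module) =>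
  (int => ('l, 'm) module) => (int => ('l, 'm) module) => ('l, 'm) tot endo => ('l, 'm) tot endo => bool"
 where "gses L a b X Y Z i p \<longleftrightarrow> (EX f:ghom L a X Y. EX g:ghom L b Y Z. i = arr a X Y f & p = arr b Y Z g &
  (ALL n. exact_seq L (X n) (Y (n + a)) (Z (n + a + b)) (f n) (g (n + a))))"

lemma gses_short_exact:
 fixes X Y Z :: "int => ('l, 'm) module"
 assumes "gses L a b X Y Z i p" shows "gcat.short_exact ecomp (bhom L) a b X Y Z i p" proof -
 interpret gcat ecomp "bhom L" gid "Collect (graded_ob L) :: (int => ('l, 'm) module) set" by (rule gcat_big)
 obtain f g where fg: "f : ghom L a X Y" "g : ghom L b Y Z" "i = arr a X Y f" "p = arr b Y Z g"
  and ex: "!!n. exact_seq L (X n) (Y (n + a)) (Z (n + a + b)) (f n) (g (n + a))" using assms unfolding gses_def by blast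
 note F = ghomD[OF fg(1)] and G = ghomD[OF fg(2)]
 have exY: "exact_seq L (X (n - a)) (Y n) (Z (n + b)) (f (n - a)) (g n)" for n using ex[of "n - a"] by simp
 have exZ: "exact_seq L (X (n - b - a)) (Y (n - b)) (Z n) (f (n - b - a)) (g (n - b))" for n
  using ex[of "n - b - a"] by simp
 have ker: "EX z':bhom L (k - a) A X. z = ecomp i z'" if z: "z : bhom L k A Y" and pz: "ecomp p z = 0" for z k A proof -
  obtain h where h: "h : ghom L k A Y" "z = arr k A Y h" using z by (rule bhomE)
  have gh: "g (n + k) (h n x) = 0[Z (n + k + b)]" if "x :. (A n)" for n x
   using pz unfolding fg h by (rule arr_comp_eq_0D[OF _ fg(2) h(1) that]) simp_all
  have "EX v:lin_hom L (A n) (X (n + k - a)). ALL x:carrier (A n). h n x = f (n + k - a) (v x)" for n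
   by (rule exact_seq_kernel[OF exY]) (use ghomD[OF h(1)] gh in auto)
  then obtain v where v: "!!n. v n : lin_hom L (A n) (X (n + k - a))"
   "!!n x. x :. (A n) ==> h n x = f (n + k - a) (v n x)" by metis
  have vg: "v : ghom L (k - a) A X" by (rule ghomI) (use ghomD[OF h(1)] F v(1) in "auto simp: add_diff_eq")
  have "ecomp i (arr (k - a) A X v) = arr k A Y (%n x. f (n + (k - a)) (v n x))"
   using arr_comp[OF fg(1) vg] by (simp add: fg)
  also have "\<dots> = z" unfolding h(2) using ghom_comp[OF fg(1) vg]
   by (intro arr_eqI[OF _ h(1)]) (simp_all add: v(2) add_diff_eq)
  finally show ?thesis using bhomI[OF vg] by metis
 qed
 have coker: "EX z':bhom L (k - b) Z A. z = ecomp z' p" if z: "z : bhom L k Y A" and pz: "ecomp z i = 0" for z k A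
 proof -
  obtain h where h: "h : ghom L k Y A" "z = arr k Y A h" using z by (rule bhomE)
  have hf: "h (n + a) (f n x) = 0[A (n + a + k)]" if "x :. (X n)" for n x
   using pz unfolding fg h by (rule arr_comp_eq_0D[OF _ h(1) fg(1) that]) simp_all
  have "EX v:lin_hom L (Z n) (A (n - b + k)). ALL x:carrier (Y (n - b)). h (n - b) x = v (g (n - b) x)" for n
   by (rule exact_seq_cokernel[OF exZ]) (use ghomD[OF h(1)] hf[of _ "n - b - a"] in auto)
  then obtain v where v: "!!n. v n : lin_hom L (Z n) (A (n - b + k))"
   "!!n x. x :. (Y (n - b)) ==> h (n - b) x = v n (g (n - b) x)" by metis
  have v2: "h n x = v (n + b) (g n x)" if "x :. (Y n)" for n x using v(2)[of x "n + b"] that by simp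
  have vg: "v : ghom L (k - b) Z A" by (rule ghomI) (use ghomD[OF h(1)] G v(1) in "auto simp: add_diff_eq diff_add_eq")
  have "ecomp (arr (k - b) Z A v) p = arr k Y A (%n x. v (n + b) (g n x))" using arr_comp[OF vg fg(2)] by (simp add: fg)
  also have "\<dots> = z" unfolding h(2) using ghom_comp[OF vg fg(2)] by (intro arr_eqI[OF _ h(1)]) (simp_all add: v2)
  finally show ?thesis using bhomI[OF vg] by metis
 qed
 have mono: "z = 0" if z: "z : bhom L k A X" and iz: "ecomp i z = 0" for z k A proof -
  obtain h where h: "h : ghom L k A X" "z = arr k A X h" using z by (rule bhomE)
  have "h n x = 0[X (n + k)]" if x: "x :. (A n)" for n x proof (rule inj_onD[OF exact_seqD(6)[OF ex[of "n + k"]]])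
   have "f (n + k) (h n x) = 0[Y (n + k + a)]"
    using iz unfolding fg h by (rule arr_comp_eq_0D[OF _ fg(1) h(1) x]) simp_all
   also have "\<dots> = f (n + k) 0[X (n + k)]" using lin_hom_zero[OF F(7,8,3)] by simp
   finally show "f (n + k) (h n x) = f (n + k) 0[X (n + k)]" .
  qed (use lin_homD(1)[OF ghomD(3)[OF h(1)] x] F(7) in "auto intro: abelian_groupE")
  thus ?thesis using arr_eq_0_iff[OF h(1)] h(2) by simp
 qed
 have epi: "z = 0" if z: "z : bhom L k Z A" and zp: "ecomp z p = 0" for z k A proof -
  obtain h where h: "h : ghom L k Z A" "z = arr k Z A h" using z by (rule bhomE)
  have "h n y = 0[A (n + k)]" if "y :. (Z n)" for n y proof -
   obtain x where x: "x :. (Y (n - b))" "y = g (n - b) x" using exact_seqD(7)[OF exZ[of n]] `y :. (Z n)` by auto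
   have "h n (g (n - b) x) = 0[A (n + k)]"
    using zp unfolding fg h by (rule arr_comp_eq_0D[OF _ h(1) fg(2) x(1)]) simp_all
   thus ?thesis using x by simp
  qed
  thus ?thesis using arr_eq_0_iff[OF h(1)] h(2) by simp
 qed
 have "ecomp p i = 0" unfolding fg(3,4) arr_comp[OF fg(2,1)] arr_eq_0_iff[OF ghom_comp[OF fg(2,1)]]
  using exact_seqD(8)[OF ex] by (fastforce simp: algebra_simps)
 thus ?thesis unfolding short_exact_def using bhomI[OF fg(1)] bhomI[OF fg(2)] ker coker mono epi by (simp add: fg(3,4))
qed

lemma gcat_ses_big: "gcat_ses ecomp (bhom L) gid (Collect (graded_ob L)) (gses L)"
 by (intro gcat_ses.intro gcat_big gcat_ses_axioms.intro gses_short_exact)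

section \<open>Finitely generated modules over an artin algebra\<close>

lemma (in module) submoduleI':
 assumes "H \<subseteq> carrier M" "0[M] : H" "!!x y. x : H ==> y : H ==> x +[M] y : H"
  "!!a x. a :. R ==> x : H ==> a *[M] x : H" shows "submodule H R M" proof (rule submoduleI)
 fix x assume x: "x : H"
 have "-[M] x = (\<ominus> \<one>) *[M] x" using x assms(1) by (auto simp: smult_l_minus)
 also have "\<dots> : H" using assms(4)[of "\<ominus> \<one>" x] x by simp
 finally show "-[M] x : H" .
qed (use assms in auto)

lemma (in module) submodule_zero: "submodule H R M ==> 0[M] : H"
 using subgroup.one_closed[of H "add_monoid M"] submodule.axioms(1) by fastforce

text \<open>A composition series of \<open>R\<close> makes every finite span of finite length;
  conversely a series provides the generators one by one.\<close>

lemma (in artinian_cring) fin_length_iff: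
 fixes M :: "('a, 'c) module"
 assumes M: "module R M" shows "fin_length R M \<longleftrightarrow> finitely_generated R M" proof -
 interpret M: module R M by fact
 interpret V: rmod R "act M" "embedded M" by (rule rmod_embedded) fact
 note ab = M.abelian_group_axioms
 show ?thesis proof
  assume "fin_length R M"
  then obtain xs where xs: "set xs \<subseteq> embedded M" "V.spans xs = embedded M"
   unfolding fin_length_def using finite_length_finitely_spanned by blast
  have S: "prj M ` set xs \<subseteq> carrier M" using prj_mem[OF ab] by auto
  have "N = carrier M" if N: "submodule N R M" "prj M ` set xs \<subseteq> N" for N proof -
   note Nc = M.submoduleE(1,4,5)[OF N(1)]
   have "rmod R (act M) (emb 0 M ` N)" proof (rule V.rmodI_sub)
    show "0 : emb 0 M ` N" using M.submodule_zero[OF N(1)] emb_zero[OF ab, of 0] by force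
    show "x + y : emb 0 M ` N" if xy: "x : emb 0 M ` N" "y : emb 0 M ` N" for x y proof -
     obtain u v where "x = emb 0 M u" "y = emb 0 M v" "u : N" "v : N" using xy by auto
     hence "x + y = emb 0 M (u +[M] v)" "u +[M] v : N" using Nc by (auto simp: emb_add[OF ab] subset_iff)
     thus ?thesis by (rule image_eqI)
    qed
    show "act M r x : emb 0 M ` N" if "r :. R" "x : emb 0 M ` N" for r x
     using that Nc act_emb[OF M] by (auto simp: subset_iff)
   qed (use Nc in "auto simp: embedded_def")
   moreover have "set xs \<subseteq> emb 0 M ` N" proof
    fix x assume x: "x : set xs"
    then obtain u where u: "x = emb 0 M u" "u :. M" using xs(1) by (auto simp: embedded_def)
    hence "prj M x = u" using ab by simp
    thus "x : emb 0 M ` N" using u N(2) x by auto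
   qed
   ultimately have sub: "embedded M \<subseteq> emb 0 M ` N" using V.spans_minimal xs(2) by metis
   have "x : N" if x: "x :. M" for x proof -
    obtain u where "emb 0 M x = emb 0 M u" "u : N" using sub x by (auto simp: embedded_def)
    thus ?thesis using emb_eq_iff[OF ab x, of u] Nc(1) by auto
   qed
   thus ?thesis using Nc(1) by auto
  qed
  thus "finitely_generated R M" unfolding finitely_generated_def using S by blast
 next
  assume "finitely_generated R M"
  then obtain S where S: "finite S" "S \<subseteq> carrier M" "ALL N. submodule N R M & S \<subseteq> N --> N = carrier M"
   unfolding finitely_generated_def by (elim exE conjE)
  obtain ys where ys: "set ys = S" using S(1) finite_list by blast
  have sub: "set (map (emb 0 M) ys) \<subseteq> embedded M" using S(2) ys by (auto simp: embedded_def)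
  define U where "U = V.spans (map (emb 0 M) ys)"
  have U: "rmod R (act M) U" "U \<subseteq> embedded M" "set (map (emb 0 M) ys) \<subseteq> U"
   using V.spans[OF sub] by (auto simp: U_def)
  interpret U: rmod R "act M" U by (rule U)
  have "submodule {x : carrier M. emb 0 M x : U} R M" by (rule M.submoduleI')
    (use U.zero_mem U.add_mem U.smult_mem in "auto simp: emb_zero[OF ab] emb_add[OF ab] simp flip: act_emb[OF M]")
  hence "{x : carrier M. emb 0 M x : U} = carrier M" by (intro S(3)[rule_format] conjI) (use S(2) U(3) ys in auto)
  hence "embedded M = U" using U(2) by (auto simp: embedded_def)
  thus "fin_length R M"
   unfolding fin_length_def using V.finite_length_spans[OF ideal_chain_zero sub] by (simp add: U_def)
 qed
qed

definition base_module :: "('r, 'l, 'y) module_scheme => ('l, 'm) module => ('r, 'm) module"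
 where "base_module L M = \<lparr>carrier = carrier M, mult = undefined, one = undefined,
  zero = 0[M], add = add M, smult = (%r x. (r *[L] 1[L]) *[M] x)\<rparr>"

lemma base_module_simps [simp]:
 "carrier (base_module L M) = carrier M" "0[base_module L M] = 0[M]"
 "x +[base_module L M] y = x +[M] y"
 "r *[base_module L M] x = (r *[L] 1[L]) *[M] x" by (simp_all add: base_module_def)

text \<open>Finite length over \<open>R\<close> passes to submodules and quotients at once; for
  modules over an artin algebra it coincides with finite presentation.\<close>

definition small :: "('r, 'z) ring_scheme => ('r, 'l, 'y) module_scheme => ('l, 'm) module => bool"
 where "small R L M \<longleftrightarrow> right_module L M & fin_length R (base_module L M)"

lemma free_right_module_simps [simp]:
 "carrier (free_right_module A n) = {..<n} \<rightarrow>\<^sub>E carrier A"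
 "0[free_right_module A n] = (\<lambda>i\<in>{..<n}. 0[A])"
 "x +[free_right_module A n] y = (\<lambda>i\<in>{..<n}. x i +[A] y i)"
 "a *[free_right_module A n] x = (\<lambda>i\<in>{..<n}. x i **[A] a)" by (simp_all add: free_right_module_def)

lemma free_right_module: "ring A ==> right_module A (free_right_module A n)"
proof -
 assume "ring A"
 then interpret A: ring A .
 let ?F = "free_right_module A n"
 have ext: "(\<lambda>i\<in>{..<n}. f (x i)) = x" if "x : {..<n} \<rightarrow>\<^sub>E carrier A" "!!a. a :. A ==> f a = a" for f x
  using that by (auto simp: fun_eq_iff PiE_def extensional_def)
 have "abelian_group ?F" proof (rule abelian_groupI)
  fix x y z assume xyz: "x : carrier ?F" "y : carrier ?F" "z : carrier ?F"
  hence m: "x i :. A" "y i :. A" "z i :. A" if "i < n" for i using that by auto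
  show "x +[?F] y : carrier ?F" using m by auto
  show "x +[?F] y +[?F] z = x +[?F] (y +[?F] z)" using m by (auto intro!: restrict_ext simp: A.a_assoc)
  show "x +[?F] y = y +[?F] x" using m by (auto intro!: restrict_ext simp: A.a_comm)
 next
  fix x assume x: "x : carrier ?F"
  hence m: "x i :. A" if "i < n" for i using that by auto
  show "0[?F] +[?F] x = x" using ext[of x "%a. 0[A] +[A] a"] x by (simp cong: restrict_cong)
  have "(\<lambda>i\<in>{..<n}. -[A] x i) +[?F] x = 0[?F]" using m by (auto intro!: restrict_ext simp: A.l_neg)
  moreover have "(\<lambda>i\<in>{..<n}. -[A] x i) : carrier ?F" using m by auto
  ultimately show "EX y:carrier ?F. y +[?F] x = 0[?F]" by blast
 qed auto
 thus ?thesis proof (rule right_module.intro[OF `ring A` _ right_module_axioms.intro])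
  fix x assume x: "x : carrier ?F"
  hence m: "x i :. A" if "i < n" for i using that by auto
  show "1[A] *[?F] x = x" using ext[of x "%a. a **[A] 1[A]"] x by (simp cong: restrict_cong)
  fix a assume a: "a :. A"
  show "a *[?F] x : carrier ?F" using a m by auto
  show "(a +[A] b) *[?F] x = a *[?F] x +[?F] b *[?F] x" if "b :. A" for b
   using a m that by (auto intro!: restrict_ext simp: A.r_distr)
  show "(a **[A] b) *[?F] x = b *[?F] (a *[?F] x)" if "b :. A" for b
   using a m that by (auto intro!: restrict_ext simp: A.m_assoc)
  fix y assume y: "y : carrier ?F"
  hence "y i :. A" if "i < n" for i using that by auto
  thus "a *[?F] (x +[?F] y) = a *[?F] x +[?F] a *[?F] y" using a m by (auto intro!: restrict_ext simp: A.l_distr)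
 qed
qed

text \<open>\<open>W\<close> need not contain inverses explicitly, as these are multiples by \<open>-1\<close>.\<close>

definition generated :: "('l, 'z) ring_scheme => ('l, 'm) module => 'm set => bool"
 where "generated A M S \<longleftrightarrow> S \<subseteq> carrier M & (ALL W. W \<subseteq> carrier M --> 0[M] : W -->
  (ALL x:W. ALL y:W. x +[M] y : W) --> (ALL a:carrier A. ALL x:W. a *[M] x : W) --> S \<subseteq> W --> W = carrier M)"

lemma generatedD:
 assumes "generated A M S" "W \<subseteq> carrier M" "0[M] : W" "!!x y. x : W ==> y : W ==> x +[M] y : W"
  "!!a x. a :. A ==> x : W ==> a *[M] x : W" "S \<subseteq> W" shows "W = carrier M"
 by (rule assms(1)[unfolded generated_def, THEN conjunct2, rule_format, OF assms(2-6)])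

lemma generated_free:
 assumes "ring A"
 shows "generated A (free_right_module A n) ((%k. \<lambda>i\<in>{..<n}. if i = k then 1[A] else 0[A]) ` {..<n})"
 unfolding generated_def proof (intro conjI allI impI)
 interpret A: ring A by fact
 let ?F = "free_right_module A n" and ?e = "%k. \<lambda>i\<in>{..<n}. if i = k then 1[A] else 0[A]"
 have "?e k : carrier ?F" for k by (simp add: restrict_PiE_iff)
 thus "?e ` {..<n} \<subseteq> carrier ?F" by blast
 fix W assume W: "W \<subseteq> carrier ?F" "0[?F] : W" "ALL x:W. ALL y:W. x +[?F] y : W"
  "ALL a:carrier A. ALL x:W. a *[?F] x : W" "?e ` {..<n} \<subseteq> W"
 have "x : W" if x: "x : carrier ?F" for x proof -
  have m: "x i :. A" if "i < n" for i using that x by auto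
  have "(\<lambda>i\<in>{..<n}. if i < k then x i else 0[A]) : W" if "k <= n" for k using that proof (induction k)
   case 0 show ?case using W(2) by (simp add: restrict_def)
  next
   case (Suc k)
   have e: "?e k : W" by (rule subsetD[OF W(5)], rule imageI) (use Suc.prems in simp)
   have "(\<lambda>i\<in>{..<n}. if i < k then x i else 0[A]) +[?F] x k *[?F] ?e k : W"
    by (rule W(3)[rule_format, OF Suc.IH W(4)[rule_format, OF m e]]) (use Suc.prems in simp_all)
   also have "(\<lambda>i\<in>{..<n}. if i < k then x i else 0[A]) +[?F] x k *[?F] ?e k =
     (\<lambda>i\<in>{..<n}. if i < Suc k then x i else 0[A])" unfolding free_right_module_simps
   proof (rule restrict_ext)
    fix i assume "i : {..<n}"
    thus "(\<lambda>i\<in>{..<n}. if i < k then x i else 0[A]) i +[A] (\<lambda>i\<in>{..<n}. ?e k i **[A] x k) i =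
      (if i < Suc k then x i else 0[A])" using m[of i] m[of k] Suc.prems by (cases i k rule: linorder_cases) simp_all
   qed
   finally show ?case .
  qed
  from this[of n] have "(\<lambda>i\<in>{..<n}. if i < n then x i else 0[A]) : W" by blast
  also have "(\<lambda>i\<in>{..<n}. if i < n then x i else 0[A]) = restrict x {..<n}" by (rule restrict_ext) simp
  also have "\<dots> = x" using x by (simp add: PiE_restrict)
  finally show ?thesis .
 qed
 thus "W = carrier ?F" using W(1) by blast
qed

primrec lincomb :: "('l, 'm) module => (nat => 'm) => nat => (nat => 'l) => 'm" where "lincomb M y 0 x = 0[M]"
 | "lincomb M y (Suc k) x = lincomb M y k x +[M] x k *[M] y k"

lemma free_cover:
 fixes M :: "('l, 'm) module"
 assumes M: "right_module A M" and S: "generated A M S" "finite S"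
 shows "EX n. EX p:lin_hom A (free_right_module A n) M. p ` carrier (free_right_module A n) = carrier M" proof -
 interpret M: right_module A M by fact
 obtain ys where ys: "set ys = S" using S(2) finite_list by blast
 define n where "n = length ys"
 let ?F = "free_right_module A n" and ?p = "lincomb M (%i. ys ! i)"
 have y: "ys ! k :. M" if "k < n" for k using that S(1) ys by (auto simp: generated_def n_def)
 interpret F: right_module A ?F by (rule free_right_module[OF M.ring_axioms])
 have cl: "?p k x :. M" if "k <= n" "x : carrier ?F" for k x proof -
  have "x i :. A" if "i < n" for i using that `x : carrier ?F` by auto
  thus ?thesis using `k <= n` by (induction k) (simp_all add: M.smult_closed y)
 qed
 have p: "?p n : lin_hom A ?F M" proof (rule lin_homI)
  fix x assume x: "x : carrier ?F"
  hence m: "x i :. A" if "i < n" for i using that by auto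
  show "?p n x :. M" using cl x by blast
  show "?p n (x +[?F] z) = ?p n x +[M] ?p n z" if z: "z : carrier ?F" for z proof -
   have mz: "z i :. A" if "i < n" for i using that z by auto
   have "?p k (x +[?F] z) = ?p k x +[M] ?p k z" if "k <= n" for k using that proof (induction k)
    case (Suc k)
    hence "(x +[?F] z) k *[M] ys ! k = x k *[M] ys ! k +[M] z k *[M] ys ! k" using m mz y by (simp add: M.smult_l_distr)
    thus ?case using Suc m mz y cl[OF _ x, of k] cl[OF _ z, of k] M.smult_closed
     by (simp add: M.M.a_ac del: free_right_module_simps)
   qed simp
   thus ?thesis by simp
  qed
  show "?p n (a *[?F] x) = a *[M] ?p n x" if a: "a :. A" for a proof -
   have "?p k (a *[?F] x) = a *[M] ?p k x" if "k <= n" for k using that proof (induction k)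
    case (Suc k)
    hence "(a *[?F] x) k *[M] ys ! k = a *[M] (x k *[M] ys ! k)" using m y a by (simp add: M.smult_assoc)
    thus ?case using Suc m y a cl[OF _ x, of k] M.smult_closed
     by (simp add: M.smult_r_distr del: free_right_module_simps)
   qed (simp add: M.smult_zero a)
   thus ?thesis by simp
  qed
 qed
 have "?p n ` carrier ?F = carrier M" proof (rule generatedD[OF S(1) lin_hom_image[OF F.right_module_axioms M p]])
  show "S \<subseteq> ?p n ` carrier ?F" proof
   fix s assume "s : S"
   then obtain k where k: "k < n" "s = ys ! k" using ys by (auto simp: n_def in_set_conv_nth)
   let ?e = "\<lambda>i\<in>{..<n}. if i = k then 1[A] else 0[A]"
   have "?p i ?e = (if k < i then ys ! k else 0[M])" if "i <= n" for i
    using that by (induction i) (auto simp: y M.zero_smult M.smult_one k less_Suc_eq)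
   hence "?p n ?e = s" using k by simp
   moreover have "?e : carrier ?F" by (simp add: restrict_PiE_iff)
   ultimately show "s : ?p n ` carrier ?F" by (metis image_eqI)
  qed
 qed
 thus ?thesis using p by blast
qed

section \<open>Finite length and finite presentation over an artin algebra\<close>

context artin_algebra
begin

lemma unit_smult [simp]:
 "r :. R ==> r *[L] 1[L] :. L" by simp

lemma unit_smult_mult:
 assumes "r :. R" "a :. L" shows "(r *[L] 1[L]) **[L] a = r *[L] a" "a **[L] (r *[L] 1[L]) = r *[L] a"
 using assms by (simp_all add: smult_mult_left smult_mult_right)

lemma module_base:
 fixes M :: "('c, 'm) module"
 assumes "right_module L M" shows "module R (base_module L M)" proof -
 interpret M: right_module L M by fact
 have ab: "abelian_group (base_module L M)" by (rule abelian_groupI) (auto simp: M.M.a_ac intro: M.M.l_neg)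
 have as: "((r **[R] s) *[L] 1[L]) *[M] x = (r *[L] 1[L]) *[M] ((s *[L] 1[L]) *[M] x)"
  if "r :. R" "s :. R" "x :. M" for r s x proof -
  have "(r **[R] s) *[L] 1[L] = (s *[L] 1[L]) **[L] (r *[L] 1[L])"
   using that by (simp add: unit_smult_mult(2) smult_assoc1)
  thus ?thesis using that by (simp add: M.smult_assoc)
 qed
 show ?thesis by (rule moduleI[OF cring_axioms ab])
   (simp_all add: M.smult_closed M.smult_l_distr M.smult_r_distr M.smult_one as smult_l_distr)
qed

lemma lin_hom_base:
 "f : lin_hom L M N ==> f : lin_hom R (base_module L M) (base_module L N)" by (auto simp: lin_hom_def)

lemma smallD: "small R L M ==> right_module L M" "small R L M ==> fin_length R (base_module L M)"
 by (auto simp: small_def)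

lemma small_image:
 assumes "small R L M" "right_module L N" "f : lin_hom L M N" "f ` carrier M = carrier N" shows "small R L N"
 using fin_length_image[OF _ module_base module_base lin_hom_base[OF assms(3)]] assms by (simp add: small_def)

lemma small_sub:
 assumes "small R L N" "right_module L M" "f : lin_hom L M N" "inj_on f (carrier M)" shows "small R L M"
 using fin_length_sub[OF _ module_base module_base lin_hom_base[OF assms(3)]] assms by (simp add: small_def)

lemma small_of_generated:
 fixes M :: "('c, 'm) module"
 assumes M: "right_module L M" and S: "generated L M S" "finite S" shows "small R L M" proof -
 interpret M: right_module L M by fact
 let ?B = "base_module L M"
 interpret B: module R ?B by (rule module_base[OF M])
 obtain T where T: "finite T" "T \<subseteq> carrier L" "ALL N. submodule N R L & T \<subseteq> N --> N = carrier L"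
  using finitely_generated unfolding finitely_generated_def by (elim exE conjE)
 have SM: "S \<subseteq> carrier M" using S(1) by (simp add: generated_def)
 \<comment> \<open>Products of \<open>R\<close>-generators of \<open>L\<close> with
   \<open>L\<close>-generators of \<open>M\<close> generate \<open>M\<close> over
   \<open>R\<close>.\<close>
 define U where "U = (%(t, s). t *[M] s) ` (T \<times> S)"
 have UM: "U \<subseteq> carrier M" using T(2) SM by (auto simp: U_def intro!: M.smult_closed)
 have "N = carrier ?B" if N: "submodule N R ?B" "U \<subseteq> N" for N proof -
  note Nc = B.submoduleE(1,4,5)[OF N(1)] B.submodule_zero[OF N(1)]
  have sN: "l *[M] s : N" if s: "s : S" and l: "l :. L" for s l proof -
   have sM: "s :. M" using s SM by auto
   have "submodule {l : carrier L. l *[M] s : N} R L" proof (rule submoduleI')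
    show "0[L] : {l : carrier L. l *[M] s : N}" using Nc(4) sM by (simp add: M.zero_smult)
    show "r *[L] x : {l : carrier L. l *[M] s : N}" if "r :. R" "x : {l : carrier L. l *[M] s : N}" for r x
     using that Nc(2)[of r "x *[M] s"] sM
      M.smult_assoc[of x "r *[L] 1[L]" s] by (simp add: unit_smult_mult)
   qed (use Nc(3) sM in "auto simp: M.smult_l_distr")
   moreover have "T \<subseteq> {l : carrier L. l *[M] s : N}" using T(2) s N(2) by (auto simp: U_def)
   ultimately have "{l : carrier L. l *[M] s : N} = carrier L" by (intro T(3)[rule_format] conjI)
   thus ?thesis using l by blast
  qed
  define W where "W = {x : carrier M. ALL l:carrier L. l *[M] x : N}"
  have "W = carrier M" proof (rule generatedD[OF S(1)])
   show "S \<subseteq> W" using SM sN by (auto simp: W_def)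
   show "0[M] : W" using Nc(4) by (simp add: W_def M.smult_zero)
   show "x +[M] y : W" if "x : W" "y : W" for x y using that Nc(3) by (simp add: W_def M.smult_r_distr)
   show "a *[M] x : W" if "a :. L" "x : W" for a x using that by (simp add: W_def M.smult_closed flip: M.smult_assoc)
  qed (auto simp: W_def)
  hence "x : N" if "x :. M" for x proof -
   have "1[L] *[M] x : N" using that `W = carrier M` unfolding W_def by blast
   thus ?thesis using that by (simp add: M.smult_one)
  qed
  thus ?thesis using Nc(1) by auto
 qed
 hence "finitely_generated R ?B"
  unfolding finitely_generated_def using UM T(1) S(2) by (intro exI[of _ U]) (simp add: U_def)
 thus ?thesis using fin_length_iff[OF module_base[OF M]] M by (simp add: small_def)
qed

lemma small_free: "small R L (free_right_module L n)"
 by (rule small_of_generated[OF free_right_module[OF L.ring_axioms] generated_free[OF L.ring_axioms]]) simp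

lemma small_generated:
 fixes M :: "('c, 'm) module"
 assumes "small R L M" obtains S where "finite S" "generated L M S" proof -
 interpret M: right_module L M by (rule smallD) fact
 let ?B = "base_module L M"
 interpret B: module R ?B by (rule module_base[OF smallD(1)[OF assms]])
 have "finitely_generated R ?B" using fin_length_iff[OF B.module_axioms] smallD(2)[OF assms] by simp
 then obtain S where S: "finite S" "S \<subseteq> carrier ?B" "ALL N. submodule N R ?B & S \<subseteq> N --> N = carrier ?B"
  unfolding finitely_generated_def by (elim exE conjE)
 have "generated L M S" unfolding generated_def proof (intro conjI allI impI)
  show "S \<subseteq> carrier M" using S(2) by simp
  fix W assume W: "W \<subseteq> carrier M" "0[M] : W" "ALL x:W. ALL y:W. x +[M] y : W"
   "ALL a:carrier L. ALL x:W. a *[M] x : W" "S \<subseteq> W"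
  have "submodule W R ?B" by (rule B.submoduleI') (use W in simp_all)
  hence "W = carrier ?B" using W(5) by (intro S(3)[rule_format] conjI)
  thus "W = carrier M" by simp
 qed
 thus thesis using S(1) that by blast
qed

lemma small_cover:
 fixes M :: "('c, 'm) module"
 assumes "small R L M"
 obtains n p where "p : lin_hom L (free_right_module L n) M" "p ` carrier (free_right_module L n) = carrier M"
 using small_generated[OF assms] free_cover[OF smallD(1)[OF assms]] by metis

text \<open>The kernel of a finite free cover is a submodule of a module of finite length, so it is
  again finitely generated.\<close>

lemma finitely_presented_iff_small:
 fixes M :: "('c, 'm) module" shows "finitely_presented L M \<longleftrightarrow> small R L M" proof
 assume "finitely_presented L M"
 then obtain n p where "right_module L M" "p : lin_hom L (free_right_module L n) M"
  "p ` carrier (free_right_module L n) = carrier M" unfolding finitely_presented_def by blast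
 thus "small R L M" using small_image[OF small_free] by blast
next
 assume M: "small R L M"
 note Mr = smallD(1)[OF M]
 obtain n p where p: "p : lin_hom L (free_right_module L n) M" "p ` carrier (free_right_module L n) = carrier M"
  by (rule small_cover[OF M])
 let ?F = "free_right_module L n"
 let ?K = "?F\<lparr>carrier := hom_kernel ?F M p\<rparr>"
 note ex = exact_seq_of_kernel[OF free_right_module[OF L.ring_axioms] Mr p]
 note K = exact_seqD[OF ex]
 have sK: "small R L ?K" by (rule small_sub[OF small_free K(1,4)]) simp
 obtain m g where g: "g : lin_hom L (free_right_module L m) ?K" "g ` carrier (free_right_module L m) = carrier ?K"
  by (rule small_cover[OF sK])
 have "g : lin_hom L (free_right_module L m) ?F" using lin_hom_comp[OF K(4) g(1)] by simp
 moreover have "g ` carrier (free_right_module L m) = hom_kernel ?F M p" using g(2) by simp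
 ultimately show "finitely_presented L M" unfolding finitely_presented_def using Mr p by blast
qed

end

lemma lin_hom_inverse:
 assumes M: "right_module A M" and N: "right_module A N" and f: "f : lin_hom A M N" "inj_on f (carrier M)"
  "f ` carrier M = carrier N" shows "inv_into (carrier M) f : lin_hom A N M" proof (rule lin_homI)
 interpret M: right_module A M by fact
 interpret N: right_module A N by fact
 fix x assume x: "x :. N"
 let ?g = "inv_into (carrier M) f"
 have g: "?g x :. M" "f (?g x) = x" if "x :. N" for x using that f(3) by (metis inv_into_into, metis f_inv_into_f)
 show "?g x :. M" using g x by simp
 show "?g (x +[N] y) = ?g x +[M] ?g y" if "y :. N" for y
  by (rule inv_into_f_eq[OF f(2)]) (use x that g lin_homD(2)[OF f(1)] in simp_all)
 show "?g (a *[N] x) = a *[M] ?g x" if "a :. A" for a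
  by (rule inv_into_f_eq[OF f(2)]) (use x that g lin_homD(3)[OF f(1)] M.smult_closed in simp_all)
qed

text \<open>This is where \<open>\<iota>\<close> enters: an element of \<open>M\<close> is coded by
  the list of coefficients of a chosen preimage in a free cover, and \<open>\<iota>\<close> turns
  lists into elements of the universe \<open>'m\<close>.\<close>

lemma (in artin_algebra) small_copy:
 fixes M :: "('c, 'n) module" and \<iota> :: "'c list => 'm"
 assumes M: "small R L M" and \<iota>: "inj_on \<iota> (lists (carrier L))"
 obtains N :: "('c, 'm) module" and q q' where "small R L N" "q : lin_hom L M N" "q' : lin_hom L N M"
  "ALL x:carrier M. q' (q x) = x" "ALL y:carrier N. q (q' y) = y" proof -
 note Mr = smallD(1)[OF M]
 interpret M: right_module L M by fact
 obtain n p where p: "p : lin_hom L (free_right_module L n) M" "p ` carrier (free_right_module L n) = carrier M"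
  by (rule small_cover[OF M])
 define c where "c = inv_into (carrier (free_right_module L n)) p"
 have c: "c x :. (free_right_module L n)" "p (c x) = x" if "x :. M" for x
  unfolding c_def using that p(2) by (metis inv_into_into, metis f_inv_into_f)
 define q where "q x = \<iota> (map (c x) [0..<n])" for x
 have inj: "x = y" if "x :. M" "y :. M" "q x = q y" for x y proof -
  have "c x i :. L" "c y i :. L" if "i < n" for i using c(1)[OF `x : carrier M`] c(1)[OF `y : carrier M`] that by auto
  hence "map (c x) [0..<n] = map (c y) [0..<n]"
   using that(3) unfolding q_def by (intro inj_onD[OF \<iota>]) (auto simp: in_lists_conv_set)
  hence "c x i = c y i" if "i : {..<n}" for i using that by simp
  hence "c x = c y"
   using c(1)[OF that(1)] c(1)[OF that(2)] unfolding free_right_module_simps by (rule PiE_ext[rotated 2])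
  thus ?thesis using c(2) that(1,2) by metis
 qed
 define N where "N = induced_module M q"
 have N: "right_module L N" "q : lin_hom L M N" "q ` carrier M = carrier N"
  unfolding N_def by (intro induced_module[OF Mr]; metis inj)+ (simp add: induced_module_def)
 have qi: "inj_on q (carrier M)" using inj by (auto intro: inj_onI)
 note inv = lin_hom_inverse[OF Mr N(1,2) qi N(3)]
 show thesis by (rule that[OF small_image[OF M N] N(2) inv]) (use qi N(3) in "auto simp: f_inv_into_f")
qed

section \<open>The injective envelope of the semisimple quotient\<close>

lemma (in cring) jacobson_radical_ideal: "ideal (jacobson_radical R) R"
 unfolding jacobson_radical_def ideal_iff proof (intro conjI ballI)
 have "ideal n R" if "n : {I. maximalideal I R}" for n using that maximalideal.axioms(1) by auto
 hence n: "\<zero> : n" "!!x y. x : n ==> y : n ==> x \<oplus> y : n" "!!r x. r :. R ==> x : n ==> r \<otimes> x : n"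
  if "n : {I. maximalideal I R}" for n using that unfolding ideal_iff by blast+
 show "\<zero> : carrier R \<inter> \<Inter> {I. maximalideal I R}" using n(1) by blast
 show "x \<oplus> y : carrier R \<inter> \<Inter> {I. maximalideal I R}"
  if "x : carrier R \<inter> \<Inter> {I. maximalideal I R}" "y : carrier R \<inter> \<Inter> {I. maximalideal I R}" for x y
  using that n(2) by auto
 show "r \<otimes> x : carrier R \<inter> \<Inter> {I. maximalideal I R}"
  if "r :. R" "x : carrier R \<inter> \<Inter> {I. maximalideal I R}" for r x using that n(3) by auto
qed auto

lemma (in cring) maximalideal_subset_eq:
 assumes "maximalideal n R" "maximalideal m R" "n \<subseteq> m" shows "m = n" proof -
 have m: "ideal m R" using assms(2) by (rule maximalideal.axioms)
 hence "m \<subseteq> carrier R" unfolding ideal_iff by blast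
 thus ?thesis using maximalideal.I_maximal[OF assms(1) m assms(3)] maximalideal.I_notcarr[OF assms(2)] by auto
qed

text \<open>By the minimum condition some finite intersection of maximal ideals lies in the radical.
  As \<open>m\<close> is prime, there is an element outside \<open>m\<close> but in all the other
  ideals of that intersection; modulo the radical it spans a copy of \<open>R / m\<close>.\<close>

lemma (in artinian_cring) jacobson_radical_colon:
 assumes m: "maximalideal m R"
 obtains x where "x :. R" "x ~: m" "!!r. r : m ==> r \<otimes> x : jacobson_radical R" proof -
 define A where "A I \<longleftrightarrow> (EX F. finite F & (ALL n:F. maximalideal n R) & I = carrier R \<inter> \<Inter>F)" for I
 have idl: "ideal I R" if A: "A I" for I proof -
  obtain F where F: "ALL n:F. maximalideal n R" "I = carrier R \<inter> \<Inter>F" using A unfolding A_def by blast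
  have "n : F ==> ideal n R" for n using F(1) maximalideal.axioms(1) by blast
  thus ?thesis unfolding F(2) ideal_iff by auto
 qed
 have "A (carrier R)" unfolding A_def by (rule exI[of _ "{}"]) simp
 hence "EX I. A I & (ALL J. A J --> J \<subseteq> I --> J = I)" by (rule minimal_ideal) (rule idl)
 then obtain I0 where I0: "A I0" "ALL J. A J --> J \<subseteq> I0 --> J = I0" by (elim exE conjE)
 obtain F where F: "finite F" "ALL n:F. maximalideal n R" "I0 = carrier R \<inter> \<Inter>F" using I0(1) unfolding A_def by blast
 have I0_sub: "I0 \<subseteq> n" if n: "maximalideal n R" for n proof -
  have "A (I0 \<inter> n)" unfolding A_def by (rule exI[of _ "insert n F"]) (use F n in auto)
  hence "I0 \<inter> n = I0" using I0(2) by blast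
  thus ?thesis by blast
 qed
 have rad: "I0 \<subseteq> jacobson_radical R" using I0_sub F(3) by (auto simp: jacobson_radical_def)
 have prime: "primeideal m R" using m by (rule maximalideal_prime)
 have mc: "m \<subseteq> carrier R" "ideal m R" using maximalideal.axioms(1)[OF m] by (auto simp: ideal_iff)
 have "EX x:carrier R. x ~: m & (ALL n:F'. x : n)" if "finite F'" "F' \<subseteq> F - {m}" for F' using that
 proof (induction F')
  case empty
  have "\<one> ~: m" using mc maximalideal.I_notcarr[OF m] ideal.one_imp_carrier by blast
  thus ?case by blast
 next
  case (insert n F')
  obtain x where x: "x :. R" "x ~: m" "ALL n:F'. x : n" using insert by blast
  have n: "maximalideal n R" "n ~= m" using insert.prems F(2) by auto
  hence nc: "n \<subseteq> carrier R" "ideal n R" using maximalideal.axioms(1)[OF n(1)] by (auto simp: ideal_iff)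
  obtain y where y: "y : n" "y ~: m" using maximalideal_subset_eq[OF n(1) m] n(2) by blast
  have "x \<otimes> y ~: m" using primeideal.I_prime[OF prime x(1)] y nc x(2) by blast
  moreover have "x \<otimes> y : n'" if n': "n' : insert n F'" for n' proof (cases "n' = n")
   case True
   thus ?thesis using nc(2) x(1) y(1) unfolding ideal_iff by blast
  next
   case False
   hence "n' : F'" using n' by blast
   moreover have "ideal n' R" using `n' : F'` insert.prems F(2) maximalideal.axioms(1) by blast
   ultimately have "y \<otimes> x : n'" using x(3) y(1) nc(1) unfolding ideal_iff by blast
   thus ?thesis using x(1) y(1) nc(1) m_comm by auto
  qed
  ultimately show ?case using x(1) y(1) nc(1) by blast
 qed
 from this[of "F - {m}"] obtain x where x: "x :. R" "x ~: m" "ALL n:F - {m}. x : n" using F(1) by blast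
 have "r \<otimes> x : jacobson_radical R" if r: "r : m" for r proof -
  have rc: "r :. R" using r mc(1) by blast
  have "r \<otimes> x : n" if n: "n : F" for n proof (cases "n = m")
   case True
   have "x \<otimes> r : m" using mc(2) x(1) r unfolding ideal_iff by blast
   thus ?thesis using True rc x(1) m_comm by simp
  next
   case False
   have "ideal n R" using n F(2) maximalideal.axioms(1) by blast
   thus ?thesis using x(3) n False rc unfolding ideal_iff by blast
  qed
  hence "r \<otimes> x : I0" using F(3) rc x(1) by simp
  thus ?thesis using rad by blast
 qed
 thus thesis using that x by blast
qed

lemma (in cring) ideal_module:
 assumes I: "ideal I R"
 shows "module R \<lparr>carrier = I, mult = mult R, one = \<one>, zero = \<zero>, add = add R, smult = mult R\<rparr>" (is "module R ?M")
proof (rule moduleI[OF cring_axioms])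
 note I' = I[unfolded ideal_iff]
 have inv: "\<ominus> x : I" if "x : I" for x using that I by (meson additive_subgroup.a_inv_closed ideal.axioms(1))
 show "abelian_group ?M" proof (rule abelian_groupI)
  fix x assume x: "x : carrier ?M"
  hence "\<ominus> x \<oplus> x = \<zero>" using I' by (auto intro: l_neg)
  thus "EX y:carrier ?M. y +[?M] x = 0[?M]" using inv x by auto
 qed (use I' in "auto simp: subset_iff a_ac")
qed (use I in "auto simp: ideal_iff subset_iff l_distr r_distr m_assoc")

lemma (in cring) quotient_module_hom:
 assumes J: "ideal J R" and E: "module R E" and j: "j : lin_hom R (quotient_module R J) E"
  and inj: "inj_on j (carrier (quotient_module R J))"
 obtains c where "!!r. r :. R ==> c r :. E"
  "!!r s. r :. R ==> s :. R ==> c (r \<otimes> s) = r *[E] c s"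
  "!!r. r :. R ==> c r = 0[E] \<longleftrightarrow> r : J"
  "j ` carrier (quotient_module R J) = c ` carrier R" proof -
 interpret J: ideal J R by fact
 interpret E: module R E by fact
 let ?Q = "quotient_module R J"
 define c where "c r = j (J +> r)" for r
 have car: "carrier ?Q = (%r. J +> r) ` carrier R" by (auto simp: quotient_module_def FactRing_def A_RCOSETS_def')
 have in_car: "J +> r : carrier ?Q" if "r :. R" for r using car that by blast
 have c1: "c r :. E" if "r :. R" for r unfolding c_def by (rule lin_homD(1)[OF j in_car[OF that]])
 have c3: "c (r \<otimes> s) = r *[E] c s" if "r :. R" "s :. R" for r s proof -
  have "r *[?Q] (J +> s) = J +> (r \<otimes> s)"
   using that by (simp add: quotient_module_def FactRing_def J.rcoset_mult_add)
  thus ?thesis using lin_homD(3)[OF j that(1) in_car[OF that(2)]] by (simp add: c_def)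
 qed
 have c0: "c \<zero> = 0[E]" using c3[of \<zero> \<zero>] c1[of \<zero>] by simp
 have "c r = 0[E] \<longleftrightarrow> r : J" if r: "r :. R" for r proof
  assume "c r = 0[E]"
  hence "J +> r = J +> \<zero>" using inj_onD[OF inj _ in_car[OF r] in_car[OF zero_closed]] c0 by (simp add: c_def)
  moreover have "r : J +> r" by (rule J.a_rcos_self[OF r])
  ultimately show "r : J" using J.a_rcos_const[OF J.zero_closed] by simp
 next
  assume "r : J"
  hence "J +> r = J +> \<zero>" using J.a_rcos_const J.zero_closed by metis
  thus "c r = 0[E]" using c0 by (simp add: c_def)
 qed
 moreover have "j ` carrier ?Q = c ` carrier R" unfolding car c_def by (rule image_image)
 ultimately show thesis using that c1 c3 by blast
qed

locale artin_dual = artin_algebra R L for R (structure) and L (structure) +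
 fixes E :: "('a, 'e) module" and j :: "'a set => 'e"
 assumes envelope: "injective_envelope R (quotient_module R (jacobson_radical R)) E j"
begin

lemma E_module: "module R E"
 using envelope by (simp add: injective_envelope_def injective_module_def)

lemma E_abelian: "abelian_group E"
 using E_module by (rule module.axioms)

lemma baer:
 assumes I: "ideal I R" and g: "!!r. r : I ==> g r :. E"
  "!!r q. [|r : I; q : I|] ==> g (r +[R] q) = g r +[E] g q"
  "!!r q. [|r :. R; q : I|] ==> g (r **[R] q) = r *[E] g q" shows "EX e:carrier E. ALL r:I. g r = r *[E] e" proof -
 note I' = I[unfolded ideal_iff]
 let ?M = "%W. \<lparr>carrier = W, mult = mult R, one = 1[R], zero = 0[R], add = add R, smult = mult R\<rparr> :: ('a, 'a) module"
 have mod: "module R (?M I)" "module R (?M (carrier R))" by (rule ideal_module[OF I], rule ideal_module[OF oneideal])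
 have id: "(%x. x) : lin_hom R (?M I) (?M (carrier R))" using I' by (auto intro!: lin_homI)
 have gl: "g : lin_hom R (?M I) E" by (rule lin_homI) (use g in simp_all)
 have "inj_on (%x. x) (carrier (?M I))" by simp
 hence "EX h:lin_hom R (?M (carrier R)) E. ALL x:carrier (?M I). h x = g x"
  using envelope[unfolded injective_envelope_def injective_module_def, THEN conjunct1, THEN conjunct2, rule_format, OF id gl]
   mod by blast
 then obtain h where h: "h : lin_hom R (?M (carrier R)) E" "ALL x:I. h x = g x" by auto
 have "h x = x *[E] h 1[R]" if "x :. R" for x using lin_homD(3)[OF h(1) that, of "1[R]"] that by simp
 moreover have "h 1[R] :. E" using lin_homD(1)[OF h(1), of "1[R]"] by simp
 ultimately show ?thesis using h(2) I' by (metis subsetD)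
qed

text \<open>The element of \<open>jacobson_radical_colon\<close>, moved to \<open>E\<close>, spans
  the socle at \<open>m\<close>. If \<open>e\<close> is nonzero and killed by \<open>m\<close>, the
  submodule it generates meets the image of \<open>R\<close> modulo its radical by essentiality, so
  \<open>e\<close> lies in that image; as \<open>x\<close> is invertible modulo \<open>m\<close>, it
  is a multiple of \<open>c x\<close>.\<close>

lemma socle:
 assumes m: "maximalideal m R" shows "EX e0:carrier E. e0 ~= 0[E] & (ALL r:m. r *[E] e0 = 0[E]) &
  (ALL e:carrier E. (ALL r:m. r *[E] e = 0[E]) --> (EX r:carrier R. e = r *[E] e0))" proof -
 interpret E: module R E by (rule E_module)
 define J where "J = jacobson_radical R"
 have J: "ideal J R" unfolding J_def by (rule jacobson_radical_ideal)
 have Jm: "J \<subseteq> m" using m by (auto simp: J_def jacobson_radical_def)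
 have env: "j : lin_hom R (quotient_module R J) E" "inj_on j (carrier (quotient_module R J))"
  and ess: "!!N. submodule N R E ==> N \<inter> j ` carrier (quotient_module R J) = {0[E]} ==> N = {0[E]}"
  using envelope unfolding J_def injective_envelope_def by auto
 obtain c where c: "!!r. r :. R ==> c r :. E"
   "!!r s. r :. R ==> s :. R ==> c (r **[R] s) = r *[E] c s"
   "!!r. r :. R ==> c r = 0[E] \<longleftrightarrow> r : J"
   "j ` carrier (quotient_module R J) = c ` carrier R" using quotient_module_hom[OF J E_module env] by blast
 have mc: "m \<subseteq> carrier R" using maximalideal.axioms(1)[OF m] by (auto simp: ideal_iff)
 obtain x where x: "x :. R" "x ~: m" "!!r. r : m ==> r **[R] x : J"
  using jacobson_radical_colon[OF m] unfolding J_def by blast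
 have e0: "c x :. E" "c x ~= 0[E]" "ALL r:m. r *[E] c x = 0[E]" proof -
  show "c x :. E" "c x ~= 0[E]" using c(1,3) x(1,2) Jm by auto
  show "ALL r:m. r *[E] c x = 0[E]" proof
   fix r assume r: "r : m"
   hence "r :. R" using mc by blast
   thus "r *[E] c x = 0[E]" using c(2)[of r x] c(3)[of "r **[R] x"] x(1) x(3)[OF r] by simp
  qed
 qed
 have "EX r:carrier R. e = r *[E] c x" if e: "e :. E" and me: "ALL r:m. r *[E] e = 0[E]" for e proof (cases "e = 0[E]")
  case True
  thus ?thesis using e0(1) by (intro bexI[of _ "0[R]"]) auto
 next
  case False
  let ?N = "(%r. r *[E] e) ` carrier R"
  have "submodule ?N R E" proof (rule E.submoduleI')
   show "0[E] : ?N" using e by (intro image_eqI[of _ _ "0[R]"]) auto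
   show "u +[E] v : ?N" if uv: "u : ?N" "v : ?N" for u v proof -
    obtain r s where "u = r *[E] e" "v = s *[E] e" "r :. R" "s :. R" using uv by auto
    thus ?thesis using e by (intro image_eqI[of _ _ "r +[R] s"]) (auto simp: E.smult_l_distr)
   qed
   show "a *[E] u : ?N" if au: "a :. R" "u : ?N" for a u proof -
    obtain r where "u = r *[E] e" "r :. R" using au by auto
    thus ?thesis using e au(1) by (intro image_eqI[of _ _ "a **[R] r"]) (auto simp: E.smult_assoc1)
   qed
  qed (use e in auto)
  moreover have "e : ?N" using e by (intro image_eqI[of _ _ "1[R]"]) auto
  ultimately have "?N \<inter> c ` carrier R ~= {0[E]}" using ess[of ?N] False c(4) by auto
  moreover have "0[E] : ?N" using e by (intro image_eqI[of _ _ "0[R]"]) auto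
  moreover have "0[E] : c ` carrier R"
   using c(3)[of "0[R]"] J[unfolded ideal_iff] by (intro image_eqI[of _ _ "0[R]"]) auto
  ultimately obtain w where w: "w : ?N" "w : c ` carrier R" "w ~= 0[E]" by blast
  then obtain r y where r: "r :. R" "y :. R" "r *[E] e = c y" "r *[E] e ~= 0[E]" by auto
  have "r ~: m" using me r(4) by auto
  then obtain s p where s: "s :. R" "p : m" "s **[R] r +[R] p = 1[R]" using maximalideal_inverse[OF m r(1)] by blast
  have pc: "p :. R" using s(2) mc by blast
  have "e = (s **[R] r +[R] p) *[E] e" using s(3) e by simp
  also have "\<dots> = s *[E] (r *[E] e)" using s(1,2) pc r(1) e me by (simp add: E.smult_l_distr E.smult_assoc1)
  also have "\<dots> = c (s **[R] y)" using r c(2) s(1) by simp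
  finally have ez: "e = c (s **[R] y)" .
  define z where "z = s **[R] y"
  have z: "z :. R" "e = c z" using ez s(1) r(2) by (simp_all add: z_def)
  obtain s' q where s': "s' :. R" "q : m" "s' **[R] x +[R] q = 1[R]" using maximalideal_inverse[OF m x(1,2)] by blast
  have qc: "q :. R" using s'(2) mc by blast
  have "e = (s' **[R] x +[R] q) *[E] e" using s'(3) e by simp
  also have "\<dots> = (s' **[R] x) *[E] c z" using s'(1,2) qc x(1) e me z by (simp add: E.smult_l_distr)
  also have "\<dots> = c ((s' **[R] x) **[R] z)" using c(2) s'(1) x(1) z(1) by simp
  also have "(s' **[R] x) **[R] z = (s' **[R] z) **[R] x" using s'(1) x(1) z(1) by (simp add: m_assoc m_comm[of x z])
  also have "c \<dots> = (s' **[R] z) *[E] c x" using c(2) s'(1) x(1) z(1) by simp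
  finally show ?thesis using s'(1) z(1) by blast
 qed
 thus ?thesis using e0 by blast
qed

lemma matlis_E: "matlis R (act E) (embedded E)"
proof (intro matlis.intro matlis_axioms.intro artinian_cring_axioms rmod_embedded E_module)
 note ab = E_abelian and em = act_emb[OF E_module]
 have prj_in: "prj E v :. E" "emb 0 E (prj E v) = v" if "v : embedded E" for v
  using that ab by (auto simp: embedded_def)
 show "EX e:embedded E. ALL r:I. g r = act E r e" if I: "ideal I R" and g: "!!r. r : I ==> g r : embedded E"
  "!!r q. [|r : I; q : I|] ==> g (r +[R] q) = g r + g q"
  "!!r q. [|r :. R; q : I|] ==> g (r **[R] q) = act E r (g q)" for I and g :: "'a => ('a, 'e) tot" proof -
  have "EX e:carrier E. ALL r:I. prj E (g r) = r *[E] e" proof (rule baer[OF I])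
   show "prj E (g (r **[R] q)) = r *[E] prj E (g q)" if "r :. R" "q : I" for r q
    using g(3)[OF that] prj_in[OF g(1)[OF that(2)]] module.smult_closed[OF E_module that(1)] by (simp add: act_def ab)
  qed (use g prj_in in "auto simp: prj_add[OF ab]")
  then obtain e where e: "e :. E" "ALL r:I. prj E (g r) = r *[E] e" by blast
  have "g r = act E r (emb 0 E e)" if "r : I" for r using prj_in(2)[OF g(1)[OF that]] e(2) that em[OF e(1)] by metis
  thus ?thesis using e(1) by (auto simp: embedded_def)
 qed
 show "EX e0:embedded E. e0 ~= 0 & (ALL r:m. act E r e0 = 0) &
   (ALL e:embedded E. (ALL r:m. act E r e = 0) --> (EX r:carrier R. e = act E r e0))" if m: "maximalideal m R" for m
 proof -
  obtain e0 where e0: "e0 :. E" "e0 ~= 0[E]" "ALL r:m. r *[E] e0 = 0[E]"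
   "!!e. e :. E ==> (ALL r:m. r *[E] e = 0[E]) ==> EX r:carrier R. e = r *[E] e0" using socle[OF m] by blast
  have mc: "m \<subseteq> carrier R" using maximalideal.axioms(1)[OF m] by (auto simp: ideal_iff)
  have z: "emb 0 E x = 0 \<longleftrightarrow> x = 0[E]" if "x :. E" for x
   using emb_eq_iff[OF ab that abelian_groupE(2)[OF ab]] emb_zero[OF ab] by metis
  show ?thesis proof (intro bexI[of _ "emb 0 E e0"] conjI ballI impI)
   show "emb 0 E e0 ~= 0" using z e0(1,2) by simp
   show "act E r (emb 0 E e0) = 0" if "r : m" for r using e0(1,3) that by (simp add: em emb_zero[OF ab])
   show "EX r:carrier R. e = act E r (emb 0 E e0)" if e: "e : embedded E" "ALL r:m. act E r e = 0" for e proof -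
    obtain x where x: "x :. E" "e = emb 0 E x" using e(1) by (auto simp: embedded_def)
    have "ALL r:m. r *[E] x = 0[E]" proof
     fix r assume "r : m"
     hence "emb 0 E (r *[E] x) = 0" "r :. R" using e(2) x em mc by auto
     thus "r *[E] x = 0[E]" using z module.smult_closed[OF E_module _ x(1)] by blast
    qed
    then obtain r where "r :. R" "x = r *[E] e0" using e0(4)[OF x(1)] by blast
    thus ?thesis using x(2) em[OF e0(1)] by auto
   qed
  qed (use e0(1) in "auto simp: embedded_def")
 qed
qed

end

section \<open>Cofree modules\<close>

lemma lin_hom_of_linear_on:
 fixes N :: "('r, 'b) module" and P :: "('r, 'c) module"
 assumes N: "module R N" and P: "module R P" and h: "linear_on R (act N) (embedded N) (act P) (embedded P) h"
 shows "(%y. prj P (h (emb 0 N y))) : lin_hom R N P"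
  and "y :. N ==> emb 0 P (prj P (h (emb 0 N y))) = h (emb 0 N y)" proof -
 interpret N: module R N by fact
 interpret P: module R P by fact
 note abN = N.M.abelian_group_axioms and abP = P.M.abelian_group_axioms
 have in_emb: "emb 0 N x : embedded N" if "x :. N" for x using that by (simp add: embedded_def)
 have eq: "emb 0 P (prj P (h (emb 0 N y))) = h (emb 0 N y)" if y: "y :. N" for y proof -
  obtain z where "z :. P" "h (emb 0 N y) = emb 0 P z"
   using linear_onD(1)[OF h in_emb[OF y]] by (auto simp: embedded_def)
  thus ?thesis using abP by simp
 qed
 show "y :. N ==> emb 0 P (prj P (h (emb 0 N y))) = h (emb 0 N y)" by (rule eq)
 show "(%y. prj P (h (emb 0 N y))) : lin_hom R N P" proof (rule lin_homI)
  fix x assume x: "x :. N"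
  show "prj P (h (emb 0 N x)) :. P" by (rule prj_mem[OF abP])
  show "prj P (h (emb 0 N (x +[N] y))) = prj P (h (emb 0 N x)) +[P] prj P (h (emb 0 N y))" if "y :. N" for y
   using x that linear_onD(2)[OF h in_emb in_emb] by (simp add: emb_add[OF abN] prj_add[OF abP])
  show "prj P (h (emb 0 N (a *[N] x))) = a *[P] prj P (h (emb 0 N x))" if a: "a :. R" for a proof -
   have "h (emb 0 N (a *[N] x)) = act P a (h (emb 0 N x))"
    using linear_onD(3)[OF h a in_emb[OF x]] by (simp add: act_emb[OF N x])
   also have "\<dots> = emb 0 P (a *[P] prj P (h (emb 0 N x)))" by (simp add: act_def)
   finally show ?thesis using P.smult_closed[OF a prj_mem[OF abP]] abP by simp
  qed
 qed
qed

lemma emb_eq_0_iff: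
 "abelian_group M ==> x :. M ==> emb i M x = 0 \<longleftrightarrow> x = 0[M]"
 using emb_eq_iff[of M x "0[M]" i] emb_zero[of M i] by (simp add: abelian_groupE(2))

lemma lin_hom_eq_0_iff:
 assumes "abelian_group M" "abelian_group N" "f : lin_hom A M N" "inj_on f (carrier M)" "x :. M"
 shows "f x = 0[N] \<longleftrightarrow> x = 0[M]"
 using lin_hom_zero[OF assms(1-3)] inj_onD[OF assms(4) _ assms(5) abelian_groupE(2)[OF assms(1)]] by metis

context artin_dual
begin

sublocale E: matlis R "act E" "embedded E" by (rule matlis_E)

text \<open>\<open>injective_module\<close> tests only modules carried by the type of
  \<open>R\<close>; Baer's criterion, through \<open>matlis\<close>, gives the extension property
  over all types.\<close>

lemma E_lift:
 fixes M :: "('a, 'm) module" and N :: "('a, 'n) module"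
 assumes M: "module R M" and N: "module R N" and i: "i : lin_hom R M N" "inj_on i (carrier M)"
  and ph: "ph : lin_hom R M E"
 obtains ps where "ps : lin_hom R N E" "!!x. x :. M ==> ps (i x) = ph x" proof -
 note abM = module.axioms(2)[OF M] and abN = module.axioms(2)[OF N]
 interpret M: rmod R "act M" "embedded M" by (rule rmod_embedded[OF M])
 interpret N: rmod R "act N" "embedded N" by (rule rmod_embedded[OF N])
 let ?f = "%v. emb 0 E (ph (prj M v))" and ?F = "%v. emb 0 N (i (prj M v))"
 note f = linear_on_embedded[OF M E_module ph] and F = linear_on_embedded[OF M N i(1)]
 define W where "W = ?F ` embedded M"
 have W: "rmod R (act N) W" unfolding W_def by (rule M.rmod_image[OF F N.rmod_axioms])
 have WN: "W \<subseteq> embedded N" unfolding W_def using linear_onD(1)[OF F] by blast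
 have FW: "linear_on R (act M) (embedded M) (act N) W ?F" using F by (auto simp: linear_on_def W_def)
 have ker: "?f v = 0" if v: "v : embedded M" "?F v = 0" for v proof -
  obtain x where x: "x :. M" "v = emb 0 M x" using v(1) by (auto simp: embedded_def)
  have "i x = 0[N]" using v(2) x abM emb_eq_0_iff[OF abN lin_homD(1)[OF i(1) x(1)]] by simp
  hence "x = 0[M]" using lin_hom_eq_0_iff[OF abM abN i x(1)] by simp
  thus ?thesis using x abM lin_hom_zero[OF abM E_abelian ph] by (simp add: emb_zero[OF E_abelian])
 qed
 obtain g where g: "E.functional (act N) W g" "!!v. v : embedded M ==> g (?F v) = ?f v"
  using E.functional_factor[OF M.rmod_axioms W FW f ker] by blast
 obtain h where h: "E.functional (act N) (embedded N) h" "!!w. w : W ==> h w = g w"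
  using E.functional_extend[OF N.rmod_axioms W WN g(1)] by blast
 have "prj E (h (emb 0 N (i x))) = ph x" if x: "x :. M" for x proof -
  have "emb 0 M x : embedded M" using x by (simp add: embedded_def)
  hence "h (?F (emb 0 M x)) = ?f (emb 0 M x)" using g(2) h(2) by (simp add: W_def)
  thus ?thesis using x abM E_abelian lin_homD(1)[OF ph x] by simp
 qed
 thus thesis using that[OF lin_hom_of_linear_on(1)[OF N E_module h(1)]] by blast
qed

lemma E_separate:
 fixes M :: "('a, 'm) module"
 assumes M: "module R M" and x: "x :. M" "x ~= 0[M]"
 obtains ph where "ph : lin_hom R M E" "ph x ~= 0[E]" proof -
 note abM = module.axioms(2)[OF M]
 interpret M: rmod R "act M" "embedded M" by (rule rmod_embedded[OF M])
 have v: "emb 0 M x : embedded M" "emb 0 M x ~: {0}" using x emb_eq_0_iff[OF abM x(1)] by (auto simp: embedded_def)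
 have "rmod R (act M) {0}" by (rule finite_length_rmod[OF M.finite_length_trivial])
 then obtain g where g: "E.functional (act M) (embedded M) g" "g (emb 0 M x) ~= 0"
  using E.functional_separate[OF M.rmod_axioms _ _ v] by (metis M.zero_mem empty_subsetI insert_subset)
 note l = lin_hom_of_linear_on[OF M E_module g(1)]
 have "prj E (g (emb 0 M x)) ~= 0[E]" using l(2)[OF x(1)] g(2) emb_zero[OF E_abelian] by metis
 thus thesis using that l(1) by blast
qed

text \<open>The dual has finite length, so finitely many functionals span it. The functionals
  vanishing at \<open>x\<close> form a submodule; if it contains the spanning ones, every functional
  vanishes at \<open>x\<close>.\<close>

lemma E_cogenerators:
 fixes M :: "('a, 'm) module"
 assumes M: "module R M" and fl: "fin_length R M"
 obtains Ph where "finite Ph" "Ph \<subseteq> lin_hom R M E"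
  "!!x. x :. M ==> (!!ph. ph : Ph ==> ph x = 0[E]) ==> x = 0[M]" proof -
 note abM = module.axioms(2)[OF M]
 interpret M: rmod R "act M" "embedded M" by (rule rmod_embedded[OF M])
 let ?D = "E.dual (act M) (embedded M)"
 interpret D: rmod R E.sdual ?D by (rule E.rmod_dual[OF M.rmod_axioms])
 obtain xs where xs: "set xs \<subseteq> ?D" "D.spans xs = ?D"
  using finite_length_finitely_spanned[OF E.finite_length_dual] fl unfolding fin_length_def by blast
 have xsf: "E.functional (act M) (embedded M) f" if "f : set xs" for f using that xs(1) by (auto simp: E.dual_def)
 let ?Ph = "(%f y. prj E (f (emb 0 M y))) ` set xs"
 have "?Ph \<subseteq> lin_hom R M E" using lin_hom_of_linear_on(1)[OF M E_module xsf] by blast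
 moreover have "x = 0[M]" if x: "x :. M" and z: "!!ph. ph : ?Ph ==> ph x = 0[E]" for x
 proof (rule ccontr)
  assume nz: "x ~= 0[M]"
  have v: "emb 0 M x : embedded M" using x by (simp add: embedded_def)
  have "rmod R E.sdual {f : ?D. f (emb 0 M x) = 0}" by (rule D.rmod_kernel[where s' = "act E" and V' = "embedded E"])
    (auto simp: linear_on_def E.dual_def v E.E.rmod_axioms)
  moreover have "set xs \<subseteq> {f : ?D. f (emb 0 M x) = 0}" proof
   fix f assume f: "f : set xs"
   hence "prj E (f (emb 0 M x)) = 0[E]" by (intro z[of "%y. prj E (f (emb 0 M y))"] imageI)
   hence "f (emb 0 M x) = 0"
    using lin_hom_of_linear_on(2)[OF M E_module xsf[OF f] x] emb_zero[OF E_abelian, of 0] by simp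
   thus "f : {f : ?D. f (emb 0 M x) = 0}" using f xs(1) by blast
  qed
  ultimately have all: "?D \<subseteq> {f : ?D. f (emb 0 M x) = 0}" by (rule D.spans_minimal[of _ xs, unfolded xs(2)])
  obtain ph where ph: "ph : lin_hom R M E" "ph x ~= 0[E]" by (rule E_separate[OF M x nz])
  note fd = E.functional_in_dual[OF M.rmod_axioms linear_on_embedded[OF M E_module ph(1)]]
  have "(%v. if v : embedded M then emb 0 E (ph (prj M v)) else 0) (emb 0 M x) = 0"
   using subsetD[OF all fd] by blast
  hence "emb 0 E (ph x) = 0" using v x abM by simp
  thus False using emb_eq_0_iff[OF E_abelian lin_homD(1)[OF ph(1) x]] ph(2) by simp
 qed
 ultimately show thesis using that[of ?Ph] by blast
qed

text \<open>\<open>Hom(L, E)\<close> over \<open>R\<close>, with the right action of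
  \<open>L\<close> induced by left multiplication on the argument.\<close>

definition cofree :: "('c, 'c => 'e) module"
 where "cofree = \<lparr>carrier = lin_hom R L E \<inter> extensional (carrier L), mult = undefined, one = undefined,
  zero = (\<lambda>x\<in>carrier L. 0[E]), add = (%f g. \<lambda>x\<in>carrier L. f x +[E] g x),
  smult = (%a f. \<lambda>x\<in>carrier L. f (a **[L] x))\<rparr>"

lemma cofree_simps [simp]:
 "carrier cofree = lin_hom R L E \<inter> extensional (carrier L)" "0[cofree] = (\<lambda>x\<in>carrier L. 0[E])"
 "f +[cofree] g = (\<lambda>x\<in>carrier L. f x +[E] g x)" "a *[cofree] f = (\<lambda>x\<in>carrier L. f (a **[L] x))"
 by (simp_all add: cofree_def)

lemma cofree_mem:
 assumes "!!x. x :. L ==> f x :. E"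
  "!!x y. x :. L ==> y :. L ==> f (x +[L] y) = f x +[E] f y"
  "!!r x. r :. R ==> x :. L ==> f (r *[L] x) = r *[E] f x" shows "restrict f (carrier L) :. cofree"
 using assms by (auto intro!: lin_homI)

lemma cofree_apply:
 assumes "f :. cofree" shows "x :. L ==> f x :. E"
  "x :. L ==> y :. L ==> f (x +[L] y) = f x +[E] f y"
  "r :. R ==> x :. L ==> f (r *[L] x) = r *[E] f x" using assms by (auto simp: lin_hom_def)

lemma cofree_eqI:
 "f :. cofree ==> g :. cofree ==> (!!x. x :. L ==> f x = g x) ==> f = g" by (auto intro: extensionalityI)

lemma right_module_cofree: "right_module L cofree"
proof (rule right_module.intro[OF L.ring_axioms _ right_module_axioms.intro])
 interpret E': module R E by (rule E_module)
 note c = cofree_apply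
 have add: "f +[cofree] g :. cofree" if fg: "f :. cofree" "g :. cofree" for f g unfolding cofree_simps(3)
  by (rule cofree_mem) (simp_all add: c[OF fg(1)] c[OF fg(2)] E'.M.a_ac E'.smult_r_distr)
 have zero: "0[cofree] :. cofree" unfolding cofree_simps(2) by (rule cofree_mem) simp_all
 have sm: "a *[cofree] f :. cofree" if f: "f :. cofree" and a: "a :. L" for f a unfolding cofree_simps(4)
  by (rule cofree_mem) (simp_all add: c[OF f] a L.r_distr smult_mult_right)
 have one: "1[L] *[cofree] f = f" if f: "f :. cofree" for f by (rule cofree_eqI[OF sm[OF f L.one_closed] f]) simp
 show "abelian_group cofree" proof (rule abelian_groupI)
  fix f assume f: "f :. cofree"
  let ?g = "\<lambda>x\<in>carrier L. -[E] f x"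
  have "?g :. cofree" by (rule cofree_mem) (simp_all add: c[OF f] E'.M.minus_add E'.smult_r_minus)
  moreover have "?g +[cofree] f = 0[cofree]"
   unfolding cofree_simps(2,3) by (rule restrict_ext) (simp add: c[OF f] E'.M.l_neg)
  ultimately show "EX g:carrier cofree. g +[cofree] f = 0[cofree]" by blast
  show "0[cofree] +[cofree] f = f" by (rule cofree_eqI[OF add[OF zero f] f]) (simp add: c[OF f])
  fix g assume g: "g :. cofree"
  show "f +[cofree] g = g +[cofree] f"
   by (rule cofree_eqI[OF add[OF f g] add[OF g f]]) (simp add: c[OF f] c[OF g] E'.M.a_comm)
  fix h assume h: "h :. cofree"
  show "f +[cofree] g +[cofree] h = f +[cofree] (g +[cofree] h)"
   by (rule cofree_eqI[OF add[OF add[OF f g] h] add[OF f add[OF g h]]]) (simp add: c[OF f] c[OF g] c[OF h] E'.M.a_assoc)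
 qed (rule add zero; assumption)+
 show "1[L] *[cofree] f = f" if "f :. cofree" for f by (rule one[OF that])
 fix f a assume f: "f :. cofree" and a: "a :. L"
 show "a *[cofree] f :. cofree" by (rule sm[OF f a])
 show "(a +[L] b) *[cofree] f = a *[cofree] f +[cofree] b *[cofree] f" if b: "b :. L" for b
  by (rule cofree_eqI[OF sm[OF f] add[OF sm[OF f a] sm[OF f b]]]) (simp_all add: a b c[OF f] L.l_distr)
 show "(a **[L] b) *[cofree] f = b *[cofree] (a *[cofree] f)" if b: "b :. L" for b
  by (rule cofree_eqI[OF sm[OF f] sm[OF sm[OF f a] b]]) (simp_all add: a b L.m_assoc)
 show "a *[cofree] (f +[cofree] g) = a *[cofree] f +[cofree] a *[cofree] g" if g: "g :. cofree" for g
  by (rule cofree_eqI[OF sm[OF add[OF f g] a] add[OF sm[OF f a] sm[OF g a]]]) (simp add: a)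
qed

text \<open>The adjunction between maps \<open>M -> Hom(L, E)\<close> over \<open>L\<close> and maps
  \<open>M -> E\<close> over \<open>R\<close>, given by evaluation at the unit.\<close>

lemma cofree_repr:
 fixes M :: "('c, 'm) module"
 assumes M: "right_module L M" and ph: "ph : lin_hom R (base_module L M) E"
 shows "EX a:lin_hom L M cofree. ALL m:carrier M. a m 1[L] = ph m" proof -
 interpret M: right_module L M by fact
 note p = lin_homD[OF ph, unfolded base_module_simps]
 let ?a = "%m. \<lambda>x\<in>carrier L. ph (x *[M] m)"
 have a: "?a m :. cofree" if m: "m :. M" for m proof (rule cofree_mem)
  fix r x assume r: "r :. R" and x: "x :. L"
  have "(r *[L] x) *[M] m = (r *[L] 1[L]) *[M] (x *[M] m)"
   using M.smult_assoc[of x "r *[L] 1[L]" m] r x m by (simp add: unit_smult_mult)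
  thus "ph ((r *[L] x) *[M] m) = r *[E] ph (x *[M] m)" using p(3) r x m M.smult_closed by simp
 qed (use m p in "simp_all add: M.smult_closed M.smult_l_distr")
 interpret C: right_module L cofree by (rule right_module_cofree)
 have al: "?a : lin_hom L M cofree" proof (rule lin_homI)
  fix m assume m: "m :. M"
  show "?a m :. cofree" by (rule a[OF m])
  show "?a (m +[M] n) = ?a m +[cofree] ?a n" if n: "n :. M" for n by (rule cofree_eqI[OF a C.M.a_closed[OF a a]])
    (simp_all add: m n p M.smult_r_distr M.smult_closed)
  show "?a (l *[M] m) = l *[cofree] ?a m" if l: "l :. L" for l by (rule cofree_eqI[OF a C.smult_closed[OF l a]])
    (simp_all add: m l M.smult_closed M.smult_assoc)
 qed
 show ?thesis by (rule bexI[OF _ al]) (simp add: M.smult_one)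
qed

text \<open>The value of \<open>a m\<close> at \<open>x\<close> is the value of
  \<open>a (x *[M] m)\<close> at the unit.\<close>

lemma cofree_zero:
 fixes M :: "('c, 'm) module"
 assumes M: "right_module L M" and a: "a : lin_hom L M cofree"
  and z: "!!m. m :. M ==> a m 1[L] = 0[E]" and m: "m :. M" shows "a m = 0[cofree]" proof (rule cofree_eqI)
 interpret M: right_module L M by fact
 interpret C: right_module L cofree by (rule right_module_cofree)
 show "a m :. cofree" by (rule lin_homD(1)[OF a m])
 show "0[cofree] :. cofree" by (rule C.M.zero_closed)
 fix x assume x: "x :. L"
 have "a (x *[M] m) = (\<lambda>y\<in>carrier L. a m (x **[L] y))" using lin_homD(3)[OF a x m] by simp
 hence "a (x *[M] m) 1[L] = a m x" using x by simp
 thus "a m x = 0[cofree] x" using z[OF M.smult_closed[OF x m]] x by simp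
qed

end

section \<open>The regular module and products of two modules\<close>

context artin_algebra
begin

definition regular :: "('c, 'c) module"
 where "regular = \<lparr>carrier = carrier L, mult = undefined, one = undefined, zero = 0[L], add = add L,
  smult = (%a x. x **[L] a)\<rparr>"

lemma regular_simps [simp]:
 "carrier regular = carrier L" "0[regular] = 0[L]" "x +[regular] y = x +[L] y" "a *[regular] x = x **[L] a"
 by (simp_all add: regular_def)

lemma small_regular: "small R L regular"
proof (rule small_of_generated)
 have ab: "abelian_group L" by (rule ring.is_abelian_group[OF L.ring_axioms])
 note abm = abelian_group.axioms(1)[OF ab]
 have "abelian_group regular" proof (rule abelian_groupI)
  fix x assume x: "x :. regular"
  hence "-[L] x +[regular] x = 0[regular]" by (simp add: abelian_group.l_neg[OF ab])
  thus "EX y:carrier regular. y +[regular] x = 0[regular]" using x by (intro bexI[of _ "-[L] x"]) simp_all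
 qed (simp_all add: abelian_monoid.a_assoc[OF abm] abelian_monoid.a_comm[OF abm]
   abelian_monoid.a_lcomm[OF abm])
 thus "right_module L regular" by (intro right_module.intro L.ring_axioms right_module_axioms.intro)
   (simp_all add: L.l_distr L.r_distr L.m_assoc)
 show "generated L regular {1[L]}" unfolding generated_def proof (intro conjI allI impI)
  fix W assume W: "W \<subseteq> carrier regular" "ALL a:carrier L. ALL x:W. a *[regular] x : W" "{1[L]} \<subseteq> W"
  have "x : W" if x: "x :. L" for x proof -
   have "x *[regular] 1[L] : W" using W(2,3) x by blast
   thus ?thesis using x by simp
  qed
  thus "W = carrier regular" using W(1) by auto
 qed simp
qed simp

lemma regular_hom:
 fixes M :: "('c, 'm) module"
 assumes M: "right_module L M" and x: "x :. M" shows "(%a. a *[M] x) : lin_hom L regular M" proof -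
 interpret M: right_module L M by fact
 show ?thesis using x by (intro lin_homI) (simp_all add: M.smult_closed M.smult_l_distr M.smult_assoc)
qed

definition product_module :: "('c, 'm) module => ('c, 'n) module => ('c, 'm \<times> 'n) module"
 where "product_module M N = \<lparr>carrier = carrier M \<times> carrier N, mult = undefined, one = undefined,
  zero = (0[M], 0[N]), add = (%(x, y) (x', y'). (x +[M] x', y +[N] y')),
  smult = (%a (x, y). (a *[M] x, a *[N] y))\<rparr>"

lemma product_module_simps [simp]:
 "carrier (product_module M N) = carrier M \<times> carrier N" "0[product_module M N] = (0[M], 0[N])"
 "(x, y) +[product_module M N] (x', y') = (x +[M] x', y +[N] y')"
 "a *[product_module M N] (x, y) = (a *[M] x, a *[N] y)" by (simp_all add: product_module_def)

lemma small_product: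
 fixes M :: "('c, 'm) module" and N :: "('c, 'n) module"
 assumes M: "small R L M" and N: "small R L N" shows "small R L (product_module M N)" proof -
 interpret M: right_module L M by (rule smallD(1)[OF M])
 interpret N: right_module L N by (rule smallD(1)[OF N])
 let ?P = "product_module M N"
 obtain S where S: "finite S" "generated L M S" by (rule small_generated[OF M])
 obtain T where T: "finite T" "generated L N T" by (rule small_generated[OF N])
 have ST: "S \<subseteq> carrier M" "T \<subseteq> carrier N" using S(2) T(2) by (simp_all add: generated_def)
 have "abelian_group ?P" proof (rule abelian_groupI)
  fix z assume "z : carrier ?P"
  then obtain x y where z: "z = (x, y)" "x :. M" "y :. N" by auto
  hence "(-[M] x, -[N] y) +[?P] z = 0[?P]" by (simp add: M.M.l_neg N.M.l_neg)
  thus "EX w:carrier ?P. w +[?P] z = 0[?P]" using z by (intro bexI[of _ "(-[M] x, -[N] y)"]) simp_all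
 qed (auto simp: M.M.a_ac N.M.a_ac)
 hence P: "right_module L ?P" by (intro right_module.intro L.ring_axioms right_module_axioms.intro)
   (auto simp: M.smult_closed M.smult_l_distr M.smult_r_distr M.smult_assoc M.smult_one
    N.smult_closed N.smult_l_distr N.smult_r_distr N.smult_assoc N.smult_one)
 have "generated L ?P ((%s. (s, 0[N])) ` S \<union> (%t. (0[M], t)) ` T)" unfolding generated_def
 proof (intro conjI allI impI)
  show "(%s. (s, 0[N])) ` S \<union> (%t. (0[M], t)) ` T \<subseteq> carrier ?P" using ST by auto
  fix W assume W: "W \<subseteq> carrier ?P" "0[?P] : W" "ALL x:W. ALL y:W. x +[?P] y : W"
   "ALL a:carrier L. ALL x:W. a *[?P] x : W" "(%s. (s, 0[N])) ` S \<union> (%t. (0[M], t)) ` T \<subseteq> W"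
  have 1: "{x : carrier M. (x, 0[N]) : W} = carrier M" proof (rule generatedD[OF S(2)])
   show "x +[M] y : {x : carrier M. (x, 0[N]) : W}"
    if "x : {x : carrier M. (x, 0[N]) : W}" "y : {x : carrier M. (x, 0[N]) : W}" for x y
    using that W(3)[rule_format, of "(x, 0[N])" "(y, 0[N])"] by simp
   show "a *[M] x : {x : carrier M. (x, 0[N]) : W}" if "a :. L" "x : {x : carrier M. (x, 0[N]) : W}" for a x
    using that W(4)[rule_format, of a "(x, 0[N])"] by (simp add: M.smult_closed N.smult_zero)
  qed (use W(2,5) ST in auto)
  have 2: "{x : carrier N. (0[M], x) : W} = carrier N" proof (rule generatedD[OF T(2)])
   show "x +[N] y : {x : carrier N. (0[M], x) : W}"
    if "x : {x : carrier N. (0[M], x) : W}" "y : {x : carrier N. (0[M], x) : W}" for x y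
    using that W(3)[rule_format, of "(0[M], x)" "(0[M], y)"] by simp
   show "a *[N] x : {x : carrier N. (0[M], x) : W}" if "a :. L" "x : {x : carrier N. (0[M], x) : W}" for a x
    using that W(4)[rule_format, of a "(0[M], x)"] by (simp add: N.smult_closed M.smult_zero)
  qed (use W(2,5) ST in auto)
  have "(x, y) : W" if xy: "x :. M" "y :. N" for x y proof -
   have "(x, 0[N]) : W" "(0[M], y) : W" using 1 2 xy by blast+
   thus ?thesis using W(3)[rule_format, of "(x, 0[N])" "(0[M], y)"] xy by simp
  qed
  thus "W = carrier ?P" using W(1) by auto
 qed
 thus ?thesis using small_of_generated[OF P] S(1) T(1) by blast
qed

end

context artin_dual
begin

text \<open>Over \<open>R\<close> this is the Matlis dual of \<open>L\<close>, and duality preserves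
  finite length. The map \<open>G\<close> translates functionals on the embedded copy of
  \<open>L\<close> into elements of \<open>cofree\<close>.\<close>

lemma small_cofree: "small R L cofree"
proof -
 let ?B = "base_module L regular" and ?C = "base_module L cofree"
 have B: "module R ?B" and C: "module R ?C" using module_base smallD(1)[OF small_regular] right_module_cofree by blast+
 note abB = module.axioms(2)[OF B] and abC = module.axioms(2)[OF C]
 interpret B: rmod R "act ?B" "embedded ?B" by (rule rmod_embedded[OF B])
 interpret C: module R ?C by (rule C)
 have fl: "finite_length R (act ?B) (embedded ?B)" using smallD(2)[OF small_regular] by (simp add: fin_length_def)
 let ?D = "E.dual (act ?B) (embedded ?B)"
 define G where "G ph = (\<lambda>x\<in>carrier L. prj E (ph (emb 0 ?B x)))" for ph
 have Df: "E.functional (act ?B) (embedded ?B) ph" if "ph : ?D" for ph using that by (simp add: E.dual_def)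
 have hb: "restrict f (carrier L) :. cofree" if f: "f : lin_hom R ?B E" for f
  using lin_homD[OF f] by (intro cofree_mem) (simp_all add: unit_smult_mult)
 have Gc: "G ph :. cofree" if "ph : ?D" for ph
  unfolding G_def by (rule hb[OF lin_hom_of_linear_on(1)[OF B E_module Df[OF that]]])
 have lin: "linear_on R E.sdual ?D (act ?C) (embedded ?C) (%ph. emb 0 ?C (G ph))" proof (rule linear_onI)
  fix ph assume ph: "ph : ?D"
  show "emb 0 ?C (G ph) : embedded ?C" using Gc[OF ph] by (simp add: embedded_def)
  show "emb 0 ?C (G (ph + ps)) = emb 0 ?C (G ph) + emb 0 ?C (G ps)" if ps: "ps : ?D" for ps
  proof -
   have "G (ph + ps) = G ph +[?C] G ps"
    unfolding base_module_simps cofree_simps(3) G_def by (rule restrict_ext) (simp add: prj_add[OF E_abelian])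
   thus ?thesis using emb_add[OF abC, of "G ph" "G ps" 0] Gc[OF ph] Gc[OF ps] by simp
  qed
  show "emb 0 ?C (G (E.sdual r ph)) = act ?C r (emb 0 ?C (G ph))" if r: "r :. R" for r proof -
   have "G (E.sdual r ph) = r *[?C] G ph" unfolding base_module_simps cofree_simps(4) G_def
   proof (rule restrict_ext)
    fix x assume x: "x :. L"
    have xB: "emb 0 ?B x : embedded ?B" using x by (simp add: embedded_def)
    have "prj E (ph (emb 0 ?B (r *[?B] x))) = r *[E] prj E (ph (emb 0 ?B x))"
     using lin_homD(3)[OF lin_hom_of_linear_on(1)[OF B E_module Df[OF ph]] r, of x] x by simp
    moreover have "prj E (E.sdual r ph (emb 0 ?B x)) = r *[E] prj E (ph (emb 0 ?B x))"
     using module.smult_closed[OF E_module r prj_mem[OF E_abelian]] by (simp add: act_def E_abelian)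
    ultimately show "prj E (E.sdual r ph (emb 0 ?B x)) =
      (\<lambda>x\<in>carrier L. prj E (ph (emb 0 ?B x))) ((r *[L] 1[L]) **[L] x)"
     using r x by (simp add: unit_smult_mult)
   qed
   thus ?thesis using act_emb[OF C, of "G ph" r] Gc[OF ph] by simp
  qed
 qed
 have "embedded ?C \<subseteq> (%ph. emb 0 ?C (G ph)) ` ?D" proof
  fix v assume "v : embedded ?C"
  then obtain f where f: "f :. cofree" "v = emb 0 ?C f" by (auto simp: embedded_def)
  have fB: "f : lin_hom R ?B E" using cofree_apply[OF f(1)] by (intro lin_homI) (simp_all add: unit_smult_mult)
  let ?ph = "%v. if v : embedded ?B then emb 0 E (f (prj ?B v)) else 0"
  have phD: "?ph : ?D" by (rule E.functional_in_dual[OF B.rmod_axioms linear_on_embedded[OF B E_module fB]])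
  have Gf: "G ?ph = f" proof (rule cofree_eqI[OF Gc[OF phD] f(1)])
   fix x assume x: "x :. L"
   hence "emb 0 ?B x : embedded ?B" by (simp add: embedded_def)
   thus "G ?ph x = f x" using x abB E_abelian cofree_apply(1)[OF f(1) x] by (simp add: G_def)
  qed
  show "v : (%ph. emb 0 ?C (G ph)) ` ?D" by (rule image_eqI[OF _ phD]) (simp only: f(2) Gf)
 qed
 moreover have "(%ph. emb 0 ?C (G ph)) ` ?D \<subseteq> embedded ?C" using Gc by (auto simp: embedded_def)
 ultimately have "(%ph. emb 0 ?C (G ph)) ` ?D = embedded ?C" by blast
 hence "finite_length R (act ?C) (embedded ?C)"
  using finite_length_image[OF E.finite_length_dual[OF fl] rmod_embedded[OF C] lin] by simp
 thus ?thesis using right_module_cofree by (simp add: small_def fin_length_def)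
qed

end

definition module_sum :: "('r, 'z) ring_scheme => ('r, 'l, 'y) module_scheme => ('l, 'm) module => ('l, 'm) module =>
  ('l, 'm) module => ('m => 'm) => ('m => 'm) => ('m => 'm) => ('m => 'm) => bool"
 where "module_sum R L M N S i1 i2 p1 p2 \<longleftrightarrow> small R L S &
  i1 : lin_hom L M S & i2 : lin_hom L N S & p1 : lin_hom L S M & p2 : lin_hom L S N &
  (ALL x:carrier M. p1 (i1 x) = x) & (ALL y:carrier N. p2 (i2 y) = y) &
  (ALL y:carrier N. p1 (i2 y) = 0[M]) & (ALL x:carrier M. p2 (i1 x) = 0[N]) &
  (ALL z:carrier S. i1 (p1 z) +[S] i2 (p2 z) = z)"

text \<open>Inside the universe: the modules \<open>Q \<cong> \<Lambda>\<close> (generated by \<open>u\<close>) and \<open>J \<cong> Hom\<^sub>R(\<Lambda>, E)\<close> (with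
 evaluation \<open>ev\<close> at \<open>1\<close>) and a zero module \<open>Z\<close>.\<close>

locale graded_setup = artin_dual R L E j
 for R :: "('r, 'x) ring_scheme" (structure) and L :: "('r, 'l, 'y) module_scheme" (structure)
  and E :: "('r, 'e) module" and j +
 fixes J Q Z :: "('l, 'm) module" and ev :: "'m => 'e" and u :: 'm
 assumes J_small: "small R L J" and ev_hom: "ev : lin_hom R (base_module L J) E"
  and J_repr: "right_module L (M :: ('l, 'm) module) ==> ph : lin_hom R (base_module L M) E ==>
   EX a:lin_hom L M J. ALL m:carrier M. ev (a m) = ph m"
  and J_zero: "right_module L (M :: ('l, 'm) module) ==> a : lin_hom L M J ==> (ALL m:carrier M. ev (a m) = 0[E]) ==>
   m :. M ==> a m = 0[J]"
  and Q_small: "small R L Q" and u_mem: "u :. Q"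
  and Q_repr: "right_module L (M :: ('l, 'm) module) ==> x :. M ==> EX f:lin_hom L Q M. f u = x"
  and Q_zero: "right_module L (M :: ('l, 'm) module) ==> f : lin_hom L Q M ==> f u = 0[M] ==> y :. Q ==> f y = 0[M]"
  and Z_small: "small R L Z" and Z_zero: "carrier Z = {0[Z]}"
  and sum: "small R L M ==> small R L N ==> EX S i1 i2 p1 p2. module_sum R L M N S i1 i2 p1 p2"

theorem (in artin_dual) graded_setup_exists:
 fixes \<iota> :: "'c list => 'm"
 assumes \<iota>: "inj_on \<iota> (lists (carrier L))"
 shows "EX (J :: ('c, 'm) module) Q Z ev u. graded_setup R L E j J Q Z ev u" proof -
 obtain J :: "('c, 'm) module" and q q' where J: "small R L J" "q : lin_hom L cofree J" "q' : lin_hom L J cofree"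
  "ALL x:carrier cofree. q' (q x) = x" "ALL y:carrier J. q (q' y) = y" by (rule small_copy[OF small_cofree \<iota>])
 obtain Q :: "('c, 'm) module" and v v' where Q: "small R L Q" "v : lin_hom L regular Q" "v' : lin_hom L Q regular"
  "ALL x:carrier regular. v' (v x) = x" "ALL y:carrier Q. v (v' y) = y" by (rule small_copy[OF small_regular \<iota>])
 obtain Z :: "('c, 'm) module" and w w' where Z: "small R L Z" "w : lin_hom L (free_right_module L 0) Z"
  "w' : lin_hom L Z (free_right_module L 0)"
  "ALL x:carrier (free_right_module L 0). w' (w x) = x" "ALL y:carrier Z. w (w' y) = y"
  by (rule small_copy[OF small_free \<iota>])
 have "graded_setup R L E j J Q Z (%x. q' x 1[L]) (v 1[L])"
 proof (rule graded_setup.intro[OF artin_dual_axioms graded_setup_axioms.intro])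
  show "small R L J" "small R L Q" "small R L Z" by fact+
  show "(%x. q' x 1[L]) : lin_hom R (base_module L J) E" proof (rule lin_homI)
   fix x assume x: "x :. (base_module L J)"
   note q'x = lin_homD(1)[OF J(3), of x]
   show "q' x 1[L] :. E" using cofree_apply(1)[OF q'x] x by simp
   show "q' (x +[base_module L J] y) 1[L] = q' x 1[L] +[E] q' y 1[L]" if "y :. (base_module L J)" for y
    using x that lin_homD(2)[OF J(3), of x y] by simp
   show "q' (r *[base_module L J] x) 1[L] = r *[E] q' x 1[L]" if r: "r :. R" for r proof -
    have "q' ((r *[L] 1[L]) *[J] x) 1[L] = q' x (r *[L] 1[L])"
     using lin_homD(3)[OF J(3), of "r *[L] 1[L]" x] x r by simp
    thus ?thesis using cofree_apply(3)[OF q'x r, of "1[L]"] x by simp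
   qed
  qed
  show "EX a:lin_hom L M J. ALL m:carrier M. q' (a m) 1[L] = ph m"
   if M: "right_module L M" and ph: "ph : lin_hom R (base_module L M) E" for M :: "('c, 'm) module" and ph
  proof -
   obtain a where a: "a : lin_hom L M cofree" "ALL m:carrier M. a m 1[L] = ph m"
    using cofree_repr[OF M ph] by blast
   show ?thesis by (rule bexI[OF _ lin_hom_comp[OF J(2) a(1)]]) (use a(2) J(4) lin_homD(1)[OF a(1)] in simp)
  qed
  show "a m = 0[J]" if M: "right_module L M" and a: "a : lin_hom L M J"
   and z: "ALL m:carrier M. q' (a m) 1[L] = 0[E]" and m: "m :. M" for M :: "('c, 'm) module" and a m proof -
   have "q' (a m) = 0[cofree]" by (rule cofree_zero[OF M lin_hom_comp[OF J(3) a] _ m]) (use z in simp)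
   hence "a m = q 0[cofree]" using J(5)[rule_format, OF lin_homD(1)[OF a m]] by simp
   also have "\<dots> = 0[J]"
    by (rule lin_hom_zero[OF right_module_abelian[OF right_module_cofree] right_module_abelian[OF smallD(1)[OF J(1)]] J(2)])
   finally show ?thesis .
  qed
  have one: "1[L] :. regular" by simp
  show "v 1[L] :. Q" by (rule lin_homD(1)[OF Q(2) one])
  show "EX f:lin_hom L Q M. f (v 1[L]) = x" if M: "right_module L M" and x: "x :. M" for M :: "('c, 'm) module" and x
  proof -
   interpret M: right_module L M by fact
   show ?thesis
    by (rule bexI[OF _ lin_hom_comp[OF regular_hom[OF M x] Q(3)]]) (simp add: Q(4)[rule_format, OF one] M.smult_one x)
  qed
  show "f y = 0[M]" if M: "right_module L M" and f: "f : lin_hom L Q M"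
   and z: "f (v 1[L]) = 0[M]" and y: "y :. Q" for M :: "('c, 'm) module" and f y proof -
   interpret M: right_module L M by fact
   have y': "v' y :. L" using lin_homD(1)[OF Q(3) y] by simp
   have "y = v (v' y *[regular] 1[L])" using Q(5)[rule_format, OF y] y' by simp
   also have "\<dots> = v' y *[Q] v 1[L]" using lin_homD(3)[OF Q(2) y' one] .
   finally show ?thesis using lin_homD(3)[OF f y' lin_homD(1)[OF Q(2) one]] z y' by (simp add: M.smult_zero)
  qed
  show "carrier Z = {0[Z]}" proof -
   have "y = 0[Z]" if y: "y :. Z" for y proof -
    have "w' y = 0[free_right_module L 0]" using lin_homD(1)[OF Z(3) y] by auto
    hence "y = w 0[free_right_module L 0]" using Z(5)[rule_format, OF y] by simp
    also have "\<dots> = 0[Z]"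
     by (rule lin_hom_zero[OF right_module_abelian[OF smallD(1)[OF small_free]] right_module_abelian[OF smallD(1)[OF Z(1)]] Z(2)])
    finally show ?thesis .
   qed
   thus ?thesis using abelian_groupE(2)[OF right_module_abelian[OF smallD(1)[OF Z(1)]]] by blast
  qed
  show "EX S i1 i2 p1 p2. module_sum R L M N S i1 i2 p1 p2"
   if M: "small R L M" and N: "small R L N" for M N :: "('c, 'm) module" proof -
   interpret M: right_module L M by (rule smallD(1)[OF M])
   interpret N: right_module L N by (rule smallD(1)[OF N])
   let ?P = "product_module M N"
   obtain S :: "('c, 'm) module" and s s' where S: "small R L S" "s : lin_hom L ?P S" "s' : lin_hom L S ?P"
    "ALL x:carrier ?P. s' (s x) = x" "ALL y:carrier S. s (s' y) = y"
    by (rule small_copy[OF small_product[OF M N] \<iota>])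
   have 1: "(%x. (x, 0[N])) : lin_hom L M ?P" by (rule lin_homI) (simp_all add: N.smult_zero)
   have 2: "(%x. (0[M], x)) : lin_hom L N ?P" by (rule lin_homI) (simp_all add: M.smult_zero)
   have 3: "fst : lin_hom L ?P M" by (rule lin_homI) auto
   have 4: "snd : lin_hom L ?P N" by (rule lin_homI) auto
   have "module_sum R L M N S (%x. s (x, 0[N])) (%x. s (0[M], x)) (%z. fst (s' z)) (%z. snd (s' z))"
    unfolding module_sum_def
   proof (intro conjI ballI S(1) lin_hom_comp[OF S(2) 1] lin_hom_comp[OF S(2) 2] lin_hom_comp[OF 3 S(3)] lin_hom_comp[OF 4 S(3)])
    fix z assume z: "z :. S"
    obtain x y where xy: "s' z = (x, y)" "x :. M" "y :. N" using lin_homD(1)[OF S(3) z] by auto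
    have "s (x, 0[N]) +[S] s (0[M], y) = s ((x, 0[N]) +[?P] (0[M], y))"
     using lin_homD(2)[OF S(2), of "(x, 0[N])" "(0[M], y)"] xy by simp
    also have "\<dots> = z" using S(5)[rule_format, OF z] xy by simp
    finally show "s (fst (s' z), 0[N]) +[S] s (0[M], snd (s' z)) = z" using xy by simp
   qed (simp_all add: S(4))
   thus ?thesis by blast
  qed
 qed
 thus ?thesis by blast
qed

text \<open>Passing to the kernels of one map after another replaces an embedding into a finite
  product.\<close>

lemma finite_length_jointly_injective:
 assumes "!!s' V' f. (s', V', f) : set xs ==> finite_length R s' V' & linear_on R s V s' V' f"
  and "rmod R s V" "!!x. x : V ==> (!!s' V' f. (s', V', f) : set xs ==> f x = 0) ==> x = 0" shows "finite_length R s V"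
 using assms proof (induction xs arbitrary: V)
 case Nil
 interpret rmod R s V by (rule Nil)
 have "x = 0" if "x : V" for x by (rule Nil(3)[OF that]) simp
 hence "V = {0}" using zero_mem by blast
 thus ?case using finite_length_trivial by simp
next
 case (Cons t xs)
 obtain s' V' f where t: "t = (s', V', f)" by (cases t)
 interpret V: rmod R s V by (rule Cons)
 have f: "finite_length R s' V'" "linear_on R s V s' V' f" using Cons.prems(1)[of s' V' f] t by auto
 have V': "rmod R s' V'" by (rule finite_length_rmod[OF f(1)])
 let ?K = "{x : V. f x = 0}"
 have K: "finite_length R s ?K" proof (rule Cons.IH)
  show "rmod R s ?K" by (rule V.rmod_kernel[OF f(2) V'])
  show "finite_length R s'' V'' & linear_on R s ?K s'' V'' g" if "(s'', V'', g) : set xs" for s'' V'' g proof -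
   have "finite_length R s'' V''" "linear_on R s V s'' V'' g" using Cons.prems(1)[of s'' V'' g] that by auto
   thus ?thesis using linear_on_subset[of R s V s'' V'' g ?K] by auto
  qed
  show "x = 0" if x: "x : ?K" and z: "!!s' V' f. (s', V', f) : set xs ==> f x = 0" for x proof (rule Cons.prems(3))
   show "x : V" using x by simp
   show "g x = 0" if "(s'', V'', g) : set (t # xs)" for s'' V'' g using that x z t by auto
  qed
 qed
 have "finite_length R s' (f ` V)"
  by (rule finite_length_sub[OF f(1) V.rmod_image[OF f(2) V']]) (use linear_onD(1)[OF f(2)] in blast)
 moreover have "linear_on R s V s' (f ` V) f" using f(2) by (auto simp: linear_on_def)
 ultimately show ?case using finite_length_extension[OF _ V.rmod_axioms _ refl K] by blast
qed

section \<open>The category of finite graded modules\<close>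

lemma gsesI:
 assumes "!!n. exact_seq L (X n) (Y (n + a)) (Z (n + a + b)) (f n) (g (n + a))"
 shows "gses L a b X Y Z (arr a X Y f) (arr b Y Z g)" proof -
 note e = exact_seqD[OF assms]
 have "right_module L (Y n)" for n using e(2)[of "n - a"] by simp
 moreover have "right_module L (Z n)" for n using e(3)[of "n - b - a"] by simp
 moreover have "g n : lin_hom L (Y n) (Z (n + b))" for n using e(5)[of "n - a"] by simp
 ultimately have "f : ghom L a X Y" "g : ghom L b Y Z" using e(1,4) by (auto simp: ghom_def graded_ob_def)
 thus ?thesis using assms unfolding gses_def by blast
qed

lemma exact_seq_zero:
 assumes "exact_seq L M N P f g" "carrier N = {0[N]}" shows "carrier M = {0[M]}" "carrier P = {0[P]}" proof -
 note e = exact_seqD[OF assms(1)]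
 note ab = right_module_abelian[OF e(1)] right_module_abelian[OF e(2)] right_module_abelian[OF e(3)]
 have "x = 0[M]" if x: "x :. M" for x
  using lin_homD(1)[OF e(4) x] assms(2) lin_hom_eq_0_iff[OF ab(1,2) e(4,6) x] by simp
 thus "carrier M = {0[M]}" using abelian_groupE(2)[OF ab(1)] by blast
 show "carrier P = {0[P]}" using e(7) assms(2) lin_hom_zero[OF ab(2,3) e(5)] by simp
qed

context graded_setup
begin

definition smod :: "(int => ('l, 'm) module) set"
 where "smod = {X. (ALL i. small R L (X i)) & (EX a b. ALL i. i < a | b < i --> carrier (X i) = {0[X i]})}"

definition shom :: "int => (int => ('l, 'm) module) => (int => ('l, 'm) module) => ('l, 'm) tot endo set"
 where "shom k X Y = (if X : smod & Y : smod then bhom L k X Y else {})"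

text \<open>Multiplication by \<open>r\<close> on every coordinate that is a right module, as one
  endomorphism of the universal group. Scaling is composition with it, so most module axioms reduce
  to associativity and biadditivity.\<close>

definition rho :: "'r => ('l, 'm) tot endo" where "rho r = Abs_endo (%v. mk_tot (%i N.
  if right_module L N then (r *[L] 1[L]) *[N] Rep_tot v i N else 0[N]))"

definition scale :: "'r => ('l, 'm) tot endo => ('l, 'm) tot endo" where "scale r z = ecomp (rho r) z"

definition single :: "('l, 'm) module => int => int => ('l, 'm) module" where "single M k i = (if i = k then M else Z)"

lemma smodD: "X : smod ==> small R L (X i)" "X : smod ==> right_module L (X i)" "X : smod ==> graded_ob L X"
 by (auto simp: smod_def graded_ob_def dest: smallD(1))

lemma smod_graded: "smod \<subseteq> Collect (graded_ob L)"
 using smodD(3) by blast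

lemma smodI:
 "(!!i. small R L (X i)) ==> (!!i. i < a | b < i ==> carrier (X i) = {0[X i]}) ==> X : smod" unfolding smod_def by blast

lemma smod_bound:
 assumes "X : smod" obtains a b where "!!i. i < a | b < i ==> carrier (X i) = {0[X i]}"
 using assms unfolding smod_def by blast

lemma shomE:
 assumes "z : shom k X Y" obtains f where "X : smod" "Y : smod" "f : ghom L k X Y" "z = arr k X Y f"
 using assms unfolding shom_def by (auto elim: bhomE split: if_splits)

lemma shomI: "X : smod ==> Y : smod ==> f : ghom L k X Y ==> arr k X Y f : shom k X Y"
 by (simp add: shom_def bhomI)

lemma ghom_smodI:
 "X : smod ==> Y : smod ==> (!!i. f i : lin_hom L (X i) (Y (i + k))) ==> f : ghom L k X Y" by (intro ghomI smodD(3))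

lemma single_smod: "small R L M ==> single M k : smod"
 by (rule smodI[of _ k k]) (use Z_small Z_zero in "auto simp: single_def")

sublocale G: gcat ecomp shom gid smod proof -
 have "shom = (%k X Y. if X : smod & Y : smod then bhom L k X Y else {})" by (simp add: fun_eq_iff shom_def)
 thus "gcat ecomp shom gid smod" using gcat_restrict[OF gcat_big smod_graded] by simp
qed

lemma gses_small_short_exact:
 assumes "gses L a b X Y W i p" "X : smod" "Y : smod" "W : smod" shows "G.short_exact a b X Y W i p" proof -
 have "shom = (%k X Y. if X : smod & Y : smod then bhom L k X Y else {})" by (simp add: fun_eq_iff shom_def)
 thus ?thesis using short_exact_restrict[OF gcat_big smod_graded gses_short_exact[OF assms(1)] assms(2-4)] by simp
qed

lemma scale_hom:
 assumes f: "f : ghom L k X Y" and r: "r :. R" shows "(%i x. (r *[L] 1[L]) *[Y (i + k)] f i x) : ghom L k X Y"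
proof (rule ghomI[OF ghomD(1,2)[OF f]], rule lin_homI)
 fix i x assume x: "x :. (X i)"
 interpret Y: right_module L "Y (i + k)" by (rule ghomD(6)[OF f])
 note F = lin_homD[OF ghomD(3)[OF f]]
 note r1 = unit_smult[OF r]
 show "(r *[L] 1[L]) *[Y (i + k)] f i x :. (Y (i + k))" using Y.smult_closed r1 F(1) x by simp
 show "(r *[L] 1[L]) *[Y (i + k)] f i (x +[X i] y) =
   (r *[L] 1[L]) *[Y (i + k)] f i x +[Y (i + k)] (r *[L] 1[L]) *[Y (i + k)] f i y" if "y :. (X i)" for y
  using x that F r1 by (simp add: Y.smult_r_distr)
 show "(r *[L] 1[L]) *[Y (i + k)] f i (a *[X i] x) = a *[Y (i + k)] ((r *[L] 1[L]) *[Y (i + k)] f i x)"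
  if a: "a :. L" for a using Y.smult_assoc[OF a r1 F(1)[OF x]] Y.smult_assoc[OF r1 a F(1)[OF x]] F(3)[OF a x] a r
  by (simp add: unit_smult_mult)
qed

lemma Rep_rho:
 fixes N :: "('l, 'm) module"
 assumes r: "r :. R" and N: "abelian_group N" shows "Rep_tot (Rep_endo (rho r) v) i N =
  (if right_module L N then (r *[L] 1[L]) *[N] Rep_tot v i N else 0[N])" proof -
 let ?S = "%v. mk_tot (%i (N :: ('l, 'm) module). if right_module L N then (r *[L] 1[L]) *[N] Rep_tot v i N else 0[N])"
 have S: "Rep_tot (?S v) i N = (if right_module L N then (r *[L] 1[L]) *[N] Rep_tot v i N else 0[N])"
  if "abelian_group N" for v i and N :: "('l, 'm) module" by (rule Rep_mk_tot[OF _ that])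
   (auto simp: abelian_groupE(2) intro!: right_module.smult_closed unit_smult[OF r] Rep_tot_mem)
 have "?S (v + w) = ?S v + ?S w" for v w proof (rule tot_eqI)
  fix i and N :: "('l, 'm) module" assume N: "abelian_group N"
  then interpret abelian_group N .
  show "Rep_tot (?S (v + w)) i N = Rep_tot (?S v + ?S w) i N"
   using right_module.smult_r_distr[OF _ unit_smult[OF r] Rep_tot_mem[OF N] Rep_tot_mem[OF N]] N
   by (simp add: S Rep_tot_plus)
 qed
 hence "Rep_endo (rho r) v = ?S v" unfolding rho_def by (rule Rep_Abs_endo)
 thus ?thesis using S[OF N] by simp
qed

lemma rho_add: "r :. R ==> q :. R ==> rho (r +[R] q) = rho r + rho q"
 and rho_mult: "r :. R ==> q :. R ==> rho (r **[R] q) = ecomp (rho r) (rho q)"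
 using module.smult_l_distr[OF module_base, of "_ :: ('l, 'm) module" r q]
  module.smult_assoc1[OF module_base, of "_ :: ('l, 'm) module" r q]
 by (auto intro!: endo_eqI tot_eqI simp: Rep_rho Rep_endo_plus Rep_tot_plus Rep_tot_mem Rep_ecomp abelian_groupE
   abelian_monoid.l_zero abelian_group.axioms(1))

lemma scale_arr:
 assumes f: "f : ghom L k X Y" and r: "r :. R"
 shows "scale r (arr k X Y f) = arr k X Y (%i x. (r *[L] 1[L]) *[Y (i + k)] f i x)" proof (rule endo_eqI, rule tot_eqI)
 fix v i and M :: "('l, 'm) module" assume M: "abelian_group M"
 show "Rep_tot (Rep_endo (scale r (arr k X Y f)) v) i M =
   Rep_tot (Rep_endo (arr k X Y (%i x. (r *[L] 1[L]) *[Y (i + k)] f i x)) v) i M"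
  using M ghomD(6)[OF f, of i] right_module.smult_zero[OF _ unit_smult[OF r], of M]
  by (auto simp: scale_def Rep_ecomp Rep_rho[OF r] Rep_arr[OF f] Rep_arr[OF scale_hom[OF f r]])
qed

lemma scale_mem: "r :. R ==> z : shom k X Y ==> scale r z : shom k X Y"
 by (elim shomE) (simp add: scale_arr shomI scale_hom)

lemma rmod_shom:
 assumes X: "X : smod" and Y: "Y : smod" shows "rmod R scale (shom k X Y)"
proof (intro rmod.intro rmod_axioms.intro cring_axioms)
 show "scale 1[R] z = z" if z: "z : shom k X Y" for z proof -
  obtain f where f: "f : ghom L k X Y" "z = arr k X Y f" using z by (rule shomE)
  show ?thesis unfolding f(2) scale_arr[OF f(1) one_closed] by (rule arr_eqI[OF scale_hom[OF f(1) one_closed] f(1)])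
    (use module.smult_one[OF module_base[OF smodD(2)[OF Y]]] lin_homD(1)[OF ghomD(3)[OF f(1)]] in simp)
 qed
qed (simp_all add: scale_mem G.hom_add G.hom_zero X Y, simp_all add: scale_def ecomp_add rho_add rho_mult ecomp_assoc)

lemma scale_comp:
 assumes r: "r :. R" and g: "g : shom k Y W" and f: "f : shom l X Y"
 shows "scale r (ecomp g f) = ecomp (scale r g) f" "scale r (ecomp g f) = ecomp g (scale r f)" proof -
 obtain v where v: "v : ghom L k Y W" "g = arr k Y W v" using g by (rule shomE)
 obtain w where w: "w : ghom L l X Y" "f = arr l X Y w" using f by (rule shomE)
 show "scale r (ecomp g f) = ecomp (scale r g) f" by (simp add: scale_def ecomp_assoc)
 show "scale r (ecomp g f) = ecomp g (scale r f)"
  unfolding v(2) w(2) arr_comp[OF v(1) w(1)] scale_arr[OF ghom_comp[OF v(1) w(1)] r] scale_arr[OF w(1) r]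
   arr_comp[OF v(1) scale_hom[OF w(1) r]]
  by (rule arr_eqI[OF scale_hom[OF ghom_comp[OF v(1) w(1)] r] ghom_comp[OF v(1) scale_hom[OF w(1) r]]])
   (use lin_homD(3)[OF ghomD(3)[OF v(1)] unit_smult[OF r] lin_homD(1)[OF ghomD(3)[OF w(1)]]] in
    \<open>simp add: add.assoc add.commute[of l]\<close>)
qed

end

section \<open>Elements and functionals as maps from \<open>L0\<close> and to
  \<open>D0\<close>\<close>

context graded_setup
begin

abbreviation L0 :: "int => ('l, 'm) module" where "L0 \<equiv> single Q 0"
abbreviation D0 :: "int => ('l, 'm) module" where "D0 \<equiv> single J 0"

text \<open>Maps of degree \<open>k\<close> from \<open>L0\<close> to \<open>X\<close> correspond to
  elements of \<open>X k\<close>, by their value at the generator \<open>u\<close>.\<close>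

definition val :: "(int => ('l, 'm) module) => int => ('l, 'm) tot endo => 'm"
 where "val X k z = Rep_tot (Rep_endo z (emb 0 Q u)) k (X k)"

definition t0 :: "('l, 'm) tot endo => ('r, 'e) tot" where "t0 z = emb 0 E (ev (val D0 0 z))"

lemma L0_smod: "L0 : smod" and D0_smod: "D0 : smod"
 by (simp_all add: single_smod Q_small J_small)

lemma val_arr:
 assumes "f : ghom L k L0 X" shows "val X k (arr k L0 X f) = f 0 u"
 using arr_apply[OF assms, of u 0] u_mem by (simp add: val_def single_def)

lemma val_mem:
 assumes "w : shom k L0 X" shows "val X k w :. (X k)" proof -
 have "X : smod" using assms by (rule shomE)
 thus ?thesis by (simp add: val_def Rep_tot_mem right_module_abelian[OF smodD(2)])
qed

lemma val_comp:
 assumes w: "w : shom k L0 X" and g: "g : ghom L l X Y" and n: "n = l + k"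
 shows "val Y n (ecomp (arr l X Y g) w) = g k (val X k w)" proof -
 obtain f where f: "f : ghom L k L0 X" "w = arr k L0 X f" using w by (rule shomE)
 show ?thesis unfolding f(2) arr_comp[OF g f(1)] n val_arr[OF ghom_comp[OF g f(1)]] val_arr[OF f(1)] by simp
qed

lemma val_add: "X : smod ==> val X k (z + w) = val X k z +[X k] val X k w"
 by (simp add: val_def Rep_endo_plus Rep_tot_plus right_module_abelian[OF smodD(2)])

lemma val_0: "X : smod ==> val X k 0 = 0[X k]"
 by (simp add: val_def Rep_endo_zero Rep_tot_zero right_module_abelian[OF smodD(2)])

lemma val_scale:
 assumes w: "w : shom k L0 X" and r: "r :. R" shows "val X k (scale r w) = r *[base_module L (X k)] val X k w" proof -
 obtain f where f: "f : ghom L k L0 X" "w = arr k L0 X f" using w by (rule shomE)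
 show ?thesis unfolding f(2) scale_arr[OF f(1) r] val_arr[OF scale_hom[OF f(1) r]] val_arr[OF f(1)] by simp
qed

lemma val_eq_0:
 assumes w: "w : shom k L0 X" and z: "val X k w = 0[X k]" shows "w = 0" proof -
 obtain f where f: "X : smod" "f : ghom L k L0 X" "w = arr k L0 X f" using w by (rule shomE)
 have "f i x = 0[X (i + k)]" if x: "x :. (L0 i)" for i x proof (cases "i = 0")
  case True
  have "f 0 : lin_hom L Q (X k)" using ghomD(4)[OF f(2), of 0 k] by (simp add: single_def)
  moreover have "f 0 u = 0[X k]" using z unfolding f(3) val_arr[OF f(2)] .
  moreover have "x :. Q" using x True by (simp add: single_def)
  ultimately have "f 0 x = 0[X k]" by (rule Q_zero[OF smodD(2)[OF f(1)]])
  thus ?thesis using True by simp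
 next
  case False
  hence "x = 0[L0 i]" using x Z_zero by (simp add: single_def)
  thus ?thesis using lin_hom_zero[OF ghomD(7)[OF f(2)] ghomD(8)[OF f(2)] ghomD(3)[OF f(2)]] by simp
 qed
 thus ?thesis unfolding f(3) by (simp add: arr_eq_0_iff[OF f(2)])
qed

lemma val_inj:
 assumes "w : shom k L0 X" "w' : shom k L0 X" "val X k w = val X k w'" shows "w = w'" proof -
 have X: "X : smod" using assms(1) by (rule shomE)
 interpret X: abelian_group "X k" by (rule right_module_abelian[OF smodD(2)[OF X]])
 note m = val_mem[OF G.hom_diff[OF assms(1,2)]] val_mem[OF assms(2)]
 have "val X k (w - w') +[X k] val X k w' = val X k w'" using val_add[OF X, of k "w - w'" w'] assms(3) by simp
 hence "val X k (w - w') = 0[X k]" using X.add.r_cancel_one[OF m(2,1)] by simp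
 hence "w - w' = 0" by (rule val_eq_0[OF G.hom_diff[OF assms(1,2)]])
 thus ?thesis by simp
qed

lemma point:
 assumes X: "X : smod" and x: "x :. (X k)"
 obtains w where "w : shom k L0 X" "val X k w = x" proof -
 obtain a where a: "a : lin_hom L Q (X k)" "a u = x" using Q_repr[OF smodD(2)[OF X] x] by (elim bexE)
 let ?f = "%i. if i = 0 then a else (%_. 0[X (i + k)])"
 have f: "?f : ghom L k L0 X" by (rule ghom_smodI[OF L0_smod X])
   (simp add: single_def a(1) lin_hom_const_zero[OF smodD(2)[OF X]])
 show thesis by (rule that[OF shomI[OF L0_smod X f]]) (use val_arr[OF f] a(2) in simp)
qed

text \<open>The counterpart of \<open>point\<close>: every functional on \<open>X k\<close> is the
  trace of a map from \<open>X\<close> to \<open>D0\<close>, whose only relevant component is the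
  one in degree \<open>k\<close>.\<close>

lemma copoint:
 assumes X: "X : smod" and ph: "ph : lin_hom R (base_module L (X k)) E"
 obtains a where "a : shom (- k) X D0" "ALL w:shom k L0 X. t0 (ecomp a w) = emb 0 E (ph (val X k w))" proof -
 obtain a where a: "a : lin_hom L (X k) J" "ALL m:carrier (X k). ev (a m) = ph m"
  using J_repr[OF smodD(2)[OF X] ph] by (elim bexE)
 let ?f = "%i. if i = k then a else (%_. 0[D0 (i + - k)])"
 have f: "?f : ghom L (- k) X D0" by (rule ghom_smodI[OF X D0_smod])
   (simp add: a(1) lin_hom_const_zero[OF smodD(2)[OF D0_smod]], simp add: single_def a(1))
 have "t0 (ecomp (arr (- k) X D0 ?f) w) = emb 0 E (ph (val X k w))" if w: "w : shom k L0 X" for w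
  using val_comp[OF w f, of 0] a(2) val_mem[OF w] by (simp add: t0_def)
 thus thesis using that[OF shomI[OF X D0_smod f]] by simp
qed

lemma hom_eq_0:
 assumes f: "f : ghom L k X Y" and X: "X : smod" and Y: "Y : smod"
  and z: "!!l w. w : shom l L0 X ==> ecomp (arr k X Y f) w = 0" shows "arr k X Y f = 0" unfolding arr_eq_0_iff[OF f]
proof (intro allI ballI)
 fix i x assume x: "x :. (X i)"
 obtain w where w: "w : shom i L0 X" "val X i w = x" by (rule point[OF X x])
 have "f i x = val Y (i + k) (ecomp (arr k X Y f) w)" using val_comp[OF w(1) f, of "i + k"] w(2) by simp
 thus "f i x = 0[Y (i + k)]" using z[OF w(1)] val_0[OF Y] by simp
qed

lemma t0_eq_0:
 assumes a: "a : shom k X D0" and z: "!!w. w : shom (- k) L0 X ==> t0 (ecomp a w) = 0" shows "a = 0" proof -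
 obtain h where h: "X : smod" "h : ghom L k X D0" "a = arr k X D0 h" using a by (rule shomE)
 have "h i x = 0[D0 (i + k)]" if x: "x :. (X i)" for i x proof (cases "i = - k")
  case True
  have hJ: "h (- k) : lin_hom L (X (- k)) J" using ghomD(4)[OF h(2), of "- k" 0] by (simp add: single_def)
  have "ev (h (- k) y) = 0[E]" if y: "y :. (X (- k))" for y proof -
   obtain w where w: "w : shom (- k) L0 X" "val X (- k) w = y" by (rule point[OF h(1) y])
   have "emb 0 E (ev (h (- k) y)) = 0" using z[OF w(1)] val_comp[OF w(1) h(2), of 0] w(2) by (simp add: t0_def h(3))
   thus ?thesis using emb_eq_0_iff[OF E_abelian lin_homD(1)[OF ev_hom, of "h (- k) y"]] lin_homD(1)[OF hJ y] by simp
  qed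
  hence "h (- k) x = 0[J]" using J_zero[OF smodD(2)[OF h(1)] hJ _] x True by simp
  thus ?thesis using True by (simp add: single_def)
 next
  case False
  hence "D0 (i + k) = Z" by (auto simp: single_def)
  thus ?thesis using lin_homD(1)[OF ghomD(3)[OF h(2)] x] Z_zero by simp
 qed
 thus ?thesis unfolding h(3) by (simp add: arr_eq_0_iff[OF h(2)])
qed

lemma generators:
 assumes X: "X : smod"
 obtains G where "finite G" "ALL (i, s):G. s :. (X i)"
  "ALL k Y f. f : ghom L k X Y --> (ALL (i, s):G. f i s = 0[Y (i + k)]) --> arr k X Y f = 0" proof -
 obtain a b where ab: "!!i. i < a | b < i ==> carrier (X i) = {0[X i]}" using smod_bound[OF X] by blast
 have "EX S. finite S & generated L (X i) S" for i by (rule small_generated[OF smodD(1)[OF X, of i]]) blast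
 then obtain S where S: "!!i. finite (S i)" "!!i. generated L (X i) (S i)" by metis
 have Sc: "S i \<subseteq> carrier (X i)" for i using S(2)[of i] by (simp add: generated_def)
 \<comment> \<open>Boundedness of \<open>X\<close> leaves only the degrees from \<open>a\<close> to
   \<open>b\<close>, so the generators are finite in number.\<close>
 show thesis proof (rule that[of "Sigma {a..b} S"])
  show "finite (Sigma {a..b} S)" using S(1) by simp
  show "ALL (i, s):Sigma {a..b} S. s :. (X i)" using Sc by auto
  show "ALL k Y f. f : ghom L k X Y --> (ALL (i, s):Sigma {a..b} S. f i s = 0[Y (i + k)]) --> arr k X Y f = 0"
  proof (intro allI impI)
  fix k Y f assume f: "f : ghom L k X Y" and z: "ALL (i, s):Sigma {a..b} S. f i s = 0[Y (i + k)]"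
  show "arr k X Y f = 0" unfolding arr_eq_0_iff[OF f] proof (intro allI ballI)
   fix i x assume x: "x :. (X i)"
   interpret X: right_module L "X i" by (rule ghomD(5)[OF f])
   interpret Y: right_module L "Y (i + k)" by (rule ghomD(6)[OF f])
   note F = ghomD(3)[OF f, of i]
   have f0: "f i 0[X i] = 0[Y (i + k)]" by (rule lin_hom_zero[OF ghomD(7)[OF f] ghomD(8)[OF f] F])
   show "f i x = 0[Y (i + k)]" proof (cases "i < a | b < i")
    case True
    thus ?thesis using ab[OF True] x f0 by simp
   next
    case False
    have "{x : carrier (X i). f i x = 0[Y (i + k)]} = carrier (X i)" by (rule generatedD[OF S(2)])
      (use f0 Sc z False in "auto simp: lin_homD(2,3)[OF F] X.smult_closed Y.smult_zero")
    thus ?thesis using x by blast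
   qed
  qed
  qed
 qed
qed

text \<open>A map is determined by its values at finitely many homogeneous generators of
  \<open>X\<close>, and these values lie in modules of finite length.\<close>

lemma hom_finite_length:
 assumes X: "X : smod" and Y: "Y : smod" shows "finite_length R scale (shom k X Y)" proof -
 obtain G where G: "finite G" "ALL (i, s):G. s :. (X i)"
  "ALL k Y f. f : ghom L k X Y --> (ALL (i, s):G. f i s = 0[Y (i + k)]) --> arr k X Y f = 0" by (rule generators[OF X])
 let ?B = "%i. base_module L (Y (i + k))"
 define F where "F i s z = emb 0 (?B i) (Rep_tot (Rep_endo z (emb i (X i) s)) (i + k) (Y (i + k)))" for i s z
 have B: "module R (?B i)" for i by (rule module_base[OF smodD(2)[OF Y]])
 have ab: "abelian_group (?B i)" for i by (rule module.axioms(2)[OF B])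
 have abY: "abelian_group (Y i)" for i by (rule right_module_abelian[OF smodD(2)[OF Y]])
 have Farr: "F i s (arr k X Y f) = emb 0 (?B i) (f i s)" if "f : ghom L k X Y" "s :. (X i)" for i s f
  using arr_apply[OF that] by (simp add: F_def)
 obtain gs where gs: "set gs = G" using finite_list[OF G(1)] by blast
 let ?xs = "map (%(i, s). (act (?B i), embedded (?B i), F i s)) gs"
 show ?thesis proof (rule finite_length_jointly_injective[of ?xs])
  show "rmod R scale (shom k X Y)" by (rule rmod_shom[OF X Y])
  show "finite_length R s' V' & linear_on R scale (shom k X Y) s' V' f" if mem: "(s', V', f) : set ?xs" for s' V' f
  proof -
   obtain i s where iG: "(i, s) : G" "s' = act (?B i)" "V' = embedded (?B i)" "f = F i s" using mem gs by auto
   have s: "s :. (X i)" using G(2) iG(1) by blast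
   have "linear_on R scale (shom k X Y) (act (?B i)) (embedded (?B i)) (F i s)" proof (rule linear_onI)
    fix z assume z: "z : shom k X Y"
    obtain g where g: "g : ghom L k X Y" "z = arr k X Y g" using z by (rule shomE)
    have gs: "g i s :. (Y (i + k))" by (rule lin_homD(1)[OF ghomD(3)[OF g(1)] s])
    show "F i s z : embedded (?B i)" using gs by (simp add: g(2) Farr[OF g(1) s] embedded_def)
    show "F i s (z + w) = F i s z + F i s w" for w
     using emb_add[OF ab, of "Rep_tot (Rep_endo z (emb i (X i) s)) (i + k) (Y (i + k))" i
      "Rep_tot (Rep_endo w (emb i (X i) s)) (i + k) (Y (i + k))" 0] Rep_tot_mem[OF abY]
     by (simp add: F_def Rep_endo_plus Rep_tot_plus abY)
    show "F i s (scale r z) = act (?B i) r (F i s z)" if r: "r :. R" for r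
     unfolding g(2) scale_arr[OF g(1) r] Farr[OF g(1) s] Farr[OF scale_hom[OF g(1) r] s]
     using act_emb[OF B, of "g i s" i r] gs by simp
   qed
   thus ?thesis using smallD(2)[OF smodD(1)[OF Y]] iG by (simp add: fin_length_def)
  qed
  fix z assume z: "z : shom k X Y" and 0: "!!s' V' f. (s', V', f) : set ?xs ==> f z = 0"
  obtain g where g: "g : ghom L k X Y" "z = arr k X Y g" using z by (rule shomE)
  have "g i s = 0[Y (i + k)]" if iG: "(i, s) : G" for i s proof -
   have s: "s :. (X i)" using G(2) iG by blast
   have "(act (?B i), embedded (?B i), F i s) : set ?xs" using iG gs by force
   hence "F i s z = 0" by (rule 0)
   thus ?thesis
    using emb_eq_0_iff[OF ab, of "g i s" i 0] lin_homD(1)[OF ghomD(3)[OF g(1)] s] by (simp add: g(2) Farr[OF g(1) s])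
  qed
  thus "z = 0" unfolding g(2) by (intro G(3)[rule_format, OF g(1)]) auto
 qed
qed

end

section \<open>Graded modules satisfy the axioms of \<open>serre_setup\<close>\<close>

context graded_setup
begin

lemma val_linear:
 assumes X: "X : smod" and ph: "ph : lin_hom R (base_module L (X k)) E"
 shows "linear_on R scale (shom k L0 X) (act E) (embedded E) (%w. emb 0 E (ph (val X k w)))" proof (rule linear_onI)
 note p = lin_homD[OF ph, unfolded base_module_simps]
 fix w assume w: "w : shom k L0 X"
 note wX = val_mem[OF w]
 show "emb 0 E (ph (val X k w)) : embedded E" using p(1)[OF wX] by (simp add: embedded_def)
 show "emb 0 E (ph (val X k (w + v))) = emb 0 E (ph (val X k w)) + emb 0 E (ph (val X k v))"
  if v: "v : shom k L0 X" for v
  using p(1,2)[OF wX] p(1) val_mem[OF v] by (simp add: val_add[OF X] emb_add[OF E_abelian])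
 show "emb 0 E (ph (val X k (scale r w))) = act E r (emb 0 E (ph (val X k w)))" if r: "r :. R" for r
  using p(3)[OF r wX] act_emb[OF E_module p(1)[OF wX]] by (simp add: val_scale[OF w r])
qed

lemma functional_val:
 assumes X: "X : smod" and ph: "E.functional scale (shom k L0 X) ph"
 obtains ps where "ps : lin_hom R (base_module L (X k)) E" "ALL w:shom k L0 X. ph w = emb 0 E (ps (val X k w))"
proof -
 interpret H: rmod R scale "shom k L0 X" by (rule rmod_shom[OF L0_smod X])
 interpret X: right_module L "X k" by (rule smodD(2)[OF X])
 define W where "W x = (SOME w. w : shom k L0 X & val X k w = x)" for x
 have W: "W x : shom k L0 X & val X k (W x) = x" if "x :. (X k)" for x proof -
  have "EX w. w : shom k L0 X & val X k w = x" by (rule point[OF X that]) blast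
  thus ?thesis unfolding W_def by (rule someI_ex)
 qed
 have Wv: "W (val X k w) = w" if "w : shom k L0 X" for w using W[OF val_mem[OF that]] val_inj that by blast
 have prj: "prj E (ph w) :. E" "emb 0 E (prj E (ph w)) = ph w" if w: "w : shom k L0 X" for w
  using linear_onD(1)[OF ph w] E_abelian by (auto simp: embedded_def prj_mem)
 have "(%x. prj E (ph (W x))) : lin_hom R (base_module L (X k)) E" proof (rule lin_homI, unfold base_module_simps)
  fix x assume x: "x :. (X k)"
  show "prj E (ph (W x)) :. E" using prj(1) W[OF x] by blast
  show "prj E (ph (W (x +[X k] y))) = prj E (ph (W x)) +[E] prj E (ph (W y))" if y: "y :. (X k)" for y
  proof -
   have "W (val X k (W x + W y)) = W x + W y" by (rule Wv) (simp add: W[OF x] W[OF y] H.add_mem)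
   hence "W (x +[X k] y) = W x + W y" by (simp add: val_add[OF X] W[OF x] W[OF y])
   thus ?thesis using linear_onD(2)[OF ph] W[OF x] W[OF y] prj_add[OF E_abelian] by simp
  qed
  show "prj E (ph (W ((r *[L] 1[L]) *[X k] x))) = r *[E] prj E (ph (W x))" if r: "r :. R" for r proof -
   have Wx: "W x : shom k L0 X" using W[OF x] by simp
   have "W (val X k (scale r (W x))) = scale r (W x)" by (rule Wv[OF scale_mem[OF r Wx]])
   hence "W ((r *[L] 1[L]) *[X k] x) = scale r (W x)" by (simp add: val_scale[OF Wx r] W[OF x])
   hence "prj E (ph (W ((r *[L] 1[L]) *[X k] x))) = prj E (act E r (ph (W x)))"
    using linear_onD(3)[OF ph r Wx] by simp
   thus ?thesis using module.smult_closed[OF E_module r prj(1)[OF Wx]] E_abelian by (simp add: act_def)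
  qed
 qed
 thus thesis by (rule that) (simp add: Wv prj(2))
qed

text \<open>The homogeneous generators of \<open>X\<close>, read as maps from
  \<open>L0\<close>.\<close>

lemma finite_generation:
 assumes X: "X : smod" shows "EX G. finite G & (ALL (k, w):G. w : shom k L0 X) &
  (ALL l. ALL a:shom l X D0. (ALL (k, w):G. ecomp a w = 0) --> a = 0)" proof -
 obtain G where G: "finite G" "ALL (i, s):G. s :. (X i)"
  "ALL k Y f. f : ghom L k X Y --> (ALL (i, s):G. f i s = 0[Y (i + k)]) --> arr k X Y f = 0" by (rule generators[OF X])
 define W where "W i s = (SOME w. w : shom i L0 X & val X i w = s)" for i s
 have W: "W i s : shom i L0 X & val X i (W i s) = s" if "(i, s) : G" for i s proof -
  have s: "s :. (X i)" using G(2) that by blast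
  have "EX w. w : shom i L0 X & val X i w = s" by (rule point[OF X s]) blast
  thus ?thesis unfolding W_def by (rule someI_ex)
 qed
 have "a = 0" if a: "a : shom l X D0" and z: "ALL (k, w):(%(i, s). (i, W i s)) ` G. ecomp a w = 0" for l a proof -
  obtain f where f: "f : ghom L l X D0" "a = arr l X D0 f" using a by (rule shomE)
  have "f i s = 0[D0 (i + l)]" if iG: "(i, s) : G" for i s proof -
   have "ecomp a (W i s) = 0" using z iG by force
   moreover have "val D0 (i + l) (ecomp a (W i s)) = f i s"
    unfolding f(2) using val_comp[OF _ f(1), of "W i s" i "i + l"] W[OF iG] by simp
   ultimately show ?thesis using val_0[OF D0_smod] by simp
  qed
  thus "a = 0" unfolding f(2) by (intro G(3)[rule_format, OF f(1)]) auto
 qed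
 thus ?thesis using G(1) W by (intro exI[of _ "(%(i, s). (i, W i s)) ` G"]) auto
qed

text \<open>Finitely many functionals separating the elements in each of finitely many degrees, read
  as maps to \<open>D0\<close>.\<close>

lemma finite_cogeneration:
 assumes X: "X : smod" shows "EX G. finite G & (ALL (k, w):G. w : shom k X D0) &
  (ALL l. ALL a:shom l L0 X. (ALL (k, w):G. ecomp w a = 0) --> a = 0)" proof -
 obtain a b where ab: "!!i. i < a | b < i ==> carrier (X i) = {0[X i]}" using smod_bound[OF X] by blast
 have "EX Ph. finite Ph & Ph \<subseteq> lin_hom R (base_module L (X i)) E &
   (ALL x:carrier (X i). (ALL ph:Ph. ph x = 0[E]) --> x = 0[X i])" for i
 proof (rule E_cogenerators[OF module_base[OF smodD(2)[OF X]] smallD(2)[OF smodD(1)[OF X]], of i])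
  fix Ph assume "finite Ph" "Ph \<subseteq> lin_hom R (base_module L (X i)) E"
   and "!!x. x :. (base_module L (X i)) ==> (!!ph. ph : Ph ==> ph x = 0[E]) ==> x = 0[base_module L (X i)]"
  thus ?thesis by (intro exI[of _ Ph]) simp
 qed
 hence "ALL i. EX Ph. finite Ph & Ph \<subseteq> lin_hom R (base_module L (X i)) E &
   (ALL x:carrier (X i). (ALL ph:Ph. ph x = 0[E]) --> x = 0[X i])" by (rule allI)
 from choice[OF this] obtain Ph where all: "ALL i. finite (Ph i) & Ph i \<subseteq> lin_hom R (base_module L (X i)) E &
   (ALL x:carrier (X i). (ALL ph:Ph i. ph x = 0[E]) --> x = 0[X i])" by (elim exE)
 have Ph: "finite (Ph i)" "Ph i \<subseteq> lin_hom R (base_module L (X i)) E"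
  "x :. (X i) ==> ALL ph:Ph i. ph x = 0[E] ==> x = 0[X i]" for i x using all[rule_format, of i] by simp_all
 define W where "W i ph = (SOME a. a : shom (- i) X D0 & (ALL w:shom i L0 X. t0 (ecomp a w) = emb 0 E (ph (val X i w))))" for i ph
 have W: "W i ph : shom (- i) X D0 & (ALL w:shom i L0 X. t0 (ecomp (W i ph) w) = emb 0 E (ph (val X i w)))" if "ph : Ph i" for i ph
 proof -
  have "EX a. a : shom (- i) X D0 & (ALL w:shom i L0 X. t0 (ecomp a w) = emb 0 E (ph (val X i w)))"
   by (rule copoint[OF X subsetD[OF Ph(2) that]]) blast
  thus ?thesis unfolding W_def by (rule someI_ex)
 qed
 let ?G = "(%(i, ph). (- i, W i ph)) ` Sigma {a..b} Ph"
 have "w = 0" if w: "w : shom l L0 X" and z: "ALL (k, v):?G. ecomp v w = 0" for l w proof -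
  have "val X l w = 0[X l]" proof (cases "l < a | b < l")
   case True
   thus ?thesis using ab[OF True] val_mem[OF w] by simp
  next
   case False
   show ?thesis proof (rule Ph(3)[OF val_mem[OF w]], rule ballI)
    fix ph assume ph: "ph : Ph l"
    have "(- l, W l ph) : ?G" using ph False by force
    hence "ecomp (W l ph) w = 0" using z by blast
    moreover have "t0 0 = 0"
     using lin_hom_zero[OF module.axioms(2)[OF module_base[OF smallD(1)[OF J_small]]] E_abelian ev_hom]
     by (simp add: t0_def val_0[OF D0_smod] single_def emb_zero[OF E_abelian])
    ultimately have "emb 0 E (ph (val X l w)) = 0" using W[OF ph] w by metis
    thus "ph (val X l w) = 0[E]"
     using emb_eq_0_iff[OF E_abelian, of "ph (val X l w)" 0] lin_homD(1)[OF subsetD[OF Ph(2) ph], of "val X l w"] val_mem[OF w]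
     by simp
   qed
  qed
  thus "w = 0" by (rule val_eq_0[OF w])
 qed
 thus ?thesis using Ph(1) W by (intro exI[of _ ?G]) auto
qed

lemma shift:
 assumes X: "X : smod"
 shows "EX X' s s'. s : shom k X' X & s' : shom (- k) X X' & ecomp s s' = gid X & ecomp s' s = gid X'" proof -
 let ?X = "%i. X (i + k)"
 obtain a b where ab: "!!i. i < a | b < i ==> carrier (X i) = {0[X i]}" using smod_bound[OF X] by blast
 have X': "?X : smod" by (rule smodI[of _ "a - k" "b - k"]) (use ab smodD(1)[OF X] in auto)
 have s: "(%i x. x) : ghom L k ?X X" by (rule ghom_smodI[OF X' X]) (simp add: lin_hom_def)
 have s': "(%i x. x) : ghom L (- k) X ?X" by (rule ghom_smodI[OF X X']) (simp add: lin_hom_def)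
 have "ecomp (arr k ?X X (%i x. x)) (arr (- k) X ?X (%i x. x)) = gid X" unfolding arr_comp[OF s s'] gid_def by simp
 moreover have "ecomp (arr (- k) X ?X (%i x. x)) (arr k ?X X (%i x. x)) = gid ?X"
  unfolding arr_comp[OF s' s] gid_def by simp
 ultimately show ?thesis using shomI[OF X' X s] shomI[OF X X' s'] by blast
qed

lemma biproduct:
 assumes X: "X : smod" and Y: "Y : smod" shows "EX S i1 i2 p1 p2. G.biprod 0 X Y S i1 i2 p1 p2" proof -
 have "EX S i1 i2 p1 p2. module_sum R L (X n) (Y n) S i1 i2 p1 p2" for n by (rule sum[OF smodD(1)[OF X] smodD(1)[OF Y]])
 then obtain S i1 i2 p1 p2 where ms: "!!n. module_sum R L (X n) (Y n) (S n) (i1 n) (i2 n) (p1 n) (p2 n)" by metis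
 note M = ms[unfolded module_sum_def]
 have l: "i1 n : lin_hom L (X n) (S n)" "i2 n : lin_hom L (Y n) (S n)" "p1 n : lin_hom L (S n) (X n)"
  "p2 n : lin_hom L (S n) (Y n)" for n using M by blast+
 obtain a b where ab: "!!i. i < a | b < i ==> carrier (X i) = {0[X i]}" using smod_bound[OF X] by blast
 obtain c d where cd: "!!i. i < c | d < i ==> carrier (Y i) = {0[Y i]}" using smod_bound[OF Y] by blast
 have S: "S : smod" proof (rule smodI[of _ "min a c" "max b d"])
  show sS: "small R L (S n)" for n using M by blast
  fix n assume "n < min a c | max b d < n"
  hence n: "n < a | b < n" "n < c | d < n" by auto
  interpret S: right_module L "S n" by (rule smallD(1)[OF sS])
  have "z = 0[S n]" if z: "z :. (S n)" for z proof -
   have "p1 n z = 0[X n]" "p2 n z = 0[Y n]"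
    using lin_homD(1)[OF l(3) z] lin_homD(1)[OF l(4) z] ab[OF n(1)] cd[OF n(2)] by auto
   moreover have "i1 n 0[X n] = 0[S n]" "i2 n 0[Y n] = 0[S n]"
    by (rule lin_hom_zero[OF right_module_abelian[OF smodD(2)[OF X]] S.M.abelian_group_axioms l(1)],
      rule lin_hom_zero[OF right_module_abelian[OF smodD(2)[OF Y]] S.M.abelian_group_axioms l(2)])
   moreover have "i1 n (p1 n z) +[S n] i2 n (p2 n z) = z" using M z by blast
   ultimately show ?thesis by simp
  qed
  thus "carrier (S n) = {0[S n]}" using S.M.zero_closed by blast
 qed
 have g: "i1 : ghom L 0 X S" "i2 : ghom L 0 Y S" "p1 : ghom L 0 S X" "p2 : ghom L 0 S Y"
  using l by (auto intro!: ghom_smodI X Y S)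
 have comp0: "ecomp (arr 0 B C h) (arr 0 A B h') = arr 0 A C (%n x. h n (h' n x))"
  if "h : ghom L 0 B C" "h' : ghom L 0 A B" for A B C h h' using arr_comp[OF that] by simp
 have ghom_comp0: "(%n x. h n (h' n x)) : ghom L 0 A C" if "h : ghom L 0 B C" "h' : ghom L 0 A B" for A B C h h'
  using ghom_comp[OF that] by simp
 have "G.biprod 0 X Y S (arr 0 X S i1) (arr 0 Y S i2) (arr 0 S X p1) (arr 0 S Y p2)" unfolding G.biprod_def
 proof (intro conjI)
  show "arr 0 X S i1 : shom 0 X S" "arr 0 Y S i2 : shom 0 Y S" "arr 0 S X p1 : shom 0 S X"
   "arr 0 S Y p2 : shom (- 0) S Y" using g X Y S by (simp_all add: shomI)
  show "ecomp (arr 0 S X p1) (arr 0 X S i1) = gid X" unfolding comp0[OF g(3,1)] gid_def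
   by (rule arr_eqI[OF ghom_comp0[OF g(3,1)] ghom_id[OF smodD(3)[OF X]]]) (use M in blast)
  show "ecomp (arr 0 S Y p2) (arr 0 Y S i2) = gid Y" unfolding comp0[OF g(4,2)] gid_def
   by (rule arr_eqI[OF ghom_comp0[OF g(4,2)] ghom_id[OF smodD(3)[OF Y]]]) (use M in blast)
  show "ecomp (arr 0 S X p1) (arr 0 Y S i2) = 0"
   unfolding comp0[OF g(3,2)] arr_eq_0_iff[OF ghom_comp0[OF g(3,2)]] using M by simp
  show "ecomp (arr 0 S Y p2) (arr 0 X S i1) = 0"
   unfolding comp0[OF g(4,1)] arr_eq_0_iff[OF ghom_comp0[OF g(4,1)]] using M by simp
  show "ecomp (arr 0 X S i1) (arr 0 S X p1) + ecomp (arr 0 Y S i2) (arr 0 S Y p2) = gid S"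
   unfolding comp0[OF g(1,3)] comp0[OF g(2,4)] gid_def
    arr_add[OF ghom_comp0[OF g(1,3)] ghom_comp0[OF g(2,4)], symmetric]
   by (rule arr_eqI[OF ghom_add[OF ghom_comp0[OF g(1,3)] ghom_comp0[OF g(2,4)]] ghom_id[OF smodD(3)[OF S]]])
    (use M in simp)
 qed
 thus ?thesis by blast
qed

lemma factorization:
 assumes f: "f : shom k X Y"
 shows "EX K I C kap p i c. G.short_exact 0 k K X I kap p & G.short_exact 0 0 I Y C i c & f = ecomp i p"
proof -
 obtain h where h: "X : smod" "Y : smod" "h : ghom L k X Y" "f = arr k X Y h" using f by (rule shomE)
 have "EX K I (C :: ('l, 'm) module) c. exact_seq L K (X n) I (%x. x) (h n) & exact_seq L I (Y (n + k)) C (%x. x) c" for n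
  by (rule exact_seq_factorization[OF ghomD(5)[OF h(3), of n] ghomD(6)[OF h(3), of "n + k"] ghomD(3)[OF h(3), of n]]) blast
 hence "ALL n. EX K I (C :: ('l, 'm) module) c. exact_seq L K (X n) I (%x. x) (h n) & exact_seq L I (Y (n + k)) C (%x. x) c"
  by (rule allI)
 hence "EX K I (C :: int => ('l, 'm) module) c. ALL n. exact_seq L (K n) (X n) (I n) (%x. x) (h n) &
   exact_seq L (I n) (Y (n + k)) (C n) (%x. x) (c n)" unfolding choice_iff .
 then obtain K I' C' c' where "ALL n. exact_seq L (K n) (X n) (I' n) (%x. x) (h n) &
   exact_seq L (I' n) (Y (n + k)) (C' n :: ('l, 'm) module) (%x. x) (c' n)" by (elim exE)
 hence e: "exact_seq L (K n) (X n) (I' n) (%x. x) (h n)"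
  "exact_seq L (I' n) (Y (n + k)) (C' n) (%x. x) (c' n)" for n by simp_all
 \<comment> \<open>Reindexing places the image in the degree of its ambient component of
   \<open>Y\<close>, so that the epimorphism has degree \<open>k\<close> and the inclusion degree
   0.\<close>
 define I where "I n = I' (n - k)" for n
 define C where "C n = C' (n - k)" for n
 define c where "c n = c' (n - k)" for n
 have e1: "exact_seq L (K n) (X n) (I (n + k)) (%x. x) (h n)" for n using e(1)[of n] by (simp add: I_def)
 have e2: "exact_seq L (I n) (Y n) (C n) (%x. x) (c n)" for n using e(2)[of "n - k"] by (simp add: I_def C_def c_def)
 obtain a b where ab: "!!i. i < a | b < i ==> carrier (X i) = {0[X i]}" using smod_bound[OF h(1)] by blast
 obtain a' b' where ab': "!!i. i < a' | b' < i ==> carrier (Y i) = {0[Y i]}" using smod_bound[OF h(2)] by blast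
 have K: "K : smod" by (rule smodI[of _ a b], rule small_sub[OF smodD(1)[OF h(1)] exact_seqD(1,4,6)[OF e1]])
   (rule exact_seq_zero(1)[OF e1 ab])
 have I: "I : smod" by (rule smodI[of _ a' b'], rule small_sub[OF smodD(1)[OF h(2)] exact_seqD(1,4,6)[OF e2]])
   (rule exact_seq_zero(1)[OF e2 ab'])
 have C: "C : smod" by (rule smodI[of _ a' b'], rule small_image[OF smodD(1)[OF h(2)] exact_seqD(3,5,7)[OF e2]])
   (rule exact_seq_zero(2)[OF e2 ab'])
 have "gses L 0 k K X I (arr 0 K X (%i x. x)) (arr k X I h)" by (rule gsesI) (use e1 in simp)
 hence s1: "G.short_exact 0 k K X I (arr 0 K X (%i x. x)) (arr k X I h)" by (rule gses_small_short_exact[OF _ K h(1) I])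
 have "gses L 0 0 I Y C (arr 0 I Y (%i x. x)) (arr 0 Y C c)" by (rule gsesI) (use e2 in simp)
 hence s2: "G.short_exact 0 0 I Y C (arr 0 I Y (%i x. x)) (arr 0 Y C c)" by (rule gses_small_short_exact[OF _ I h(2) C])
 have gi: "(%i x. x) : ghom L 0 I Y" by (rule ghom_smodI[OF I h(2)]) (use exact_seqD(4)[OF e2] in simp)
 have gh: "h : ghom L k X I" by (rule ghom_smodI[OF h(1) I]) (rule exact_seqD(5)[OF e1])
 have "f = ecomp (arr 0 I Y (%i x. x)) (arr k X I h)" unfolding arr_comp[OF gi gh] h(4) by simp
 thus ?thesis using s1 s2 by blast
qed

theorem serre_setup_graded: "serre_setup R (act E) (embedded E) ecomp shom gid smod scale L0 D0 t0"
proof (intro serre_setup.intro serre_setup_axioms.intro matlis_E G.gcat_axioms)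
 have evD: "ev : lin_hom R (base_module L (D0 0)) E" using ev_hom by (simp add: single_def)
 show "E.functional scale (shom 0 L0 D0) t0" using val_linear[OF D0_smod evD] by (simp add: t0_def[abs_def])
 show "EX a:shom (- k) X D0. ALL f:shom k L0 X. ph f = t0 (ecomp a f)"
  if X: "X : smod" and ph: "E.functional scale (shom k L0 X) ph" for X k ph proof -
  obtain ps where ps: "ps : lin_hom R (base_module L (X k)) E" "ALL w:shom k L0 X. ph w = emb 0 E (ps (val X k w))"
   by (rule functional_val[OF X ph])
  obtain a where a: "a : shom (- k) X D0" "ALL w:shom k L0 X. t0 (ecomp a w) = emb 0 E (ps (val X k w))"
   by (rule copoint[OF X ps(1)])
  show ?thesis by (rule bexI[OF _ a(1)]) (simp add: a(2) ps(2))
 qed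
 show "EX Z:smod. gid Z = 0" proof (rule bexI)
  show Zs: "single Z 0 : smod" by (rule single_smod[OF Z_small])
  show "gid (single Z 0) = 0"
   unfolding gid_def arr_eq_0_iff[OF ghom_id[OF smodD(3)[OF Zs]]] using Z_zero by (simp add: single_def)
 qed
 show "f = 0" if f: "f : shom k X Y" and z: "!!l w. w : shom l L0 X ==> ecomp f w = 0" for f k X Y proof -
  obtain h where h: "X : smod" "Y : smod" "h : ghom L k X Y" "f = arr k X Y h" using f by (rule shomE)
  show ?thesis unfolding h(4) by (rule hom_eq_0[OF h(3,1,2)]) (use z h(4) in simp)
 qed
 show "f = 0" if f: "f : shom k X Y" and z: "!!l w. w : shom l Y D0 ==> ecomp w f = 0" for f k X Y proof -
  obtain h where h: "X : smod" "Y : smod" "h : ghom L k X Y" "f = arr k X Y h" using f by (rule shomE)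
  have "h i x = 0[Y (i + k)]" if x: "x :. (X i)" for i x proof (rule ccontr)
   assume nz: "h i x ~= 0[Y (i + k)]"
   have hx: "h i x :. (base_module L (Y (i + k)))" "h i x ~= 0[base_module L (Y (i + k))]"
    using lin_homD(1)[OF ghomD(3)[OF h(3)] x] nz by simp_all
   obtain ph where ph: "ph : lin_hom R (base_module L (Y (i + k))) E" "ph (h i x) ~= 0[E]"
    by (rule E_separate[OF module_base[OF smodD(2)[OF h(2)]] hx])
   obtain a where a: "a : shom (- (i + k)) Y D0" "ALL w:shom (i + k) L0 Y. t0 (ecomp a w) = emb 0 E (ph (val Y (i + k) w))"
    by (rule copoint[OF h(2) ph(1)])
   obtain w where w: "w : shom i L0 X" "val X i w = x" by (rule point[OF h(1) x])
   have fw: "ecomp f w : shom (i + k) L0 Y" by (rule G.hom_compI[OF f w(1)]) simp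
   have "val Y (i + k) (ecomp f w) = h i x" unfolding h(4) using val_comp[OF w(1) h(3), of "i + k"] w(2) by simp
   hence "t0 (ecomp a (ecomp f w)) = emb 0 E (ph (h i x))" using a(2) fw by simp
   moreover have "ecomp a (ecomp f w) = ecomp 0 w" using z[OF a(1)] by (simp flip: ecomp_assoc)
   moreover have "t0 (ecomp 0 w) = 0"
    using lin_hom_zero[OF module.axioms(2)[OF module_base[OF smallD(1)[OF J_small]]] E_abelian ev_hom]
    by (simp add: t0_def val_0[OF D0_smod] single_def emb_zero[OF E_abelian])
   ultimately show False using emb_eq_0_iff[OF E_abelian lin_homD(1)[OF ph(1) hx(1)]] ph(2) by simp
  qed
  thus ?thesis unfolding h(4) by (simp add: arr_eq_0_iff[OF h(3)])
 qed
qed (fact hom_finite_length scale_comp shift biproduct factorization L0_smod D0_smod t0_eq_0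
  finite_generation finite_cogeneration)+

end

section \<open>Injective dimension\<close>

lemma projective_ob_big:
 fixes P :: "int => ('l, 'm) module"
 assumes "!!i. projective_module L (P i)" shows "gcat_ses.projective_ob ecomp (bhom L) (gses L) P" proof -
 interpret B: gcat_ses ecomp "bhom L" gid "Collect (graded_ob L) :: (int => ('l, 'm) module) set" "gses L"
  by (rule gcat_ses_big)
 show ?thesis unfolding B.projective_ob_def proof (intro allI impI ballI)
  fix a b X Y W i p k z assume s: "gses L a b X Y W i p" and z: "z : bhom L k P W"
  obtain f g where fg: "f : ghom L a X Y" "g : ghom L b Y W" "p = arr b Y W g"
   and ex: "!!n. exact_seq L (X n) (Y (n + a)) (W (n + a + b)) (f n) (g (n + a))" using s unfolding gses_def by blast
  obtain h where h: "h : ghom L k P W" "z = arr k P W h" using z by (rule bhomE)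
  have "EX v:lin_hom L (P n) (Y (n + (k - b))). ALL x:carrier (P n). g (n + (k - b)) (v x) = h n x" for n proof -
   have e: "n + (k - b) = n + k - b - a + a" "n + k - b - a + a + b = n + k" by simp_all
   have "g (n + (k - b)) ` carrier (Y (n + (k - b))) = carrier (W (n + k))"
    using exact_seqD(7)[OF ex[of "n + k - b - a"]] unfolding e by simp
   moreover have "g (n + (k - b)) : lin_hom L (Y (n + (k - b))) (W (n + k))" by (rule ghomD(4)[OF fg(2)]) simp
   ultimately show ?thesis using assms[of n] ghomD(3)[OF h(1), of n] ghomD(5)[OF fg(2)] ghomD(6)[OF fg(2)]
    unfolding projective_module_def by blast
  qed
  hence "ALL n. EX v. v : lin_hom L (P n) (Y (n + (k - b))) & (ALL x:carrier (P n). g (n + (k - b)) (v x) = h n x)" by blast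
  from choice[OF this] obtain v where v: "!!n. v n : lin_hom L (P n) (Y (n + (k - b)))"
   "!!n x. x :. (P n) ==> g (n + (k - b)) (v n x) = h n x" by blast
  have vg: "v : ghom L (k - b) P Y" by (rule ghomI[OF ghomD(1)[OF h(1)] ghomD(1)[OF fg(2)] v(1)])
  have "z = ecomp p (arr (k - b) P Y v)" unfolding h(2) fg(3) arr_comp[OF fg(2) vg] using ghom_comp[OF fg(2) vg]
   by (simp add: arr_eqI[OF h(1)] v(2))
  thus "EX g:bhom L (k - b) P Y. z = ecomp p g" using bhomI[OF vg] by blast
 qed
qed

lemma projective_module_zero:
 fixes P :: "('l, 'm) module"
 assumes P: "right_module L P" and z: "carrier P = {0[P]}" shows "projective_module L P" unfolding projective_module_def
proof (intro conjI allI ballI impI P)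
 fix M N :: "('l, 'm) module" and g f
 assume g: "g : lin_hom L M N" and f: "f : lin_hom L P N"
  and MN: "right_module L M & right_module L N & g ` carrier M = carrier N"
 interpret M: right_module L M using MN by blast
 have N: "abelian_group N" using MN right_module_abelian by blast
 have "g 0[M] = 0[N]" "f 0[P] = 0[N]"
  by (rule lin_hom_zero[OF M.M.abelian_group_axioms N g], rule lin_hom_zero[OF right_module_abelian[OF P] N f])
 thus "EX h:lin_hom L P M. ALL x:carrier P. g (h x) = f x"
  using z lin_hom_const_zero[OF M.right_module_axioms] by (intro bexI[of _ "%_. 0[M]"]) auto
qed

text \<open>Cutting off the first term leaves a resolution of the syzygy that is shorter by one; for
  length 0 the syzygy is zero.\<close>

lemma projective_dimension_step:
 fixes M :: "('l, 'm) module"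
 assumes pd: "projective_dimension_le L M n" and M: "right_module L M"
 obtains P :: "('l, 'm) module" and e where "projective_module L P" "exact_seq L (P\<lparr>carrier := hom_kernel P M e\<rparr>) P M (%x. x) e"
  "n = 0 ==> carrier (P\<lparr>carrier := hom_kernel P M e\<rparr>) = {0[P\<lparr>carrier := hom_kernel P M e\<rparr>]}"
  "!!n'. n = Suc n' ==> projective_dimension_le L (P\<lparr>carrier := hom_kernel P M e\<rparr>) n'" proof -
 obtain P :: "nat => ('l, 'm) module" and d e where r: "ALL i. projective_module L (P i)" "ALL i>n. carrier (P i) = {0[P i]}"
   "ALL i. d i : lin_hom L (P (Suc i)) (P i)" "e : lin_hom L (P 0) M" "e ` carrier (P 0) = carrier M"
   "d 0 ` carrier (P 1) = hom_kernel (P 0) M e"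
   "ALL i. d (Suc i) ` carrier (P (Suc (Suc i))) = hom_kernel (P (Suc i)) (P i) (d i)"
  using pd unfolding projective_dimension_le_def by (elim exE conjE)
 have Pr: "right_module L (P i)" for i using r(1) by (simp add: projective_module_def)
 note ab = right_module_abelian[OF Pr]
 let ?K = "P 0\<lparr>carrier := hom_kernel (P 0) M e\<rparr>"
 show thesis proof (rule that[of "P 0" e])
  show "projective_module L (P 0)" using r(1) by blast
  show "exact_seq L ?K (P 0) M (%x. x) e" by (rule exact_seq_of_kernel[OF Pr M r(4,5)])
  show "carrier ?K = {0[?K]}" if "n = 0" proof -
   have "carrier (P 1) = {0[P 1]}" using r(2) that by simp
   moreover have "d 0 0[P 1] = 0[P 0]" by (rule lin_hom_zero[OF ab ab, where A = L]) (use r(3) in simp)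
   ultimately show ?thesis using r(6) by simp
  qed
  show "projective_dimension_le L ?K n'" if n: "n = Suc n'" for n' unfolding projective_dimension_le_def
  proof (intro exI[of _ "%i. P (Suc i)"] exI[of _ "%i. d (Suc i)"] exI[of _ "d 0"] conjI)
   have "d 0 x : hom_kernel (P 0) M e" if "x :. (P 1)" for x using r(6) that by blast
   moreover have "d 0 : lin_hom L (P (Suc 0)) (P 0)" using r(3) by blast
   ultimately show "d 0 : lin_hom L (P (Suc 0)) ?K" by (auto simp: lin_hom_def)
   show "d 0 ` carrier (P (Suc 0)) = carrier ?K" using r(6) by simp
   show "d (Suc 0) ` carrier (P (Suc 1)) = hom_kernel (P (Suc 0)) ?K (d 0)"
    using r(7)[rule_format, of 0] by (simp add: hom_kernel_def)
   show "ALL i>n'. carrier (P (Suc i)) = {0[P (Suc i)]}" using r(2) n by simp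
  qed (use r in blast)+
 qed
qed

text \<open>The index is \<open>Suc n\<close> because a resolution of length 0 is used as a short
  exact sequence with zero kernel, which is projective, rather than as an isomorphism.\<close>

lemma pdim_le_big:
 fixes X :: "int => ('l, 'm) module"
 assumes "!!i. right_module L (X i)" "!!i. projective_dimension_le L (X i) n"
 shows "gcat_ses.pdim_le ecomp (bhom L) (gses L) (Suc n) X" proof -
 interpret B: gcat_ses ecomp "bhom L" gid "Collect (graded_ob L) :: (int => ('l, 'm) module) set" "gses L"
  by (rule gcat_ses_big)
 show ?thesis using assms proof (induction n arbitrary: X)
  case 0
  have "ALL i. EX (P :: ('l, 'm) module) e. projective_module L P & exact_seq L (P\<lparr>carrier := hom_kernel P (X i) e\<rparr>) P (X i) (%x. x) e &
    projective_module L (P\<lparr>carrier := hom_kernel P (X i) e\<rparr>)" proof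
   fix i
   obtain P :: "('l, 'm) module" and e where P: "projective_module L P" "exact_seq L (P\<lparr>carrier := hom_kernel P (X i) e\<rparr>) P (X i) (%x. x) e"
    "carrier (P\<lparr>carrier := hom_kernel P (X i) e\<rparr>) = {0[P\<lparr>carrier := hom_kernel P (X i) e\<rparr>]}"
    by (rule projective_dimension_step[OF 0(2)[of i] 0(1)[of i]]) blast
   show "EX (P :: ('l, 'm) module) e. projective_module L P & exact_seq L (P\<lparr>carrier := hom_kernel P (X i) e\<rparr>) P (X i) (%x. x) e &
     projective_module L (P\<lparr>carrier := hom_kernel P (X i) e\<rparr>)"
    using P(1,2) projective_module_zero[OF exact_seqD(1)[OF P(2)] P(3)] by blast
  qed
  then obtain P :: "int => ('l, 'm) module" and e where P: "ALL i. projective_module L (P i) &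
    exact_seq L (P i\<lparr>carrier := hom_kernel (P i) (X i) (e i)\<rparr>) (P i) (X i) (%x. x) (e i) &
    projective_module L (P i\<lparr>carrier := hom_kernel (P i) (X i) (e i)\<rparr>)" unfolding choice_iff by (elim exE)
  let ?K = "%i. P i\<lparr>carrier := hom_kernel (P i) (X i) (e i)\<rparr>"
  have "gses L 0 0 ?K P X (arr 0 ?K P (%i x. x)) (arr 0 P X e)" by (rule gsesI) (use P in simp)
  thus ?case
   by (rule B.pdim_le.intros(2)[OF _ projective_ob_big B.pdim_le.intros(1)[OF projective_ob_big]]) (use P in blast)+
 next
  case (Suc n)
  have "ALL i. EX (P :: ('l, 'm) module) e. projective_module L P & exact_seq L (P\<lparr>carrier := hom_kernel P (X i) e\<rparr>) P (X i) (%x. x) e &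
    projective_dimension_le L (P\<lparr>carrier := hom_kernel P (X i) e\<rparr>) n" proof
   fix i
   show "EX (P :: ('l, 'm) module) e. projective_module L P & exact_seq L (P\<lparr>carrier := hom_kernel P (X i) e\<rparr>) P (X i) (%x. x) e &
     projective_dimension_le L (P\<lparr>carrier := hom_kernel P (X i) e\<rparr>) n"
    by (rule projective_dimension_step[OF Suc.prems(2)[of i] Suc.prems(1)[of i]]) blast
  qed
  then obtain P :: "int => ('l, 'm) module" and e where P: "ALL i. projective_module L (P i) &
    exact_seq L (P i\<lparr>carrier := hom_kernel (P i) (X i) (e i)\<rparr>) (P i) (X i) (%x. x) (e i) &
    projective_dimension_le L (P i\<lparr>carrier := hom_kernel (P i) (X i) (e i)\<rparr>) n"
   unfolding choice_iff by (elim exE)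
  let ?K = "%i. P i\<lparr>carrier := hom_kernel (P i) (X i) (e i)\<rparr>"
  have e: "exact_seq L (?K i) (P i) (X i) (%x. x) (e i)" for i using P by blast
  have K: "B.pdim_le (Suc n) ?K" by (rule Suc.IH) (use exact_seqD(1)[OF e] P in blast)+
  have "gses L 0 0 ?K P X (arr 0 ?K P (%i x. x)) (arr 0 P X e)" by (rule gsesI) (use e in simp)
  thus ?case by (rule B.pdim_le.intros(2)[OF _ projective_ob_big K]) (use P in blast)
 qed
qed

definition injective_right_module :: "('l, 'z) ring_scheme => ('l, 'm) module => bool"
 where "injective_right_module A N \<longleftrightarrow> right_module A N &
  (ALL (M :: ('l, 'm) module) (M' :: ('l, 'm) module). ALL f:lin_hom A M M'. ALL h:lin_hom A M N.
   right_module A M --> right_module A M' --> inj_on f (carrier M) -->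
   (EX g:lin_hom A M' N. ALL x:carrier M. g (f x) = h x))"

lemma injective_graded:
 assumes N: "!!i. injective_right_module L (N i)" and f: "f : ghom L a X Y" "!!n. inj_on (f n) (carrier (X n))"
  and z: "z : bhom L k X N" shows "EX g:ghom L (k - a) Y N. z = ecomp (arr (k - a) Y N g) (arr a X Y f)" proof -
 obtain h where h: "h : ghom L k X N" "z = arr k X N h" using z by (rule bhomE)
 have "EX v:lin_hom L (Y n) (N (n + (k - a))). ALL x:carrier (X (n - a)). v (f (n - a) x) = h (n - a) x" for n proof -
  have "f (n - a) : lin_hom L (X (n - a)) (Y n)" by (rule ghomD(4)[OF f(1)]) simp
  moreover have "h (n - a) : lin_hom L (X (n - a)) (N (n + (k - a)))" by (rule ghomD(4)[OF h(1)]) simp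
  ultimately show ?thesis
   using N[of "n + (k - a)"] f(2)[of "n - a"] ghomD(5)[OF f(1), of "n - a"] ghomD(6)[OF f(1), of n]
   unfolding injective_right_module_def by blast
 qed
 hence "ALL n. EX v. v : lin_hom L (Y n) (N (n + (k - a))) & (ALL x:carrier (X (n - a)). v (f (n - a) x) = h (n - a) x)" by blast
 from choice[OF this] obtain v where v: "!!n. v n : lin_hom L (Y n) (N (n + (k - a)))"
  "!!n x. x :. (X (n - a)) ==> v n (f (n - a) x) = h (n - a) x" by blast
 have vg: "v : ghom L (k - a) Y N" by (rule ghomI[OF ghomD(2)[OF f(1)] ghomD(2)[OF h(1)] v(1)])
 have "v (n + a) (f n x) = h n x" if "x :. (X n)" for n x using v(2)[of x "n + a"] that by simp
 hence "z = ecomp (arr (k - a) Y N v) (arr a X Y f)"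
  unfolding h(2) arr_comp[OF vg f(1)] using ghom_comp[OF vg f(1)] by (simp add: arr_eqI[OF h(1)])
 thus ?thesis using vg by blast
qed

lemma lin_hom_inj_onI:
 assumes "right_module A M" "right_module A N" "f : lin_hom A M N"
  "!!x. x :. M ==> f x = 0[N] ==> x = 0[M]" shows "inj_on f (carrier M)" proof (rule inj_onI)
 interpret M: right_module A M by fact
 interpret N: right_module A N by fact
 fix x y assume xy: "x :. M" "y :. M" "f x = f y"
 have "f (x -[M] y) = f x -[N] f y"
  by (rule lin_hom_minus[OF M.M.abelian_group_axioms N.M.abelian_group_axioms assms(3) xy(1,2)])
 also have "\<dots> = 0[N]" using N.M.minus_eq_zero_iff xy lin_homD(1)[OF assms(3)] by simp
 finally have "x -[M] y = 0[M]" using assms(4) xy by simp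
 thus "x = y" using M.M.minus_eq_zero_iff xy by simp
qed

lemma exact_seq_of_inj:
 fixes M :: "('a, 'b) module" and N :: "('a, 'c) module"
 assumes M: "right_module A M" and N: "right_module A N" and f: "f : lin_hom A M N" "inj_on f (carrier M)"
 obtains Q :: "('a, 'c) module" and q where "exact_seq A M N Q f q" proof -
 note im = lin_hom_image[OF M N f(1)]
 obtain Q :: "('a, 'c) module" and q where e: "exact_seq A (N\<lparr>carrier := f ` carrier M\<rparr>) N Q (%x. x) q"
  by (rule exact_seq_of_submodule[OF N im(1) right_module_sub[OF N im]])
 have "exact_seq A M N Q f q" using e M f unfolding exact_seq_def by simp
 thus thesis by (rule that)
qed

context graded_setup
begin

text \<open>Maps into \<open>J\<close> are functionals, by composition with \<open>ev\<close>. The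
  functional of \<open>h\<close> extends to \<open>M'\<close> by injectivity of \<open>E\<close>,
  and a map into \<open>J\<close> is zero as soon as its functional is.\<close>

lemma J_injective: "injective_right_module L J"
 unfolding injective_right_module_def proof (intro conjI allI ballI impI)
 show J: "right_module L J" by (rule smallD(1)[OF J_small])
 interpret J: right_module L J by (rule J)
 fix M M' :: "('l, 'm) module" and f h
 assume f: "f : lin_hom L M M'" and h: "h : lin_hom L M J" and M: "right_module L M" and M': "right_module L M'"
  and inj: "inj_on f (carrier M)"
 have inj': "inj_on f (carrier (base_module L M))" using inj by simp
 obtain ps where ps: "ps : lin_hom R (base_module L M') E" "!!x. x :. M ==> ps (f x) = ev (h x)"
  using E_lift[OF module_base[OF M] module_base[OF M'] lin_hom_base[OF f] inj'
   lin_hom_comp[OF ev_hom lin_hom_base[OF h]]] by auto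
 obtain a where a: "a : lin_hom L M' J" "ALL m:carrier M'. ev (a m) = ps m"
  using J_repr[OF M' ps(1)] by (elim bexE)
 let ?d = "%x. a (f x) -[J] h x"
 note af = lin_hom_comp[OF a(1) f]
 have d: "?d : lin_hom L M J" by (rule lin_hom_diff[OF J af h])
 have "ev (?d m) = 0[E]" if m: "m :. M" for m proof -
  have dm: "?d m :. J" by (rule lin_homD(1)[OF d m])
  note hm = lin_homD(1)[OF h m] and am = lin_homD(1)[OF af m]
  note e = lin_homD[OF ev_hom, unfolded base_module_simps]
  interpret E': abelian_group E by (rule E_abelian)
  have "?d m +[J] h m = a (f m)" using hm am by (simp add: a_minus_def J.M.a_assoc J.M.l_neg)
  hence "ev (?d m) +[E] ev (h m) = ev (h m)" using e(2)[OF dm hm] a(2) ps(2)[OF m] lin_homD(1)[OF f m] by simp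
  thus ?thesis using E'.add.r_cancel_one[OF e(1)[OF hm] e(1)[OF dm]] by simp
 qed
 hence "?d m = 0[J]" if "m :. M" for m using J_zero[OF M d _ that] by simp
 hence "a (f m) = h m" if "m :. M" for m
  using J.M.minus_eq_zero_iff[OF lin_homD(1)[OF af that] lin_homD(1)[OF h that]] that by simp
 thus "EX g:lin_hom L M' J. ALL x:carrier M. g (f x) = h x" using a(1) by blast
qed

lemma sum_injective:
 fixes M N S :: "('l, 'm) module"
 assumes M: "injective_right_module L M" and N: "injective_right_module L N"
  and s: "module_sum R L M N S i1 i2 p1 p2" shows "injective_right_module L S" unfolding injective_right_module_def
proof (intro conjI allI ballI impI)
 note s' = s[unfolded module_sum_def]
 have S: "right_module L S" using s' smallD(1) by blast
 thus "right_module L S" .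
 have l: "i1 : lin_hom L M S" "i2 : lin_hom L N S" "p1 : lin_hom L S M" "p2 : lin_hom L S N" using s' by blast+
 fix X X' :: "('l, 'm) module" and f h
 assume f: "f : lin_hom L X X'" and h: "h : lin_hom L X S" and X: "right_module L X" and X': "right_module L X'"
  and inj: "inj_on f (carrier X)"
 obtain g1 where g1: "g1 : lin_hom L X' M" "ALL x:carrier X. g1 (f x) = p1 (h x)"
  using M[unfolded injective_right_module_def, THEN conjunct2, rule_format, OF f lin_hom_comp[OF l(3) h] X X' inj] by blast
 obtain g2 where g2: "g2 : lin_hom L X' N" "ALL x:carrier X. g2 (f x) = p2 (h x)"
  using N[unfolded injective_right_module_def, THEN conjunct2, rule_format, OF f lin_hom_comp[OF l(4) h] X X' inj] by blast
 show "EX g:lin_hom L X' S. ALL x:carrier X. g (f x) = h x"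
 proof (rule bexI[OF _ lin_hom_add[OF S lin_hom_comp[OF l(1) g1(1)] lin_hom_comp[OF l(2) g2(1)]]], rule ballI)
  fix x assume x: "x :. X"
  have "ALL z:carrier S. i1 (p1 z) +[S] i2 (p2 z) = z" using s' by blast
  thus "i1 (g1 (f x)) +[S] i2 (g2 (f x)) = h x" using g1(2) g2(2) x lin_homD(1)[OF h x] by simp
 qed
qed

lemma Z_injective: "injective_right_module L Z"
 unfolding injective_right_module_def proof (intro conjI allI ballI impI)
 show Z: "right_module L Z" by (rule smallD(1)[OF Z_small])
 fix M M' :: "('l, 'm) module" and f h
 assume h: "h : lin_hom L M Z"
 have "h x = 0[Z]" if "x :. M" for x using lin_homD(1)[OF h that] Z_zero by simp
 thus "EX g:lin_hom L M' Z. ALL x:carrier M. g (f x) = h x" by (intro bexI[OF _ lin_hom_const_zero[OF Z]]) simp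
qed

text \<open>Finitely many functionals separate the elements of \<open>M\<close>, and each comes from
  a map into \<open>J\<close>; so \<open>M\<close> embeds into a finite sum of copies of
  \<open>J\<close>.\<close>

lemma injective_embedding:
 fixes M :: "('l, 'm) module"
 assumes M: "small R L M"
 shows "EX (N :: ('l, 'm) module) f. small R L N & injective_right_module L N & f : lin_hom L M N & inj_on f (carrier M)"
proof -
 note Mr = smallD(1)[OF M]
 have *: "EX (N :: ('l, 'm) module) f. small R L N & injective_right_module L N & f : lin_hom L M N &
   (ALL x:carrier M. f x = 0[N] --> (ALL ph:set Ph. ph x = 0[E]))" if "set Ph \<subseteq> lin_hom R (base_module L M) E" for Ph
  using that proof (induction Ph)
  case Nil
  show ?case by (rule exI[of _ Z], rule exI[of _ "%_. 0[Z]"])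
    (simp add: Z_small Z_injective lin_hom_const_zero[OF smallD(1)[OF Z_small]])
 next
  case (Cons ph Ph)
  then obtain N :: "('l, 'm) module" and f where N: "small R L N" "injective_right_module L N" "f : lin_hom L M N"
   "ALL x:carrier M. f x = 0[N] --> (ALL ph:set Ph. ph x = 0[E])" by auto
  have ph: "ph : lin_hom R (base_module L M) E" using Cons.prems by simp
  obtain a where a: "a : lin_hom L M J" "ALL m:carrier M. ev (a m) = ph m" using J_repr[OF Mr ph] by (elim bexE)
  obtain S i1 i2 p1 p2 where s: "module_sum R L N J S i1 i2 p1 p2" using sum[OF N(1) J_small] by (elim exE)
  note s' = s[unfolded module_sum_def]
  have S: "small R L S" using s' by blast
  have l: "i1 : lin_hom L N S" "i2 : lin_hom L J S" "p1 : lin_hom L S N" "p2 : lin_hom L S J" using s' by blast+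
  note ab = right_module_abelian[OF smallD(1)[OF S]] right_module_abelian[OF smallD(1)[OF N(1)]] right_module_abelian[OF smallD(1)[OF J_small]]
  interpret N: abelian_group N by (rule ab)
  interpret J: abelian_group J by (rule ab)
  let ?F = "%x. i1 (f x) +[S] i2 (a x)"
  have F: "?F : lin_hom L M S" by (rule lin_hom_add[OF smallD(1)[OF S] lin_hom_comp[OF l(1) N(3)] lin_hom_comp[OF l(2) a(1)]])
  have "ps x = 0[E]" if x: "x :. M" and 0: "?F x = 0[S]" and ps: "ps : set (ph # Ph)" for x ps
  proof -
   have fx: "f x :. N" "a x :. J" using lin_homD(1)[OF N(3) x] lin_homD(1)[OF a(1) x] by auto
   have ifx: "i1 (f x) :. S" "i2 (a x) :. S" using fx lin_homD(1)[OF l(1)] lin_homD(1)[OF l(2)] by auto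
   have "p1 (?F x) = f x" using lin_homD(2)[OF l(3) ifx] s' fx by simp
   moreover have "p2 (?F x) = a x" using lin_homD(2)[OF l(4) ifx] s' fx by simp
   moreover have "p1 0[S] = 0[N]" "p2 0[S] = 0[J]"
    by (rule lin_hom_zero[OF ab(1,2) l(3)], rule lin_hom_zero[OF ab(1,3) l(4)])
   ultimately have "f x = 0[N]" "a x = 0[J]" unfolding 0 by simp_all
   moreover have "ev 0[J] = 0[E]"
    using lin_hom_zero[OF module.axioms(2)[OF module_base[OF smallD(1)[OF J_small]]] E_abelian ev_hom] by simp
   ultimately show ?thesis using N(4) a(2) x ps by auto
  qed
  thus ?case using S sum_injective[OF N(2) J_injective s] F by blast
 qed
 show ?thesis proof (rule E_cogenerators[OF module_base[OF Mr] smallD(2)[OF M]])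
  fix Ph assume Ph: "finite Ph" "Ph \<subseteq> lin_hom R (base_module L M) E"
   "!!x. x :. (base_module L M) ==> (!!ph. ph : Ph ==> ph x = 0[E]) ==> x = 0[base_module L M]"
  obtain Ph' where Ph': "set Ph' = Ph" using finite_list[OF Ph(1)] by blast
  then obtain N :: "('l, 'm) module" and f where N: "small R L N" "injective_right_module L N" "f : lin_hom L M N"
   "ALL x:carrier M. f x = 0[N] --> (ALL ph:Ph. ph x = 0[E])" using *[of Ph'] Ph(2) by auto
  have "inj_on f (carrier M)" by (rule lin_hom_inj_onI[OF Mr smallD(1)[OF N(1)] N(3)]) (use N(4) Ph(3) in simp)
  thus ?thesis using N by blast
 qed
qed

sublocale S: serre_setup R "act E" "embedded E" ecomp shom gid smod scale L0 D0 t0 by (rule serre_setup_graded)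

lemma gses_smod:
 assumes s: "gses L a b X Y W i p" and Y: "Y : smod" shows "X : smod" "W : smod" proof -
 obtain f g where ex: "!!n. exact_seq L (X n) (Y (n + a)) (W (n + a + b)) (f n) (g (n + a))"
  using s unfolding gses_def by blast
 have exW: "exact_seq L (X (n - b - a)) (Y (n - b)) (W n) (f (n - b - a)) (g (n - b))" for n
  using ex[of "n - b - a"] by simp
 obtain c d where cd: "!!i. i < c | d < i ==> carrier (Y i) = {0[Y i]}" using smod_bound[OF Y] by blast
 show "X : smod" proof (rule smodI[of _ "c - a" "d - a"])
  show "small R L (X n)" for n by (rule small_sub[OF smodD(1)[OF Y] exact_seqD(1,4,6)[OF ex]])
  show "carrier (X n) = {0[X n]}" if "n < c - a | d - a < n" for n
   by (rule exact_seq_zero(1)[OF ex cd]) (use that in linarith)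
 qed
 show "W : smod" proof (rule smodI[of _ "c + b" "d + b"])
  show "small R L (W n)" for n by (rule small_image[OF smodD(1)[OF Y] exact_seqD(3,5,7)[OF exW]])
  show "carrier (W n) = {0[W n]}" if "n < c + b | d + b < n" for n
   by (rule exact_seq_zero(2)[OF exW cd]) (use that in linarith)
 qed
qed

text \<open>Injectivity is needed with respect to all modules, where \<open>\<Lambda>\<close> has finite global dimension,
 as well as in the category of finitely generated modules.\<close>

definition inj_obs :: "(int => ('l, 'm) module) set"
 where "inj_obs = {N : smod. S.injective_ob N & gcat_ses.injective_ob ecomp (bhom L) (gses L) N}"

lemma inj_obsI:
 assumes N: "N : smod" and inj: "!!i. injective_right_module L (N i)" shows "N : inj_obs" proof -
 interpret B: gcat_ses ecomp "bhom L" gid "Collect (graded_ob L) :: (int => ('l, 'm) module) set" "gses L"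
  by (rule gcat_ses_big)
 have "B.injective_ob N" unfolding B.injective_ob_def proof (intro allI impI ballI)
  fix a b X Y W i p k z assume s: "gses L a b X Y W i p" and z: "z : bhom L k X N"
  obtain f where f: "f : ghom L a X Y" "i = arr a X Y f" "!!n. inj_on (f n) (carrier (X n))"
   using s unfolding gses_def exact_seq_def by blast
  obtain g where g: "g : ghom L (k - a) Y N" "z = ecomp (arr (k - a) Y N g) (arr a X Y f)"
   using injective_graded[OF inj f(1,3) z] by blast
  thus "EX g:bhom L (k - a) Y N. z = ecomp g i" unfolding f(2) by (intro bexI[OF _ bhomI[OF g(1)]])
 qed
 moreover have "S.injective_ob N" unfolding S.injective_ob_def proof (intro allI impI ballI)
  fix a b X Y W i p k z assume s: "G.short_exact a b X Y W i p" and z: "z : shom k X N"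
  obtain f where f: "X : smod" "Y : smod" "f : ghom L a X Y" "i = arr a X Y f"
   using G.short_exactD(1)[OF s] by (rule shomE)
  \<comment> \<open>A categorical monomorphism of graded modules is injective, because elements are
    maps from \<open>L0\<close>.\<close>
  have inj_f: "inj_on (f n) (carrier (X n))" for n
  proof (rule lin_hom_inj_onI[OF ghomD(5)[OF f(3)] ghomD(6)[OF f(3)] ghomD(3)[OF f(3)]])
   fix x assume x: "x :. (X n)" and 0: "f n x = 0[Y (n + a)]"
   obtain w where w: "w : shom n L0 X" "val X n w = x" by (rule point[OF f(1) x])
   have iw: "ecomp i w : shom (n + a) L0 Y" by (rule G.hom_compI[OF G.short_exactD(1)[OF s] w(1)]) simp
   have "val Y (n + a) (ecomp i w) = 0[Y (n + a)]"
    unfolding f(4) using val_comp[OF w(1) f(3), of "n + a"] w(2) 0 by simp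
   hence "ecomp i w = 0" by (rule val_eq_0[OF iw])
   hence "w = 0" by (rule G.short_exact_mono[OF s w(1)])
   thus "x = 0[X n]" using w(2) val_0[OF f(1)] by simp
  qed
  have zb: "z : bhom L k X N" using z by (simp add: shom_def split: if_splits)
  obtain g where g: "g : ghom L (k - a) Y N" "z = ecomp (arr (k - a) Y N g) (arr a X Y f)"
   using injective_graded[OF inj f(3) inj_f zb] by blast
  thus "EX g:shom (k - a) Y N. z = ecomp g i" unfolding f(4) by (intro bexI[OF _ shomI[OF f(2) N g(1)]])
 qed
 ultimately show ?thesis using N by (simp add: inj_obs_def)
qed

text \<open>The embeddings are chosen degree by degree. A zero module is sent into a zero module,
  which keeps the hull bounded.\<close>

lemma injective_hull_graded:
 assumes X: "X : smod" shows "EX a b N C i p. gses L a b X N C i p & N : inj_obs & C : smod" proof -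
 have "ALL n. EX (N :: ('l, 'm) module) f. small R L N & injective_right_module L N & f : lin_hom L (X n) N & inj_on f (carrier (X n)) &
   (carrier (X n) = {0[X n]} --> carrier N = {0[N]})" proof
  fix n
  show "EX (N :: ('l, 'm) module) f. small R L N & injective_right_module L N & f : lin_hom L (X n) N & inj_on f (carrier (X n)) &
   (carrier (X n) = {0[X n]} --> carrier N = {0[N]})" proof (cases "carrier (X n) = {0[X n]}")
   case True
   show ?thesis by (rule exI[of _ Z], rule exI[of _ "%_. 0[Z]"])
     (simp add: True Z_small Z_injective Z_zero lin_hom_const_zero[OF smallD(1)[OF Z_small]])
  next
   case False
   thus ?thesis using injective_embedding[OF smodD(1)[OF X, of n]] by blast
  qed
 qed
 then obtain N :: "int => ('l, 'm) module" and f where Nf: "ALL n. small R L (N n) & injective_right_module L (N n) & f n : lin_hom L (X n) (N n) &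
   inj_on (f n) (carrier (X n)) & (carrier (X n) = {0[X n]} --> carrier (N n) = {0[N n]})"
  unfolding choice_iff by (elim exE)
 have N: "small R L (N n)" "injective_right_module L (N n)" "f n : lin_hom L (X n) (N n)"
  "inj_on (f n) (carrier (X n))" for n using Nf by blast+
 obtain c d where cd: "!!i. i < c | d < i ==> carrier (X i) = {0[X i]}" using smod_bound[OF X] by blast
 have Ns: "N : smod" by (rule smodI[OF N(1), of c d]) (use cd Nf in blast)
 have "ALL n. EX (C :: ('l, 'm) module) q. exact_seq L (X n) (N n) C (f n) q" proof
  fix n
  show "EX (C :: ('l, 'm) module) q. exact_seq L (X n) (N n) C (f n) q"
   by (rule exact_seq_of_inj[OF smodD(2)[OF X] smallD(1)[OF N(1)] N(3,4)]) blast
 qed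
 then obtain C :: "int => ('l, 'm) module" and q where "ALL n. exact_seq L (X n) (N n) (C n) (f n) (q n)"
  unfolding choice_iff by (elim exE)
 hence "gses L 0 0 X N C (arr 0 X N f) (arr 0 N C q)" by (intro gsesI) simp
 thus ?thesis using gses_smod(2)[OF _ Ns] inj_obsI[OF Ns N(2)] by blast
qed

theorem finite_injective_dimension:
 assumes "finite_global_dimension TYPE('m) L"
 obtains n where "!!X. X : smod ==> S.idim_le inj_obs n X" proof -
 interpret B: gcat_ses ecomp "bhom L" gid "Collect (graded_ob L) :: (int => ('l, 'm) module) set" "gses L"
  by (rule gcat_ses_big)
 obtain n where n: "ALL M :: ('l, 'm) module. right_module L M --> projective_dimension_le L M n"
  using assms unfolding finite_global_dimension_def by blast
 \<comment> \<open>One step is added by \<open>pdim_le_big\<close> and one by the splitting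
   argument. Projective dimension is measured among all graded modules, while the hulls stay among
   the bounded finitely generated ones.\<close>
 have big: "B.idim_le inj_obs (Suc (Suc n)) X" if X: "X : smod" for X
 proof (rule B.idim_le_of_pdim_le[OF injective_hull_graded _ _ _ X])
  show "B.injective_ob N" if "N : inj_obs" for N using that by (simp add: inj_obs_def)
  show "B.pdim_le (Suc n) Y" if "Y : smod" for Y by (rule pdim_le_big) (use smodD(2)[OF that] n in blast)+
  fix N C i p a assume N: "N : inj_obs" and C: "C : smod" and i: "i : bhom L a C N" and p: "p : bhom L (- a) N C"
   and pi: "ecomp p i = gid C"
  have Ns: "N : smod" "S.injective_ob N" "B.injective_ob N" using N by (simp_all add: inj_obs_def)
  have "B.injective_ob C" by (rule B.injective_ob_retract[OF Ns(3) i p pi])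
  moreover have "S.injective_ob C"
   by (rule S.injective_ob_retract[OF Ns(2) _ _ pi]) (use i p C Ns(1) in "simp_all add: shom_def")
  ultimately show "C : inj_obs" using C by (simp add: inj_obs_def)
 qed
 \<comment> \<open>The terms of such a coresolution are bounded and finitely generated, so its
   sequences are also exact in the smaller category.\<close>
 have "X : smod & S.idim_le inj_obs k X" if "B.idim_le inj_obs k X" for k X using that
 proof (induction rule: B.idim_le.induct)
  case (1 N)
  thus ?case using S.idim_le.intros(1) by (simp add: inj_obs_def)
 next
  case (2 a b X N C i p k)
  have N: "N : smod" using 2(2) by (simp add: inj_obs_def)
  note XC = gses_smod[OF 2(1) N]
  show ?case using S.idim_le.intros(2)[OF gses_small_short_exact[OF 2(1) XC(1) N XC(2)] 2(2)] 2(4) XC(1) by blast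
 qed
 thus thesis using that big by blast
qed

end

section \<open>The homotopy category of acyclic complexes\<close>

text \<open>The morphism records of the homotopy category are quotients of modules of chain maps. A
  surjection \<open>k\<close> compatible with the operations transfers the module axioms to
  them.\<close>

lemma quotient_record:
 fixes M :: "('r, 'b) module" and s :: "'r => 'v::ab_group_add => 'v"
 assumes V: "rmod R s V" and c: "carrier M = k ` V" and z: "0[M] = k 0"
  and add: "!!x y. x : V ==> y : V ==> k x +[M] k y = k (x + y)"
  and sm: "!!r x. r :. R ==> x : V ==> r *[M] k x = k (s r x)"
 shows "module R M" "linear_on R s V (act M) (embedded M) (%x. emb 0 M (k x))" proof -
 interpret V: rmod R s V by fact
 have ab: "abelian_group M" proof (rule abelian_groupI)
  show "EX y:carrier M. y +[M] x = 0[M]" if xM: "x :. M" for x proof -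
   obtain v where v: "x = k v" "v : V" using xM c by auto
   show ?thesis by (rule bexI[of _ "k (- v)"]) (use v V.uminus_mem in "simp_all add: add c z")
  qed
 qed (auto simp: c add z V.add_mem algebra_simps)
 show M: "module R M" by (rule moduleI[OF V.cring_axioms ab])
   (auto simp: c sm add V.smult_mem V.add_mem V.smult_add V.add_smult V.mult_smult)
 show "linear_on R s V (act M) (embedded M) (%x. emb 0 M (k x))" by (rule linear_onI)
   (simp_all add: embedded_def c add[symmetric] sm[symmetric] act_emb[OF M] emb_add[OF ab])
qed

lemma quotient_record_fin_length:
 fixes M :: "('r, 'b) module" and s :: "'r => 'v::ab_group_add => 'v"
 assumes V: "finite_length R s V" and c: "carrier M = k ` V" and M: "module R M"
  and lin: "linear_on R s V (act M) (embedded M) (%x. emb 0 M (k x))" shows "fin_length R M" proof -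
 have "(%x. emb 0 M (k x)) ` V = embedded M" by (simp add: embedded_def c image_image)
 thus ?thesis using finite_length_image[OF V rmod_embedded[OF M] lin] by (simp add: fin_length_def)
qed

context artin_dual
begin

lemma E_separated:
 fixes M :: "('a, 'm) module"
 assumes M: "module R M" and x: "x :. M" and y: "y :. M"
  and eq: "!!ph. ph : lin_hom R M E ==> ph x = ph y" shows "x = y" proof (rule ccontr)
 interpret M: module R M by fact
 note ab = module.axioms(2)[OF M]
 assume "x ~= y"
 hence nz: "x -[M] y ~= 0[M]" using abelian_group.minus_eq_zero_iff[OF ab x y] by simp
 have xy: "x -[M] y :. M" using x y by simp
 obtain ph where ph: "ph : lin_hom R M E" "ph (x -[M] y) ~= 0[E]" by (rule E_separate[OF M xy nz])
 have "ph (x -[M] y) = ph x -[E] ph y" by (rule lin_hom_minus[OF ab E_abelian ph(1) x y])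
 also have "\<dots> = 0[E]"
  using abelian_group.minus_eq_zero_iff[OF E_abelian] lin_homD(1)[OF ph(1) x] lin_homD(1)[OF ph(1) y] eq[OF ph(1)] by simp
 finally show False using ph(2) by simp
qed

text \<open>\<open>reflexive_dual\<close> for module records: \<open>G\<close> turns functionals on
  the embedded copy of \<open>M\<close> into elements of \<open>dual_module\<close>.\<close>

lemma E_reflexive:
 fixes M :: "('a, 'm) module"
 assumes M: "module R M" and fl: "fin_length R M" and Ph: "Ph : lin_hom R (dual_module R E M) E"
 shows "EX x:carrier M. ALL ph:carrier (dual_module R E M). Ph ph = ph x" proof -
 note abM = module.axioms(2)[OF M]
 interpret M: rmod R "act M" "embedded M" by (rule rmod_embedded[OF M])
 have fl': "finite_length R (act M) (embedded M)" using fl by (simp add: fin_length_def)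
 let ?D = "E.dual (act M) (embedded M)"
 define G where "G ph = (\<lambda>x\<in>carrier M. prj E (ph (emb 0 M x)))" for ph
 have Df: "E.functional (act M) (embedded M) f" if "f : ?D" for f using that by (simp add: E.dual_def)
 have Gc: "G f :. (dual_module R E M)" if "f : ?D" for f
  unfolding G_def by (rule restrict_in_dual[OF M lin_hom_of_linear_on(1)[OF M E_module Df[OF that]]])
 note P = lin_homD[OF Ph]
 have "E.functional E.sdual ?D (%f. emb 0 E (Ph (G f)))" proof (rule linear_onI)
  fix f assume f: "f : ?D"
  show "emb 0 E (Ph (G f)) : embedded E" using P(1)[OF Gc[OF f]] by (simp add: embedded_def)
  show "emb 0 E (Ph (G (f + g))) = emb 0 E (Ph (G f)) + emb 0 E (Ph (G g))" if g: "g : ?D" for g proof -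
   have "G (f + g) = G f +[dual_module R E M] G g"
    unfolding dual_module_simps G_def by (rule restrict_ext) (simp add: prj_add[OF E_abelian])
   thus ?thesis
    using P(2)[OF Gc[OF f] Gc[OF g]] P(1)[OF Gc[OF f]] P(1)[OF Gc[OF g]] by (simp add: emb_add[OF E_abelian])
  qed
  show "emb 0 E (Ph (G (E.sdual r f))) = act E r (emb 0 E (Ph (G f)))" if r: "r :. R" for r proof -
   have "G (E.sdual r f) = r *[dual_module R E M] G f" unfolding dual_module_simps G_def by (rule restrict_ext)
     (use module.smult_closed[OF E_module r prj_mem[OF E_abelian]] in "simp add: act_def E_abelian")
   thus ?thesis using P(3)[OF r Gc[OF f]] act_emb[OF E_module P(1)[OF Gc[OF f]]] by simp
  qed
 qed
 then obtain v where v: "v : embedded M" "ALL f:?D. emb 0 E (Ph (G f)) = f v"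
  using E.reflexive_dual[OF fl'] by blast
 obtain x where x: "x :. M" "v = emb 0 M x" using v(1) by (auto simp: embedded_def)
 have "Ph ph = ph x" if ph: "ph :. (dual_module R E M)" for ph proof -
  have l: "ph : lin_hom R M E" and e: "ph : extensional (carrier M)" using ph by auto
  let ?f = "%v. if v : embedded M then emb 0 E (ph (prj M v)) else 0"
  have f: "?f : ?D" by (rule E.functional_in_dual[OF M.rmod_axioms linear_on_embedded[OF M E_module l]])
  have Gf: "G ?f = ph" proof (rule extensionalityI[OF _ e])
   show "G ?f : extensional (carrier M)" by (simp add: G_def)
   fix y assume y: "y :. M"
   hence "emb 0 M y : embedded M" by (simp add: embedded_def)
   thus "G ?f y = ph y" using y abM E_abelian lin_homD(1)[OF l y] by (simp add: G_def)
  qed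
  have "emb 0 E (Ph ph) = ?f v" using bspec[OF v(2) f] unfolding Gf .
  also have "\<dots> = emb 0 E (ph x)" using v(1) x abM by simp
  finally show ?thesis using emb_eq_iff[OF E_abelian P(1)[OF ph] lin_homD(1)[OF l x(1)]] by simp
 qed
 thus ?thesis using x(1) by blast
qed

end

lemma arr_diff:
 assumes "f : ghom L k X Y" "g : ghom L k X Y" shows "(%i x. f i x -[Y (i + k)] g i x) : ghom L k X Y"
  "arr k X Y (%i x. f i x -[Y (i + k)] g i x) = arr k X Y f - arr k X Y g"
 using ghom_add[OF assms(1) ghom_uminus[OF assms(2)]] arr_add[OF assms(1) ghom_uminus[OF assms(2)]]
  arr_uminus[OF assms(2)] by (simp_all add: a_minus_def)

lemma arr_eq_iff:
 "f : ghom L k X Y ==> g : ghom L k X Y ==>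
  arr k X Y f = arr k X Y g \<longleftrightarrow> (ALL i. ALL x:carrier (X i). f i x = g i x)"
 using arr_eqI[of f L k X Y g] arr_eqD[of k X Y f g L] by blast

section \<open>Complexes as graded modules with a differential\<close>

context graded_setup
begin

abbreviation Cat :: "(('l, 'm) cochain_complex, (int => 'm => 'm) set, 'r) lin_cat"
 where "Cat \<equiv> acyclic_homotopy_category L"

abbreviation diff :: "('l, 'm) cochain_complex => ('l, 'm) tot endo"
 where "diff X \<equiv> arr 1 (cobj X) (cobj X) (cdiff X)"

abbreviation A :: "('l, 'm) cochain_complex => ('l, 'm) cochain_complex => (int => 'm => 'm) => ('l, 'm) tot endo"
 where "A X Y \<equiv> arr 0 (cobj X) (cobj Y)"

abbreviation Ch :: "('l, 'm) cochain_complex => ('l, 'm) cochain_complex => ('l, 'm) tot endo set"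
 where "Ch X Y \<equiv> S.chain (cobj X) (diff X) (cobj Y) (diff Y)"

abbreviation Bd :: "('l, 'm) cochain_complex => ('l, 'm) cochain_complex => ('l, 'm) tot endo set"
 where "Bd X Y \<equiv> S.bdry (cobj X) (diff X) (cobj Y) (diff Y)"

lemma Cat_simps:
 "Ob Cat = {X : bounded_complexes L. acyclic_complex X}" "Mor Cat = homotopy_hom L"
 "Comp Cat X Y W G F = (UN g:G. UN f:F. hclass L X W (%i x. g i (f i x)))"
 "Ident Cat X = hclass L X X (%i x. x)"
 by (simp_all add: acyclic_homotopy_category_def full_subcategory_def bounded_homotopy_category_def)

lemma complexD:
 assumes "X : bounded_complexes L"
 shows "cobj X : smod" "cdiff X : ghom L 1 (cobj X) (cobj X)" "S.cplx (cobj X) (diff X)" proof -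
 have X: "ALL i. small R L (cobj X i)" "ALL i. cdiff X i : lin_hom L (cobj X i) (cobj X (i + 1))"
  "ALL i. ALL x:carrier (cobj X i). cdiff X (i + 1) (cdiff X i x) = 0[cobj X (i + 1 + 1)]"
  "EX a b. ALL i. i < a | b < i --> carrier (cobj X i) = {0[cobj X i]}"
  using assms by (simp_all add: bounded_complexes_def finitely_presented_iff_small)
 show s: "cobj X : smod" using X(1,4) by (simp add: smod_def)
 show d: "cdiff X : ghom L 1 (cobj X) (cobj X)" by (rule ghom_smodI[OF s s]) (use X(2) in blast)
 have "ecomp (diff X) (diff X) = 0"
  unfolding arr_comp[OF d d] arr_eq_0_iff[OF ghom_comp[OF d d]] using X(3) by (simp add: algebra_simps)
 thus "S.cplx (cobj X) (diff X)" by (simp add: S.cplx_def shomI[OF s s d])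
qed

text \<open>Elements of degree \<open>k\<close> are maps of degree \<open>k\<close> from
  \<open>L0\<close>, which translates the categorical exactness test into equality of image and
  kernel.\<close>

lemma acyc_iff:
 assumes X: "X : bounded_complexes L" shows "S.acyc (cobj X) (diff X) \<longleftrightarrow> acyclic_complex X" proof -
 note cx = complexD[OF X]
 have "EX w:shom k L0 (cobj X). val (cobj X) k w = x" if "x :. (cobj X k)" for k x by (rule point[OF cx(1) that]) blast
 hence im: "val (cobj X) k ` shom k L0 (cobj X) = carrier (cobj X k)" for k using val_mem by blast
 have 0: "ecomp (diff X) w = 0 \<longleftrightarrow> cdiff X k (val (cobj X) k w) = 0[cobj X (k + 1)]"
  if w: "w : shom k L0 (cobj X)" for k w
  using val_eq_0[of "ecomp (diff X) w" "1 + k" "cobj X"] val_comp[OF w cx(2), of "1 + k"] val_0[OF cx(1)]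
   G.hom_comp[OF shomI[OF cx(1,1,2)] w] by (metis add.commute)
 have 1: "w = ecomp (diff X) v \<longleftrightarrow> val (cobj X) k w = cdiff X (k - 1) (val (cobj X) (k - 1) v)"
  if "w : shom k L0 (cobj X)" "v : shom (k - 1) L0 (cobj X)" for k v w
  using val_inj[OF that(1), of "ecomp (diff X) v"] val_comp[OF that(2) cx(2), of k]
   G.hom_comp[OF shomI[OF cx(1,1,2)] that(2)] by auto
 have "S.acyc (cobj X) (diff X) \<longleftrightarrow> (ALL k. ALL x:carrier (cobj X k). cdiff X k x = 0[cobj X (k + 1)] -->
   x : cdiff X (k - 1) ` carrier (cobj X (k - 1)))" by (simp add: S.acyc_def cx(3) 0 1 image_iff flip: im)
 also have "\<dots> \<longleftrightarrow> (ALL i. ALL x:carrier (cobj X (i + 1)). cdiff X (i + 1) x = 0[cobj X (i + 1 + 1)] -->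
   x : cdiff X i ` carrier (cobj X i))" by (metis add_diff_cancel_right' diff_add_cancel)
 also have "\<dots> \<longleftrightarrow> acyclic_complex X" using X lin_homD(1)[OF ghomD(3)[OF cx(2)]]
  by (auto simp: acyclic_complex_def hom_kernel_def bounded_complexes_def set_eq_iff)
 finally show ?thesis .
qed

lemma acyc_complex: "X : Ob Cat ==> S.acyc (cobj X) (diff X)"
 by (simp add: Cat_simps acyc_iff)

lemma complex_of_acyc:
 assumes T: "S.acyc T e" obtains X where "X : Ob Cat" "cobj X = T" "arr 1 T T (cdiff X) = e" proof -
 have e: "e : shom 1 T T" "ecomp e e = 0" using T by (simp_all add: S.acyc_def S.cplx_def)
 obtain h where h: "T : smod" "h : ghom L 1 T T" "e = arr 1 T T h" using e(1) by (rule shomE)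
 let ?X = "\<lparr>cobj = T, cdiff = h\<rparr>"
 have "h (i + 1) (h i x) = 0[T (i + 1 + 1)]" if "x :. (T i)" for i x
  using e(2) unfolding h(3) by (rule arr_comp_eq_0D[OF _ h(2,2) that]) simp_all
 hence "?X : bounded_complexes L"
  using h(1) ghomD(3)[OF h(2)] unfolding bounded_complexes_def smod_def finitely_presented_iff_small by simp
 thus thesis using that[of ?X] h(3) T by (simp add: Cat_simps flip: acyc_iff)
qed

lemma chain_iff:
 assumes X: "X : bounded_complexes L" and Y: "Y : bounded_complexes L" and f: "f : ghom L 0 (cobj X) (cobj Y)"
 shows "A X Y f : Ch X Y \<longleftrightarrow> f : chain_maps L X Y" proof -
 note cX = complexD[OF X] and cY = complexD[OF Y]
 show ?thesis using arr_eq_iff[OF ghom_comp[OF f cX(2)], of "%i x. cdiff Y (i + 0) (f i x)"] ghom_comp[OF cY(2) f]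
   arr_comp[OF f cX(2)] arr_comp[OF cY(2) f] shomI[OF cX(1) cY(1) f] ghomD(3)[OF f]
  by (simp add: S.chain_def chain_maps_def)
qed

lemma chain_mapD:
 assumes "X : bounded_complexes L" "Y : bounded_complexes L" "f : chain_maps L X Y"
 shows "f : ghom L 0 (cobj X) (cobj Y)" "A X Y f : Ch X Y" proof -
 show "f : ghom L 0 (cobj X) (cobj Y)"
  using assms(3) by (intro ghom_smodI complexD(1) assms(1,2)) (simp add: chain_maps_def)
 thus "A X Y f : Ch X Y" using chain_iff assms by blast
qed

lemma chain_mapE:
 assumes "X : bounded_complexes L" "Y : bounded_complexes L" "z : Ch X Y"
 obtains f where "f : chain_maps L X Y" "z = A X Y f"
 using assms(3) chain_iff[OF assms(1,2)] that by (metis (no_types, lifting) S.chain_def mem_Collect_eq shomE)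

lemma homotopic_iff:
 assumes X: "X : bounded_complexes L" and Y: "Y : bounded_complexes L"
  and f: "f : chain_maps L X Y" and g: "g : chain_maps L X Y"
 shows "homotopic L X Y f g \<longleftrightarrow> A X Y f - A X Y g : Bd X Y" proof -
 note cX = complexD[OF X] and cY = complexD[OF Y]
 note fg = arr_diff[OF chain_mapD(1)[OF X Y f] chain_mapD(1)[OF X Y g]]
 have eq: "A X Y f - A X Y g = ecomp (diff Y) (arr (- 1) (cobj X) (cobj Y) s) + ecomp (arr (- 1) (cobj X) (cobj Y) s) (diff X) \<longleftrightarrow>
   (ALL i. ALL x:carrier (cobj X i). f i x -[cobj Y i] g i x =
    cdiff Y (i - 1) (s i x) +[cobj Y i] s (i + 1) (cdiff X i x))" if s: "s : ghom L (- 1) (cobj X) (cobj Y)" for s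
 proof -
  have "(%i x. cdiff Y (i - 1) (s i x)) : ghom L 0 (cobj X) (cobj Y)" "(%i x. s (i + 1) (cdiff X i x)) : ghom L 0 (cobj X) (cobj Y)"
   using ghom_comp[OF cY(2) s] ghom_comp[OF s cX(2)] by simp_all
  from arr_add[OF this] arr_eq_iff[OF fg(1) ghom_add[OF this]] show ?thesis
   using arr_comp[OF cY(2) s] arr_comp[OF s cX(2)] fg(2) by simp
 qed
 have s: "s : ghom L (- 1) (cobj X) (cobj Y) \<longleftrightarrow> (ALL i. s i : lin_hom L (cobj X i) (cobj Y (i - 1)))" for s
  using smodD(3)[OF cX(1)] smodD(3)[OF cY(1)] by (simp add: ghom_def)
 have "A X Y f - A X Y g : Bd X Y \<longleftrightarrow> (EX s:ghom L (- 1) (cobj X) (cobj Y). A X Y f - A X Y g =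
   ecomp (diff Y) (arr (- 1) (cobj X) (cobj Y) s) + ecomp (arr (- 1) (cobj X) (cobj Y) s) (diff X))"
  unfolding S.bdry_def using shomI[OF cX(1) cY(1)] by (fastforce elim: shomE)
 thus ?thesis by (simp add: homotopic_def Bex_def s eq[unfolded s] cong: conj_cong)
qed

end

section \<open>Homotopy classes as morphisms of a linear category\<close>

context graded_setup
begin

text \<open>The homotopy class belonging to an abstract chain map \<open>z\<close>: all families of
  functions whose morphism differs from \<open>z\<close> by a boundary. It is \<open>hclass\<close>
  of any representative, without a choice of one.\<close>

definition K :: "('l, 'm) cochain_complex => ('l, 'm) cochain_complex => ('l, 'm) tot endo => (int => 'm => 'm) set"
 where "K X Y z = {g : chain_maps L X Y. z - A X Y g : Bd X Y}"

lemma ObD [simp]: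
 assumes "X : Ob Cat"
 shows "X : bounded_complexes L" "cobj X : smod" "S.cplx (cobj X) (diff X)" "cdiff X : ghom L 1 (cobj X) (cobj X)"
  "diff X : shom 1 (cobj X) (cobj X)" "graded_ob L (cobj X)"
 using assms complexD smodD(3) by (auto simp: Cat_simps S.cplx_def)

lemma ChD: "z : Ch X Y ==> z : shom 0 (cobj X) (cobj Y)"
 by (simp add: S.chain_def)

lemma Ch_rmod: "X : Ob Cat ==> Y : Ob Cat ==> rmod R scale (Ch X Y)"
 by (simp add: S.chain_rmod)

lemma Ch_closed [simp]:
 assumes "X : Ob Cat" "Y : Ob Cat" "z : Ch X Y"
 shows "w : Ch X Y ==> z + w : Ch X Y" "w : Ch X Y ==> z - w : Ch X Y" "r :. R ==> scale r z : Ch X Y" proof -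
 interpret rmod R scale "Ch X Y" using assms by (simp add: Ch_rmod)
 show "w : Ch X Y ==> z + w : Ch X Y" "w : Ch X Y ==> z - w : Ch X Y" "r :. R ==> scale r z : Ch X Y"
  using assms by (simp_all add: add_mem diff_mem smult_mem)
qed

lemma Bd_scale:
 assumes "X : Ob Cat" "Y : Ob Cat" "r :. R" "b : Bd X Y" shows "scale r b : Bd X Y" proof -
 interpret rmod R scale "shom 0 (cobj X) (cobj Y)" using assms by (simp add: rmod_shom)
 obtain s where s: "s : shom (- 1) (cobj X) (cobj Y)" "b = ecomp (diff Y) s + ecomp s (diff X)"
  using assms(4) unfolding S.bdry_def by blast
 have "ecomp (diff Y) s : shom 0 (cobj X) (cobj Y)" "ecomp s (diff X) : shom 0 (cobj X) (cobj Y)"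
  using G.hom_comp[OF ObD(5)[OF assms(2)] s(1)] G.hom_comp[OF s(1) ObD(5)[OF assms(1)]] by simp_all
 moreover note scale_comp(2)[OF assms(3) ObD(5)[OF assms(2)] s(1)] scale_comp(1)[OF assms(3) s(1) ObD(5)[OF assms(1)]]
 ultimately have "scale r b = ecomp (diff Y) (scale r s) + ecomp (scale r s) (diff X)"
  using s(2) assms(3) by (simp add: smult_add)
 thus ?thesis unfolding S.bdry_def using scale_mem[OF assms(3) s(1)] by blast
qed

lemma K_mem:
 assumes "X : Ob Cat" "Y : Ob Cat" "f : K X Y z"
 shows "f : ghom L 0 (cobj X) (cobj Y)" "A X Y f : Ch X Y" "z - A X Y f : Bd X Y"
 using assms chain_mapD[of X Y f] by (auto simp: K_def)

lemma K_eqI: "z - w : Bd X Y ==> K X Y z = K X Y w"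
 unfolding K_def using S.bdry_diff[of "z - _" _ _ _ _ "z - w"] S.bdry_add[of "w - _" _ _ _ _ "z - w"]
 by (force simp: algebra_simps)

lemma Bd_0 [simp]: "X : Ob Cat ==> Y : Ob Cat ==> 0 : Bd X Y"
 unfolding S.bdry_def by (intro CollectI exI[of _ 0]) (simp add: G.hom_zero G.m_zero_left G.m_zero_right)

lemma K_self:
 assumes "X : Ob Cat" "Y : Ob Cat" "z : Ch X Y"
 obtains f where "f : K X Y z" "f : chain_maps L X Y" "z = A X Y f" proof -
 obtain f where "f : chain_maps L X Y" "z = A X Y f" using chain_mapE[of X Y z] assms by (metis ObD(1))
 thus thesis using that assms by (simp add: K_def)
qed

lemma K_nonempty: "X : Ob Cat ==> Y : Ob Cat ==> z : Ch X Y ==> K X Y z ~= {}"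
 using K_self by blast

lemma K_eqD:
 assumes "X : Ob Cat" "Y : Ob Cat" "z : Ch X Y" "K X Y w = K X Y z" shows "w - z : Bd X Y"
 using K_self[OF assms(1-3)] K_mem(3)[OF assms(1,2), of _ w] assms(4) by metis

lemma hclass_eq:
 assumes "X : Ob Cat" "Y : Ob Cat" "f : chain_maps L X Y" shows "hclass L X Y f = K X Y (A X Y f)"
 unfolding hclass_def K_def using homotopic_iff[of X Y f] assms by auto

lemma hclass_of_chain:
 assumes X: "X : Ob Cat" and Y: "Y : Ob Cat" and h: "h : ghom L 0 (cobj X) (cobj Y)"
  and c: "A X Y h : Ch X Y" and z: "z - A X Y h : Bd X Y" shows "hclass L X Y h = K X Y z" proof -
 obtain f where f: "f : chain_maps L X Y" "A X Y h = A X Y f" using chain_mapE[of X Y "A X Y h"] X Y c by auto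
 have "f : ghom L 0 (cobj X) (cobj Y)" using chain_mapD f(1) X Y by auto
 hence eq: "h i x = f i x" if "x :. (cobj X i)" for i x using arr_eqD[OF f(2) h _ that] by simp
 have "h : chain_maps L X Y"
  using f(1) eq lin_homD(1)[OF ghomD(3)[OF ObD(4)[OF X]]] ghomD(3)[OF h] unfolding chain_maps_def by simp
 thus ?thesis unfolding K_eqI[OF z] by (rule hclass_eq[OF X Y])
qed

lemma Mor_carrier:
 assumes "X : Ob Cat" "Y : Ob Cat" shows "Arr Cat X Y = K X Y ` Ch X Y" proof -
 have "A X Y ` chain_maps L X Y = Ch X Y"
  using chain_mapD(2)[OF assms[THEN ObD(1)]] chain_mapE[OF assms[THEN ObD(1)]] by blast
 hence "K X Y ` Ch X Y = (%f. K X Y (A X Y f)) ` chain_maps L X Y" by (metis image_image)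
 thus ?thesis using hclass_eq[OF assms] by (simp add: Cat_simps homotopy_hom_def)
qed

lemma K_Arr [simp]: "X : Ob Cat ==> Y : Ob Cat ==> z : Ch X Y ==> K X Y z : Arr Cat X Y"
 by (simp add: Mor_carrier)

text \<open>All pairs of representatives yield the same class, so the union in the definition of the
  sum collapses.\<close>

lemma Mor_add [simp]:
 assumes [simp]: "X : Ob Cat" "Y : Ob Cat" "z : Ch X Y" "w : Ch X Y"
 shows "K X Y z +[Mor Cat X Y] K X Y w = K X Y (z + w)" proof -
 have "hclass L X Y (%i x. f i x +[cobj Y i] g i x) = K X Y (z + w)" if "f : K X Y z" "g : K X Y w" for f g
  using K_mem[OF assms(1,2) that(1)] K_mem[OF assms(1,2) that(2)] ghom_add[of f L 0 _ _ g] arr_add[of f L 0 _ _ g]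
   S.bdry_add[of "z - A X Y f" _ _ _ _ "w - A X Y g"] by (intro hclass_of_chain) (simp_all add: algebra_simps)
 thus ?thesis using K_nonempty[of X Y] by (simp add: Cat_simps(2) homotopy_hom_def cong: SUP_cong)
qed

lemma Mor_smult [simp]:
 assumes [simp]: "X : Ob Cat" "Y : Ob Cat" "r :. R" "z : Ch X Y" shows "r *[Mor Cat X Y] K X Y z = K X Y (scale r z)"
proof -
 interpret rmod R scale "Ch X Y" by (simp add: Ch_rmod)
 have "hclass L X Y (%i x. (r *[L] 1[L]) *[cobj Y i] f i x) = K X Y (scale r z)" if "f : K X Y z" for f
  using K_mem[OF assms(1,2) that] scale_arr[of f 0 _ _ r] scale_hom[of f 0 _ _ r]
   Bd_scale[of X Y r "z - A X Y f"] Ch_closed(3)[of X Y "A X Y f" r]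
  by (intro hclass_of_chain) (simp_all add: smult_diff)
 thus ?thesis using K_nonempty[of X Y] by (simp add: Cat_simps(2) homotopy_hom_def cong: SUP_cong)
qed

lemma Mor_zero: "X : Ob Cat ==> Y : Ob Cat ==> 0[Mor Cat X Y] = K X Y 0"
 using hclass_of_chain[of X Y _ 0] ghom_zero[of L "cobj X" "cobj Y" 0] arr_zero[of L "cobj X" "cobj Y" 0]
  rmod.zero_mem[OF Ch_rmod] by (simp add: Cat_simps(2) homotopy_hom_def)

lemma Cat_Comp [simp]:
 assumes X: "X : Ob Cat" and Y: "Y : Ob Cat" and W: "W : Ob Cat" and z: "z : Ch Y W" and w: "w : Ch X Y"
 shows "Comp Cat X Y W (K Y W z) (K X Y w) = K X W (ecomp z w)" proof -
 have "hclass L X W (%i x. g i (f i x)) = K X W (ecomp z w)" if g: "g : K Y W z" and f: "f : K X Y w" for f g proof -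
  note F = K_mem[OF X Y f] and G = K_mem[OF Y W g]
  have "ecomp z w - ecomp (A Y W g) (A X Y f) = ecomp (z - A Y W g) w + ecomp (A Y W g) (w - A X Y f)"
   by (simp add: G.m_diff_left G.m_diff_right)
  thus ?thesis using S.bdry_add[OF S.bdry_comp_left[OF G(3) w] S.bdry_comp_right[OF G(2) F(3)]] ghom_comp[OF G(1) F(1)]
    arr_comp[OF G(1) F(1)] S.chain_comp[OF G(2) F(2)] by (intro hclass_of_chain X W) simp_all
 qed
 thus ?thesis using K_nonempty[OF X Y w] K_nonempty[OF Y W z] by (simp add: Cat_simps(3) cong: SUP_cong)
qed

lemma Ident_chain [simp]: "X : Ob Cat ==> gid (cobj X) : Ch X X"
 unfolding S.chain_def using G.Id_left[OF ObD(5)] G.Id_right[OF ObD(5)] by (simp add: G.Id_hom)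

lemma Cat_Ident [simp]: "X : Ob Cat ==> Ident Cat X = K X X (gid (cobj X))"
 unfolding Cat_simps(4) gid_def using hclass_of_chain[of X X "%i x. x" "A X X (%i x. x)"] Ident_chain[of X]
 by (simp add: gid_def ghom_id)

lemma Mor_quotient:
 assumes "X : Ob Cat" "Y : Ob Cat" shows "module R (Mor Cat X Y)" "fin_length R (Mor Cat X Y)" proof -
 note q = quotient_record[OF Ch_rmod[OF assms] Mor_carrier[OF assms] Mor_zero[OF assms]
   Mor_add[OF assms] Mor_smult[OF assms], simplified]
 show "module R (Mor Cat X Y)" by (rule q)
 have "finite_length R scale (Ch X Y)"
  by (rule finite_length_sub[OF hom_finite_length Ch_rmod]) (use assms in "auto intro: ChD")
 thus "fin_length R (Mor Cat X Y)" by (rule quotient_record_fin_length[OF _ Mor_carrier[OF assms] q])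
qed

lemma scale_Ch [simp]:
 assumes "r :. R" "z : Ch Y W" "w : Ch X Y"
 shows "ecomp (scale r z) w = scale r (ecomp z w)" "ecomp z (scale r w) = scale r (ecomp z w)"
 using scale_comp[OF assms(1) assms(2,3)[THEN ChD]] by simp_all

lemma linear_category_Cat: "linear_category R Cat"
proof (intro linear_category.intro linear_category_axioms.intro cring_axioms)
 show "Comp Cat X Y Y (Ident Cat Y) F = F" "Comp Cat X X Y F (Ident Cat X) = F"
  if "X : Ob Cat" "Y : Ob Cat" "F : Arr Cat X Y" for X Y F
  using that G.Id_left[OF ChD] G.Id_right[OF ChD] by (auto simp: Mor_carrier)
qed (auto intro!: lin_homI Mor_quotient imageI S.chain_comp simp: Mor_carrier ecomp_add ecomp_assoc S.chain_comp)

end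

section \<open>Representing objects in the acyclic homotopy category\<close>

context graded_setup
begin

text \<open>\<open>tau\<close> vanishes on boundaries, so it descends to homotopy classes through
  any choice of representatives.\<close>

lemma induced_functional:
 assumes X: "X : Ob Cat" and Y: "Y : Ob Cat" and tau: "E.functional scale (shom 0 (cobj X) (cobj Y)) tau"
  and bd: "!!b. b : Bd X Y ==> tau b = 0"
 obtains t where "t : lin_hom R (Mor Cat X Y) E" "!!z. z : Ch X Y ==> emb 0 E (t (K X Y z)) = tau z" proof -
 interpret H: rmod R scale "Ch X Y" by (rule Ch_rmod[OF X Y])
 interpret E': module R E by (rule E_module)
 have "Ch X Y \<subseteq> shom 0 (cobj X) (cobj Y)" by (auto simp: S.chain_def)
 note tau' = linear_on_subset[OF tau this]
 define t where "t F = prj E (tau (SOME z. z : Ch X Y & K X Y z = F))" for F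
 have t: "emb 0 E (t (K X Y z)) = tau z" if z: "z : Ch X Y" for z proof -
  define y where "y = (SOME y. y : Ch X Y & K X Y y = K X Y z)"
  have y: "y : Ch X Y & K X Y y = K X Y z" unfolding y_def by (rule someI[of _ z]) (use z in simp)
  hence "tau y = tau z" using H.linear_on_diff[OF tau', of y z] bd[OF K_eqD[OF X Y z]] z by simp
  moreover obtain e where "e :. E" "tau y = emb 0 E e" using linear_onD(1)[OF tau'] y by (auto simp: embedded_def)
  ultimately show ?thesis unfolding t_def y_def[symmetric] by (metis E_abelian prj_emb)
 qed
 have mem: "t F :. E" for F by (simp add: t_def prj_mem E_abelian)
 have "t : lin_hom R (Mor Cat X Y) E" by (rule lin_homI; (rule emb_eqI[OF E_abelian])?)
   (auto simp: Mor_carrier X Y mem t emb_add E_abelian linear_onD[OF tau'] simp flip: act_emb[OF E_module])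
 thus thesis using that t by blast
qed

lemma functional_of_lin_hom:
 assumes X: "X : Ob Cat" and Y: "Y : Ob Cat" and ph: "ph : lin_hom R (Mor Cat X Y) E"
 shows "E.functional scale (Ch X Y) (%z. emb 0 E (ph (K X Y z)))" "ALL b:Bd X Y. emb 0 E (ph (K X Y b)) = 0"
proof -
 have "ph (K X Y (z + w)) = ph (K X Y z) +[E] ph (K X Y w)" "r :. R ==> ph (K X Y (scale r z)) = r *[E] ph (K X Y z)"
  if "z : Ch X Y" "w : Ch X Y" for z w r
  using lin_homD(2)[OF ph, of "K X Y z" "K X Y w"] lin_homD(3)[OF ph, of r "K X Y z"] that X Y by simp_all
 thus "E.functional scale (Ch X Y) (%z. emb 0 E (ph (K X Y z)))" using X Y lin_homD(1)[OF ph]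
  by (intro linear_onI) (simp_all add: embedded_def emb_add E_abelian act_emb[OF E_module])
 have "ph (K X Y 0) = 0[E]"
  using lin_hom_zero[OF module.axioms(2)[OF Mor_quotient(1)[OF X Y]] E_abelian ph] Mor_zero[OF X Y] by simp
 thus "ALL b:Bd X Y. emb 0 E (ph (K X Y b)) = 0" using K_eqI[of _ 0 X Y] by (simp add: emb_zero[OF E_abelian])
qed

text \<open>One statement for both sides of the duality: \<open>c\<close> and \<open>m\<close> stand
  for composition of chain maps and of classes, either in the usual or in the reversed
  order.\<close>

lemma dual_transfer:
 assumes O: "V : Ob Cat" "W : Ob Cat" "V' : Ob Cat" "W' : Ob Cat" "V'' : Ob Cat" "W'' : Ob Cat"
  and c: "!!h f. h : Ch V' W' ==> f : Ch V W ==> c h f : Ch V'' W'' & m (K V' W' h) (K V W f) = K V'' W'' (c h f)"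
  and c_diff: "!!h h' f. c (h - h') f = c h f - c h' f"
  and t: "t : lin_hom R (Mor Cat V'' W'') E" "!!z. z : Ch V'' W'' ==> emb 0 E (t (K V'' W'' z)) = tau z"
  and repr: "!!ph. E.functional scale (Ch V W) ph ==> (!!b. b : Bd V W ==> ph b = 0) ==>
   EX h:Ch V' W'. ALL f:Ch V W. ph f = tau (c h f)"
  and inj: "!!h. h : Ch V' W' ==> (!!f. f : Ch V W ==> tau (c h f) = 0) ==> h : Bd V' W'"
 shows "(ALL ph:lin_hom R (Mor Cat V W) E. EX h:Arr Cat V' W'. ALL f:Arr Cat V W. ph f = t (m h f)) &
  (ALL h:Arr Cat V' W'. ALL h':Arr Cat V' W'. (ALL f:Arr Cat V W. t (m h f) = t (m h' f)) --> h = h')"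
proof (intro conjI ballI impI)
 fix ph assume ph: "ph : lin_hom R (Mor Cat V W) E"
 obtain h where h: "h : Ch V' W'" "ALL f:Ch V W. emb 0 E (ph (K V W f)) = tau (c h f)"
  using repr[OF functional_of_lin_hom(1)[OF O(1,2) ph]] functional_of_lin_hom(2)[OF O(1,2) ph] by blast
 have "ph (K V W f) = t (m (K V' W' h) (K V W f))" if "f : Ch V W" for f by (rule emb_eqI[OF E_abelian])
   (use that h c[OF h(1) that] t lin_homD(1)[OF t(1)] lin_homD(1)[OF ph] in "simp_all add: Mor_carrier O")
 thus "EX h:Arr Cat V' W'. ALL f:Arr Cat V W. ph f = t (m h f)" using h(1) by (auto simp: Mor_carrier O)
next
 fix h h' assume "h : Arr Cat V' W'" "h' : Arr Cat V' W'" and eq: "ALL f:Arr Cat V W. t (m h f) = t (m h' f)"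
 then obtain z z' where z: "z : Ch V' W'" "h = K V' W' z" "z' : Ch V' W'" "h' = K V' W' z'"
  by (auto simp: Mor_carrier O)
 have tau: "tau x = tau y + tau (x - y)" if "x : Ch V'' W''" "y : Ch V'' W''" for x y
  using lin_homD(1)[OF t(1)] lin_homD(2)[OF t(1), of "K V'' W'' y" "K V'' W'' (x - y)"] that O
  by (simp add: E_abelian emb_add flip: t(2))
 have "tau (c (z - z') f) = 0" if f: "f : Ch V W" for f proof -
  note c1 = c[OF z(1) f] c[OF z(3) f]
  have "t (K V'' W'' (c z f)) = t (K V'' W'' (c z' f))" using eq c1 z f O by (auto simp: Mor_carrier)
  hence "tau (c z f) = tau (c z' f)" using t(2) c1 by metis
  thus ?thesis using tau[of "c z f" "c z' f"] c1 by (simp add: c_diff)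
 qed
 thus "h = h'" unfolding z(2,4) using z O by (intro K_eqI inj) simp_all
qed

definition right_dual :: "('l, 'm) cochain_complex => ('l, 'm) cochain_complex => ((int => 'm => 'm) set => 'e) => bool"
 where "right_dual X T t \<longleftrightarrow> T : Ob Cat & t : lin_hom R (Mor Cat X T) E & (ALL Y:Ob Cat.
  (ALL ph:lin_hom R (Mor Cat X Y) E. EX h:Arr Cat Y T. ALL f:Arr Cat X Y. ph f = t (Comp Cat X Y T h f)) &
  (ALL h:Arr Cat Y T. ALL h':Arr Cat Y T.
   (ALL f:Arr Cat X Y. t (Comp Cat X Y T h f) = t (Comp Cat X Y T h' f)) --> h = h'))"

definition left_dual :: "('l, 'm) cochain_complex => ('l, 'm) cochain_complex => ((int => 'm => 'm) set => 'e) => bool"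
 where "left_dual X T t \<longleftrightarrow> T : Ob Cat & t : lin_hom R (Mor Cat T X) E & (ALL Y:Ob Cat.
  (ALL ph:lin_hom R (Mor Cat Y X) E. EX h:Arr Cat T Y. ALL f:Arr Cat Y X. ph f = t (Comp Cat T Y X f h)) &
  (ALL h:Arr Cat T Y. ALL h':Arr Cat T Y.
   (ALL f:Arr Cat Y X. t (Comp Cat T Y X f h) = t (Comp Cat T Y X f h')) --> h = h'))"

lemma dual_complexes:
 assumes fgd: "finite_global_dimension TYPE('m) L" and X: "X : Ob Cat"
 shows "EX T t. right_dual X T t" "EX T t. left_dual X T t" proof -
 obtain n where dim: "!!Y. Y : smod ==> S.idim_le inj_obs n Y" using finite_injective_dimension[OF fgd] by blast
 have inj: "S.injective_ob N" if "N : inj_obs" for N using that by (simp add: inj_obs_def)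
 obtain T0 e tau where T0: "S.acyc T0 e" "E.functional scale (shom 0 (cobj X) T0) tau"
  "!!b. b : S.bdry (cobj X) (diff X) T0 e ==> tau b = 0"
  "!!Y d. S.acyc Y d ==> S.represents (cobj X) (diff X) T0 e tau Y d"
  using S.serre_duality_acyc[OF exI inj ObD(3)[OF X], OF dim] by metis
 obtain T where "T : Ob Cat" "cobj T = T0" "diff T = e" using complex_of_acyc[OF T0(1)] by metis
 with T0 have T: "T : Ob Cat" "E.functional scale (shom 0 (cobj X) (cobj T)) tau" "!!b. b : Bd X T ==> tau b = 0"
  and rep: "!!Y. Y : Ob Cat ==> S.represents (cobj X) (diff X) (cobj T) (diff T) tau (cobj Y) (diff Y)"
  using acyc_complex by auto
 obtain t where t: "t : lin_hom R (Mor Cat X T) E" "!!z. z : Ch X T ==> emb 0 E (t (K X T z)) = tau z"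
  using induced_functional[OF X T] by metis
 show "EX T t. right_dual X T t" unfolding right_dual_def
  by (intro exI[of _ T] exI[of _ t] conjI[OF T(1)] conjI[OF t(1)] ballI, rule dual_transfer[where c = ecomp, OF X _ _ T(1) X T(1) _ _ t])
   (use rep in "auto simp: X T(1) G.m_diff_left S.chain_comp S.represents_def")
 show "EX T t. left_dual X T t" proof (rule S.serre_duality_acyc_dual[OF dim inj ObD(3)[OF X]])
  fix T0 e tau assume T0: "S.acyc T0 e" "E.functional scale (shom 0 T0 (cobj X)) tau"
  "!!b. b : S.bdry T0 e (cobj X) (diff X) ==> tau b = 0"
  "!!Z c ph. S.acyc Z c ==> E.functional scale (S.chain Z c (cobj X) (diff X)) ph ==>
   (!!b. b : S.bdry Z c (cobj X) (diff X) ==> ph b = 0) ==>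
   EX h:S.chain T0 e Z c. ALL f:S.chain Z c (cobj X) (diff X). ph f = tau (ecomp f h)"
  "!!Z c h. S.acyc Z c ==> h : S.chain T0 e Z c ==>
   (!!f. f : S.chain Z c (cobj X) (diff X) ==> tau (ecomp f h) = 0) ==> h : S.bdry T0 e Z c"
  obtain T where T': "T : Ob Cat" "cobj T = T0" "diff T = e" using complex_of_acyc[OF T0(1)] by metis
  note T = T'(1) T0(2-5)[folded T'(2,3)]
  obtain t where t: "t : lin_hom R (Mor Cat T X) E" "!!z. z : Ch T X ==> emb 0 E (t (K T X z)) = tau z"
   using induced_functional[OF T(1) X T(2,3)] by metis
  show ?thesis unfolding left_dual_def by (intro exI[of _ T] exI[of _ t] conjI[OF T(1)] conjI[OF t(1)] ballI,
     rule dual_transfer[where c = "%h f. ecomp f h", OF _ X T(1) _ T(1) X _ _ t])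
    (assumption | (rule T(4)[OF acyc_complex] T(5)[OF acyc_complex]; assumption) |
     simp add: X T(1) S.chain_comp G.m_diff_right)+
 qed
qed

theorem serre_functor_acyclic:
 assumes fgd: "finite_global_dimension TYPE('m) L" shows "EX SO SM \<eta>. serre_functor R E Cat SO SM \<eta>" proof -
 obtain S t where S: "ALL X:Ob Cat. right_dual X (S X) (t X)" using dual_complexes(1)[OF fgd] by metis
 obtain G u where G: "ALL X:Ob Cat. left_dual X (G X) (u X)" using dual_complexes(2)[OF fgd] by metis
 note r = bspec[OF S, unfolded right_dual_def] bspec[OF G, unfolded left_dual_def]
 note r' = r[THEN conjunct2, THEN conjunct2, THEN bspec]
 have "serre_criterion R Cat E S G t u"
 proof (intro serre_criterion.intro linear_category_Cat E_module serre_criterion_axioms.intro)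
  fix X Y assume O: "X : Ob Cat" "Y : Ob Cat"
  show "EX x:Arr Cat X Y. ALL ph:carrier (dual_module R E (Mor Cat X Y)). Ph ph = ph x"
   if "Ph : lin_hom R (dual_module R E (Mor Cat X Y)) E" for Ph
   by (rule E_reflexive[OF Mor_quotient[OF O] that])
  show "x = y" if "x : Arr Cat X Y" "y : Arr Cat X Y" "!!ph. ph : lin_hom R (Mor Cat X Y) E ==> ph x = ph y" for x y
   by (rule E_separated[OF Mor_quotient(1)[OF O] that])
 qed (rule r(1)[THEN conjunct1] r(1)[THEN conjunct2, THEN conjunct1] r(2)[THEN conjunct1] r(2)[THEN conjunct2, THEN conjunct1]
   r'[THEN conjunct1, rule_format] r'[THEN conjunct2, rule_format]; assumption)+
 thus ?thesis by (rule serre_criterion.serre_functor_exists)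
qed

end

theorem proposition5p3:
  fixes R :: "('r, 'x) ring_scheme"
    and \<Lambda> :: "('r, 'l, 'y) module_scheme"
    and E :: "('r, 'e) module" and j :: "'r set \<Rightarrow> 'e"
    and \<iota> :: "'l list \<Rightarrow> 'm"
  assumes "artin_algebra R \<Lambda>"
    and "inj_on \<iota> (lists (carrier \<Lambda>))"
    and "finite_global_dimension TYPE('m) \<Lambda>"
    and "injective_envelope R (quotient_module R (jacobson_radical R)) E j"
  shows "\<exists>SO SM \<eta>. serre_functor R E
    (acyclic_homotopy_category \<Lambda> ::
      (('l, 'm) cochain_complex, (int \<Rightarrow> 'm \<Rightarrow> 'm) set, 'r) lin_cat) SO SM \<eta>"
proof -
 have "artin_dual R \<Lambda> E j" by (rule artin_dual.intro[OF assms(1) artin_dual_axioms.intro[OF assms(4)]])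
 then obtain J Q Z :: "('l, 'm) module" and ev u where "graded_setup R \<Lambda> E j J Q Z ev u"
  using artin_dual.graded_setup_exists[OF _ assms(2)] by blast
 thus ?thesis by (rule graded_setup.serre_functor_acyclic[OF _ assms(3)])
qed

end
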